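(* Let $f\colon\mathbb{R}_{\ge 0}\to\mathbb{R}_{\ge 0}$ be any function such that $f(0)=0$ and $f(x)>0$ for all $x>0$. For any $\eta>0$ and any sufficiently small $\epsilon_2>0$, there exists a classical algorithm that has sampling access (in the data-structure model described in the context) to a matrix $A\in\mathbb{C}^{m\times n}$ and to a non-zero vector $b\in\mathbb{C}^m$ and has the following behavior: if $f$ is differentiable on the set $L$ and the projection of $b$ on the column space of $\Phi_f(A^* )$ has norm $\Omega(\|b\|)$, then with probability at least $1-\eta$ the algorithm samples from a distribution which is $\epsilon_2$-close in total variation distance to the distribution $\mathcal{P}_{\Phi_f(A^* )b}$, using \[O\left(\frac{\|A\|_F^{10}\kappa_{2}^{14}}{\epsilon_{2}^{4}\eta^{2}\|A\|^{6}}\left(\frac{\Omega}{\omega}\right)^{2}\left\{\frac{\phi}{\omega}+3\sqrt{2}\frac{\Omega}{\omega}\frac{\kappa_{2}}{\|A\|}\right\}^{4}\mathrm{polylog}(mn)\right)\] samples and \[O\left(\frac{\|A\|_F^{12}\kappa_{2}^{12}}{\epsilon_{2}^{6}\eta^{3}}\left\{\frac{\phi}{\omega}+7\sqrt{2}\frac{\Omega}{\omega}\frac{\kappa_{2}}{\|A\|}\right\}^{6}\mathrm{polylog}(mn)\right)\] time complexity, where $\Omega=\max_{\sigma\in L}|f(\sigma)|$, $\phi=\max_{\sigma\in L}|f'(\sigma)|$ and $\omega=\min_{\sigma\in L}|f(\sigma)|$.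
   Context: $\|M\|_F$ denotes the Frobenius norm, $\|M\|$ the spectral norm of a matrix, $\|v\|$ the Euclidean norm of a vector, $M^*$ the conjugate transpose. For $M\in\mathbb{C}^{m\times n}$ with SVD $M=\sum_{i=1}^{\min(m,n)}\sigma_i u_i v_i^*$ and $f\colon\mathbb{R}_{\ge0}\to\mathbb{R}_{\ge0}$ with $f(0)=0$, the singular value transformation is $\Phi_f(M)=\sum_{i=1}^{\min(m,n)} f(\sigma_i)u_iv_i^*$. $\kappa_2=\kappa_2(A)=\sigma_{\max}(A)/\sigma_{\min}(A)$, where $\sigma_{\min}(A)$ is the smallest non-zero singular value of $A$. The interval $L$ is $L=\left[\frac{\|A\|}{\sqrt2\kappa_2},\ \frac{\|A\|}{\sqrt2\kappa_2}\sqrt{2\kappa_2^2+1}\right]$. For a non-zero vector $v\in\mathbb{C}^n$, $\mathcal{P}_v$ is the distribution on $[n]$ with $\mathcal{P}_v(i)=|v_i|^2/\|v\|^2$; the total variation distance is $\frac12\sum_i|\mathcal{P}_v(i)-\mathcal{P}_w(i)|$. Sampling access: a matrix $M\in\mathbb{C}^{m\times n}$ (a vector being a one-column/one-row matrix) is stored in a data structure supporting: output $\|M\|_F^2$ in $O(1)$ time; read an entry $M_{(i,j)}$ in $O(\log^2(mn))$ time; output a row norm $\|M_{(i,\cdot)}\|$ in $O(\log^2 m)$ time; sample $i\in[m]$ with probability $\|M_{(i,\cdot)}\|^2/\|M\|_F^2$ in $O(\log^2(mn))$ time; and, for any $i\in[m]$, sample $j\in[n]$ with probability $|M_{(i,j)}|^2/\|M_{(i,\cdot)}\|^2$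 in $O(\log^2(mn))$ time. The sample complexity of an algorithm is the total number of such samples it uses.
   Formalization: The projection of b is onto the column space of Φ_f(A^* )^* (that of Φ_f(A^* ) lies in C^n, not C^m); "sufficiently small" ε_2 may depend on f, η and ‖A‖; the maximum φ is assumed to exist; the algorithm is given m, n, η, ε_2, ‖A‖, κ_2, Ω, φ, ω and the constant in Ω(‖b‖). *)

theory Defs
  imports
    "HOL-Probability.Probability_Mass_Function"
    "Jordan_Normal_Form.Schur_Decomposition"
    "Jordan_Normal_Form.VS_Connect"
begin

unbundle no vec_syntax

section \<open>Norms, singular values and singular value transformation\<close>

definition eucl_norm :: "complex vec \<Rightarrow> real" where
  "eucl_norm v = sqrt (\<Sum>i<dim_vec v. (cmod (v $ i))\<^sup>2)"

definition frob_norm :: "complex mat \<Rightarrow> real" where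
  "frob_norm M = sqrt (\<Sum>i<dim_row M. \<Sum>j<dim_col M. (cmod (M $$ (i, j)))\<^sup>2)"

definition spectral_norm :: "complex mat \<Rightarrow> real" where
  "spectral_norm M =
     Sup {eucl_norm (M *\<^sub>v x) | x. x \<in> carrier_vec (dim_col M) \<and> eucl_norm x = 1}"

definition orthonormal_family :: "nat \<Rightarrow> nat \<Rightarrow> (nat \<Rightarrow> complex vec) \<Rightarrow> bool" where
  "orthonormal_family d l u \<longleftrightarrow>
     (\<forall>i<l. u i \<in> carrier_vec d) \<and>
     (\<forall>i<l. \<forall>j<l. u i \<bullet>c u j = (if i = j then 1 else 0))"

definition rank_one_sum ::
  "nat \<Rightarrow> nat \<Rightarrow> (nat \<Rightarrow> real) \<Rightarrow> (nat \<Rightarrow> complex vec) \<Rightarrow> (nat \<Rightarrow> complex vec) \<Rightarrow> complex mat" where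
  "rank_one_sum m n s u v =
     Matrix.mat m n (\<lambda>(i, j). \<Sum>l<min m n. complex_of_real (s l) * (u l $ i) * cnj (v l $ j))"

definition is_svd ::
  "complex mat \<Rightarrow> (nat \<Rightarrow> real) \<Rightarrow> (nat \<Rightarrow> complex vec) \<Rightarrow> (nat \<Rightarrow> complex vec) \<Rightarrow> bool" where
  "is_svd M s u v \<longleftrightarrow>
     (let m = dim_row M; n = dim_col M; l = min m n in
       (\<forall>i<l. 0 \<le> s i) \<and> orthonormal_family m l u \<and> orthonormal_family n l v \<and>
       M = rank_one_sum m n s u v)"

text \<open>If \<open>f 0 = 0\<close>, the matrix below is the same for every singular value decomposition of
  \<open>M\<close>, so the choice made by \<open>SOME\<close> is immaterial.\<close>

definition svt :: "(real \<Rightarrow> real) \<Rightarrow> complex mat \<Rightarrow> complex mat" where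
  "svt f M =
     (SOME X. \<exists>s u v. is_svd M s u v \<and>
        X = rank_one_sum (dim_row M) (dim_col M) (\<lambda>i. f (s i)) u v)"

definition singular_values :: "complex mat \<Rightarrow> real set" where
  "singular_values M =
     {x. \<exists>s u v. is_svd M s u v \<and> x \<in> s ` {..<min (dim_row M) (dim_col M)}}"

definition kappa2 :: "complex mat \<Rightarrow> real" where
  "kappa2 M = Max (singular_values M) / Min (singular_values M - {0})"

definition sv_interval :: "complex mat \<Rightarrow> real set" where
  "sv_interval M =
     {spectral_norm M / (sqrt 2 * kappa2 M) ..
      spectral_norm M / (sqrt 2 * kappa2 M) * sqrt (2 * (kappa2 M)\<^sup>2 + 1)}"

definition orth_proj :: "complex vec set \<Rightarrow> complex vec \<Rightarrow> complex vec" where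
  "orth_proj V b = (THE p. p \<in> V \<and> (\<forall>w\<in>V. (b - p) \<bullet>c w = 0))"

text \<open>
  For \<open>A \<in> \<complex>\<^sup>m\<^sup>\<times>\<^sup>n\<close> the matrix \<open>\<Phi>\<^sub>f(A\<^sup>*)\<close> is \<open>n \<times> m\<close> and acts on \<open>b \<in> \<complex>\<^sup>m\<close>.  The part of \<open>b\<close>
  seen by \<open>\<Phi>\<^sub>f(A\<^sup>*)\<close> is its projection on the subspace of \<open>\<complex>\<^sup>m\<close> spanned by the left singular
  vectors of \<open>A\<close> that \<open>\<Phi>\<^sub>f(A\<^sup>*)\<close> does not annihilate, that is, on the column space of the
  \<open>m \<times> n\<close> matrix \<open>\<Phi>\<^sub>f(A\<^sup>*)\<^sup>*\<close>.  (The column space of \<open>\<Phi>\<^sub>f(A\<^sup>*)\<close> itself lies in \<open>\<complex>\<^sup>n\<close>.)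
\<close>

definition svt_proj :: "(real \<Rightarrow> real) \<Rightarrow> complex mat \<Rightarrow> complex vec \<Rightarrow> complex vec" where
  "svt_proj f A b =
     orth_proj (vec_space.col_space (dim_row A) (mat_adjoint (svt f (mat_adjoint A)))) b"


section \<open>Distributions\<close>

definition vec_pmf :: "complex vec \<Rightarrow> nat pmf" where
  "vec_pmf v =
     embed_pmf (\<lambda>i. if i < dim_vec v then (cmod (v $ i))\<^sup>2 / (eucl_norm v)\<^sup>2 else 0)"

definition row_pmf :: "complex mat \<Rightarrow> nat pmf" where
  "row_pmf M =
     embed_pmf (\<lambda>i. if i < dim_row M
                    then (eucl_norm (Matrix.row M i))\<^sup>2 / (frob_norm M)\<^sup>2 else 0)"

lemma pmf_embed_finite_weights:
  fixes w :: "nat \<Rightarrow> real"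
  assumes nn: "\<And>i. i < d \<Longrightarrow> 0 \<le> w i" and sm: "(\<Sum>i<d. w i) = 1"
  shows "pmf (embed_pmf (\<lambda>i. if i < d then w i else 0)) j = (if j < d then w j else 0)"
proof -
  let ?g = "\<lambda>i. if i < d then w i else 0"
  have "(\<integral>\<^sup>+i. ennreal (?g i) \<partial>count_space UNIV) = (\<Sum>i\<in>{..<d}. ennreal (?g i))"
    by (rule nn_integral_count_space') auto
  also have "\<dots> = ennreal (\<Sum>i<d. w i)"
    using nn by (subst sum_ennreal) (auto intro!: arg_cong[where f = ennreal] sum.cong)
  also have "\<dots> = 1"
    by (simp add: sm)
  finally show ?thesis
    using nn by (subst pmf_embed_pmf) auto
qed

lemma eucl_norm_sq: "(eucl_norm v)\<^sup>2 = (\<Sum>i<dim_vec v. (cmod (v $ i))\<^sup>2)"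
  unfolding eucl_norm_def by (simp add: sum_nonneg)

lemma frob_norm_sq: "(frob_norm M)\<^sup>2 = (\<Sum>i<dim_row M. (eucl_norm (Matrix.row M i))\<^sup>2)"
proof -
  have "(frob_norm M)\<^sup>2 = (\<Sum>i<dim_row M. \<Sum>j<dim_col M. (cmod (M $$ (i, j)))\<^sup>2)"
    unfolding frob_norm_def by (simp add: sum_nonneg)
  then show ?thesis
    by (simp add: eucl_norm_sq)
qed

lemma pmf_vec_pmf:
  assumes "eucl_norm v \<noteq> 0"
  shows "pmf (vec_pmf v) i =
    (if i < dim_vec v then (cmod (v $ i))\<^sup>2 / (eucl_norm v)\<^sup>2 else 0)"
  unfolding vec_pmf_def
  by (rule pmf_embed_finite_weights)
    (use assms in \<open>simp_all add: eucl_norm_sq[symmetric] sum_divide_distrib[symmetric]\<close>)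

lemma pmf_row_pmf:
  assumes "frob_norm M \<noteq> 0"
  shows "pmf (row_pmf M) i =
    (if i < dim_row M then (eucl_norm (Matrix.row M i))\<^sup>2 / (frob_norm M)\<^sup>2 else 0)"
  unfolding row_pmf_def
  by (rule pmf_embed_finite_weights)
    (use assms in \<open>simp_all add: frob_norm_sq[symmetric] sum_divide_distrib[symmetric]\<close>)

definition tv_dist :: "nat pmf \<Rightarrow> nat pmf \<Rightarrow> real" where
  "tv_dist p q = (\<Sum>\<^sub>\<infinity>i. \<bar>pmf p i - pmf q i\<bar>) / 2"


section \<open>Classical randomised algorithms with sampling access\<close>

text \<open>
  An algorithm is a finite program for a random access machine with one memory of natural numbers
  and one memory of exact complex numbers, both indirectly addressable.  It reaches the stored
  matrix and the stored vector only through the five operations of the sampling data structure.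

  An expression costs one unit per node.  The only constants are natural numbers, so a program
  cannot contain precomputed real numbers.  There is no rounding operation and no conversion from
  complex to natural numbers; the two memories interact through comparisons, through \<open>COfNat\<close> and
  through indirect addressing.  \<open>CFun e\<close> evaluates \<open>f\<close> on the non-negative reals.
\<close>

datatype nexp =
    NConst nat
  | NMem nexp
  | NAdd nexp nexp
  | NSub nexp nexp
  | NMul nexp nexp

datatype cexp =
    COfNat nexp
  | CMem nexp
  | CAdd cexp cexp
  | CSub cexp cexp
  | CMul cexp cexp
  | CDiv cexp cexp
  | CConj cexp
  | CSqrt cexp
  | CFun cexp

datatype bexp =
    BNatLess nexp nexp
  | BReLess cexp cexp
  | BNot bexp
  | BAnd bexp bexp

datatype source = SrcMat | SrcVec

datatype com =
    Skip
  | NAssign nexp nexp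
  | CAssign nexp cexp
  | Coin nexp cexp
  | GetFrob source nexp
  | GetEntry source nexp nexp nexp
  | GetRowNorm source nexp nexp
  | SampleRow source nexp
  | SampleCol source nexp nexp
  | Seq com com
  | If bexp com com
  | While bexp com

record state =
  nmem :: "nat \<Rightarrow> nat"
  cmem :: "nat \<Rightarrow> complex"
  samples_used :: nat
  time_used :: real

fun nval :: "state \<Rightarrow> nexp \<Rightarrow> nat" where
  "nval s (NConst k) = k"
| "nval s (NMem a) = nmem s (nval s a)"
| "nval s (NAdd a b) = nval s a + nval s b"
| "nval s (NSub a b) = nval s a - nval s b"
| "nval s (NMul a b) = nval s a * nval s b"

fun cval :: "(real \<Rightarrow> real) \<Rightarrow> state \<Rightarrow> cexp \<Rightarrow> complex" where
  "cval f s (COfNat a) = of_nat (nval s a)"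
| "cval f s (CMem a) = cmem s (nval s a)"
| "cval f s (CAdd x y) = cval f s x + cval f s y"
| "cval f s (CSub x y) = cval f s x - cval f s y"
| "cval f s (CMul x y) = cval f s x * cval f s y"
| "cval f s (CDiv x y) = cval f s x / cval f s y"
| "cval f s (CConj x) = cnj (cval f s x)"
| "cval f s (CSqrt x) = csqrt (cval f s x)"
| "cval f s (CFun x) = complex_of_real (f \<bar>Re (cval f s x)\<bar>)"

fun bval :: "(real \<Rightarrow> real) \<Rightarrow> state \<Rightarrow> bexp \<Rightarrow> bool" where
  "bval f s (BNatLess a b) \<longleftrightarrow> nval s a < nval s b"
| "bval f s (BReLess x y) \<longleftrightarrow> Re (cval f s x) < Re (cval f s y)"
| "bval f s (BNot x) \<longleftrightarrow> \<not> bval f s x"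
| "bval f s (BAnd x y) \<longleftrightarrow> bval f s x \<and> bval f s y"

fun ncost :: "nexp \<Rightarrow> real" where
  "ncost (NConst k) = 1"
| "ncost (NMem a) = 1 + ncost a"
| "ncost (NAdd a b) = 1 + ncost a + ncost b"
| "ncost (NSub a b) = 1 + ncost a + ncost b"
| "ncost (NMul a b) = 1 + ncost a + ncost b"

fun ccost :: "cexp \<Rightarrow> real" where
  "ccost (COfNat a) = 1 + ncost a"
| "ccost (CMem a) = 1 + ncost a"
| "ccost (CAdd x y) = 1 + ccost x + ccost y"
| "ccost (CSub x y) = 1 + ccost x + ccost y"
| "ccost (CMul x y) = 1 + ccost x + ccost y"
| "ccost (CDiv x y) = 1 + ccost x + ccost y"
| "ccost (CConj x) = 1 + ccost x"
| "ccost (CSqrt x) = 1 + ccost x"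
| "ccost (CFun x) = 1 + ccost x"

fun bcost :: "bexp \<Rightarrow> real" where
  "bcost (BNatLess a b) = 1 + ncost a + ncost b"
| "bcost (BReLess x y) = 1 + ccost x + ccost y"
| "bcost (BNot x) = 1 + bcost x"
| "bcost (BAnd x y) = 1 + bcost x + bcost y"

text \<open>The summand \<open>1\<close> keeps the access costs positive when the matrix has a single entry (or a
  single row) and the logarithm vanishes.\<close>

definition entry_cost :: "complex mat \<Rightarrow> real" where
  "entry_cost M = 1 + (ln (real (dim_row M * dim_col M)))\<^sup>2"

definition row_cost :: "complex mat \<Rightarrow> real" where
  "row_cost M = 1 + (ln (real (dim_row M)))\<^sup>2"

definition charge :: "real \<Rightarrow> state \<Rightarrow> state" where
  "charge t s = s\<lparr>time_used := time_used s + t\<rparr>"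

definition count_sample :: "state \<Rightarrow> state" where
  "count_sample s = s\<lparr>samples_used := samples_used s + 1\<rparr>"

definition nput :: "nat \<Rightarrow> nat \<Rightarrow> state \<Rightarrow> state" where
  "nput a x s = s\<lparr>nmem := (nmem s)(a := x)\<rparr>"

definition cput :: "nat \<Rightarrow> complex \<Rightarrow> state \<Rightarrow> state" where
  "cput a x s = s\<lparr>cmem := (cmem s)(a := x)\<rparr>"

text \<open>
  \<open>exec f M P s D\<close>: started in \<open>s\<close>, the program \<open>P\<close> terminates for every outcome of its random
  choices, and \<open>D\<close> is the distribution of the final state.  Since the predicate is inductive, a
  non-terminating branch admits no derivation; neither does an access with an index out of range
  or a request to sample from a zero row or a zero matrix.
\<close>

inductive exec ::
  "(real \<Rightarrow> real) \<Rightarrow> (source \<Rightarrow> complex mat) \<Rightarrow> com \<Rightarrow> state \<Rightarrow> state pmf \<Rightarrow> bool"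
  for f M where
  Skip: "exec f M Skip s (return_pmf s)"
| NAssign: "exec f M (NAssign a e) s
    (return_pmf (charge (1 + ncost a + ncost e) (nput (nval s a) (nval s e) s)))"
| CAssign: "exec f M (CAssign a e) s
    (return_pmf (charge (1 + ncost a + ccost e) (cput (nval s a) (cval f s e) s)))"
| Coin: "exec f M (Coin a e) s
    (map_pmf (\<lambda>x. charge (1 + ncost a + ccost e) (nput (nval s a) (of_bool x) s))
       (bernoulli_pmf (max 0 (min 1 (Re (cval f s e))))))"
| GetFrob: "exec f M (GetFrob h a) s
    (return_pmf (charge (1 + ncost a)
       (cput (nval s a) (complex_of_real ((frob_norm (M h))\<^sup>2)) s)))"
| GetEntry: "nval s i < dim_row (M h) \<Longrightarrow> nval s j < dim_col (M h) \<Longrightarrow>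
    exec f M (GetEntry h i j a) s
      (return_pmf (charge (entry_cost (M h) + ncost i + ncost j + ncost a)
         (cput (nval s a) (M h $$ (nval s i, nval s j)) s)))"
| GetRowNorm: "nval s i < dim_row (M h) \<Longrightarrow>
    exec f M (GetRowNorm h i a) s
      (return_pmf (charge (row_cost (M h) + ncost i + ncost a)
         (cput (nval s a)
            (complex_of_real (eucl_norm (Matrix.row (M h) (nval s i)))) s)))"
| SampleRow: "frob_norm (M h) \<noteq> 0 \<Longrightarrow>
    exec f M (SampleRow h a) s
      (map_pmf (\<lambda>i. count_sample (charge (entry_cost (M h) + ncost a) (nput (nval s a) i s)))
         (row_pmf (M h)))"
| SampleCol: "nval s i < dim_row (M h) \<Longrightarrow> eucl_norm (Matrix.row (M h) (nval s i)) \<noteq> 0 \<Longrightarrow>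
    exec f M (SampleCol h i a) s
      (map_pmf (\<lambda>j. count_sample
           (charge (entry_cost (M h) + ncost i + ncost a) (nput (nval s a) j s)))
         (vec_pmf (Matrix.row (M h) (nval s i))))"
| Seq: "exec f M P s D \<Longrightarrow> (\<forall>t\<in>set_pmf D. exec f M Q t (E t)) \<Longrightarrow>
    exec f M (Seq P Q) s (bind_pmf D E)"
| IfTrue: "bval f s g \<Longrightarrow> exec f M P (charge (bcost g) s) D \<Longrightarrow> exec f M (If g P Q) s D"
| IfFalse: "\<not> bval f s g \<Longrightarrow> exec f M Q (charge (bcost g) s) D \<Longrightarrow> exec f M (If g P Q) s D"
| WhileFalse: "\<not> bval f s g \<Longrightarrow> exec f M (While g P) s (return_pmf (charge (bcost g) s))"
| WhileTrue: "bval f s g \<Longrightarrow> exec f M (Seq P (While g P)) (charge (bcost g) s) D \<Longrightarrow>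
    exec f M (While g P) s D"

inductive_cases exec_SkipE: "exec f M Skip s D"
inductive_cases exec_NAssignE: "exec f M (NAssign a e) s D"
inductive_cases exec_CAssignE: "exec f M (CAssign a e) s D"
inductive_cases exec_CoinE: "exec f M (Coin a e) s D"
inductive_cases exec_GetFrobE: "exec f M (GetFrob h a) s D"
inductive_cases exec_GetEntryE: "exec f M (GetEntry h i j a) s D"
inductive_cases exec_GetRowNormE: "exec f M (GetRowNorm h i a) s D"
inductive_cases exec_SampleRowE: "exec f M (SampleRow h a) s D"
inductive_cases exec_SampleColE: "exec f M (SampleCol h i a) s D"
inductive_cases exec_SeqE: "exec f M (Seq P Q) s D"
inductive_cases exec_IfE: "exec f M (If g P Q) s D"
inductive_cases exec_WhileE: "exec f M (While g P) s D"

lemma exec_deterministic: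
  "exec f M P s D \<Longrightarrow> exec f M P s D' \<Longrightarrow> D' = D"
proof (induction arbitrary: D' rule: exec.induct)
  case (Seq P s D Q E)
  from Seq.prems obtain D1 E1 where D': "D' = bind_pmf D1 E1" and P: "exec f M P s D1"
    and Q: "\<forall>t\<in>set_pmf D1. exec f M Q t (E1 t)"
    by (rule exec_SeqE)
  have "D1 = D"
    by (rule Seq.IH(1)[OF P])
  have "E1 t = E t" if "t \<in> set_pmf D" for t
    using Seq.IH(2) Q that unfolding \<open>D1 = D\<close> by blast
  then show ?case
    unfolding D' \<open>D1 = D\<close> by (intro bind_pmf_cong) auto
next
  case (IfTrue s g P D Q)
  from IfTrue.prems show ?case
    by (rule exec_IfE) (use IfTrue.hyps(1) IfTrue.IH in blast)+
next
  case (IfFalse s g Q D P)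
  from IfFalse.prems show ?case
    by (rule exec_IfE) (use IfFalse.hyps(1) IfFalse.IH in blast)+
next
  case (WhileFalse s g P)
  from WhileFalse.prems show ?case
    by (rule exec_WhileE) (use WhileFalse.hyps in simp_all)
next
  case (WhileTrue s g P D)
  from WhileTrue.prems show ?case
    by (rule exec_WhileE) (use WhileTrue.hyps(1) WhileTrue.IH in blast)+
qed (erule exec_SkipE exec_NAssignE exec_CAssignE exec_CoinE exec_GetFrobE exec_GetEntryE
      exec_GetRowNormE exec_SampleRowE exec_SampleColE; simp)+

text \<open>The vector \<open>b\<close> is stored as a matrix with one column, so that sampling a row of it is
  sampling from \<open>vec_pmf b\<close>.\<close>

definition access :: "complex mat \<Rightarrow> complex vec \<Rightarrow> source \<Rightarrow> complex mat" where
  "access A b h = (case h of SrcMat \<Rightarrow> A | SrcVec \<Rightarrow> mat_of_cols (dim_vec b) [b])"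

definition init_state :: "nat list \<Rightarrow> real list \<Rightarrow> state" where
  "init_state ns xs =
     \<lparr>nmem = (\<lambda>i. if i < length ns then ns ! i else 0),
      cmem = (\<lambda>i. if i < length xs then complex_of_real (xs ! i) else 0),
      samples_used = 0, time_used = 0\<rparr>"

definition result :: "state \<Rightarrow> nat" where
  "result s = nmem s 0"

text \<open>
  An algorithm that samples from a distribution which is itself determined by random choices is
  given by a preparation program \<open>P\<close> followed by a sampling program \<open>Q\<close>.  With probability at
  least \<open>1 - \<eta>\<close> over the state left behind by \<open>P\<close>, the output of \<open>Q\<close> started from that state is
  distributed within \<open>\<epsilon>\<close> of \<open>p\<close>.  Every run of \<open>P\<close> followed by \<open>Q\<close> obeys both resource bounds.
\<close>

definition samples_from ::
  "(real \<Rightarrow> real) \<Rightarrow> (source \<Rightarrow> complex mat) \<Rightarrow> com \<Rightarrow> com \<Rightarrow> state \<Rightarrow>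
   real \<Rightarrow> real \<Rightarrow> nat pmf \<Rightarrow> real \<Rightarrow> real \<Rightarrow> bool" where
  "samples_from f M P Q s \<eta> \<epsilon> p max_samples max_time \<longleftrightarrow>
     (\<exists>D E. exec f M P s D \<and> (\<forall>t\<in>set_pmf D. exec f M Q t (E t)) \<and>
        measure_pmf.prob D {t. tv_dist (map_pmf result (E t)) p \<le> \<epsilon>} \<ge> 1 - \<eta> \<and>
        (\<forall>t\<in>set_pmf D. \<forall>u\<in>set_pmf (E t).
           real (samples_used u) \<le> max_samples \<and> time_used u \<le> max_time))"

end

theory Submission
  imports Defs "HOL-Computational_Algebra.Fundamental_Theorem_Algebra" "HOL-Probability.Product_PMF"
begin

text \<open>Write the transformed vector as \<open>h(A\<^sup>* A) A\<^sup>* b\<close> with \<open>h(x) = f(sqrt x) / sqrt x\<close>, and extend \<open>h\<close> from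
  the squares of the interval to a bounded Lipschitz function on the half-line.  Sampling \<open>r\<close> rows \<open>S\<close> and
  then \<open>r\<close> columns \<open>W\<close> of \<open>S\<close> by squared length approximates \<open>A\<^sup>* A\<close> by \<open>S\<^sup>* S\<close>, \<open>A\<^sup>* b\<close> by the sampled
  product and \<open>S S\<^sup>*\<close> by \<open>W W\<^sup>*\<close> in Frobenius norm, so the answer is close to \<open>S\<^sup>* h(W W\<^sup>*) b'\<close>.  Since programs
  have no eigenvalue solver, \<open>h\<close> is replaced by its Bernstein polynomial of degree \<open>r\<close>, which is evaluated
  by the de Casteljau scheme.  To stay within the time bound the scheme is run in the Krylov space of
  \<open>W W\<^sup>*\<close>, where a Lanczos recurrence makes the operator tridiagonal; the recurrence stops after at most
  \<open>rank A + 1\<close> steps, and the rank is at most \<open>(F \<kappa> / N)\<^sup>2\<close>.  The final sample is drawn from \<open>S\<^sup>* y\<close> by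
  rejection, proposing a row according to \<open>|y|\<^sup>2\<close> and an entry of that row by squared length.  All factors of
  the cost not covered by the claimed bounds are powers of \<open>N\<close> and \<open>\<eta>\<close>, and are absorbed by taking \<open>\<epsilon>\<close> small.\<close>

section \<open>Finite-dimensional complex linear algebra\<close>

text \<open>Evaluated directly, a degree-\<open>r\<close> Bernstein form of an \<open>r\<close> by
  \<open>r\<close> operator takes about \<open>r^2\<close> applications of cost \<open>r^2\<close>,
  more than the claimed time allows. In Krylov coordinates an application costs only the dimension
  of the Krylov space, so the table costs \<open>r^2\<close> times the rank. Arithmetic is exact, so
  the recurrence keeps its orthogonality and its test for a zero vector is reliable. The Frobenius
  norm is the norm of choice: in it a Lipschitz function acts on Hermitian matrices with the same
  Lipschitz constant, and squared-length sampling has an explicit variance. The Bernstein form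
  inherits the Lipschitz constant of \<open>h\<close>, so passing from \<open>A\<close> to sampled
  matrices costs the same for both. The number \<open>3 sqrt 2\<close> in the sample bound is that
  Lipschitz constant in disguise. Replacing \<open>A\<close> by \<open>t A\<close> and
  \<open>f(x)\<close> by \<open>f(x / t)\<close> leaves the sample bound invariant but multiplies
  the time bound by \<open>t^6\<close>. The missing divisor \<open>N^6\<close>, with one factor
  \<open>\<eta>\<close>, must be paid by \<open>\<epsilon>\<close>, whence the threshold of order
  \<open>N^3 sqrt \<eta>\<close>.\<close>

definition ip :: "nat \<Rightarrow> (nat \<Rightarrow> complex) \<Rightarrow> (nat \<Rightarrow> complex) \<Rightarrow> complex" where
  "ip n u v = (\<Sum>i<n. u i * cnj (v i))"

definition nsq :: "nat \<Rightarrow> (nat \<Rightarrow> complex) \<Rightarrow> real" where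
  "nsq n v = (\<Sum>i<n. (cmod (v i))\<^sup>2)"

text \<open>Vectors and matrices are total functions on the naturals, with the dimension as a
  separate argument and the values beyond it left arbitrary. This removes carrier conditions and
  matches what a program sees in its memory. The price is that many equalities hold only below the
  dimension, which the congruence rules handle.\<close>

definition mop :: "nat \<Rightarrow> (nat \<Rightarrow> nat \<Rightarrow> complex) \<Rightarrow> (nat \<Rightarrow> complex) \<Rightarrow> nat \<Rightarrow> complex" where
  "mop n H v = (\<lambda>i. \<Sum>j<n. H i j * v j)"

definition ortho :: "nat \<Rightarrow> 'a set \<Rightarrow> ('a \<Rightarrow> nat \<Rightarrow> complex) \<Rightarrow> bool" where
  "ortho n K x \<longleftrightarrow> (\<forall>a\<in>K. \<forall>b\<in>K. ip n (x a) (x b) = (if a = b then 1 else 0))"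

lemma cmod_sq: "complex_of_real ((cmod z)\<^sup>2) = z * cnj z"
  using complex_norm_square[of z] by simp

lemma ip_self: "ip n v v = complex_of_real (nsq n v)"
  unfolding ip_def nsq_def of_real_sum by (intro sum.cong refl) (simp only: cmod_sq)

lemma nsq_nonneg [simp]: "nsq n v \<ge> 0"
  by (simp add: nsq_def sum_nonneg)

lemma nsq_eq_0: "nsq n v = 0 \<longleftrightarrow> (\<forall>i<n. v i = 0)"
  by (auto simp: nsq_def sum_nonneg_eq_0_iff)

lemma ip_cnj: "ip n u v = cnj (ip n v u)"
  by (simp add: ip_def mult.commute)

lemma ip_cong: "(\<And>i. i < n \<Longrightarrow> u i = u' i) \<Longrightarrow> (\<And>i. i < n \<Longrightarrow> v i = v' i) \<Longrightarrow> ip n u v = ip n u' v'"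
  by (simp add: ip_def)

lemma nsq_cong: "(\<And>i. i < n \<Longrightarrow> u i = u' i) \<Longrightarrow> nsq n u = nsq n u'"
  by (simp add: nsq_def)

lemma nsq_scale: "nsq n (\<lambda>i. c * v i) = (cmod c)\<^sup>2 * nsq n v"
  by (simp add: nsq_def norm_mult power_mult_distrib sum_distrib_left)

lemma mop_diff_scale: "mop n H (\<lambda>i. u i - c * v i) = (\<lambda>i. mop n H u i - c * mop n H v i)"
  by (simp add: mop_def algebra_simps sum_subtractf sum_distrib_left)

lemma ip_normalize:
  assumes "nsq n w > 0"
  defines "z \<equiv> (\<lambda>i. complex_of_real (1 / sqrt (nsq n w)) * w i)"
  shows "ip n z z = 1"
proof -
  have "nsq n z = (1 / sqrt (nsq n w))\<^sup>2 * nsq n w"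
    unfolding z_def nsq_scale norm_of_real by simp
  then show ?thesis using assms(1) by (simp add: ip_self power_divide)
qed

lemma ip_add_left: "ip n (\<lambda>i. u i + v i) w = ip n u w + ip n v w"
  by (simp add: ip_def algebra_simps sum.distrib)

lemma ip_diff_left: "ip n (\<lambda>i. u i - v i) w = ip n u w - ip n v w"
  by (simp add: ip_def algebra_simps sum_subtractf)

lemma ip_diff_right: "ip n w (\<lambda>i. u i - v i) = ip n w u - ip n w v"
  by (simp add: ip_def algebra_simps sum_subtractf)

lemma ip_scale_left: "ip n (\<lambda>i. c * u i) w = c * ip n u w"
  by (simp add: ip_def algebra_simps sum_distrib_left)

lemma ip_sum_left: "ip n (\<lambda>i. \<Sum>a\<in>K. c a * x a i) w = (\<Sum>a\<in>K. c a * ip n (x a) w)"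
  unfolding ip_def sum_distrib_left sum_distrib_right
  by (subst sum.swap) (simp add: algebra_simps)

lemma ip_sum_right: "ip n w (\<lambda>i. \<Sum>a\<in>K. c a * x a i) = (\<Sum>a\<in>K. cnj (c a) * ip n w (x a))"
  by (subst ip_cnj) (simp add: ip_sum_left ip_cnj[of n w])

lemma ip_mop_left: "ip m (mop n H v) w = (\<Sum>i<m. \<Sum>j<n. H i j * v j * cnj (w i))"
  by (simp add: ip_def mop_def sum_distrib_right)

lemma ip_mop_adj: "ip m (mop n H v) w = ip n v (mop m (\<lambda>j i. cnj (H i j)) w)"
  unfolding ip_mop_left unfolding ip_def mop_def
  by (subst sum.swap) (simp add: sum_distrib_left algebra_simps)

section \<open>Linear dependence and completeness of orthonormal families\<close>

text \<open>Gaussian elimination, one equation per induction step: equation \<open>i\<close> is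
  solved for a pivot \<open>k0\<close>, and the remaining unknowns satisfy the reduced system
  \<open>B'\<close>. All dimension counts below, from the size of orthonormal families to the
  termination of the Lanczos recurrence, reduce to this fact.\<close>

lemma homogeneous_system:
  fixes B :: "'k \<Rightarrow> 'i \<Rightarrow> complex"
  assumes "finite I" "finite K" "card I < card K"
  shows "\<exists>c. (\<exists>k\<in>K. c k \<noteq> 0) \<and> (\<forall>i\<in>I. (\<Sum>k\<in>K. c k * B k i) = 0)"
  using assms
proof (induction I arbitrary: K B rule: finite_induct)
  case empty
  then obtain k where "k \<in> K" by fastforce
  then show ?case by (intro exI[of _ "\<lambda>_. 1"]) auto
next
  case (insert i I)
  show ?case
  proof (cases "\<forall>k\<in>K. B k i = 0")
    case True
    obtain c where "\<exists>k\<in>K. c k \<noteq> 0" "\<forall>i\<in>I. (\<Sum>k\<in>K. c k * B k i) = 0"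
      using insert.IH[of K B] insert.prems insert.hyps by auto
    with True show ?thesis by (intro exI[of _ c]) auto
  next
    case False
    then obtain k0 where k0: "k0 \<in> K" "B k0 i \<noteq> 0" by blast
    define B' where "B' = (\<lambda>k j. B k j - B k i / B k0 i * B k0 j)"
    have "card I < card (K - {k0})" using insert.prems insert.hyps k0 by simp
    then obtain c where c: "\<exists>k\<in>K-{k0}. c k \<noteq> 0" "\<forall>j\<in>I. (\<Sum>k\<in>K-{k0}. c k * B' k j) = 0"
      using insert.IH[of "K-{k0}" B'] insert.prems by auto
    define d where "d = c(k0 := - (\<Sum>k\<in>K-{k0}. c k * B k i / B k0 i))"
    have split: "(\<Sum>k\<in>K. d k * g k) = d k0 * g k0 + (\<Sum>k\<in>K-{k0}. c k * g k)" for g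
      using insert.prems k0 by (subst sum.remove[of K k0]) (auto simp: d_def intro!: sum.cong)
    have "(\<Sum>k\<in>K. d k * B k j) = (\<Sum>k\<in>K-{k0}. c k * B' k j)" for j
      unfolding split
      by (simp add: d_def B'_def sum_distrib_left sum_distrib_right algebra_simps sum_subtractf sum_divide_distrib)
    moreover have "(\<Sum>k\<in>K-{k0}. c k * B' k i) = 0"
      using k0 by (simp add: B'_def)
    ultimately have "\<forall>j\<in>insert i I. (\<Sum>k\<in>K. d k * B k j) = 0" using c(2) by auto
    moreover have "\<exists>k\<in>K. d k \<noteq> 0" using c(1) by (auto simp: d_def)
    ultimately show ?thesis by blast
  qed
qed

text \<open>Too many vectors would satisfy a nontrivial relation; pairing it with \<open>x k\<close>
  isolates the coefficient \<open>c k\<close>.\<close>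

lemma ortho_card_le:
  assumes "finite K" "ortho n K x"
  shows "card K \<le> n"
proof (rule ccontr)
  assume "\<not> card K \<le> n"
  then obtain c where c: "\<exists>k\<in>K. c k \<noteq> 0" "\<forall>i\<in>{..<n}. (\<Sum>k\<in>K. c k * x k i) = 0"
    using homogeneous_system[of "{..<n}" K x] assms by auto
  then obtain k where k: "k \<in> K" "c k \<noteq> 0" by blast
  have "0 = ip n (\<lambda>i. \<Sum>k\<in>K. c k * x k i) (x k)"
    using c(2) by (simp add: ip_def)
  also have "\<dots> = (\<Sum>a\<in>K. if a = k then c a else 0)"
    unfolding ip_sum_left using assms(2) k by (intro sum.cong) (auto simp: ortho_def)
  also have "\<dots> = c k" using k assms(1) by simp
  finally show False using k by simp
qed

text \<open>Orthogonality to the members of \<open>K\<close> amounts to fewer than \<open>n\<close>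
  linear equations in \<open>n\<close> unknowns, so there is a nonzero solution, which is then
  normalised.\<close>

lemma ortho_extend:
  assumes "finite K" "ortho n K x" "card K < n" "a \<notin> K"
  shows "\<exists>v. ortho n (insert a K) (x(a := v))"
proof -
  obtain w where w: "\<exists>i\<in>{..<n}. w i \<noteq> 0" "\<forall>k\<in>K. (\<Sum>i<n. w i * cnj (x k i)) = 0"
    using homogeneous_system[of K "{..<n}" "\<lambda>i k. cnj (x k i)"] assms by auto
  have pos: "nsq n w > 0" using w(1) nsq_eq_0[of n w] nsq_nonneg[of n w] by (auto simp: less_le)
  define v where "v = (\<lambda>i. complex_of_real (1 / sqrt (nsq n w)) * w i)"
  have "ip n v v = 1"
    unfolding v_def by (rule ip_normalize[OF pos])
  moreover have "ip n v (x k) = 0" if "k \<in> K" for k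
    using w(2) that unfolding v_def ip_scale_left by (simp add: ip_def)
  moreover from this have "ip n (x k) v = 0" if "k \<in> K" for k
    using that by (subst ip_cnj) simp
  ultimately have "ortho n (insert a K) (x(a := v))"
    using assms unfolding ortho_def by auto
  then show ?thesis by blast
qed

lemma ortho_extend_set:
  assumes "finite J" "K \<subseteq> J" "ortho n K x" "card J \<le> n"
  shows "\<exists>y. ortho n J y \<and> (\<forall>k\<in>K. y k = x k)"
proof -
  have "finite L \<Longrightarrow> L \<subseteq> J - K \<Longrightarrow> \<exists>y. ortho n (K \<union> L) y \<and> (\<forall>k\<in>K. y k = x k)" for L
  proof (induction L rule: finite_induct)
    case empty
    show ?case using assms(3) by (intro exI[of _ x]) simp
  next
    case (insert a L)
    then obtain y where y: "ortho n (K \<union> L) y" "\<forall>k\<in>K. y k = x k" by auto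
    have "finite (K \<union> L)" using insert.hyps(1) finite_subset[OF assms(2,1)] by simp
    moreover have "a \<notin> K \<union> L" using insert by auto
    moreover have "K \<union> L \<subset> J" using insert.prems insert.hyps(2) assms(2) by blast
    from less_le_trans[OF psubset_card_mono[OF assms(1) this] assms(4)]
    have "card (K \<union> L) < n" .
    ultimately obtain v where v: "ortho n (insert a (K \<union> L)) (y(a := v))"
      using ortho_extend[OF _ y(1)] by blast
    then have "ortho n (K \<union> insert a L) (y(a := v))" by simp
    moreover have "\<forall>k\<in>K. (y(a := v)) k = x k" using y insert.prems by auto
    ultimately show ?case by blast
  qed
  from this[of "J - K"] assms(1) have "\<exists>y. ortho n (K \<union> (J - K)) y \<and> (\<forall>k\<in>K. y k = x k)" by simp
  moreover have "K \<union> (J - K) = J" using assms(2) by blast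
  ultimately show ?thesis by simp
qed

text \<open>The residual of the expansion is orthogonal to all \<open>n\<close> vectors; were it
  nonzero, its normalisation would enlarge the orthonormal family to \<open>n + 1\<close>
  members.\<close>

lemma ortho_expand:
  assumes "ortho n {..<n} x" "i < n"
  shows "(\<Sum>a<n. ip n v (x a) * x a i) = v i"
proof (rule ccontr)
  assume ne: "\<not> ?thesis"
  define w where "w = (\<lambda>i. v i - (\<Sum>a<n. ip n v (x a) * x a i))"
  have orth: "ip n w (x a) = 0" if "a < n" for a
  proof -
    have "ip n w (x a) = ip n v (x a) - (\<Sum>b<n. ip n v (x b) * ip n (x b) (x a))"
      unfolding w_def ip_diff_left ip_sum_left ..
    also have "(\<Sum>b<n. ip n v (x b) * ip n (x b) (x a)) = (\<Sum>b<n. if b = a then ip n v (x b) else 0)"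
      using assms(1) that by (intro sum.cong) (auto simp: ortho_def)
    also have "\<dots> = ip n v (x a)" using that by simp
    finally show ?thesis by simp
  qed
  have pos: "nsq n w > 0" using ne assms(2) nsq_eq_0[of n w] nsq_nonneg[of n w]
    by (auto simp: less_le w_def)
  define z where "z = (\<lambda>a. if a < n then x a else (\<lambda>i. complex_of_real (1 / sqrt (nsq n w)) * w i))"
  have "ip n (z n) (z n) = 1"
    using ip_normalize[OF pos] by (simp add: z_def)
  moreover have "ip n (z n) (z a) = 0" if "a < n" for a
    using orth[OF that] that unfolding z_def by (simp add: ip_scale_left del: of_real_divide)
  moreover from this have "ip n (z a) (z n) = 0" if "a < n" for a
    using that by (subst ip_cnj) simp
  moreover have "ip n (z a) (z b) = (if a = b then 1 else 0)" if "a < n" "b < n" for a b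
    using that assms(1) by (auto simp: z_def ortho_def)
  ultimately have "ortho n {..<Suc n} z" unfolding ortho_def by (auto simp: less_Suc_eq)
  from ortho_card_le[OF _ this] show False by simp
qed

lemma parseval:
  assumes "ortho n {..<n} x"
  shows "(\<Sum>a<n. (cmod (ip n v (x a)))\<^sup>2) = nsq n v"
proof -
  have "complex_of_real (nsq n v) = ip n v v" by (simp add: ip_self)
  also have "\<dots> = ip n (\<lambda>i. \<Sum>a<n. ip n v (x a) * x a i) v"
    by (intro ip_cong) (simp_all add: ortho_expand[OF assms])
  also have "\<dots> = (\<Sum>a<n. ip n v (x a) * ip n (x a) v)" by (rule ip_sum_left)
  also have "\<dots> = (\<Sum>a<n. ip n v (x a) * cnj (ip n v (x a)))"
    by (intro sum.cong refl) (subst ip_cnj, simp)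
  also have "\<dots> = complex_of_real (\<Sum>a<n. (cmod (ip n v (x a)))\<^sup>2)"
    by (simp only: of_real_sum cmod_sq)
  finally show ?thesis by (simp only: of_real_eq_iff)
qed

lemma nsq_ortho_sum:
  assumes "finite K" "ortho n K x"
  shows "nsq n (\<lambda>i. \<Sum>a\<in>K. c a * x a i) = (\<Sum>a\<in>K. (cmod (c a))\<^sup>2)"
proof -
  have "complex_of_real (nsq n (\<lambda>i. \<Sum>a\<in>K. c a * x a i))
      = (\<Sum>a\<in>K. c a * (\<Sum>b\<in>K. cnj (c b) * ip n (x a) (x b)))"
    by (simp only: ip_self[symmetric] ip_sum_left ip_sum_right)
  also have "\<dots> = (\<Sum>a\<in>K. c a * (\<Sum>b\<in>K. if a = b then cnj (c b) else 0))"
    using assms(2) by (intro sum.cong refl arg_cong[of _ _ "\<lambda>z. _ * z"]) (auto simp: ortho_def)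
  also have "\<dots> = (\<Sum>a\<in>K. c a * cnj (c a))" using assms(1) by simp
  also have "\<dots> = complex_of_real (\<Sum>a\<in>K. (cmod (c a))\<^sup>2)" by (simp only: of_real_sum cmod_sq)
  finally show ?thesis by (simp only: of_real_eq_iff)
qed

lemma bessel:
  assumes "finite K" "ortho n K x"
  shows "(\<Sum>a\<in>K. (cmod (ip n v (x a)))\<^sup>2) \<le> nsq n v"
proof -
  define w where "w = (\<lambda>i. \<Sum>a\<in>K. ip n v (x a) * x a i)"
  define S where "S = (\<Sum>a\<in>K. (cmod (ip n v (x a)))\<^sup>2)"
  have ww: "ip n w w = of_real S"
    unfolding ip_self w_def S_def nsq_ortho_sum[OF assms] ..
  have wv: "ip n w v = of_real S"
    unfolding w_def ip_sum_left S_def of_real_sum cmod_sq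
    by (intro sum.cong refl) (subst (2) ip_cnj, simp)
  have vw: "ip n v w = of_real S" by (subst ip_cnj) (simp add: wv)
  have "complex_of_real (nsq n (\<lambda>i. v i - w i)) = of_real (nsq n v - S)"
    unfolding ip_self[symmetric] ip_diff_left ip_diff_right ww wv vw by (simp add: ip_self)
  then have "nsq n (\<lambda>i. v i - w i) = nsq n v - S" by (simp only: of_real_eq_iff)
  then show ?thesis using nsq_nonneg[of n "\<lambda>i. v i - w i"] by (simp add: S_def)
qed

text \<open>Bessel's inequality for the one-element family formed by the normalised
  \<open>v\<close>.\<close>

lemma ip_cauchy_schwarz: "(cmod (ip n u v))\<^sup>2 \<le> nsq n u * nsq n v"
proof (cases "nsq n v = 0")
  case True
  then have "ip n u v = 0" by (auto simp: ip_def nsq_eq_0)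
  then show ?thesis by simp
next
  case False
  then have pos: "nsq n v > 0" using nsq_nonneg[of n v] by linarith
  define z where "z = (\<lambda>i. complex_of_real (1 / sqrt (nsq n v)) * v i)"
  have "ortho n {()} (\<lambda>_. z)"
    unfolding ortho_def z_def using ip_normalize[OF pos] by simp
  from bessel[OF _ this, of u] have "(cmod (ip n u z))\<^sup>2 \<le> nsq n u" by simp
  moreover have "ip n u z = complex_of_real (1 / sqrt (nsq n v)) * ip n u v"
    unfolding z_def by (simp add: ip_def sum_distrib_left algebra_simps)
  ultimately show ?thesis using pos
    by (simp add: norm_mult norm_divide power_mult_distrib power_divide field_simps)
qed

text \<open>Every vector of a finite-dimensional invariant subspace is annihilated by a nonzero
  polynomial in the operator; splitting off linear factors one at a time leaves an eigenvector.\<close>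

lemma annihilated_eigenvector:
  fixes H :: "nat \<Rightarrow> nat \<Rightarrow> complex" and p :: "complex poly"
  assumes inv: "\<And>v. P v \<Longrightarrow> P (mop n H v)"
    and lin: "\<And>v c. P v \<Longrightarrow> P (\<lambda>i. mop n H v i - c * v i)"
    and "p \<noteq> 0" "P v" "\<exists>i<n. v i \<noteq> 0"
    and "\<forall>i<n. (\<Sum>j\<le>degree p. coeff p j * (mop n H ^^ j) v i) = 0"
  shows "\<exists>w l. P w \<and> (\<exists>i<n. w i \<noteq> 0) \<and> (\<forall>i<n. mop n H w i = l * w i)"
  using assms(3-)
proof (induction "degree p" arbitrary: p v)
  case 0
  then have "\<forall>i<n. coeff p 0 * v i = 0" by simp
  moreover have "coeff p 0 \<noteq> 0" using 0 by (metis leading_coeff_0_iff)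
  ultimately show ?case using 0 by auto
next
  case (Suc d)
  have "\<not> constant (poly p)" using Suc.hyps(2) by (simp add: constant_degree)
  then obtain l where "poly p l = 0" using fundamental_theorem_of_algebra by blast
  then obtain q where q: "p = [:- l, 1:] * q" by (metis poly_eq_0_iff_dvd dvdE)
  have q0: "q \<noteq> 0" using q Suc by auto
  have dq: "degree p = Suc (degree q)" unfolding q using q0 by (subst degree_mult_eq) auto
  have cp: "coeff p j = (if j = 0 then 0 else coeff q (j - 1)) - l * coeff q j" for j
    unfolding q by (simp add: coeff_pCons split: nat.split)
  define w where "w = (\<lambda>i. mop n H v i - l * v i)"
  have pow: "(mop n H ^^ j) w i = (mop n H ^^ Suc j) v i - l * (mop n H ^^ j) v i" for i j
  proof (induction j arbitrary: i)
    case 0 then show ?case by (simp add: w_def)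
  next
    case (Suc j)
    have "(mop n H ^^ j) w = (\<lambda>i. (mop n H ^^ Suc j) v i - l * (mop n H ^^ j) v i)"
      using Suc by blast
    then have "(mop n H ^^ Suc j) w i = mop n H (\<lambda>i. (mop n H ^^ Suc j) v i - l * (mop n H ^^ j) v i) i"
      by simp
    then show ?case by (simp only: mop_diff_scale funpow.simps o_apply)
  qed
  have eq: "(\<Sum>j\<le>degree p. coeff p j * (mop n H ^^ j) v i) = (\<Sum>j\<le>degree q. coeff q j * (mop n H ^^ j) w i)" for i
  proof -
    let ?K = "\<lambda>j. (mop n H ^^ j) v i"
    have "(\<Sum>j\<le>degree q. coeff q j * (mop n H ^^ j) w i)
      = (\<Sum>j\<le>degree q. coeff q j * ?K (Suc j)) - l * (\<Sum>j\<le>degree q. coeff q j * ?K j)"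
      unfolding pow by (simp add: algebra_simps sum_subtractf sum_distrib_left)
    also have "(\<Sum>j\<le>degree q. coeff q j * ?K (Suc j)) = (\<Sum>j\<le>Suc (degree q). (if j = 0 then 0 else coeff q (j - 1)) * ?K j)"
      by (subst sum.atMost_Suc_shift) simp
    also have "(\<Sum>j\<le>degree q. coeff q j * ?K j) = (\<Sum>j\<le>Suc (degree q). coeff q j * ?K j)"
      by (simp add: coeff_eq_0)
    finally have "(\<Sum>j\<le>degree q. coeff q j * (mop n H ^^ j) w i)
       = (\<Sum>j\<le>Suc (degree q). ((if j = 0 then 0 else coeff q (j - 1)) - l * coeff q j) * ?K j)"
      by (simp add: algebra_simps sum_subtractf sum_distrib_left)
    also have "\<dots> = (\<Sum>j\<le>degree p. coeff p j * ?K j)"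
      unfolding dq cp ..
    finally show ?thesis ..
  qed
  show ?case
  proof (cases "\<exists>i<n. w i \<noteq> 0")
    case True
    have "P w" unfolding w_def by (rule lin) fact
    moreover have "\<forall>i<n. (\<Sum>j\<le>degree q. coeff q j * (mop n H ^^ j) w i) = 0"
      using Suc.prems(4) unfolding eq .
    moreover have "d = degree q" using Suc.hyps(2) dq by simp
    ultimately show ?thesis using Suc.hyps(1)[OF _ q0 _ True] by blast
  next
    case False
    then show ?thesis using Suc.prems 
      by (intro exI[of _ v] exI[of _ l]) (simp add: w_def)
  qed
qed

text \<open>The vectors obtained from \<open>v\<close> by applying \<open>H\<close> up to
  \<open>n\<close> times are \<open>n + 1\<close> in number, hence dependent, and the relation is an
  annihilating polynomial. The subspace enters as a predicate \<open>P\<close>, so that an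
  orthogonal complement can be used without naming a basis of it.\<close>

lemma invariant_eigenvector:
  assumes inv: "\<And>v. P v \<Longrightarrow> P (mop n H v)"
    and lin: "\<And>v c. P v \<Longrightarrow> P (\<lambda>i. mop n H v i - c * v i)"
    and v: "P v" "\<exists>i<n. v i \<noteq> 0"
  shows "\<exists>w l. P w \<and> (\<exists>i<n. w i \<noteq> 0) \<and> (\<forall>i<n. mop n H w i = l * w i)"
proof -
  obtain c where c: "\<exists>k\<in>{..n}. c k \<noteq> 0" "\<forall>i\<in>{..<n}. (\<Sum>k\<le>n. c k * (mop n H ^^ k) v i) = 0"
    using homogeneous_system[of "{..<n}" "{..n}" "\<lambda>k. (mop n H ^^ k) v"] by auto
  define p where "p = (\<Sum>k\<le>n. monom (c k) k)"
  have co: "coeff p j = (if j \<le> n then c j else 0)" for j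
    by (simp add: p_def coeff_sum coeff_monom)
  have "p \<noteq> 0" using c(1) co by (metis atMost_iff coeff_0)
  moreover have "degree p \<le> n" using co by (intro degree_le) auto
  moreover have "(\<Sum>j\<le>degree p. coeff p j * (mop n H ^^ j) v i) = (\<Sum>k\<le>n. c k * (mop n H ^^ k) v i)" for i
  proof -
    have "(\<Sum>j\<le>degree p. coeff p j * (mop n H ^^ j) v i) = (\<Sum>j\<le>n. coeff p j * (mop n H ^^ j) v i)"
      using \<open>degree p \<le> n\<close> by (intro sum.mono_neutral_left) (auto simp: coeff_eq_0)
    then show ?thesis by (simp add: co)
  qed
  ultimately have "\<forall>i<n. (\<Sum>j\<le>degree p. coeff p j * (mop n H ^^ j) v i) = 0" using c(2) by simp
  with inv lin \<open>p \<noteq> 0\<close> v show ?thesis by (rule annihilated_eigenvector)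
qed

section \<open>Hermitian matrices and the spectral theorem\<close>

definition hermitian :: "nat \<Rightarrow> (nat \<Rightarrow> nat \<Rightarrow> complex) \<Rightarrow> bool" where
  "hermitian n H \<longleftrightarrow> (\<forall>i<n. \<forall>j<n. H j i = cnj (H i j))"

definition spectral :: "nat \<Rightarrow> (nat \<Rightarrow> nat \<Rightarrow> complex) \<Rightarrow> (nat \<Rightarrow> nat \<Rightarrow> complex) \<Rightarrow> (nat \<Rightarrow> real) \<Rightarrow> bool" where
  "spectral n H x l \<longleftrightarrow> ortho n {..<n} x \<and> (\<forall>a<n. \<forall>i<n. mop n H (x a) i = complex_of_real (l a) * x a i)"

lemma hermitianD: "hermitian n H \<Longrightarrow> i < n \<Longrightarrow> j < n \<Longrightarrow> cnj (H i j) = H j i"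
  unfolding hermitian_def by metis

lemma hermitian_mop:
  assumes "hermitian n H"
  shows "ip n (mop n H v) w = ip n v (mop n H w)"
  unfolding ip_mop_adj
  by (intro ip_cong refl) (simp add: mop_def hermitianD[OF assms])

lemma hermitian_eigenvalue:
  assumes H: "hermitian n H" and w: "\<exists>i<n. w i \<noteq> 0" "\<forall>i<n. mop n H w i = l * w i"
  shows "l = complex_of_real (Re l)"
proof -
  have "l * ip n w w = ip n (mop n H w) w"
    unfolding ip_scale_left[symmetric] using w by (intro ip_cong) auto
  also have "\<dots> = cnj (ip n (mop n H w) w)"
    unfolding hermitian_mop[OF H] by (rule ip_cnj[THEN trans]) (simp add: hermitian_mop[OF H])
  also have "\<dots> = cnj (l * ip n w w)"
    unfolding ip_scale_left[symmetric] using w by (intro arg_cong[of _ _ cnj] ip_cong) auto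
  finally have "l * of_real (nsq n w) = cnj l * of_real (nsq n w)" by (simp add: ip_self)
  moreover have "nsq n w \<noteq> 0" using w nsq_eq_0 by blast
  ultimately show ?thesis by (simp add: complex_eq_iff)
qed

text \<open>Eigenvectors are added one at a time. \<open>P\<close> is the orthogonal complement of
  those found so far; it is invariant because \<open>H\<close> is Hermitian, and it contains a
  nonzero vector as long as fewer than \<open>n\<close> eigenvectors have been found.\<close>

theorem spectral_theorem:
  assumes H: "hermitian n H"
  shows "\<exists>x l. spectral n H x l"
proof -
  have "k \<le> n \<Longrightarrow> \<exists>x l. ortho n {..<k} x \<and> (\<forall>a<k. \<forall>i<n. mop n H (x a) i = complex_of_real (l a) * x a i)" for k
  proof (induction k)
    case 0 then show ?case by (auto simp: ortho_def)
  next
    case (Suc k)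
    then obtain x l where x: "ortho n {..<k} x"
      and l: "\<forall>a<k. \<forall>i<n. mop n H (x a) i = complex_of_real (l a) * x a i" by auto
    define P where "P = (\<lambda>v. \<forall>a<k. ip n v (x a) = 0)"
    have inv: "P (mop n H v)" if "P v" for v
    proof -
      have "ip n (mop n H v) (x a) = 0" if "a < k" for a
      proof -
        have "ip n (mop n H v) (x a) = ip n v (\<lambda>i. complex_of_real (l a) * x a i)"
          unfolding hermitian_mop[OF H] using l that by (intro ip_cong) auto
        also have "\<dots> = of_real (l a) * ip n v (x a)"
          by (simp add: ip_def sum_distrib_left algebra_simps)
        finally show ?thesis using \<open>P v\<close> that by (simp add: P_def)
      qed
      then show ?thesis by (simp add: P_def)
    qed
    have lin: "P (\<lambda>i. mop n H v i - c * v i)" if "P v" for v c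
      using that inv[OF that] unfolding P_def ip_diff_left ip_scale_left by simp
    obtain v0 where "ortho n (insert k {..<k}) (x(k := v0))"
      using ortho_extend[OF _ x, of k] Suc.prems by auto
    then have v0: "P v0" "ip n v0 v0 = 1" unfolding ortho_def P_def by (auto split: if_splits)
    have "\<exists>i<n. v0 i \<noteq> 0"
      by (rule ccontr) (use v0(2) in \<open>simp add: ip_def\<close>)
    from invariant_eigenvector[of P n H, OF inv lin v0(1) this]
    obtain w c where w: "P w" "\<exists>i<n. w i \<noteq> 0" "\<forall>i<n. mop n H w i = c * w i" by blast
    have pos: "nsq n w > 0" using w(2) nsq_eq_0[of n w] nsq_nonneg[of n w] by (auto simp: less_le)
    define s where "s = complex_of_real (1 / sqrt (nsq n w))"
    define z where "z = (\<lambda>i. s * w i)"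
    have zz: "ip n z z = 1"
      unfolding z_def s_def by (rule ip_normalize[OF pos])
    have zx: "ip n z (x a) = 0" if "a < k" for a
      using w(1) that unfolding z_def ip_scale_left P_def by simp
    then have xz: "ip n (x a) z = 0" if "a < k" for a
      using that by (subst ip_cnj) simp
    have "ortho n {..<Suc k} (x(k := z))"
      using x zz zx xz unfolding ortho_def by (auto simp: less_Suc_eq)
    moreover have "\<forall>i<n. mop n H z i = complex_of_real (Re c) * z i"
    proof -
      have "mop n H z i = s * mop n H w i" for i
        by (simp add: mop_def z_def sum_distrib_left algebra_simps)
      then show ?thesis using w(3) hermitian_eigenvalue[OF H w(2,3)] by (simp add: z_def)
    qed
    moreover have "\<forall>i<n. mop n H ((x(k := z)) a) i = complex_of_real ((l(k := Re c)) a) * (x(k := z)) a i"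
      if "a < Suc k" for a using that l calculation(2) by (auto simp: less_Suc_eq)
    ultimately show ?case by (intro exI[of _ "x(k := z)"] exI[of _ "l(k := Re c)"]) blast
  qed
  from this[of n] show ?thesis by (auto simp: spectral_def)
qed

section \<open>Bernstein approximation of operator functions\<close>

text \<open>De Casteljau scheme with an operator in place of the variable: for linear
  \<open>T\<close> it yields the sum over \<open>k\<close> of
  \<open>binomial(j, k) h(i + k) T^k (1 - T)^(j - k) v\<close>. Combining two entries through their
  difference needs one application of \<open>T\<close> per entry. \<open>T\<close> is any map on
  functions, so the same recursion covers scalars, diagonal maps, matrices and the tridiagonal map
  of the program.\<close>

primrec castel :: "((nat \<Rightarrow> complex) \<Rightarrow> nat \<Rightarrow> complex) \<Rightarrow> (nat \<Rightarrow> real) \<Rightarrow> nat \<Rightarrow> nat \<Rightarrow> (nat \<Rightarrow> complex) \<Rightarrow> nat \<Rightarrow> complex" where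
  "castel T h 0 i v = (\<lambda>x. complex_of_real (h i) * v x)"
| "castel T h (Suc j) i v = (\<lambda>x. castel T h j i v x + T (\<lambda>y. castel T h j (Suc i) v y - castel T h j i v y) x)"

primrec bern :: "(nat \<Rightarrow> real) \<Rightarrow> nat \<Rightarrow> nat \<Rightarrow> real \<Rightarrow> real" where
  "bern h 0 i t = h i"
| "bern h (Suc j) i t = bern h j i t + t * (bern h j (Suc i) t - bern h j i t)"

text \<open>A linear map that carries \<open>T\<close> to \<open>T'\<close> carries the whole table
  along. This one fact yields the coefficients along eigenvectors, the exchange of \<open>S\<close>
  with its adjoint, the action on singular vectors, the scaling of the start vector and the passage
  to Krylov coordinates.\<close>

lemma castel_intertwine:
  assumes add: "\<And>u w. L (\<lambda>x. u x + w x) = (\<lambda>x. L u x + L w x)"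
    and diff: "\<And>u w. L (\<lambda>x. u x - w x) = (\<lambda>x. L u x - L w x)"
    and scale: "\<And>c u. L (\<lambda>x. c * u x) = (\<lambda>x. c * L u x)"
    and comm: "\<And>w. L (T w) = T' (L w)"
  shows "L (castel T h j i v) = castel T' h j i (L v)"
  by (induction j arbitrary: i) (simp_all add: add diff scale comm)

lemma castel_scalar:
  "castel (\<lambda>w x. complex_of_real t * w x) h j i v = (\<lambda>x. complex_of_real (bern h j i t) * v x)"
  by (induction j arbitrary: i) (simp_all add: algebra_simps)

lemma bern_mono:
  assumes "0 \<le> t" "t \<le> 1" "\<And>i. h i \<le> g i"
  shows "bern h j i t \<le> bern g j i t"
proof (induction j arbitrary: i)
  case (Suc j)
  have "(1 - t) * bern h j i t + t * bern h j (Suc i) t \<le> (1 - t) * bern g j i t + t * bern g j (Suc i) t"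
    using assms Suc by (intro add_mono mult_left_mono) auto
  then show ?case by (simp add: algebra_simps)
qed (use assms in simp)

lemma bern_affine: "bern (\<lambda>i. a * h i + b) j i t = a * bern h j i t + b"
  by (induction j arbitrary: i) (simp_all add: algebra_simps)

lemma bern_const: "bern (\<lambda>i. b) j i t = b"
  by (induction j arbitrary: i) simp_all

lemma bern_abs_le:
  assumes "0 \<le> t" "t \<le> 1" "\<And>i. \<bar>h i\<bar> \<le> B"
  shows "\<bar>bern h j i t\<bar> \<le> B"
  using bern_mono[of t h "\<lambda>_. B" j i] bern_mono[of t "\<lambda>_. - B" h j i] assms
  by (simp add: bern_const abs_le_iff) (metis minus_le_iff)

text \<open>First differences in the index commute with the scheme, so they form again a Bernstein
  form, that of the differences of the heights, and averaging does not enlarge their bound.\<close>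

lemma bern_step:
  assumes t: "0 \<le> t" "t \<le> 1" and d: "\<And>i. \<bar>h (Suc i) - h i\<bar> \<le> d"
  shows "\<bar>bern h j (Suc i) t - bern h j i t\<bar> \<le> d"
proof -
  have "bern h j (Suc i) t - bern h j i t = bern (\<lambda>i. h (Suc i) - h i) j i t"
    by (induction j arbitrary: i) (simp_all add: algebra_simps)
  then show ?thesis using bern_abs_le[OF t, of "\<lambda>i. h (Suc i) - h i" d] d by simp
qed

text \<open>The derivative of a form of degree \<open>j\<close> is \<open>j\<close> times a form of
  first differences. Here this appears without derivatives: each level of the scheme contributes one
  term \<open>d |t - s|\<close>.\<close>

lemma bern_lipschitz:
  assumes t: "0 \<le> t" "t \<le> 1" and s: "0 \<le> s" "s \<le> 1" and d: "\<And>i. \<bar>h (Suc i) - h i\<bar> \<le> d"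
  shows "\<bar>bern h j i t - bern h j i s\<bar> \<le> real j * d * \<bar>t - s\<bar>"
proof (induction j arbitrary: i)
  case (Suc j)
  let ?D = "\<lambda>i. bern h j i t - bern h j i s"
  have "bern h (Suc j) i t - bern h (Suc j) i s
     = (1 - t) * ?D i + t * ?D (Suc i) + (t - s) * (bern h j (Suc i) s - bern h j i s)"
    by (simp add: algebra_simps)
  also have "\<bar>\<dots>\<bar> \<le> (1 - t) * \<bar>?D i\<bar> + t * \<bar>?D (Suc i)\<bar> + \<bar>t - s\<bar> * \<bar>bern h j (Suc i) s - bern h j i s\<bar>"
    using t by (intro order.trans[OF abs_triangle_ineq] add_mono) (auto simp: abs_mult)
  also have "\<bar>bern h j (Suc i) s - bern h j i s\<bar> \<le> d" by (rule bern_step[OF s]) (rule d)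
  then have "(1 - t) * \<bar>?D i\<bar> + t * \<bar>?D (Suc i)\<bar> + \<bar>t - s\<bar> * \<bar>bern h j (Suc i) s - bern h j i s\<bar>
    \<le> (1 - t) * (real j * d * \<bar>t - s\<bar>) + t * (real j * d * \<bar>t - s\<bar>) + \<bar>t - s\<bar> * d"
    using t Suc by (intro add_mono mult_left_mono) auto
  finally show ?case by (simp add: algebra_simps)
qed simp

text \<open>Second moment of a binomial distribution: for \<open>i = 0\<close> and
  \<open>c = j t\<close> only the variance \<open>j t (1 - t)\<close> remains.\<close>

lemma bern_quadratic:
  "bern (\<lambda>i. (real i - c)\<^sup>2) j i t = (real i + real j * t - c)\<^sup>2 + real j * (t * (1 - t))"
proof (induction j arbitrary: i)
  case (Suc j)
  show ?case unfolding bern.simps Suc by (simp add: algebra_simps power2_eq_square)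
qed simp

text \<open>Positivity argument: the deviation of the heights from the value at \<open>t\<close> is
  dominated by a quadratic in the index, on which the form is known exactly, and monotonicity
  transfers the bound.\<close>

lemma bern_approx:
  fixes g :: "real \<Rightarrow> real"
  assumes t: "0 \<le> t" "t \<le> 1" and D: "D > 0" and R: "R > 0" and \<Lambda>: "\<Lambda> \<ge> 0"
    and lip: "\<And>x y. 0 \<le> x \<Longrightarrow> 0 \<le> y \<Longrightarrow> \<bar>g x - g y\<bar> \<le> \<Lambda> * \<bar>x - y\<bar>"
  shows "\<bar>bern (\<lambda>i. g (R * real i / real D)) D 0 t - g (R * t)\<bar> \<le> \<Lambda> * R / sqrt (real D)"
proof -
  define h where "h = (\<lambda>i. g (R * real i / real D))"
  define q where "q = sqrt (real D)"
  have q: "q > 0" "q * q = real D" using D by (auto simp: q_def)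
  \<comment> \<open>The quadratic arises from \<open>2 q |u| \<le> u^2 + q^2\<close> with
    \<open>q = sqrt D\<close>. This \<open>q\<close> makes the variance term, at most
    \<open>a D\<close>, equal to the constant term \<open>b\<close>.\<close>
  define a where "a = \<Lambda> * R / (2 * real D * q)"
  define b where "b = \<Lambda> * R / (2 * q)"
  have a: "a \<ge> 0" using q \<Lambda> R D by (auto simp: a_def)
  have key: "\<bar>h i - g (R * t)\<bar> \<le> a * (real i - real D * t)\<^sup>2 + b" for i
  proof -
    let ?u = "real i - real D * t"
    have "\<bar>h i - g (R * t)\<bar> \<le> \<Lambda> * \<bar>R * real i / real D - R * t\<bar>"
      unfolding h_def using t R by (intro lip) auto
    also have "R * real i / real D - R * t = R / real D * ?u" using D by (simp add: field_simps)
    also have "\<Lambda> * \<bar>R / real D * ?u\<bar> = \<Lambda> * R / (2 * real D * q) * (2 * q * \<bar>?u\<bar>)"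
    proof -
      have "\<bar>R / real D * ?u\<bar> = R / real D * \<bar>?u\<bar>" using R D by (simp add: abs_mult)
      then show ?thesis using D q by (simp add: field_simps)
    qed
    also have "\<dots> \<le> a * (?u\<^sup>2 + q\<^sup>2)"
      unfolding a_def[symmetric] using zero_le_power2[of "\<bar>?u\<bar> - q"] a
      by (intro mult_left_mono) (auto simp: power2_eq_square algebra_simps)
    also have "a * q\<^sup>2 = b" using q D unfolding a_def b_def power2_eq_square by (simp add: field_simps)
    then have "a * (?u\<^sup>2 + q\<^sup>2) = a * ?u\<^sup>2 + b" by (simp add: algebra_simps)
    finally show ?thesis .
  qed
  let ?Q = "\<lambda>i. a * (real i - real D * t)\<^sup>2 + b"
  have Q: "bern ?Q D 0 t \<le> 2 * b"
  proof -
    have "bern ?Q D 0 t = a * (real D * (t * (1 - t))) + b"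
      unfolding bern_affine bern_quadratic by simp
    also have "\<dots> \<le> a * (real D * 1) + b"
      using a t by (intro add_mono mult_left_mono order.refl) (auto simp: mult_le_one)
    also have "a * (real D * 1) = b" using D q by (simp add: a_def b_def)
    finally show ?thesis by simp
  qed
  have "bern h D 0 t \<le> bern (\<lambda>i. 1 * ?Q i + g (R * t)) D 0 t"
    by (rule bern_mono[OF t]) (use key in \<open>simp add: abs_le_iff algebra_simps\<close>)
  moreover have "bern (\<lambda>i. (-1) * ?Q i + g (R * t)) D 0 t \<le> bern h D 0 t"
    by (rule bern_mono[OF t]) (use key in \<open>simp add: abs_le_iff algebra_simps\<close>)
  ultimately have "\<bar>bern h D 0 t - g (R * t)\<bar> \<le> 2 * b"
    unfolding bern_affine[of _ ?Q] using Q by linarith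
  also have "2 * b = \<Lambda> * R / sqrt (real D)" by (simp add: b_def q_def)
  finally show ?thesis by (simp add: h_def)
qed

section \<open>Squared Frobenius norms, and Lipschitz functions of Hermitian matrices\<close>

definition fsq :: "nat \<Rightarrow> nat \<Rightarrow> (nat \<Rightarrow> nat \<Rightarrow> complex) \<Rightarrow> real" where
  "fsq m n X = (\<Sum>i<m. nsq n (X i))"

lemma fsq_nonneg [simp]: "fsq m n X \<ge> 0"
  by (simp add: fsq_def sum_nonneg)

text \<open>Parseval in each row: the Frobenius norm can be computed in any orthonormal
  basis.\<close>

lemma fsq_ortho:
  assumes "ortho n {..<n} z"
  shows "(\<Sum>b<n. nsq m (mop n X (z b))) = fsq m n X"
proof -
  have "(\<Sum>b<n. nsq m (mop n X (z b))) = (\<Sum>i<m. \<Sum>b<n. (cmod (ip n (\<lambda>j. cnj (X i j)) (z b)))\<^sup>2)"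
  proof -
    have "cmod (mop n X (z b) i) = cmod (ip n (\<lambda>j. cnj (X i j)) (z b))" for b i
      by (subst complex_mod_cnj[symmetric]) (simp add: mop_def ip_def)
    then show ?thesis unfolding nsq_def by (subst sum.swap) simp
  qed
  also have "\<dots> = fsq m n X"
    unfolding parseval[OF assms] fsq_def by (simp add: nsq_def)
  finally show ?thesis .
qed

lemma mop_bound: "nsq m (mop n X v) \<le> fsq m n X * nsq n v"
proof -
  have "(cmod (mop n X v i))\<^sup>2 \<le> nsq n (X i) * nsq n v" for i
  proof -
    have "mop n X v i = ip n (X i) (\<lambda>j. cnj (v j))" by (simp add: mop_def ip_def)
    then show ?thesis using ip_cauchy_schwarz[of n "X i" "\<lambda>j. cnj (v j)"] by (simp add: nsq_def)
  qed
  then show ?thesis unfolding fsq_def sum_distrib_right by (subst nsq_def) (intro sum_mono)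
qed

text \<open>In the mixed basis the difference of the two functions of matrices has the entries
  \<open>g (\<mu> a) - g (\<nu> b)\<close> times \<open>ip n (z b) (y a)\<close>, each at most
  \<open>\<Lambda>\<close> times the matching entry of \<open>Y - Z\<close>. Summing squares gives
  Frobenius norms without loss and without any condition on gaps between eigenvalues. The vectors
  \<open>v\<close> and \<open>v'\<close> are the two functions applied to \<open>w\<close>, given
  through their coefficients only.\<close>

lemma spectral_lipschitz:
  assumes Y: "hermitian n Y" "spectral n Y y \<mu>" and Z: "hermitian n Z" "spectral n Z z \<nu>"
    and v: "\<And>a. a < n \<Longrightarrow> ip n v (y a) = complex_of_real (g (\<mu> a)) * ip n w (y a)"
    and v': "\<And>b. b < n \<Longrightarrow> ip n v' (z b) = complex_of_real (g (\<nu> b)) * ip n w (z b)"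
    and lip: "\<And>a b. a < n \<Longrightarrow> b < n \<Longrightarrow> \<bar>g (\<mu> a) - g (\<nu> b)\<bar> \<le> \<Lambda> * \<bar>\<mu> a - \<nu> b\<bar>"
  shows "nsq n (\<lambda>i. v i - v' i) \<le> \<Lambda>\<^sup>2 * fsq n n (\<lambda>i j. Y i j - Z i j) * nsq n w"
proof -
  have oy: "ortho n {..<n} y" and oz: "ortho n {..<n} z" using Y Z by (auto simp: spectral_def)
  have expand: "ip n u (y a) = (\<Sum>b<n. ip n u (z b) * ip n (z b) (y a))" for u a
    unfolding ip_sum_left[symmetric] using ortho_expand[OF oz] by (intro ip_cong) auto
  let ?E = "\<lambda>i j. Y i j - Z i j"
  \<comment> \<open>\<open>Y\<close> is moved to the right factor, an eigenvector of it, while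
    \<open>Z\<close> stays with its own eigenvector on the left.\<close>
  have gap: "of_real (\<mu> a - \<nu> b) * ip n (z b) (y a) = ip n (mop n ?E (z b)) (y a)" if "a < n" "b < n" for a b
  proof -
    have "of_real (\<mu> a) * ip n (z b) (y a) = ip n (z b) (\<lambda>i. of_real (\<mu> a) * y a i)"
      by (simp add: ip_def sum_distrib_left algebra_simps)
    also have "\<dots> = ip n (z b) (mop n Y (y a))"
      using Y that by (intro ip_cong) (auto simp: spectral_def)
    also have "\<dots> = ip n (mop n Y (z b)) (y a)" by (simp add: hermitian_mop[OF Y(1)])
    finally have 1: "of_real (\<mu> a) * ip n (z b) (y a) = ip n (mop n Y (z b)) (y a)" .
    have 2: "of_real (\<nu> b) * ip n (z b) (y a) = ip n (mop n Z (z b)) (y a)"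
      unfolding ip_scale_left[symmetric] using Z that by (intro ip_cong) (auto simp: spectral_def)
    have "mop n ?E (z b) = (\<lambda>i. mop n Y (z b) i - mop n Z (z b) i)"
      by (simp add: mop_def algebra_simps sum_subtractf)
    then show ?thesis by (simp add: ip_diff_left left_diff_distrib 1 2)
  qed
  have "(cmod (ip n (\<lambda>i. v i - v' i) (y a)))\<^sup>2 \<le> \<Lambda>\<^sup>2 * (\<Sum>b<n. (cmod (ip n (mop n ?E (z b)) (y a)))\<^sup>2) * nsq n w"
    if a: "a < n" for a
  proof -
    let ?f = "\<lambda>b. of_real (g (\<mu> a) - g (\<nu> b)) * ip n (z b) (y a)"
    have "ip n (\<lambda>i. v i - v' i) (y a) = (\<Sum>b<n. ip n w (z b) * ?f b)"
      unfolding ip_diff_left v[OF a] expand[of v'] expand[of w]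
      by (simp add: v' sum_distrib_left sum_subtractf algebra_simps)
    also have "\<dots> = ip n (\<lambda>b. ip n w (z b)) (\<lambda>b. cnj (?f b))" by (simp add: ip_def)
    finally have "(cmod (ip n (\<lambda>i. v i - v' i) (y a)))\<^sup>2 \<le> (\<Sum>b<n. (cmod (ip n w (z b)))\<^sup>2) * (\<Sum>b<n. (cmod (?f b))\<^sup>2)"
      using ip_cauchy_schwarz[of n "\<lambda>b. ip n w (z b)" "\<lambda>b. cnj (?f b)"]
      unfolding nsq_def complex_mod_cnj by metis
    also have "\<dots> \<le> nsq n w * (\<Sum>b<n. \<Lambda>\<^sup>2 * (cmod (ip n (mop n ?E (z b)) (y a)))\<^sup>2)"
      unfolding parseval[OF oz]
    proof (intro mult_left_mono sum_mono)
      fix b assume "b \<in> {..<n}"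
      then have b: "b < n" by simp
      have "cmod (?f b) = \<bar>g (\<mu> a) - g (\<nu> b)\<bar> * cmod (ip n (z b) (y a))" by (simp only: norm_mult norm_of_real)
      also have "\<dots> \<le> \<Lambda> * \<bar>\<mu> a - \<nu> b\<bar> * cmod (ip n (z b) (y a))"
        by (intro mult_right_mono lip a b) simp
      also have "\<dots> = \<Lambda> * cmod (of_real (\<mu> a - \<nu> b) * ip n (z b) (y a))" by (simp only: norm_mult norm_of_real)
      finally have "cmod (?f b) \<le> \<Lambda> * cmod (ip n (mop n ?E (z b)) (y a))" unfolding gap[OF a b] .
      from power_mono[OF this, of 2]
      show "(cmod (?f b))\<^sup>2 \<le> \<Lambda>\<^sup>2 * (cmod (ip n (mop n ?E (z b)) (y a)))\<^sup>2" by (simp add: power_mult_distrib)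
    qed simp
    finally show ?thesis by (simp add: sum_distrib_left algebra_simps)
  qed
  then have "nsq n (\<lambda>i. v i - v' i) \<le> (\<Sum>a<n. \<Lambda>\<^sup>2 * (\<Sum>b<n. (cmod (ip n (mop n ?E (z b)) (y a)))\<^sup>2) * nsq n w)"
    unfolding parseval[OF oy, symmetric, of "\<lambda>i. v i - v' i"] by (intro sum_mono) auto
  also have "\<dots> = \<Lambda>\<^sup>2 * (\<Sum>b<n. \<Sum>a<n. (cmod (ip n (mop n ?E (z b)) (y a)))\<^sup>2) * nsq n w"
    by (subst sum.swap) (simp add: sum_distrib_left sum_distrib_right)
  also have "\<dots> = \<Lambda>\<^sup>2 * fsq n n ?E * nsq n w"
    unfolding parseval[OF oy] fsq_ortho[OF oz] ..
  finally show ?thesis .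
qed

section \<open>Singular values\<close>

lemma spectral_eigenvalue:
  assumes "spectral n H x l" "a < n"
  shows "complex_of_real (l a) = ip n (mop n H (x a)) (x a)"
proof -
  have "ip n (mop n H (x a)) (x a) = ip n (\<lambda>i. of_real (l a) * x a i) (x a)"
    using assms by (intro ip_cong) (auto simp: spectral_def)
  also have "\<dots> = of_real (l a)" unfolding ip_scale_left using assms by (simp add: spectral_def ortho_def)
  finally show ?thesis by simp
qed

section \<open>Gram matrices and existence of singular value decompositions\<close>

text \<open>The adjoint of \<open>M\<close> times \<open>M\<close>; applied to the adjoint array,
  the same definition gives the product in the other order.\<close>

definition gram :: "nat \<Rightarrow> (nat \<Rightarrow> nat \<Rightarrow> complex) \<Rightarrow> nat \<Rightarrow> nat \<Rightarrow> complex" where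
  "gram m M = (\<lambda>i j. \<Sum>k<m. cnj (M k i) * M k j)"

lemma hermitian_gram: "hermitian n (gram m M)"
  unfolding hermitian_def gram_def by (simp add: mult.commute)

lemma mop_gram: "mop n (gram m M) v = mop m (\<lambda>i k. cnj (M k i)) (mop n M v)"
  unfolding mop_def gram_def sum_distrib_left sum_distrib_right
  by (intro ext, subst sum.swap) (simp add: mult.assoc)

lemma ip_gram: "ip n (mop n (gram m M) v) w = ip m (mop n M v) (mop n M w)"
  unfolding mop_gram using ip_mop_adj[of n m "\<lambda>i k. cnj (M k i)" "mop n M v" w] by simp

lemma spectral_gram_bounds:
  assumes "spectral n (gram m M) x l" "a < n"
  shows "l a = nsq m (mop n M (x a))" "0 \<le> l a" "l a \<le> fsq m n M"
proof -
  show 1: "l a = nsq m (mop n M (x a))"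
    using spectral_eigenvalue[OF assms] unfolding ip_gram ip_self by (simp only: of_real_eq_iff)
  then show "0 \<le> l a" by simp
  have "nsq n (x a) = 1" using assms ip_self[of n "x a"] by (auto simp: spectral_def ortho_def)
  then show "l a \<le> fsq m n M" using mop_bound[of m n M "x a"] 1 by simp
qed

text \<open>Right singular vectors are eigenvectors of \<open>gram m M\<close>; left ones are their
  normalised images when the eigenvalue is nonzero. The left family lives in dimension
  \<open>m\<close>, so at most \<open>min m n\<close> eigenvalues are nonzero, and the family can be
  completed to exactly \<open>min m n\<close> vectors.\<close>

lemma svd_exists_fun:
  fixes M :: "nat \<Rightarrow> nat \<Rightarrow> complex" and m n :: nat
  defines "r \<equiv> min m n"
  shows "\<exists>s u v. (\<forall>k<r. 0 \<le> s k) \<and> ortho m {..<r} u \<and> ortho n {..<r} v \<and>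
    (\<forall>i<m. \<forall>j<n. M i j = (\<Sum>k<r. complex_of_real (s k) * u k i * cnj (v k j)))"
proof -
  obtain x l where sp: "spectral n (gram m M) x l" using spectral_theorem[OF hermitian_gram] by blast
  then have ox: "ortho n {..<n} x" by (simp add: spectral_def)
  note l = spectral_gram_bounds[OF sp]
  define s where "s = (\<lambda>a. sqrt (l a))"
  define u where "u = (\<lambda>a i. complex_of_real (1 / s a) * mop n M (x a) i)"
  define I where "I = {a. a < n \<and> l a \<noteq> 0}"
  have "finite I" by (simp add: I_def)
  have s: "s a > 0" if "a \<in> I" for a using that l(2)[of a] by (auto simp: I_def s_def)
  have Mx: "mop n M (x a) i = of_real (s a) * u a i" if "a \<in> I" for a i
    using s[OF that] by (simp add: u_def)
  have ou: "ortho m I u" unfolding ortho_def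
  proof (intro ballI)
    fix a b assume ab: "a \<in> I" "b \<in> I"
    then have "a < n" "b < n" by (auto simp: I_def)
    have "ip m (u a) (u b) = of_real (1 / s a) * (of_real (1 / s b) * ip m (mop n M (x a)) (mop n M (x b)))"
      unfolding u_def ip_scale_left by (simp add: ip_def sum_distrib_left algebra_simps)
    also have "ip m (mop n M (x a)) (mop n M (x b)) = of_real (l a) * ip n (x a) (x b)"
      unfolding ip_gram[symmetric] ip_scale_left[symmetric]
      using sp \<open>a < n\<close> by (intro ip_cong) (auto simp: spectral_def)
    also have "ip n (x a) (x b) = (if a = b then 1 else 0)"
      using ox \<open>a < n\<close> \<open>b < n\<close> by (auto simp: ortho_def)
    finally show "ip m (u a) (u b) = (if a = b then 1 else 0)"
      using s[OF ab(1)] l(2)[OF \<open>a < n\<close>] by (auto simp: s_def simp flip: of_real_mult)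
  qed
  have "card I \<le> r"
    using ortho_card_le[OF \<open>finite I\<close> ou] card_mono[of "{..<n}" I] by (auto simp: r_def I_def)
  \<comment> \<open>\<open>J\<close> keeps every index with nonzero eigenvalue and is filled up to
    \<open>min m n\<close> with others; indices outside \<open>J\<close> contribute nothing to the
    expansion of \<open>M\<close>.\<close>
  then obtain J where J: "I \<subseteq> J" "J \<subseteq> {..<n}" "card J = r"
    using exists_subset_between[of I r "{..<n}"] by (auto simp: r_def I_def)
  then have finJ: "finite J" using finite_subset by blast
  obtain u' where u': "ortho m J u'" "\<And>a. a \<in> I \<Longrightarrow> u' a = u a"
    using ortho_extend_set[OF finJ J(1) ou] J(3) by (auto simp: r_def)
  obtain g where g: "bij_betw g {..<r} J"
    using ex_bij_betw_nat_finite[OF finJ] J(3) by (auto simp: atLeast0LessThan)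
  have inJ: "g k \<in> J" if "k < r" for k using bij_betwE[OF g] that by auto
  have inj: "g k = g k' \<longleftrightarrow> k = k'" if "k < r" "k' < r" for k k'
    using bij_betw_imp_inj_on[OF g] that by (auto simp: inj_on_def)
  have expand: "M i j = (\<Sum>a\<in>J. of_real (s a) * u' a i * cnj (x a j))" if "i < m" "j < n" for i j
  proof -
    have 0: "mop n M (x a) i = 0" if "a < n" "a \<notin> I" for a
      using l(1)[OF that(1)] that \<open>i < m\<close> nsq_eq_0[of m "mop n M (x a)"] by (auto simp: I_def)
    have "M i j = cnj (\<Sum>a<n. ip n (\<lambda>j. cnj (M i j)) (x a) * x a j)"
      by (simp add: ortho_expand[OF ox \<open>j < n\<close>])
    also have "\<dots> = (\<Sum>a<n. mop n M (x a) i * cnj (x a j))"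
      by (simp add: ip_def mop_def mult.commute)
    also have "\<dots> = (\<Sum>a\<in>J. mop n M (x a) i * cnj (x a j))"
      by (intro sum.mono_neutral_right) (use J 0 in auto)
    also have "\<dots> = (\<Sum>a\<in>J. of_real (s a) * u' a i * cnj (x a j))"
    proof (intro sum.cong refl)
      fix a assume "a \<in> J"
      then have "a < n" using J by auto
      show "mop n M (x a) i * cnj (x a j) = of_real (s a) * u' a i * cnj (x a j)"
        using Mx[of a i] u'(2)[of a] 0[OF \<open>a < n\<close>] \<open>a < n\<close> by (cases "a \<in> I") (auto simp: I_def s_def)
    qed
    finally show ?thesis .
  qed
  show ?thesis
  proof (intro exI conjI allI impI)
    show "0 \<le> s (g k)" if "k < r" for k using inJ[OF that] J l(2) by (auto simp: s_def)
    show "ortho m {..<r} (\<lambda>k. u' (g k))" using u'(1) inJ inj by (auto simp: ortho_def)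
    show "ortho n {..<r} (\<lambda>k. x (g k))" using ox inJ inj J(2) unfolding ortho_def by (auto simp: subset_iff)
    show "M i j = (\<Sum>k<r. of_real (s (g k)) * u' (g k) i * cnj (x (g k) j))" if "i < m" "j < n" for i j
      unfolding expand[OF that] by (rule sum.reindex_bij_betw[OF g, symmetric])
  qed
qed

lemma eucl_norm_nsq: "dim_vec v = n \<Longrightarrow> (eucl_norm v)\<^sup>2 = nsq n (\<lambda>i. v $ i)"
  by (simp add: eucl_norm_sq nsq_def)

lemma ip_conjugate_prod:
  "v \<in> carrier_vec d \<Longrightarrow> w \<in> carrier_vec d \<Longrightarrow> v \<bullet>c w = ip d (\<lambda>i. v $ i) (\<lambda>i. w $ i)"
  by (simp add: ip_def scalar_prod_def atLeast0LessThan)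

lemma orthonormal_family_iff:
  assumes "\<forall>i<l. u i \<in> carrier_vec d"
  shows "orthonormal_family d l u \<longleftrightarrow> ortho d {..<l} (\<lambda>k i. u k $ i)"
proof -
  have "u i \<bullet>c u j = ip d (\<lambda>k. u i $ k) (\<lambda>k. u j $ k)" if "i < l" "j < l" for i j
    using that assms by (intro ip_conjugate_prod) auto
  then show ?thesis unfolding orthonormal_family_def ortho_def using assms by (simp add: Ball_def)
qed

lemma svd_exists: "\<exists>s u v. is_svd M s u v"
proof -
  let ?m = "dim_row M" let ?n = "dim_col M"
  obtain s u v where 1: "\<forall>k<min ?m ?n. 0 \<le> s k" "ortho ?m {..<min ?m ?n} u" "ortho ?n {..<min ?m ?n} v"
    "\<forall>i<?m. \<forall>j<?n. M $$ (i, j) = (\<Sum>k<min ?m ?n. complex_of_real (s k) * u k i * cnj (v k j))"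
    using svd_exists_fun[of ?m ?n "\<lambda>i j. M $$ (i, j)"] by blast
  have vec: "ortho d {..<l} (\<lambda>k i. Matrix.vec d (w k) $ i) \<longleftrightarrow> ortho d {..<l} w" for d l and w :: "nat \<Rightarrow> nat \<Rightarrow> complex"
    unfolding ortho_def by (intro ball_cong refl arg_cong2[of _ _ _ _ "(=)"] ip_cong) auto
  have "is_svd M s (\<lambda>k. Matrix.vec ?m (u k)) (\<lambda>k. Matrix.vec ?n (v k))"
    unfolding is_svd_def Let_def
    using 1 by (auto simp: orthonormal_family_iff vec rank_one_sum_def intro!: eq_matI)
  then show ?thesis by blast
qed

lemma eucl_norm_nonneg [simp]: "0 \<le> eucl_norm v"
  by (simp add: eucl_norm_def sum_nonneg)

section \<open>Singular values, spectral norm and condition number\<close>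

text \<open>One fixed decomposition, as families of functions; in the end it is the one chosen
  inside \<open>svt\<close>. The locale is interpreted also for a second decomposition of the same
  matrix, to compare singular values, and for the transformed matrix, which has the same singular
  vectors.\<close>

locale svd_data =
  fixes m n l :: nat and A :: "complex mat" and s :: "nat \<Rightarrow> real"
    and u v :: "nat \<Rightarrow> nat \<Rightarrow> complex"
  assumes A: "A \<in> carrier_mat m n"
    and l: "l = min m n"
    and s_nonneg: "k < l \<Longrightarrow> 0 \<le> s k"
    and ou: "ortho m {..<l} u" and ov: "ortho n {..<l} v"
    and entry: "i < m \<Longrightarrow> j < n \<Longrightarrow> A $$ (i, j) = (\<Sum>k<l. complex_of_real (s k) * u k i * cnj (v k j))"
begin

abbreviation "a \<equiv> (\<lambda>i j. A $$ (i, j))"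

lemma mop_a: "i < m \<Longrightarrow> mop n a z i = (\<Sum>k<l. (complex_of_real (s k) * ip n z (v k)) * u k i)"
  unfolding mop_def ip_def sum_distrib_left sum_distrib_right
  by (subst sum.swap) (simp add: entry sum_distrib_left sum_distrib_right algebra_simps)

lemma nsq_mop_a: "nsq m (mop n a z) = (\<Sum>k<l. (s k)\<^sup>2 * (cmod (ip n z (v k)))\<^sup>2)"
proof -
  have "nsq m (mop n a z) = nsq m (\<lambda>i. \<Sum>k<l. (complex_of_real (s k) * ip n z (v k)) * u k i)"
    by (intro nsq_cong mop_a)
  then show ?thesis
    by (simp add: nsq_ortho_sum[OF _ ou] norm_mult power_mult_distrib)
qed

lemma ip_v: "k < l \<Longrightarrow> k' < l \<Longrightarrow> ip n (v k) (v k') = (if k = k' then 1 else 0)"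
  using ov by (simp add: ortho_def)

lemma ip_u: "k < l \<Longrightarrow> k' < l \<Longrightarrow> ip m (u k) (u k') = (if k = k' then 1 else 0)"
  using ou by (simp add: ortho_def)

lemma nsq_v: "k < l \<Longrightarrow> nsq n (v k) = 1"
  using ip_v[of k k] by (simp add: ip_self)

lemma mop_a_v: "k < l \<Longrightarrow> i < m \<Longrightarrow> mop n a (v k) i = of_real (s k) * u k i"
proof -
  assume k: "k < l" and i: "i < m"
  have "mop n a (v k) i = (\<Sum>k'<l. if k' = k then of_real (s k) * u k i else 0)"
    unfolding mop_a[OF i] using ip_v k by (intro sum.cong) auto
  then show ?thesis using k by simp
qed

lemma nsq_mop_a_v: "k < l \<Longrightarrow> nsq m (mop n a (v k)) = (s k)\<^sup>2"
proof -
  assume k: "k < l"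
  have "nsq m (mop n a (v k)) = (\<Sum>k'<l. if k' = k then (s k)\<^sup>2 else 0)"
    unfolding nsq_mop_a using ip_v k by (intro sum.cong) auto
  then show ?thesis using k by simp
qed

lemma ip_mop_a_v: "k < l \<Longrightarrow> ip m (mop n a w) (mop n a (v k)) = of_real ((s k)\<^sup>2) * ip n w (v k)"
proof -
  assume k: "k < l"
  have "ip m (mop n a w) (mop n a (v k))
    = ip m (\<lambda>i. \<Sum>k<l. (of_real (s k) * ip n w (v k)) * u k i) (\<lambda>i. of_real (s k) * u k i)"
    using k by (intro ip_cong mop_a mop_a_v) auto
  also have "\<dots> = of_real (s k) * ip m (\<lambda>i. \<Sum>k<l. (of_real (s k) * ip n w (v k)) * u k i) (u k)"
    by (simp add: ip_def sum_distrib_left algebra_simps)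
  also have "ip m (\<lambda>i. \<Sum>k<l. (of_real (s k) * ip n w (v k)) * u k i) (u k)
    = (\<Sum>k'<l. if k' = k then of_real (s k) * ip n w (v k) else 0)"
    unfolding ip_sum_left by (intro sum.cong refl) (use k in \<open>auto simp: ip_u\<close>)
  finally show ?thesis using k by (simp add: power2_eq_square)
qed

lemma eucl_norm_mult_vec:
  "z \<in> carrier_vec n \<Longrightarrow> (eucl_norm (A *\<^sub>v z))\<^sup>2 = nsq m (mop n a (\<lambda>i. z $ i))"
  using A by (subst eucl_norm_nsq[of _ m])
    (auto simp: mop_def scalar_prod_def atLeast0LessThan intro!: nsq_cong)

definition "unit_images = {eucl_norm (A *\<^sub>v x) | x. x \<in> carrier_vec (dim_col A) \<and> eucl_norm x = 1}"

lemma spectral_norm_unit_images: "spectral_norm A = Sup unit_images"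
  by (simp add: spectral_norm_def unit_images_def)

lemma bound_unit_images:
  assumes B: "\<And>k. k < l \<Longrightarrow> s k \<le> B" "0 \<le> B" and y: "y \<in> unit_images"
  shows "y \<le> B"
proof -
  obtain x where x: "x \<in> carrier_vec n" "eucl_norm x = 1" "y = eucl_norm (A *\<^sub>v x)"
    using y A by (auto simp: unit_images_def)
  have "y\<^sup>2 = (\<Sum>k<l. (s k)\<^sup>2 * (cmod (ip n (\<lambda>i. x $ i) (v k)))\<^sup>2)"
    using x by (simp add: eucl_norm_mult_vec nsq_mop_a)
  also have "\<dots> \<le> (\<Sum>k<l. B\<^sup>2 * (cmod (ip n (\<lambda>i. x $ i) (v k)))\<^sup>2)"
    using B s_nonneg by (intro sum_mono mult_right_mono power_mono) auto
  also have "\<dots> \<le> B\<^sup>2 * nsq n (\<lambda>i. x $ i)"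
    unfolding sum_distrib_left[symmetric] by (intro mult_left_mono bessel[OF _ ov]) auto
  also have "nsq n (\<lambda>i. x $ i) = 1" using x eucl_norm_nsq[of x n] by simp
  finally have "y\<^sup>2 \<le> B\<^sup>2" by simp
  then show ?thesis by (rule power2_le_imp_le[OF _ B(2)])
qed

lemma s_in_unit_images: "k < l \<Longrightarrow> s k \<in> unit_images"
proof -
  assume k: "k < l"
  let ?x = "Matrix.vec n (v k)"
  have v: "mop n a (\<lambda>i. ?x $ i) = mop n a (v k)" by (simp add: mop_def)
  have "(eucl_norm ?x)\<^sup>2 = 1"
    using nsq_v[OF k] nsq_cong[of n "\<lambda>i. ?x $ i" "v k"] by (simp add: eucl_norm_nsq[of _ n])
  then have "eucl_norm ?x = 1"
    using power2_eq_imp_eq[of "eucl_norm ?x" 1] eucl_norm_nonneg[of ?x] by simp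
  moreover have "(eucl_norm (A *\<^sub>v ?x))\<^sup>2 = (s k)\<^sup>2"
    by (simp add: eucl_norm_mult_vec nsq_mop_a_v[OF k] v)
  then have "eucl_norm (A *\<^sub>v ?x) = s k"
    by (rule power2_eq_imp_eq[OF _ eucl_norm_nonneg s_nonneg[OF k]])
  ultimately show ?thesis using A by (force simp: unit_images_def)
qed

lemma s_le_spectral_norm: "k < l \<Longrightarrow> s k \<le> spectral_norm A"
proof -
  assume k: "k < l"
  \<comment> \<open>A crude bound; it serves to make the set bounded above, since otherwise the
    supremum would be unspecified.\<close>
  define B where "B = (\<Sum>k<l. s k)"
  have "0 \<le> B" unfolding B_def by (intro sum_nonneg) (simp add: s_nonneg)
  moreover have "s k \<le> B" if "k < l" for k
    unfolding B_def by (rule member_le_sum) (use that s_nonneg in auto)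
  ultimately have "y \<le> B" if "y \<in> unit_images" for y using bound_unit_images[OF _ _ that] by blast
  then have "bdd_above unit_images" by (rule bdd_aboveI)
  then show ?thesis unfolding spectral_norm_unit_images using s_in_unit_images[OF k] by (rule cSup_upper[rotated])
qed

lemma spectral_norm_le:
  assumes "0 < l" and B: "\<And>k. k < l \<Longrightarrow> s k \<le> B"
  shows "spectral_norm A \<le> B"
  unfolding spectral_norm_unit_images
proof (rule cSup_least)
  show "unit_images \<noteq> {}" using s_in_unit_images[OF assms(1)] by blast
  have "0 \<le> B" using s_nonneg[OF assms(1)] B[OF assms(1)] by linarith
  then show "y \<le> B" if "y \<in> unit_images" for y using bound_unit_images[OF B _ that] by blast
qed

lemma mop_bound_spectral:
  "nsq m (mop n a z) \<le> (spectral_norm A)\<^sup>2 * nsq n z"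
proof -
  have "nsq m (mop n a z) \<le> (\<Sum>k<l. (spectral_norm A)\<^sup>2 * (cmod (ip n z (v k)))\<^sup>2)"
    unfolding nsq_mop_a using s_le_spectral_norm s_nonneg by (intro sum_mono mult_right_mono power_mono) auto
  also have "\<dots> \<le> (spectral_norm A)\<^sup>2 * nsq n z"
    unfolding sum_distrib_left[symmetric] by (intro mult_left_mono bessel[OF _ ov]) auto
  finally show ?thesis .
qed

lemma fsq_a: "fsq m n a = (\<Sum>k<l. (s k)\<^sup>2)"
proof -
  have "complex_of_real (fsq m n a) = (\<Sum>i<m. \<Sum>j<n. a i j * cnj (a i j))"
    unfolding fsq_def nsq_def of_real_sum cmod_sq ..
  also have "\<dots> = (\<Sum>i<m. \<Sum>k<l. of_real (s k) * u k i * cnj (mop n a (v k) i))"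
  proof (rule sum.cong[OF refl])
    fix i assume "i \<in> {..<m}"
    then have "(\<Sum>j<n. a i j * cnj (a i j)) = (\<Sum>j<n. \<Sum>k<l. of_real (s k) * u k i * cnj (v k j) * cnj (a i j))"
      by (intro sum.cong refl) (subst (1) entry, auto simp: sum_distrib_right)
    also have "\<dots> = (\<Sum>k<l. of_real (s k) * u k i * cnj (mop n a (v k) i))"
      unfolding mop_def by (subst sum.swap) (simp add: sum_distrib_left algebra_simps)
    finally show "(\<Sum>j<n. a i j * cnj (a i j)) = (\<Sum>k<l. of_real (s k) * u k i * cnj (mop n a (v k) i))" .
  qed
  also have "\<dots> = (\<Sum>k<l. of_real (s k) * of_real (s k) * ip m (u k) (u k))"
    by (subst sum.swap) (simp add: mop_a_v ip_def sum_distrib_left algebra_simps)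
  also have "\<dots> = complex_of_real (\<Sum>k<l. (s k)\<^sup>2)"
    by (simp add: ip_u power2_eq_square)
  finally show ?thesis by (simp only: of_real_eq_iff)
qed

end

lemma is_svd_data:
  assumes "is_svd M s u v" "M \<in> carrier_mat m n"
  shows "svd_data m n (min m n) M s (\<lambda>k i. u k $ i) (\<lambda>k i. v k $ i)"
proof -
  from assms have *: "\<forall>i<min m n. 0 \<le> s i" "orthonormal_family m (min m n) u"
    "orthonormal_family n (min m n) v" "M = rank_one_sum m n s u v"
    by (auto simp: is_svd_def Let_def)
  have "\<forall>i<min m n. u i \<in> carrier_vec m" "\<forall>i<min m n. v i \<in> carrier_vec n"
    using *(2,3) by (auto simp: orthonormal_family_def)
  note 1 = orthonormal_family_iff[OF this(1)] orthonormal_family_iff[OF this(2)]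
  have "M $$ (i, j) = (\<Sum>k<min m n. complex_of_real (s k) * u k $ i * cnj (v k $ j))"
    if "i < m" "j < n" for i j
    using that unfolding rank_one_sum_def *(4) by simp
  then show ?thesis
    using * assms 1 by (intro svd_data.intro) auto
qed

text \<open>\<open>singular_values\<close> collects the values of every decomposition, so they have
  to be traced back to one. A vector \<open>v k\<close> with another singular value is orthogonal to
  the right singular vector of \<open>s' k'\<close>, both being eigenvectors of the Gram matrix for
  different eigenvalues; if no value matched, \<open>A\<close> would annihilate that singular
  vector.\<close>

lemma (in svd_data) nonzero_singular_value:
  assumes "is_svd A s' u' v'" "k' < l" "s' k' \<noteq> 0"
  shows "s' k' \<in> s ` {..<l}"
proof (rule ccontr)
  assume no: "\<not> ?thesis"
  interpret d: svd_data m n l A s' "\<lambda>k i. u' k $ i" "\<lambda>k i. v' k $ i"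
    using is_svd_data[OF assms(1) A] l by simp
  let ?w = "\<lambda>i. v' k' $ i"
  have 0: "ip n ?w (v k) = 0" if k: "k < l" for k
  proof -
    have "of_real ((s k)\<^sup>2) * ip n ?w (v k) = ip m (mop n a ?w) (mop n a (v k))"
      by (simp add: ip_mop_a_v[OF k])
    also have "\<dots> = cnj (ip m (mop n a (v k)) (mop n a ?w))" by (rule ip_cnj)
    also have "\<dots> = of_real ((s' k')\<^sup>2) * cnj (ip n (v k) ?w)"
      by (simp add: d.ip_mop_a_v[OF assms(2)])
    also have "cnj (ip n (v k) ?w) = ip n ?w (v k)" by (rule ip_cnj[symmetric])
    finally have "of_real ((s k)\<^sup>2 - (s' k')\<^sup>2) * ip n ?w (v k) = 0" by (simp add: algebra_simps)
    moreover have "(s k)\<^sup>2 \<noteq> (s' k')\<^sup>2"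
    proof
      assume "(s k)\<^sup>2 = (s' k')\<^sup>2"
      then have "s' k' = s k" using s_nonneg[OF k] d.s_nonneg[OF assms(2)] by (simp add: power2_eq_iff_nonneg)
      then show False using no k by blast
    qed
    ultimately show ?thesis by (metis eq_iff_diff_eq_0 mult_eq_0_iff of_real_eq_0_iff)
  qed
  have "(s' k')\<^sup>2 = nsq m (mop n a ?w)" by (simp add: d.nsq_mop_a_v[OF assms(2)])
  also have "\<dots> = 0" by (simp add: nsq_mop_a 0)
  finally show False using assms(3) by simp
qed

context svd_data
begin

text \<open>Makes \<open>kappa2\<close> usable: the set of singular values is finite, its maximum is
  the spectral norm, and the spectral norm divided by \<open>kappa2\<close> is its smallest nonzero
  element. Whether \<open>0\<close> belongs to the set depends on \<open>A\<close>, which is why it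
  is compared with an image that has \<open>0\<close> inserted.\<close>

lemma singular_values_bounds:
  assumes "is_svd A s u' v'" and nz: "\<exists>k<l. s k \<noteq> 0"
  shows "spectral_norm A > 0" "kappa2 A \<ge> 1" "\<And>k. k < l \<Longrightarrow> s k \<noteq> 0 \<Longrightarrow> spectral_norm A / kappa2 A \<le> s k"
proof -
  let ?V = "singular_values A"
  have sub: "?V \<subseteq> insert 0 (s ` {..<l})"
  proof
    fix x assume "x \<in> ?V"
    then obtain s' u'' v'' where 1: "is_svd A s' u'' v''" "x \<in> s' ` {..<min (dim_row A) (dim_col A)}"
      unfolding singular_values_def by blast
    have "min (dim_row A) (dim_col A) = l" using A l by simp
    with 1 obtain k where k: "k < l" "x = s' k" by blast
    show "x \<in> insert 0 (s ` {..<l})"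
    proof (cases "s' k = 0")
      case False
      from nonzero_singular_value[OF 1(1) k(1) this] show ?thesis by (simp add: k(2))
    qed (simp add: k(2))
  qed
  then have fin: "finite ?V" by (rule finite_subset) simp
  have mem: "s k \<in> ?V" if "k < l" for k
    unfolding singular_values_def
    using assms(1) that A l by (intro CollectI exI[of _ s] exI[of _ u'] exI[of _ v'] conjI) auto
  obtain k0 where k0: "k0 < l" "s k0 \<noteq> 0" using nz by blast
  then show N: "spectral_norm A > 0" using s_le_spectral_norm[of k0] s_nonneg[of k0] by simp
  have "spectral_norm A \<le> Max ?V"
    using k0 by (intro spectral_norm_le Max_ge fin mem) auto
  moreover have "Max ?V \<le> spectral_norm A"
  proof (rule Max.boundedI[OF fin])
    show "?V \<noteq> {}" using mem k0 by blast
    show "x \<le> spectral_norm A" if x: "x \<in> ?V" for x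
    proof (cases "x = 0")
      case False
      then obtain k where "k < l" "x = s k" using x sub by blast
      then show ?thesis using s_le_spectral_norm by simp
    qed (use N in simp)
  qed
  ultimately have max: "Max ?V = spectral_norm A" by simp
  let ?W = "?V - {0}"
  have finW: "finite ?W" "?W \<noteq> {}" using fin mem k0 by auto
  have minmem: "Min ?W \<in> ?W" using finW by (rule Min_in)
  then have "Min ?W \<in> s ` {..<l}" "Min ?W \<noteq> 0" using sub by auto
  then obtain k1 where "k1 < l" "Min ?W = s k1" by blast
  then have minpos: "Min ?W > 0" using s_nonneg[of k1] \<open>Min ?W \<noteq> 0\<close> by simp
  have "Min ?W \<le> Max ?V" using minmem fin by (intro Max_ge) auto
  then show "kappa2 A \<ge> 1" unfolding kappa2_def using minpos by simp
  show "spectral_norm A / kappa2 A \<le> s k" if "k < l" "s k \<noteq> 0" for k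
  proof -
    have "Min ?W \<le> s k" using mem[OF that(1)] that(2) finW by (intro Min_le) auto
    moreover have "spectral_norm A / kappa2 A = Min ?W" unfolding kappa2_def max using N by simp
    ultimately show ?thesis by simp
  qed
qed

end

section \<open>The transformed vector and the projection\<close>

lemma mat_adjoint_index:
  "i < dim_col M \<Longrightarrow> j < dim_row M \<Longrightarrow> mat_adjoint M $$ (i, j) = cnj (M $$ (j, i))"
  by (simp add: mat_adjoint_def mat_of_rows_def)

lemma mat_adjoint_carrier: "M \<in> carrier_mat m n \<Longrightarrow> mat_adjoint M \<in> carrier_mat n m"
  by (auto simp: mat_adjoint_def mat_of_rows_def)

text \<open>The difference of two candidates lies in \<open>V\<close> and is orthogonal to itself;
  this settles the uniqueness in the definite description.\<close>

lemma orth_proj_eq: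
  assumes V: "\<And>x y. x \<in> V \<Longrightarrow> y \<in> V \<Longrightarrow> x - y \<in> V" "V \<subseteq> carrier_vec m"
    and b: "b \<in> carrier_vec m" and p: "p \<in> V" "\<forall>w\<in>V. (b - p) \<bullet>c w = 0"
  shows "orth_proj V b = p"
  unfolding orth_proj_def
proof (rule the_equality)
  show "p \<in> V \<and> (\<forall>w\<in>V. (b - p) \<bullet>c w = 0)" using p by blast
  fix q assume q: "q \<in> V \<and> (\<forall>w\<in>V. (b - q) \<bullet>c w = 0)"
  have c: "p \<in> carrier_vec m" "q \<in> carrier_vec m" using p q V(2) by auto
  define w where "w = q - p"
  have w: "w \<in> V" "w \<in> carrier_vec m" using q p V c by (auto simp: w_def)
  have "ip m (\<lambda>i. (b - p) $ i) (\<lambda>i. w $ i) = 0" "ip m (\<lambda>i. (b - q) $ i) (\<lambda>i. w $ i) = 0"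
    using p(2) q w b c by (simp_all flip: ip_conjugate_prod)
  moreover have "ip m (\<lambda>i. w $ i) (\<lambda>i. w $ i) = ip m (\<lambda>i. (b - p) $ i - (b - q) $ i) (\<lambda>i. w $ i)"
    using b c by (intro ip_cong) (auto simp: w_def)
  ultimately have "ip m (\<lambda>i. w $ i) (\<lambda>i. w $ i) = 0" by (simp add: ip_diff_left)
  then have "\<forall>i<m. w $ i = 0" by (simp add: ip_self nsq_eq_0)
  then show "q = p" using c by (intro eq_vecI) (auto simp: w_def)
qed

text \<open>The decomposition chosen inside \<open>svt\<close> for the adjoint is, with left and
  right vectors exchanged, a decomposition of \<open>A\<close>, and everything refers to it. The
  adjoint of the transformed matrix has the same singular vectors with values
  \<open>f (s k)\<close>. As \<open>f\<close> is \<open>0\<close> at \<open>0\<close> and positive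
  beyond, its column space is spanned by the \<open>u k\<close> with nonzero
  \<open>s k\<close>.\<close>

lemma svt_data:
  assumes A: "A \<in> carrier_mat m n" and b: "b \<in> carrier_vec m"
    and f: "f 0 = 0" "\<And>x. x > 0 \<Longrightarrow> f x > (0::real)"
  obtains s u v where "svd_data m n (min m n) A s u v" "\<exists>u' v'. is_svd A s u' v'"
    "\<And>j. j < n \<Longrightarrow> (svt f (mat_adjoint A) *\<^sub>v b) $ j = (\<Sum>k<min m n. complex_of_real (f (s k)) * ip m (\<lambda>i. b $ i) (u k) * v k j)"
    "(eucl_norm (svt_proj f A b))\<^sup>2 \<le> (\<Sum>k<min m n. if s k = 0 then 0 else (cmod (ip m (\<lambda>i. b $ i) (u k)))\<^sup>2)"
proof -
  let ?l = "min m n"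
  let ?B = "mat_adjoint A"
  note B = mat_adjoint_carrier[OF A]
  have "\<exists>X s u v. is_svd ?B s u v \<and> X = rank_one_sum (dim_row ?B) (dim_col ?B) (\<lambda>i. f (s i)) u v"
    using svd_exists[of ?B] by blast
  from someI_ex[OF this[folded], folded svt_def]
  obtain s v u where sv: "is_svd ?B s v u" and X: "svt f ?B = rank_one_sum n m (\<lambda>i. f (s i)) v u"
    using B by auto
  have l: "min n m = ?l" by simp
  have *: "\<forall>k<?l. 0 \<le> s k" "orthonormal_family m ?l u" "orthonormal_family n ?l v"
    "?B = rank_one_sum n m s v u"
    using sv B unfolding is_svd_def Let_def l[symmetric] by auto
  have "A = rank_one_sum m n s u v"
  proof (rule eq_matI)
    fix i j assume "i < dim_row (rank_one_sum m n s u v)" "j < dim_col (rank_one_sum m n s u v)"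
    then have ij: "i < m" "j < n" by (auto simp: rank_one_sum_def)
    have "A $$ (i, j) = cnj (?B $$ (j, i))" using ij A by (subst mat_adjoint_index) auto
    also have "\<dots> = rank_one_sum m n s u v $$ (i, j)"
      unfolding *(4) using ij by (simp add: rank_one_sum_def l algebra_simps)
    finally show "A $$ (i, j) = rank_one_sum m n s u v $$ (i, j)" .
  qed (use A in \<open>auto simp: rank_one_sum_def\<close>)
  then have svA: "is_svd A s u v" unfolding is_svd_def Let_def using * A by simp
  define uu where "uu = (\<lambda>k i. u k $ i)"
  define vv where "vv = (\<lambda>k i. v k $ i)"
  have data: "svd_data m n ?l A s uu vv" unfolding uu_def vv_def by (rule is_svd_data[OF svA A])
  define Y where "Y = mat_adjoint (svt f ?B)"
  have Xc: "svt f ?B \<in> carrier_mat n m" unfolding X rank_one_sum_def by simp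
  then have Y: "Y \<in> carrier_mat m n" unfolding Y_def by (rule mat_adjoint_carrier)
  have fs: "0 \<le> f (s k)" if "k < ?l" for k 
    using *(1) that f(1) f(2)[of "s k"] by (cases "s k = 0") (auto simp: less_le)
  have Yij: "Y $$ (i, j) = (\<Sum>k<?l. complex_of_real (f (s k)) * uu k i * cnj (vv k j))" if "i < m" "j < n" for i j
    using that Xc unfolding Y_def uu_def vv_def
    by (subst mat_adjoint_index) (auto simp: X rank_one_sum_def l algebra_simps)
  interpret a: svd_data m n ?l A s uu vv by (rule data)
  \<comment> \<open>\<open>Y\<close> shares the singular vectors of \<open>A\<close>, so the lemmas
    on \<open>A\<close> hold for it with \<open>f (s k)\<close> as values.\<close>
  interpret y: svd_data m n ?l Y "\<lambda>k. f (s k)" uu vv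
    by unfold_locales (use Y fs a.ou a.ov Yij in auto)
  let ?b = "\<lambda>i. b $ i"
  let ?V = "vec_space.col_space m Y"
  have V: "?V = {y \<in> carrier_vec m. \<exists>x\<in>carrier_vec n. Y *\<^sub>v x = y}"
    using vec_space.col_space_eq[OF Y] Y by simp
  define c where "c = (\<lambda>k. if s k = 0 then 0 else ip m ?b (uu k))"
  define p where "p = Matrix.vec m (\<lambda>i. \<Sum>k<?l. c k * uu k i)"
  have Yz: "(Y *\<^sub>v z) $ i = mop n (\<lambda>i j. Y $$ (i, j)) (\<lambda>j. z $ j) i" if "i < m" "z \<in> carrier_vec n" for z i
    using Y that by (simp add: mop_def scalar_prod_def atLeast0LessThan)
  have pV: "p \<in> ?V"
  proof -
    \<comment> \<open>A preimage of \<open>p\<close>. Where \<open>s k = 0\<close>, the quotient is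
      \<open>0 / 0 = 0\<close>, in agreement with the coefficient \<open>c k = 0\<close>.\<close>
    define z where "z = Matrix.vec n (\<lambda>j. \<Sum>k<?l. (c k / of_real (f (s k))) * vv k j)"
    have zk: "ip n (\<lambda>j. z $ j) (vv k) = c k / of_real (f (s k))" if "k < ?l" for k
    proof -
      have "ip n (\<lambda>j. z $ j) (vv k) = ip n (\<lambda>j. \<Sum>k<?l. (c k / of_real (f (s k))) * vv k j) (vv k)"
        by (intro ip_cong) (auto simp: z_def)
      also have "\<dots> = (\<Sum>k'<?l. if k' = k then c k / of_real (f (s k)) else 0)"
        unfolding ip_sum_left by (rule sum.cong[OF refl]) (use that in \<open>auto simp: a.ip_v\<close>)
      finally show ?thesis using that by simp
    qed
    have "Y *\<^sub>v z = p"
    proof (rule eq_vecI)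
      fix i assume "i < dim_vec p"
      then have i: "i < m" by (simp add: p_def)
      have "(Y *\<^sub>v z) $ i = (\<Sum>k<?l. (complex_of_real (f (s k)) * ip n (\<lambda>j. z $ j) (vv k)) * uu k i)"
        using i by (simp add: Yz z_def[THEN arg_cong[of _ _ "\<lambda>z. z \<in> carrier_vec n"]] y.mop_a)
      also have "\<dots> = (\<Sum>k<?l. c k * uu k i)"
      proof (rule sum.cong[OF refl])
        fix k assume "k \<in> {..<?l}"
        then have k: "k < ?l" by simp
        show "(complex_of_real (f (s k)) * ip n (\<lambda>j. z $ j) (vv k)) * uu k i = c k * uu k i"
        proof (cases "s k = 0")
          case False
          then have "f (s k) \<noteq> 0" using *(1) k f(2)[of "s k"] by (simp add: less_le)
          then show ?thesis by (simp add: zk[OF k])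
        qed (simp add: c_def f(1))
      qed
      also have "\<dots> = p $ i" using i by (simp add: p_def)
      finally show "(Y *\<^sub>v z) $ i = p $ i" .
    qed (use Y in \<open>simp add: p_def\<close>)
    then show ?thesis unfolding V by (auto simp: p_def z_def)
  qed
  have orth: "(b - p) \<bullet>c w = 0" if "w \<in> ?V" for w
  proof -
    obtain z where z: "z \<in> carrier_vec n" "w = Y *\<^sub>v z" "w \<in> carrier_vec m" using \<open>w \<in> ?V\<close> unfolding V by auto
    have pu: "ip m (\<lambda>i. p $ i) (uu k) = c k" if "k < ?l" for k
    proof -
      have "ip m (\<lambda>i. p $ i) (uu k) = ip m (\<lambda>i. \<Sum>k<?l. c k * uu k i) (uu k)"
        by (intro ip_cong) (auto simp: p_def)
      also have "\<dots> = (\<Sum>k'<?l. if k' = k then c k else 0)"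
        unfolding ip_sum_left by (rule sum.cong[OF refl]) (use that in \<open>auto simp: a.ip_u\<close>)
      finally show ?thesis using that by simp
    qed
    have "(b - p) \<bullet>c w = ip m (\<lambda>i. b $ i - p $ i) (\<lambda>i. w $ i)"
      using b z by (subst ip_conjugate_prod[of _ m]) (auto simp: p_def intro!: ip_cong)
    also have "\<dots> = ip m (\<lambda>i. b $ i - p $ i) (\<lambda>i. \<Sum>k<?l. (complex_of_real (f (s k)) * ip n (\<lambda>j. z $ j) (vv k)) * uu k i)"
      by (rule ip_cong) (simp_all add: z(1,2) Yz y.mop_a)
    also have "\<dots> = (\<Sum>k<?l. cnj (complex_of_real (f (s k)) * ip n (\<lambda>j. z $ j) (vv k)) * (ip m ?b (uu k) - c k))"
      unfolding ip_sum_right by (rule sum.cong[OF refl]) (simp add: ip_diff_left pu)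
    also have "\<dots> = 0" by (rule sum.neutral) (simp add: c_def f(1))
    finally show ?thesis .
  qed
  have diff: "x - y \<in> ?V" if xy: "x \<in> ?V" "y \<in> ?V" for x y
  proof -
    obtain z z' where "z \<in> carrier_vec n" "x = Y *\<^sub>v z" "z' \<in> carrier_vec n" "y = Y *\<^sub>v z'"
      using xy unfolding V by auto
    then have 1: "x - y = Y *\<^sub>v (z - z')" using Y by (simp add: mult_minus_distrib_mat_vec)
    have 2: "x - y \<in> carrier_vec m" using xy unfolding V by auto
    have 3: "z - z' \<in> carrier_vec n" using \<open>z \<in> _\<close> \<open>z' \<in> _\<close> by simp
    have "\<exists>t\<in>carrier_vec n. Y *\<^sub>v t = x - y" using 1 3 by metis
    then show ?thesis unfolding V using 2 by blast
  qed
  have "svt_proj f A b = p"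
    unfolding svt_proj_def Y_def[symmetric]
  proof -
    have "?V \<subseteq> carrier_vec m" unfolding V by blast
    from orth_proj_eq[OF diff this b pV] orth show "orth_proj (vec_space.col_space (dim_row A) Y) b = p"
      using A by simp
  qed
  moreover have "(eucl_norm p)\<^sup>2 = (\<Sum>k<?l. (cmod (c k))\<^sup>2)"
  proof -
    have "(eucl_norm p)\<^sup>2 = nsq m (\<lambda>i. p $ i)" by (rule eucl_norm_nsq) (simp add: p_def)
    also have "\<dots> = nsq m (\<lambda>i. \<Sum>k<?l. c k * uu k i)" by (intro nsq_cong) (simp add: p_def)
    also have "\<dots> = (\<Sum>k<?l. (cmod (c k))\<^sup>2)" by (rule nsq_ortho_sum[OF _ a.ou]) simp
    finally show ?thesis .
  qed
  moreover have "(\<Sum>k<?l. (cmod (c k))\<^sup>2) = (\<Sum>k<?l. if s k = 0 then 0 else (cmod (ip m ?b (uu k)))\<^sup>2)"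
    by (rule sum.cong[OF refl]) (simp add: c_def)
  ultimately have proj: "(eucl_norm (svt_proj f A b))\<^sup>2 \<le> (\<Sum>k<?l. if s k = 0 then 0 else (cmod (ip m ?b (uu k)))\<^sup>2)"
    by simp
  have "(svt f ?B *\<^sub>v b) $ j = (\<Sum>k<?l. complex_of_real (f (s k)) * ip m ?b (uu k) * vv k j)" if "j < n" for j
  proof -
    have "(svt f ?B *\<^sub>v b) $ j = (\<Sum>i<m. (\<Sum>k<?l. complex_of_real (f (s k)) * vv k j * cnj (uu k i)) * b $ i)"
      using that b Xc by (simp add: scalar_prod_def atLeast0LessThan X rank_one_sum_def l uu_def vv_def)
    also have "\<dots> = (\<Sum>k<?l. complex_of_real (f (s k)) * ip m ?b (uu k) * vv k j)"
      unfolding ip_def sum_distrib_left sum_distrib_right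
      by (subst sum.swap) (simp add: algebra_simps)
    finally show ?thesis .
  qed
  with svA show ?thesis by (intro that[OF data _ _ proj]) blast+
qed

section \<open>Extension of the transformation beyond the spectrum\<close>

definition clip :: "real \<Rightarrow> real \<Rightarrow> real \<Rightarrow> real" where
  "clip a b x = max a (min x b)"

text \<open>The quotient \<open>f (sqrt x) / sqrt x\<close> on the interval from \<open>a\<close> to
  \<open>b\<close>, constant beyond \<open>b\<close> and linear from \<open>a\<close> down to the
  value \<open>0\<close> at \<open>0\<close>. Eigenvalues of sampled matrices and grid points of the
  Bernstein form range over the whole interval from \<open>0\<close> to \<open>F^2\<close>, whereas
  \<open>f\<close> is controlled only between \<open>sqrt a\<close> and \<open>sqrt b\<close>.
  Comparisons and arithmetic suffice to evaluate the extension, so a program can do it.\<close>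

definition ramp :: "(real \<Rightarrow> real) \<Rightarrow> real \<Rightarrow> real \<Rightarrow> real \<Rightarrow> real" where
  "ramp f a b x = f (sqrt (clip a b x)) / sqrt (clip a b x) * min 1 (x / a)"

lemma clip_bounds: "a \<le> b \<Longrightarrow> a \<le> clip a b x \<and> clip a b x \<le> b"
  by (auto simp: clip_def)

lemma clip_lipschitz: "\<bar>clip a b x - clip a b y\<bar> \<le> \<bar>x - y\<bar>"
  by (auto simp: clip_def max_def min_def)

text \<open>Mean value inequality for the derivative
  \<open>f' (sqrt t) / (2 t) - f (sqrt t) / (2 t sqrt t)\<close>. Differentiability of
  \<open>f\<close> is relative to the interval, one-sided at its ends, hence the chain rule for
  images.\<close>

lemma ramp_quotient_lipschitz:
  fixes f f' :: "real \<Rightarrow> real"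
  assumes a: "0 < a" "a \<le> b"
    and d: "\<And>\<sigma>. \<sigma> \<in> {sqrt a..sqrt b} \<Longrightarrow> (f has_real_derivative f' \<sigma>) (at \<sigma> within {sqrt a..sqrt b})"
    and \<phi>: "\<And>\<sigma>. \<sigma> \<in> {sqrt a..sqrt b} \<Longrightarrow> \<bar>f' \<sigma>\<bar> \<le> \<phi>"
    and \<Omega>: "\<And>\<sigma>. \<sigma> \<in> {sqrt a..sqrt b} \<Longrightarrow> \<bar>f \<sigma>\<bar> \<le> \<Omega>"
    and x: "x \<in> {a..b}" and y: "y \<in> {a..b}"
  shows "\<bar>f (sqrt x) / sqrt x - f (sqrt y) / sqrt y\<bar> \<le> (\<phi> / (2 * a) + \<Omega> / (2 * a * sqrt a)) * \<bar>x - y\<bar>"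
proof -
  let ?S = "{a..b}"
  have img: "sqrt ` ?S \<subseteq> {sqrt a..sqrt b}" by auto
  have "norm (f (sqrt x) / sqrt x - f (sqrt y) / sqrt y) \<le> (\<phi> / (2 * a) + \<Omega> / (2 * a * sqrt a)) * norm (x - y)"
  proof (rule field_differentiable_bound[of ?S "\<lambda>t. f (sqrt t) / sqrt t"
        "\<lambda>t. (f' (sqrt t) * (inverse (sqrt t) / 2) * sqrt t - f (sqrt t) * (inverse (sqrt t) / 2)) / (sqrt t * sqrt t)"])
    fix t assume t: "t \<in> ?S"
    then have t0: "t > 0" using a by auto
    have st: "sqrt t \<in> {sqrt a..sqrt b}" using t by auto
    have d2: "(sqrt has_real_derivative inverse (sqrt t) / 2) (at t within ?S)"
      using DERIV_real_sqrt[OF t0] by (rule has_field_derivative_at_within)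
    have d1: "(f \<circ> sqrt has_real_derivative f' (sqrt t) * (inverse (sqrt t) / 2)) (at t within ?S)"
      by (rule DERIV_image_chain[OF DERIV_subset[OF d[OF st] img] d2])
    show "((\<lambda>t. f (sqrt t) / sqrt t) has_real_derivative
        (f' (sqrt t) * (inverse (sqrt t) / 2) * sqrt t - f (sqrt t) * (inverse (sqrt t) / 2)) / (sqrt t * sqrt t)) (at t within ?S)"
      using DERIV_divide[OF d1[unfolded o_def] d2] t0 by simp
    have "(f' (sqrt t) * (inverse (sqrt t) / 2) * sqrt t - f (sqrt t) * (inverse (sqrt t) / 2)) / (sqrt t * sqrt t)
       = f' (sqrt t) / (2 * t) - f (sqrt t) / (2 * t * sqrt t)"
      using t0 by (simp add: field_simps)
    also have "norm \<dots> \<le> \<bar>f' (sqrt t)\<bar> / (2 * t) + \<bar>f (sqrt t)\<bar> / (2 * t * sqrt t)"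
      using t0 by (intro order.trans[OF norm_triangle_ineq4]) (simp add: abs_mult)
    also have "\<dots> \<le> \<phi> / (2 * a) + \<Omega> / (2 * a * sqrt a)"
    proof (intro add_mono frac_le)
      show "2 * a * sqrt a \<le> 2 * t * sqrt t" using t a by (intro mult_mono) auto
    qed (use t a \<phi>[OF st] \<Omega>[OF st] abs_ge_zero[of "f' (sqrt t)"] abs_ge_zero[of "f (sqrt t)"] in \<open>auto intro: order.trans\<close>)
    finally show "norm ((f' (sqrt t) * (inverse (sqrt t) / 2) * sqrt t - f (sqrt t) * (inverse (sqrt t) / 2)) / (sqrt t * sqrt t))
       \<le> \<phi> / (2 * a) + \<Omega> / (2 * a * sqrt a)" .
  qed (use x y in auto)
  then show ?thesis by simp
qed

text \<open>Origin of the constant \<open>3 sqrt 2\<close>: in units of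
  \<open>\<Omega> / (2 a sqrt a)\<close> the quotient contributes one part and the linear cut-off
  two. With \<open>sqrt a\<close> the left end of the interval, these become
  \<open>3 sqrt 2 \<Omega> \<kappa> / N\<close> next to \<open>\<phi>\<close>, both multiplied by
  \<open>\<kappa>^2 / N^2\<close>.\<close>

lemma ramp_lipschitz:
  fixes f f' :: "real \<Rightarrow> real"
  assumes a: "0 < a" "a \<le> b"
    and d: "\<And>\<sigma>. \<sigma> \<in> {sqrt a..sqrt b} \<Longrightarrow> (f has_real_derivative f' \<sigma>) (at \<sigma> within {sqrt a..sqrt b})"
    and \<phi>: "\<And>\<sigma>. \<sigma> \<in> {sqrt a..sqrt b} \<Longrightarrow> \<bar>f' \<sigma>\<bar> \<le> \<phi>"
    and \<Omega>: "\<And>\<sigma>. \<sigma> \<in> {sqrt a..sqrt b} \<Longrightarrow> \<bar>f \<sigma>\<bar> \<le> \<Omega>"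
    and x: "0 \<le> x" and y: "0 \<le> y"
  shows "\<bar>ramp f a b x\<bar> \<le> \<Omega> / sqrt a"
    "\<bar>ramp f a b x - ramp f a b y\<bar> \<le> (\<phi> / (2 * a) + 3 * \<Omega> / (2 * a * sqrt a)) * \<bar>x - y\<bar>"
proof -
  let ?q = "\<lambda>x. f (sqrt (clip a b x)) / sqrt (clip a b x)"
  have cb: "clip a b x \<in> {a..b}" "clip a b x > 0" for x
    using clip_bounds[OF a(2), of x] a by auto
  have qb: "\<bar>?q x\<bar> \<le> \<Omega> / sqrt a" for x
  proof -
    have "\<bar>?q x\<bar> = \<bar>f (sqrt (clip a b x))\<bar> / sqrt (clip a b x)" using cb(2)[of x] by simp
    also have "\<dots> \<le> \<Omega> / sqrt a"
      using cb[of x] a \<Omega>[of "sqrt (clip a b x)"] by (intro frac_le) (auto intro: order.trans[OF abs_ge_zero])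
    finally show ?thesis .
  qed
  have m01: "0 \<le> min 1 (x / a)" "min 1 (x / a) \<le> 1" if "0 \<le> x" for x using a that by auto
  have "\<bar>ramp f a b x\<bar> = \<bar>?q x\<bar> * min 1 (x / a)"
    using m01[OF x] unfolding ramp_def abs_mult by simp
  also have "\<dots> \<le> \<Omega> / sqrt a * 1"
    by (rule mult_mono[OF qb m01(2)[OF x] order.trans[OF abs_ge_zero qb] m01(1)[OF x]])
  finally show "\<bar>ramp f a b x\<bar> \<le> \<Omega> / sqrt a" by simp
  let ?B = "\<phi> / (2 * a) + \<Omega> / (2 * a * sqrt a)"
  have "ramp f a b x - ramp f a b y = ?q x * (min 1 (x / a) - min 1 (y / a)) + (?q x - ?q y) * min 1 (y / a)"
  proof -
    have "q * m - q' * m' = q * (m - m') + (q - q') * m'" for q q' m m' :: real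
      by (simp add: algebra_simps)
    then show ?thesis unfolding ramp_def .
  qed
  also have "\<bar>\<dots>\<bar> \<le> \<bar>?q x\<bar> * \<bar>min 1 (x / a) - min 1 (y / a)\<bar> + \<bar>?q x - ?q y\<bar> * min 1 (y / a)"
    using m01[OF y] by (intro order.trans[OF abs_triangle_ineq]) (simp add: abs_mult)
  also have "\<dots> \<le> \<Omega> / sqrt a * (\<bar>x - y\<bar> / a) + (?B * \<bar>x - y\<bar>) * 1"
  proof (intro add_mono mult_mono qb)
    have "\<bar>min 1 (x / a) - min 1 (y / a)\<bar> \<le> \<bar>x / a - y / a\<bar>" by (auto simp: min_def)
    also have "\<dots> = \<bar>x - y\<bar> / a" using a by (simp add: diff_divide_distrib[symmetric])
    finally show "\<bar>min 1 (x / a) - min 1 (y / a)\<bar> \<le> \<bar>x - y\<bar> / a" .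
    have B0: "0 \<le> ?B"
      using a \<phi>[of "sqrt a"] \<Omega>[of "sqrt a"] by (intro add_nonneg_nonneg divide_nonneg_nonneg) auto
    have "\<bar>?q x - ?q y\<bar> \<le> ?B * \<bar>clip a b x - clip a b y\<bar>"
      by (rule ramp_quotient_lipschitz[OF a d \<phi> \<Omega> cb(1) cb(1)])
    also have "\<dots> \<le> ?B * \<bar>x - y\<bar>" using B0 clip_lipschitz by (intro mult_left_mono) auto
    finally show "\<bar>?q x - ?q y\<bar> \<le> ?B * \<bar>x - y\<bar>" .
    then show "0 \<le> ?B * \<bar>x - y\<bar>" using B0 by simp
    show "0 \<le> \<Omega> / sqrt a" using qb[of x] by (rule order.trans[OF abs_ge_zero])
  qed (use m01[OF y] in auto)
  also have "\<dots> = (\<phi> / (2 * a) + 3 * \<Omega> / (2 * a * sqrt a)) * \<bar>x - y\<bar>"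
    using a by (simp add: field_simps)
  finally show "\<bar>ramp f a b x - ramp f a b y\<bar> \<le> (\<phi> / (2 * a) + 3 * \<Omega> / (2 * a * sqrt a)) * \<bar>x - y\<bar>" .
qed

lemma ramp_on_spectrum:
  assumes "0 < a" "a \<le> s\<^sup>2" "s\<^sup>2 \<le> b" "0 \<le> s"
  shows "ramp f a b (s\<^sup>2) = f s / s"
  using assms by (simp add: ramp_def clip_def max_def min_def)

section \<open>Error of the sketched transformation\<close>

definition nrm :: "nat \<Rightarrow> (nat \<Rightarrow> complex) \<Rightarrow> real" where
  "nrm n v = sqrt (nsq n v)"

lemma nrm_nonneg [simp]: "0 \<le> nrm n v"
  by (simp add: nrm_def)

lemma nrm_sq: "(nrm n v)\<^sup>2 = nsq n v"
  by (simp add: nrm_def)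

lemma nrm_L2: "nrm n v = L2_set (\<lambda>i. cmod (v i)) {..<n}"
  by (simp add: nrm_def nsq_def L2_set_def)

lemma nrm_triangle: "nrm n (\<lambda>i. u i - w i) \<le> nrm n (\<lambda>i. u i - v i) + nrm n (\<lambda>i. v i - w i)"
proof -
  have "nrm n (\<lambda>i. u i - w i) \<le> L2_set (\<lambda>i. cmod (u i - v i) + cmod (v i - w i)) {..<n}"
    unfolding nrm_L2 by (rule L2_set_mono) (auto intro: norm_diff_triangle_ineq order.trans[OF _ norm_triangle_ineq[of "u i - v i" "v i - w i" for i]])
  also have "\<dots> \<le> nrm n (\<lambda>i. u i - v i) + nrm n (\<lambda>i. v i - w i)"
    unfolding nrm_L2 by (rule L2_set_triangle_ineq)
  finally show ?thesis .
qed

lemma nrm_leI: "nsq n v \<le> B\<^sup>2 * nsq k w \<Longrightarrow> 0 \<le> B \<Longrightarrow> nrm n v \<le> B * nrm k w"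
  unfolding nrm_def using real_sqrt_le_mono[of "nsq n v" "B\<^sup>2 * nsq k w"] by (simp add: real_sqrt_mult)

section \<open>Bernstein forms of normalised Gram matrices\<close>

text \<open>Division by \<open>R\<close> moves the spectrum of a Gram matrix with trace at most
  \<open>R\<close> into the unit interval, where Bernstein forms are controlled. The value
  \<open>0\<close> beyond the dimension makes operator identities true as equations between
  functions, which the intertwining lemma requires.\<close>

definition sop :: "nat \<Rightarrow> (nat \<Rightarrow> nat \<Rightarrow> complex) \<Rightarrow> real \<Rightarrow> (nat \<Rightarrow> complex) \<Rightarrow> nat \<Rightarrow> complex" where
  "sop n H R w = (\<lambda>i. if i < n then mop n H w i / complex_of_real R else 0)"

definition adj :: "(nat \<Rightarrow> nat \<Rightarrow> complex) \<Rightarrow> nat \<Rightarrow> nat \<Rightarrow> complex" where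
  "adj M = (\<lambda>j k. cnj (M k j))"

definition gop :: "nat \<Rightarrow> nat \<Rightarrow> (nat \<Rightarrow> nat \<Rightarrow> complex) \<Rightarrow> (nat \<Rightarrow> complex) \<Rightarrow> nat \<Rightarrow> complex" where
  "gop m n M w = (\<lambda>i. if i < m then mop n M w i else 0)"

lemma adj_adj [simp]: "adj (adj M) = M" by (simp add: adj_def)

lemma fsq_adj: "fsq n m (adj M) = fsq m n M"
  unfolding fsq_def nsq_def adj_def by (subst sum.swap) simp

lemma mop_cong: "(\<And>j. j < n \<Longrightarrow> u j = v j) \<Longrightarrow> mop n H u = mop n H v"
  by (simp add: mop_def)

lemma mop_diff: "mop n H (\<lambda>i. u i - v i) = (\<lambda>i. mop n H u i - mop n H v i)"
  by (simp add: mop_def algebra_simps sum_subtractf)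

lemma mop_scale: "mop n H (\<lambda>i. c * v i) = (\<lambda>i. c * mop n H v i)"
  by (simp add: mop_def algebra_simps sum_distrib_left)

lemma mop_add: "mop n H (\<lambda>i. u i + v i) = (\<lambda>i. mop n H u i + mop n H v i)"
  by (simp add: mop_def algebra_simps sum.distrib)

lemma sop_diff: "sop n H R (\<lambda>i. u i - v i) = (\<lambda>i. sop n H R u i - sop n H R v i)"
  by (auto simp: sop_def mop_diff diff_divide_distrib)

lemma castel_diff:
  assumes "\<And>u v. T (\<lambda>i. u i - v i) = (\<lambda>i. T u i - T v i)"
  shows "castel T h j i (\<lambda>x. u x - v x) = (\<lambda>x. castel T h j i u x - castel T h j i v x)"
proof (induction j arbitrary: i)
  case (Suc j)
  show ?case unfolding castel.simps Suc assms by (rule ext) (simp add: algebra_simps)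
qed (simp add: algebra_simps)

lemma castel_diagonal:
  "castel (\<lambda>w k. complex_of_real (t k) * w k) h j i v = (\<lambda>k. complex_of_real (bern h j i (t k)) * v k)"
  by (induction j arbitrary: i) (simp_all add: algebra_simps)

text \<open>The functional that takes the coefficient along the eigenvector \<open>x\<close>
  intertwines \<open>H / R\<close> with multiplication by \<open>l / R\<close>. It is encoded as a
  map into constant functions so that \<open>castel_intertwine\<close> applies.\<close>

lemma castel_sop_coefficient:
  assumes H: "hermitian n H" and "\<forall>i<n. mop n H x i = complex_of_real l * x i"
  shows "ip n (castel (sop n H R) h j i v) x = complex_of_real (bern h j i (l / R)) * ip n v x"
proof -
  have "ip n (sop n H R w) x = complex_of_real (l / R) * ip n w x" for w
  proof -
    have "ip n (mop n H w) x = ip n w (\<lambda>i. complex_of_real l * x i)"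
      unfolding hermitian_mop[OF H] using assms(2) by (intro ip_cong) auto
    also have "\<dots> = complex_of_real l * ip n w x"
      by (simp add: ip_def sum_distrib_left algebra_simps)
    finally show ?thesis
      by (simp add: ip_def sop_def sum_divide_distrib[symmetric])
  qed
  then have "(\<lambda>v (_::nat). ip n v x) (castel (sop n H R) h j i v)
     = castel (\<lambda>w x. complex_of_real (l / R) * w x) h j i ((\<lambda>v _. ip n v x) v)"
    by (intro castel_intertwine) (simp_all add: ip_add_left ip_diff_left ip_scale_left)
  then show ?thesis unfolding castel_scalar by meson
qed

lemma castel_gram_bound:
  assumes R: "0 < R" "fsq m n M \<le> R" and B: "\<And>i. \<bar>h i\<bar> \<le> B"
  shows "nsq n (castel (sop n (gram m M) R) h j i v) \<le> B\<^sup>2 * nsq n v"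
proof -
  obtain x l where sp: "spectral n (gram m M) x l" using spectral_theorem[OF hermitian_gram] by blast
  then have ox: "ortho n {..<n} x" by (simp add: spectral_def)
  have "(cmod (ip n (castel (sop n (gram m M) R) h j i v) (x a)))\<^sup>2 \<le> B\<^sup>2 * (cmod (ip n v (x a)))\<^sup>2" if a: "a < n" for a
  proof -
    have "\<bar>bern h j i (l a / R)\<bar> \<le> B"
      using spectral_gram_bounds[OF sp a] R B by (intro bern_abs_le) auto
    then have "(bern h j i (l a / R))\<^sup>2 \<le> B\<^sup>2" using power_mono[of "\<bar>bern h j i (l a / R)\<bar>" B 2] by simp
    moreover have "ip n (castel (sop n (gram m M) R) h j i v) (x a) = complex_of_real (bern h j i (l a / R)) * ip n v (x a)"
      using sp a by (intro castel_sop_coefficient[OF hermitian_gram]) (auto simp: spectral_def)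
    ultimately show ?thesis by (simp add: norm_mult power_mult_distrib mult_right_mono)
  qed
  then show ?thesis
    unfolding parseval[OF ox, symmetric] sum_distrib_left by (intro sum_mono) auto
qed

text \<open>Heights that change by at most \<open>\<Lambda> R / D\<close> per step give a form of
  degree \<open>D\<close> with Lipschitz constant \<open>\<Lambda> R\<close> in the scaled variable,
  hence \<open>\<Lambda>\<close> in the eigenvalue. So the polynomial behaves no worse than the
  function it approximates when one Gram matrix replaces another.\<close>

lemma castel_gram_lipschitz:
  assumes R: "0 < R" "fsq m n M \<le> R" "fsq m' n M' \<le> R" and \<Lambda>: "0 \<le> \<Lambda>" and D: "D > 0"
    and h: "\<And>i. \<bar>h (Suc i) - h i\<bar> \<le> \<Lambda> * R / real D"
  shows "nsq n (\<lambda>x. castel (sop n (gram m M) R) h D 0 v x - castel (sop n (gram m' M') R) h D 0 v x)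
    \<le> \<Lambda>\<^sup>2 * fsq n n (\<lambda>i j. gram m M i j - gram m' M' i j) * nsq n v"
proof -
  obtain x l where sp: "spectral n (gram m M) x l" using spectral_theorem[OF hermitian_gram] by blast
  obtain x' l' where sp': "spectral n (gram m' M') x' l'" using spectral_theorem[OF hermitian_gram] by blast
  show ?thesis
  proof (rule spectral_lipschitz[OF hermitian_gram sp hermitian_gram sp', where g = "\<lambda>t. bern h D 0 (t / R)"])
    fix a assume a: "a < n"
    show "ip n (castel (sop n (gram m M) R) h D 0 v) (x a) = complex_of_real (bern h D 0 (l a / R)) * ip n v (x a)"
      using sp a by (intro castel_sop_coefficient[OF hermitian_gram]) (auto simp: spectral_def)
    show "ip n (castel (sop n (gram m' M') R) h D 0 v) (x' a) = complex_of_real (bern h D 0 (l' a / R)) * ip n v (x' a)"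
      using sp' a by (intro castel_sop_coefficient[OF hermitian_gram]) (auto simp: spectral_def)
    fix b assume b: "b < n"
    have "\<bar>bern h D 0 (l a / R) - bern h D 0 (l' b / R)\<bar> \<le> real D * (\<Lambda> * R / real D) * \<bar>l a / R - l' b / R\<bar>"
      using spectral_gram_bounds[OF sp a] spectral_gram_bounds[OF sp' b] R h
      by (intro bern_lipschitz) auto
    also have "\<dots> = \<Lambda> * \<bar>l a - l' b\<bar>"
      using D R(1) by (simp add: diff_divide_distrib[symmetric] abs_divide)
    finally show "\<bar>bern h D 0 (l a / R) - bern h D 0 (l' b / R)\<bar> \<le> \<Lambda> * \<bar>l a - l' b\<bar>" .
  qed
qed

text \<open>With \<open>S'\<close> the adjoint of \<open>S\<close>, every polynomial satisfies
  \<open>S' p(S S') = p(S' S) S'\<close>. This moves the computation from dimension \<open>n\<close>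
  to dimension \<open>r\<close>.\<close>

lemma castel_gram_swap:
  assumes R: "R \<noteq> 0"
  shows "gop n r (adj S) (castel (sop r (gram n (adj S)) R) h j i v) = castel (sop n (gram r S) R) h j i (gop n r (adj S) v)"
proof (rule castel_intertwine)
  fix w
  have 1: "mop r (gram n (adj S)) w = mop n S (mop r (adj S) w)" for w
    unfolding mop_gram by (simp add: adj_def)
  have 2: "mop n (gram r S) w = mop r (adj S) (mop n S w)" for w
    unfolding mop_gram by (simp add: adj_def)
  have "mop r (adj S) (sop r (gram n (adj S)) R w) = mop r (adj S) (\<lambda>i. (1 / of_real R) * mop n S (mop r (adj S) w) i)"
    by (rule mop_cong) (simp add: sop_def 1)
  also have "\<dots> = (\<lambda>i. (1 / of_real R) * mop r (adj S) (mop n S (mop r (adj S) w)) i)" by (rule mop_scale)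
  finally have 3: "mop r (adj S) (sop r (gram n (adj S)) R w) i = mop r (adj S) (mop n S (mop r (adj S) w)) i / of_real R" for i by simp
  have 4: "mop n S (gop n r (adj S) w) = mop n S (mop r (adj S) w)" by (rule mop_cong) (simp add: gop_def)
  show "gop n r (adj S) (sop r (gram n (adj S)) R w) = sop n (gram r S) R (gop n r (adj S) w)"
    by (rule ext) (simp add: gop_def[of n r "adj S" "sop r (gram n (adj S)) R w"] sop_def[of n] 2 3 4)
qed (auto simp: gop_def mop_add mop_diff mop_scale)

text \<open>Cauchy-Schwarz for the pairing of \<open>d\<close> with \<open>S\<close> applied to the
  image of \<open>d\<close>; one factor then cancels.\<close>

lemma adjoint_operator_bound:
  assumes S: "\<And>z. nsq r (mop n S z) \<le> B * nsq n z" and B: "0 \<le> B"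
  shows "nsq n (mop r (adj S) d) \<le> B * nsq r d"
proof -
  let ?z = "mop r (adj S) d"
  have "complex_of_real (nsq n ?z) = ip r d (mop n S ?z)"
    unfolding ip_self[symmetric] using ip_mop_adj[of n r "adj S" d ?z] by (simp add: adj_def)
  then have "(nsq n ?z)\<^sup>2 = (cmod (ip r d (mop n S ?z)))\<^sup>2" by (metis norm_of_real power2_abs)
  also have "\<dots> \<le> nsq r d * (B * nsq n ?z)"
    by (intro order.trans[OF ip_cauchy_schwarz] mult_left_mono S) simp
  finally have *: "nsq n ?z * nsq n ?z \<le> (B * nsq r d) * nsq n ?z" by (simp add: power2_eq_square algebra_simps)
  show ?thesis
  proof (cases "nsq n ?z = 0")
    case False
    then have "nsq n ?z > 0" using nsq_nonneg[of n ?z] by linarith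
    then show ?thesis using * by (simp only: mult_le_cancel_right_pos)
  qed (use B in simp)
qed

context svd_data
begin

lemma gram_eigen: "k < l \<Longrightarrow> i < n \<Longrightarrow> mop n (gram m a) (v k) i = of_real ((s k)\<^sup>2) * v k i"
proof -
  assume k: "k < l" and i: "i < n"
  have "mop n (gram m a) (v k) i = (\<Sum>j<m. cnj (a j i) * (of_real (s k) * u k j))"
    unfolding mop_gram using k by (simp add: mop_def[of m] mop_a_v)
  also have "\<dots> = of_real (s k) * (\<Sum>j<m. \<Sum>k'<l. complex_of_real (s k') * v k' i * (u k j * cnj (u k' j)))"
    using i by (simp add: entry sum_distrib_left sum_distrib_right algebra_simps)
  also have "\<dots> = of_real (s k) * (\<Sum>k'<l. complex_of_real (s k') * v k' i * ip m (u k) (u k'))"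
    by (subst sum.swap) (simp add: ip_def sum_distrib_left)
  also have "(\<Sum>k'<l. complex_of_real (s k') * v k' i * ip m (u k) (u k')) = (\<Sum>k'<l. if k' = k then of_real (s k) * v k i else 0)"
    by (rule sum.cong[OF refl]) (use k in \<open>auto simp: ip_u\<close>)
  finally show ?thesis using k by (simp add: power2_eq_square)
qed

lemma mop_adj_a: "i < n \<Longrightarrow> mop m (adj a) b i = (\<Sum>k<l. (of_real (s k) * ip m b (u k)) * v k i)"
  unfolding mop_def adj_def ip_def sum_distrib_left sum_distrib_right
  by (subst sum.swap) (simp add: entry sum_distrib_left sum_distrib_right algebra_simps)

lemma nsq_mop_adj_a: "nsq n (mop m (adj a) b) \<le> (spectral_norm A)\<^sup>2 * nsq m b"
proof -
  have "nsq r (mop n a z) \<le> (spectral_norm A)\<^sup>2 * nsq n z" if "r = m" for r z using mop_bound_spectral that by simp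
  then show ?thesis by (intro adjoint_operator_bound) auto
qed

text \<open>The map from coefficient sequences to combinations of the \<open>v k\<close> intertwines
  the diagonal operator with entries \<open>(s k)^2 / R\<close> and the normalised Gram
  operator.\<close>

lemma castel_svd:
  assumes R: "R \<noteq> 0" and i: "i < n"
  shows "castel (sop n (gram m a) R) h j 0 (gop n m (adj a) b) i
    = (\<Sum>k<l. (of_real (bern h j 0 ((s k)\<^sup>2 / R)) * (of_real (s k) * ip m b (u k))) * v k i)"
proof -
  define L where "L = (\<lambda>c i. if i < n then \<Sum>k<l. c k * v k i else 0)"
  have Lc: "L c i = (if i < n then \<Sum>k<l. c k * v k i else 0)" for c i by (simp add: L_def)
  have "L (castel (\<lambda>w k. complex_of_real ((s k)\<^sup>2 / R) * w k) h j 0 c) = castel (sop n (gram m a) R) h j 0 (L c)" for c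
  proof (rule castel_intertwine)
    fix w
    have "mop n (gram m a) (L w) i = (\<Sum>k<l. w k * mop n (gram m a) (v k) i)" for i
      unfolding mop_def[of n] by (simp add: Lc sum_distrib_left) (subst sum.swap, simp add: algebra_simps)
    then show "L (\<lambda>k. complex_of_real ((s k)\<^sup>2 / R) * w k) = sop n (gram m a) R (L w)"
      unfolding sop_def by (auto simp: Lc gram_eigen sum_divide_distrib algebra_simps)
  qed (auto simp: L_def algebra_simps sum.distrib sum_subtractf sum_distrib_left)
  note 1 = this[of "\<lambda>k. of_real (s k) * ip m b (u k)", unfolded castel_diagonal, symmetric]
  have G: "gop n m (adj a) b = L (\<lambda>k. of_real (s k) * ip m b (u k))"
    by (rule ext) (simp add: gop_def Lc mop_adj_a)
  show ?thesis unfolding G 1 Lc using i by simp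
qed

text \<open>The four summands come from a chain of replacements: the function by its Bernstein form,
  the Gram matrix of \<open>A\<close> by that of \<open>S\<close>, the adjoint of \<open>A\<close>
  applied to \<open>b\<close> by its sampled version, and the \<open>r\<close>-dimensional Gram
  matrix of \<open>S\<close> by that of \<open>W\<close>. The last one happens behind the adjoint of
  \<open>S\<close>, whose norm is at most \<open>sqrt 2 N\<close> because
  \<open>\<delta>1 \<le> N^2\<close>.\<close>

lemma approximation_error:
  fixes f :: "real \<Rightarrow> real" and b :: "nat \<Rightarrow> complex"
  defines "F2 \<equiv> fsq m n a" and "N \<equiv> spectral_norm A"
  assumes f0: "f 0 = 0" and D: "D > 0" and F2: "F2 > 0" and \<Lambda>: "\<Lambda> \<ge> 0" and B: "B \<ge> 0" and N: "N > 0"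
    and g: "\<And>k. k < l \<Longrightarrow> s k \<noteq> 0 \<Longrightarrow> g ((s k)\<^sup>2) = f (s k) / s k"
    and lip: "\<And>x y. 0 \<le> x \<Longrightarrow> 0 \<le> y \<Longrightarrow> \<bar>g x - g y\<bar> \<le> \<Lambda> * \<bar>x - y\<bar>"
    and gB: "\<And>x. 0 \<le> x \<Longrightarrow> \<bar>g x\<bar> \<le> B"
    and x: "\<And>j. j < n \<Longrightarrow> x j = (\<Sum>k<l. complex_of_real (f (s k)) * ip m b (u k) * v k j)"
    and S: "fsq r n S = F2" and W: "fsq r r W = F2"
    and \<Delta>1: "fsq n n (\<lambda>i j. gram m a i j - gram r S i j) \<le> \<delta>1\<^sup>2" "0 \<le> \<delta>1" "\<delta>1 \<le> N\<^sup>2"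
    and \<Delta>2: "nsq n (\<lambda>j. mop m (adj a) b j - mop r (adj S) bs j) \<le> \<delta>2\<^sup>2" "0 \<le> \<delta>2"
    and \<Delta>3: "fsq r r (\<lambda>i j. gram n (adj S) i j - gram r (adj W) i j) \<le> \<delta>3\<^sup>2" "0 \<le> \<delta>3"
  defines "h \<equiv> \<lambda>i. g (F2 * real i / real D)"
  defines "y \<equiv> castel (sop r (gram r (adj W)) F2) h D 0 bs"
  shows "nrm n (\<lambda>j. x j - mop r (adj S) y j)
    \<le> N * \<Lambda> * F2 / sqrt D * nrm m b + \<Lambda> * \<delta>1 * N * nrm m b + B * \<delta>2 + sqrt 2 * N * \<Lambda> * \<delta>3 * nrm r bs"
    "nsq r y \<le> B\<^sup>2 * nsq r bs"
proof -
  let ?w = "gop n m (adj a) b"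
  let ?TA = "sop n (gram m a) F2" and ?TS = "sop n (gram r S) F2" and ?TT = "sop r (gram n (adj S)) F2"
  let ?p = "castel ?TA h D 0 ?w" and ?q = "castel ?TS h D 0 ?w" and ?q' = "castel ?TS h D 0 (gop n r (adj S) bs)"
  let ?y' = "castel ?TT h D 0 bs"
  have hB: "\<bar>h i\<bar> \<le> B" for i unfolding h_def using F2 by (intro gB) auto
  have hstep: "\<bar>h (Suc i) - h i\<bar> \<le> \<Lambda> * F2 / real D" for i
  proof -
    have "\<bar>h (Suc i) - h i\<bar> \<le> \<Lambda> * \<bar>F2 * real (Suc i) / real D - F2 * real i / real D\<bar>"
      unfolding h_def using F2 by (intro lip) auto
    also have "F2 * real (Suc i) / real D - F2 * real i / real D = F2 / real D"
      by (simp add: diff_divide_distrib[symmetric] algebra_simps)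
    finally show ?thesis using F2 by simp
  qed
  have wle: "nsq n ?w \<le> N\<^sup>2 * nsq m b"
    using nsq_mop_adj_a[of b] nsq_cong[of n ?w "mop m (adj a) b"] by (simp add: gop_def N_def)
  show "nsq r y \<le> B\<^sup>2 * nsq r bs"
    unfolding y_def by (rule castel_gram_bound[OF F2 _ hB]) (simp add: fsq_adj W)
  \<comment> \<open>Along \<open>v k\<close> the two vectors differ by \<open>s k\<close> times the
    error of the Bernstein form at \<open>(s k)^2\<close>; the factor \<open>s k\<close> accounts
    for \<open>N\<close>.\<close>
  have e1: "nrm n (\<lambda>j. x j - ?p j) \<le> (N * \<Lambda> * F2 / sqrt D) * nrm m b"
  proof (rule nrm_leI)
    let ?E = "\<lambda>k. of_real (f (s k) - bern h D 0 ((s k)\<^sup>2 / F2) * s k) * ip m b (u k)"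
    have "x j - ?p j = (\<Sum>k<l. ?E k * v k j)" if "j < n" for j
      unfolding x[OF that] castel_svd[OF F2[THEN less_imp_neq[THEN not_sym]] that]
      by (simp add: sum_subtractf algebra_simps)
    then have "nsq n (\<lambda>j. x j - ?p j) = nsq n (\<lambda>j. \<Sum>k<l. ?E k * v k j)" by (intro nsq_cong)
    also have "\<dots> = (\<Sum>k<l. (cmod (?E k))\<^sup>2)" by (rule nsq_ortho_sum[OF _ ov]) simp
    also have "\<dots> \<le> (\<Sum>k<l. (N * \<Lambda> * F2 / sqrt D)\<^sup>2 * (cmod (ip m b (u k)))\<^sup>2)"
    proof (rule sum_mono)
      fix k assume "k \<in> {..<l}"
      then have k: "k < l" by simp
      have "\<bar>f (s k) - bern h D 0 ((s k)\<^sup>2 / F2) * s k\<bar> \<le> N * \<Lambda> * F2 / sqrt D"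
      proof (cases "s k = 0")
        case True
        then show ?thesis using f0 N \<Lambda> F2 by simp
      next
        case False
        have "(s k)\<^sup>2 \<le> F2" unfolding F2_def fsq_a by (rule member_le_sum) (use k in auto)
        then have t: "0 \<le> (s k)\<^sup>2 / F2" "(s k)\<^sup>2 / F2 \<le> 1" using F2 by auto
        have "\<bar>bern h D 0 ((s k)\<^sup>2 / F2) - g (F2 * ((s k)\<^sup>2 / F2))\<bar> \<le> \<Lambda> * F2 / sqrt D"
          unfolding h_def by (rule bern_approx[OF t D F2 \<Lambda> lip])
        then have 1: "\<bar>bern h D 0 ((s k)\<^sup>2 / F2) - f (s k) / s k\<bar> \<le> \<Lambda> * F2 / sqrt D"
          using F2 g[OF k False] by simp
        have "f (s k) - bern h D 0 ((s k)\<^sup>2 / F2) * s k = - (s k * (bern h D 0 ((s k)\<^sup>2 / F2) - f (s k) / s k))"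
          using False by (simp add: algebra_simps)
        also have "\<bar>\<dots>\<bar> = s k * \<bar>bern h D 0 ((s k)\<^sup>2 / F2) - f (s k) / s k\<bar>"
          using s_nonneg[OF k] by (simp add: abs_mult)
        also have "\<dots> \<le> N * (\<Lambda> * F2 / sqrt D)"
          using s_nonneg[OF k] s_le_spectral_norm[OF k] 1 N by (intro mult_mono) (auto simp: N_def)
        finally show ?thesis by simp
      qed
      from power_mono[OF this, of 2] show "(cmod (?E k))\<^sup>2 \<le> (N * \<Lambda> * F2 / sqrt D)\<^sup>2 * (cmod (ip m b (u k)))\<^sup>2"
        unfolding norm_mult norm_of_real power_mult_distrib by (intro mult_right_mono) auto
    qed
    also have "\<dots> \<le> (N * \<Lambda> * F2 / sqrt D)\<^sup>2 * nsq m b"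
      unfolding sum_distrib_left[symmetric] by (intro mult_left_mono bessel[OF _ ou]) auto
    finally show "nsq n (\<lambda>j. x j - ?p j) \<le> (N * \<Lambda> * F2 / sqrt D)\<^sup>2 * nsq m b" .
  qed (use N \<Lambda> F2 in auto)
  have e2: "nrm n (\<lambda>j. ?p j - ?q j) \<le> (\<Lambda> * \<delta>1 * N) * nrm m b"
  proof (rule nrm_leI)
    have "nsq n (\<lambda>j. ?p j - ?q j) \<le> \<Lambda>\<^sup>2 * fsq n n (\<lambda>i j. gram m a i j - gram r S i j) * nsq n ?w"
      by (rule castel_gram_lipschitz[where R = F2 and \<Lambda> = \<Lambda> and D = D and h = h, OF F2 _ _ \<Lambda> D hstep]) (simp_all add: F2_def S[unfolded F2_def])
    also have "\<dots> \<le> \<Lambda>\<^sup>2 * \<delta>1\<^sup>2 * (N\<^sup>2 * nsq m b)"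
      using wle \<Delta>1(1) by (intro mult_mono mult_left_mono) auto
    finally show "nsq n (\<lambda>j. ?p j - ?q j) \<le> (\<Lambda> * \<delta>1 * N)\<^sup>2 * nsq m b" by (simp add: power_mult_distrib)
  qed (use N \<Lambda> \<Delta>1 in auto)
  have e3: "nrm n (\<lambda>j. ?q j - ?q' j) \<le> B * \<delta>2"
  proof -
    have "(\<lambda>j. ?q j - ?q' j) = castel ?TS h D 0 (\<lambda>j. ?w j - gop n r (adj S) bs j)"
      by (rule castel_diff[symmetric]) (rule sop_diff)
    then have "nrm n (\<lambda>j. ?q j - ?q' j) \<le> B * nrm n (\<lambda>j. ?w j - gop n r (adj S) bs j)"
      using castel_gram_bound[OF F2 eq_refl[OF S] hB] by (intro nrm_leI B) simp
    also have "nrm n (\<lambda>j. ?w j - gop n r (adj S) bs j) \<le> \<delta>2"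
      using \<Delta>2 nsq_cong[of n "\<lambda>j. ?w j - gop n r (adj S) bs j" "\<lambda>j. mop m (adj a) b j - mop r (adj S) bs j"]
      by (simp add: gop_def nrm_def real_le_lsqrt)
    finally show ?thesis using B by (simp add: mult_left_mono)
  qed
  \<comment> \<open>The squared norms of the images under \<open>A\<close> and \<open>S\<close>
    differ by the quadratic form of the difference of the Gram matrices, which is at most
    \<open>\<delta>1\<close> times the squared norm of \<open>z\<close>.\<close>
  have Sz: "nsq r (mop n S z) \<le> (sqrt 2 * N)\<^sup>2 * nsq n z" for z
  proof -
    let ?G = "\<lambda>i j. gram m a i j - gram r S i j"
    have "complex_of_real (nsq m (mop n a z) - nsq r (mop n S z)) = ip n (mop n (gram m a) z) z - ip n (mop n (gram r S) z) z"
      unfolding ip_gram ip_self by simp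
    also have "\<dots> = ip n (mop n ?G z) z"
      unfolding ip_diff_left[symmetric] by (intro ip_cong) (auto simp: mop_def algebra_simps sum_subtractf)
    finally have "\<bar>nsq m (mop n a z) - nsq r (mop n S z)\<bar>\<^sup>2 = (cmod (ip n (mop n ?G z) z))\<^sup>2" by (metis norm_of_real)
    also have "\<dots> \<le> nsq n (mop n ?G z) * nsq n z" by (rule ip_cauchy_schwarz)
    also have "\<dots> \<le> (\<delta>1\<^sup>2 * nsq n z) * nsq n z"
      by (intro mult_right_mono order.trans[OF mop_bound] \<Delta>1(1)) auto
    finally have "\<bar>nsq m (mop n a z) - nsq r (mop n S z)\<bar>\<^sup>2 \<le> (\<delta>1 * nsq n z)\<^sup>2" by (simp add: power2_eq_square algebra_simps)
    then have "\<bar>nsq m (mop n a z) - nsq r (mop n S z)\<bar> \<le> \<delta>1 * nsq n z"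
      by (rule power2_le_imp_le) (use \<Delta>1 in simp)
    moreover have "\<delta>1 * nsq n z \<le> N\<^sup>2 * nsq n z" using \<Delta>1 by (intro mult_right_mono) auto
    moreover have "nsq m (mop n a z) \<le> N\<^sup>2 * nsq n z" unfolding N_def by (rule mop_bound_spectral)
    ultimately show ?thesis by (simp add: power_mult_distrib)
  qed
  have e4: "nrm n (\<lambda>j. ?q' j - mop r (adj S) y j) \<le> sqrt 2 * N * \<Lambda> * \<delta>3 * nrm r bs"
  proof -
    have "?q' = gop n r (adj S) ?y'" using F2 by (intro castel_gram_swap[symmetric]) simp
    then have "nsq n (\<lambda>j. ?q' j - mop r (adj S) y j) = nsq n (mop r (adj S) (\<lambda>k. ?y' k - y k))"
      by (intro nsq_cong) (simp add: gop_def mop_diff)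
    also have "\<dots> \<le> (sqrt 2 * N)\<^sup>2 * nsq r (\<lambda>k. ?y' k - y k)"
      by (rule adjoint_operator_bound[OF Sz]) simp
    also have "nsq r (\<lambda>k. ?y' k - y k) \<le> \<Lambda>\<^sup>2 * fsq r r (\<lambda>i j. gram n (adj S) i j - gram r (adj W) i j) * nsq r bs"
      unfolding y_def by (rule castel_gram_lipschitz[where R = F2 and \<Lambda> = \<Lambda> and D = D and h = h, OF F2 _ _ \<Lambda> D hstep]) (simp_all add: fsq_adj S W)
    also have "\<dots> \<le> \<Lambda>\<^sup>2 * \<delta>3\<^sup>2 * nsq r bs" using \<Delta>3 by (intro mult_right_mono mult_left_mono) auto
    finally have "nsq n (\<lambda>j. ?q' j - mop r (adj S) y j) \<le> (sqrt 2 * N)\<^sup>2 * (\<Lambda>\<^sup>2 * \<delta>3\<^sup>2 * nsq r bs)"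
      by (simp add: mult_left_mono)
    then have "nsq n (\<lambda>j. ?q' j - mop r (adj S) y j) \<le> (sqrt 2 * N * \<Lambda> * \<delta>3)\<^sup>2 * nsq r bs"
      by (simp add: power_mult_distrib)
    then show ?thesis by (rule nrm_leI) (use N \<Lambda> \<Delta>3 in auto)
  qed
  show "nrm n (\<lambda>j. x j - mop r (adj S) y j)
    \<le> N * \<Lambda> * F2 / sqrt D * nrm m b + \<Lambda> * \<delta>1 * N * nrm m b + B * \<delta>2 + sqrt 2 * N * \<Lambda> * \<delta>3 * nrm r bs"
    using nrm_triangle[of n x "mop r (adj S) y" ?p] nrm_triangle[of n ?p "mop r (adj S) y" ?q]
      nrm_triangle[of n ?q "mop r (adj S) y" ?q'] e1 e2 e3 e4 by linarith
qed

end

section \<open>Length-squared sampling\<close>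

abbreviation expect :: "'a pmf \<Rightarrow> ('a \<Rightarrow> 'b::{banach, second_countable_topology}) \<Rightarrow> 'b" where
  "expect p \<equiv> measure_pmf.expectation p"

lemma expect_finite: "finite (set_pmf p) \<Longrightarrow> expect p f = (\<Sum>x\<in>set_pmf p. pmf p x *\<^sub>R f x)"
  by (rule integral_measure_pmf) auto

lemma expect_bind:
  assumes "finite (set_pmf p)" "\<And>x. x \<in> set_pmf p \<Longrightarrow> finite (set_pmf (q x))"
  shows "expect (bind_pmf p q) f = expect p (\<lambda>x. expect (q x) f)"
  using assms by (simp add: pmf_expectation_bind[of "set_pmf p"] expect_finite[of p])

lemma expect_mono:
  fixes f g :: "'a \<Rightarrow> real"
  assumes "finite (set_pmf p)" "\<And>x. x \<in> set_pmf p \<Longrightarrow> f x \<le> g x"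
  shows "expect p f \<le> expect p g"
  unfolding expect_finite[OF assms(1)] using assms(2) by (intro sum_mono) (auto intro: mult_left_mono)

lemma expect_cong:
  "(\<And>x. x \<in> set_pmf p \<Longrightarrow> f x = g x) \<Longrightarrow> expect p f = expect p g"
  by (rule integral_cong_AE) (auto simp: AE_measure_pmf_iff)

lemma expect_add:
  "finite (set_pmf p) \<Longrightarrow> expect p (\<lambda>x. f x + g x) = expect p f + expect p g"
  by (rule Bochner_Integration.integral_add) (auto intro: integrable_measure_pmf_finite)

lemma expect_sum:
  "finite (set_pmf p) \<Longrightarrow> expect p (\<lambda>x. \<Sum>k\<in>K. f k x) = (\<Sum>k\<in>K. expect p (f k))"
  by (rule Bochner_Integration.integral_sum) (auto intro: integrable_measure_pmf_finite)

lemma finite_set_Pi_pmf: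
  "finite A \<Longrightarrow> (\<And>x. x \<in> A \<Longrightarrow> finite (set_pmf (p x))) \<Longrightarrow> finite (set_pmf (Pi_pmf A d p))"
  by (rule finite_subset[OF set_Pi_pmf_subset']) auto

text \<open>The mixed terms cancel in expectation, and the squared mean, which enters with a
  negative sign, is dropped. The shift \<open>z\<close> is there for the induction over
  coordinates.\<close>

lemma expect_shifted_square:
  fixes \<phi> :: "'a \<Rightarrow> complex"
  assumes fin: "finite (set_pmf p)"
  shows "expect p (\<lambda>x. (cmod (z + (\<phi> x - expect p \<phi>)))\<^sup>2) \<le> (cmod z)\<^sup>2 + expect p (\<lambda>x. (cmod (\<phi> x))\<^sup>2)"
proof -
  let ?\<mu> = "expect p \<phi>"
  have "(cmod (z + (\<phi> x - ?\<mu>)))\<^sup>2 = ((cmod z)\<^sup>2 - 2 * Re (cnj z * ?\<mu>) + (cmod ?\<mu>)\<^sup>2) + (Re (2 * (cnj z - cnj ?\<mu>) * \<phi> x) + (cmod (\<phi> x))\<^sup>2)" for x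
    unfolding cmod_power2 by (simp add: power2_eq_square algebra_simps)
  then have "expect p (\<lambda>x. (cmod (z + (\<phi> x - ?\<mu>)))\<^sup>2) = ((cmod z)\<^sup>2 - 2 * Re (cnj z * ?\<mu>) + (cmod ?\<mu>)\<^sup>2)
     + (expect p (\<lambda>x. Re (2 * (cnj z - cnj ?\<mu>) * \<phi> x)) + expect p (\<lambda>x. (cmod (\<phi> x))\<^sup>2))"
    by (simp add: expect_add[OF fin])
  also have "expect p (\<lambda>x. Re (2 * (cnj z - cnj ?\<mu>) * \<phi> x)) = Re (2 * (cnj z - cnj ?\<mu>) * ?\<mu>)"
    using integrable_measure_pmf_finite[OF fin, of \<phi>]
    by (subst integral_Re) (auto intro: integrable_measure_pmf_finite[OF fin])
  also have "\<dots> = 2 * Re (cnj z * ?\<mu>) - 2 * (cmod ?\<mu>)\<^sup>2"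
    unfolding cmod_power2 by (simp add: power2_eq_square algebra_simps)
  finally show ?thesis by simp
qed

text \<open>One coordinate is drawn at a time, and its deviation becomes part of the fixed shift
  \<open>z\<close> for the remaining ones; in this way independence makes the second moments add
  up.\<close>

lemma Pi_pmf_variance:
  fixes \<phi> :: "nat \<Rightarrow> 'a \<Rightarrow> complex"
  assumes "finite K" "\<And>k. k \<in> K \<Longrightarrow> finite (set_pmf (p k))"
  shows "expect (Pi_pmf K d p) (\<lambda>\<omega>. (cmod (z + (\<Sum>k\<in>K. \<phi> k (\<omega> k) - expect (p k) (\<phi> k))))\<^sup>2)
    \<le> (cmod z)\<^sup>2 + (\<Sum>k\<in>K. expect (p k) (\<lambda>x. (cmod (\<phi> k x))\<^sup>2))"
  using assms
proof (induction K arbitrary: z rule: finite_induct)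
  case (insert k K)
  let ?X = "\<lambda>\<omega>. \<Sum>k\<in>K. \<phi> k (\<omega> k) - expect (p k) (\<phi> k)"
  have fk: "finite (set_pmf (p k))" and fP: "finite (set_pmf (Pi_pmf K d p))"
    using insert by (auto intro: finite_set_Pi_pmf)
  have "expect (Pi_pmf (insert k K) d p) (\<lambda>\<omega>. (cmod (z + (\<Sum>k\<in>insert k K. \<phi> k (\<omega> k) - expect (p k) (\<phi> k))))\<^sup>2)
     = expect (p k) (\<lambda>y. expect (Pi_pmf K d p) (\<lambda>\<omega>. (cmod (z + (\<Sum>j\<in>insert k K. \<phi> j ((fun_upd \<omega> k y) j) - expect (p j) (\<phi> j))))\<^sup>2))"
    using insert.hyps fk fP by (simp add: Pi_pmf_insert' expect_bind)
  also have "\<dots> = expect (p k) (\<lambda>y. expect (Pi_pmf K d p) (\<lambda>\<omega>. (cmod ((z + (\<phi> k y - expect (p k) (\<phi> k))) + ?X \<omega>))\<^sup>2))"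
  proof -
    have "(\<Sum>j\<in>insert k K. \<phi> j ((fun_upd \<omega> k y) j) - expect (p j) (\<phi> j)) = (\<phi> k y - expect (p k) (\<phi> k)) + ?X \<omega>" for \<omega> y
      using insert.hyps by (subst sum.insert) (auto intro!: sum.cong)
    then show ?thesis by (simp only: add.assoc)
  qed
  also have "\<dots> \<le> expect (p k) (\<lambda>y. (cmod (z + (\<phi> k y - expect (p k) (\<phi> k))))\<^sup>2 + (\<Sum>k\<in>K. expect (p k) (\<lambda>x. (cmod (\<phi> k x))\<^sup>2)))"
    using insert by (intro expect_mono[OF fk] insert.IH) auto
  also have "\<dots> = expect (p k) (\<lambda>y. (cmod (z + (\<phi> k y - expect (p k) (\<phi> k))))\<^sup>2) + (\<Sum>k\<in>K. expect (p k) (\<lambda>x. (cmod (\<phi> k x))\<^sup>2))"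
    by (simp add: expect_add[OF fk])
  also have "\<dots> \<le> (cmod z)\<^sup>2 + expect (p k) (\<lambda>x. (cmod (\<phi> k x))\<^sup>2) + (\<Sum>k\<in>K. expect (p k) (\<lambda>x. (cmod (\<phi> k x))\<^sup>2))"
    using expect_shifted_square[OF fk] by simp
  finally show ?case using insert.hyps by simp
qed simp

text \<open>The coordinates may have different laws, and only the sum of their means has to be the
  target. The column estimator depends on this freedom.\<close>

lemma Pi_pmf_mean_square_error:
  fixes \<phi> :: "nat \<Rightarrow> 'a \<Rightarrow> 'c \<Rightarrow> complex"
  assumes K: "finite K" "\<And>k. k \<in> K \<Longrightarrow> finite (set_pmf (p k))"
    and \<mu>: "\<And>t. t \<in> T \<Longrightarrow> (\<Sum>k\<in>K. expect (p k) (\<lambda>x. \<phi> k x t)) = \<mu> t"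
  shows "expect (Pi_pmf K d p) (\<lambda>\<omega>. \<Sum>t\<in>T. (cmod ((\<Sum>k\<in>K. \<phi> k (\<omega> k) t) - \<mu> t))\<^sup>2)
    \<le> (\<Sum>k\<in>K. expect (p k) (\<lambda>x. \<Sum>t\<in>T. (cmod (\<phi> k x t))\<^sup>2))"
proof -
  have fP: "finite (set_pmf (Pi_pmf K d p))" using K by (rule finite_set_Pi_pmf)
  have "expect (Pi_pmf K d p) (\<lambda>\<omega>. (cmod ((\<Sum>k\<in>K. \<phi> k (\<omega> k) t) - \<mu> t))\<^sup>2)
     \<le> (\<Sum>k\<in>K. expect (p k) (\<lambda>x. (cmod (\<phi> k x t))\<^sup>2))" if "t \<in> T" for t
    using Pi_pmf_variance[where K = K and p = p and z = 0 and \<phi> = "\<lambda>k x. \<phi> k x t" and d = d, OF K]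
    by (simp add: sum_subtractf \<mu>[OF that])
  then have "(\<Sum>t\<in>T. expect (Pi_pmf K d p) (\<lambda>\<omega>. (cmod ((\<Sum>k\<in>K. \<phi> k (\<omega> k) t) - \<mu> t))\<^sup>2))
    \<le> (\<Sum>t\<in>T. \<Sum>k\<in>K. expect (p k) (\<lambda>x. (cmod (\<phi> k x t))\<^sup>2))" by (rule sum_mono)
  also have "\<dots> = (\<Sum>k\<in>K. expect (p k) (\<lambda>x. \<Sum>t\<in>T. (cmod (\<phi> k x t))\<^sup>2))"
    using K by (subst sum.swap) (simp add: expect_sum)
  finally show ?thesis by (simp add: expect_sum[OF fP])
qed

lemma expect_Pi_component:
  "finite K \<Longrightarrow> k \<in> K \<Longrightarrow> expect (Pi_pmf K d p) (\<lambda>\<omega>. f (\<omega> k)) = expect (p k) f"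
  using integral_map_pmf[of "\<lambda>\<omega>. \<omega> k" "Pi_pmf K d p" f] by (simp add: Pi_pmf_component)

section \<open>Unbiased estimators from sampled rows and columns\<close>

text \<open>The square of the weight is one over \<open>r\<close> times the probability of drawing
  the row, so the sampled Gram matrix has the right mean. All scaled rows get the same squared norm
  \<open>F2 / r\<close>.\<close>

definition scaled_rows :: "nat \<Rightarrow> nat \<Rightarrow> real \<Rightarrow> (nat \<Rightarrow> nat \<Rightarrow> complex) \<Rightarrow> (nat \<Rightarrow> nat) \<Rightarrow> nat \<Rightarrow> nat \<Rightarrow> complex" where
  "scaled_rows n r F2 a i k j = complex_of_real (sqrt (F2 / (real r * nsq n (a (i k))))) * a (i k) j"

definition scaled_entries :: "nat \<Rightarrow> nat \<Rightarrow> real \<Rightarrow> (nat \<Rightarrow> nat \<Rightarrow> complex) \<Rightarrow> (nat \<Rightarrow> complex) \<Rightarrow> (nat \<Rightarrow> nat) \<Rightarrow> nat \<Rightarrow> complex" where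
  "scaled_entries n r F2 a b i k = complex_of_real (sqrt (F2 / (real r * nsq n (a (i k))))) * b (i k)"

text \<open>The square of the weight is one over \<open>r\<close> times the probability of the
  column under the average law of all rows of \<open>S\<close>, although draw \<open>l\<close> comes
  from row \<open>l\<close> alone.\<close>

definition scaled_columns :: "nat \<Rightarrow> real \<Rightarrow> (nat \<Rightarrow> nat \<Rightarrow> complex) \<Rightarrow> (nat \<Rightarrow> nat) \<Rightarrow> nat \<Rightarrow> nat \<Rightarrow> complex" where
  "scaled_columns r F2 S j k l = complex_of_real (sqrt (F2 / (real r * nsq r (\<lambda>k. S k (j l))))) * S k (j l)"

lemma real_scalar_product:
  assumes "complex_of_real c * complex_of_real c = q"
  shows "cnj (complex_of_real c * x) * (complex_of_real c * y) = q * (cnj x * y)"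
    "cnj (cnj (complex_of_real c * x)) * cnj (complex_of_real c * y) = q * (x * cnj y)"
  unfolding assms[symmetric] by simp_all

lemma four_summands:
  assumes "x + y + z + w < (c::real)" "0 \<le> x" "0 \<le> y" "0 \<le> z" "0 \<le> w"
  shows "x \<le> c" "y \<le> c" "z \<le> c" "w \<le> c"
  using assms by linarith+

locale row_sampling =
  fixes m n r :: nat and A :: "complex mat" and a :: "nat \<Rightarrow> nat \<Rightarrow> complex" and F2 :: real
  assumes A: "A \<in> carrier_mat m n" and r: "r > 0"
  defines "a \<equiv> (\<lambda>i j. A $$ (i, j))" and "F2 \<equiv> fsq m n a"
  assumes F2: "F2 > 0"
begin

lemma frob: "(frob_norm A)\<^sup>2 = F2"
  using A unfolding frob_norm_sq F2_def fsq_def a_def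
  by (auto simp: eucl_norm_nsq[of _ n] intro!: sum.cong nsq_cong)

lemma row_norm: "i < m \<Longrightarrow> (eucl_norm (Matrix.row A i))\<^sup>2 = nsq n (a i)"
  using A unfolding a_def by (auto simp: eucl_norm_nsq[of _ n] intro!: nsq_cong)

lemma pmf_row: "pmf (row_pmf A) i = (if i < m then nsq n (a i) / F2 else 0)"
proof -
  have "frob_norm A \<noteq> 0" using frob F2 by auto
  then show ?thesis using A by (auto simp: pmf_row_pmf frob row_norm)
qed

lemma pmf_col: "i < m \<Longrightarrow> nsq n (a i) \<noteq> 0 \<Longrightarrow> pmf (vec_pmf (Matrix.row A i)) j = (if j < n then (cmod (a i j))\<^sup>2 / nsq n (a i) else 0)"
proof -
  assume i: "i < m" "nsq n (a i) \<noteq> 0"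
  have "eucl_norm (Matrix.row A i) \<noteq> 0" using row_norm[OF i(1)] i(2) by auto
  then show ?thesis using A i row_norm[OF i(1)] by (auto simp: pmf_vec_pmf a_def)
qed

lemma set_row: "i \<in> set_pmf (row_pmf A) \<longleftrightarrow> i < m \<and> nsq n (a i) \<noteq> 0"
  using F2 by (auto simp: set_pmf_iff pmf_row)

lemma set_col: "i < m \<Longrightarrow> nsq n (a i) \<noteq> 0 \<Longrightarrow> j \<in> set_pmf (vec_pmf (Matrix.row A i)) \<longleftrightarrow> j < n \<and> a i j \<noteq> 0"
  by (auto simp: set_pmf_iff pmf_col)

lemma finite_row: "finite (set_pmf (row_pmf A))"
  by (rule finite_subset[of _ "{..<m}"]) (auto simp: set_row)

lemma finite_col: "i \<in> set_pmf (row_pmf A) \<Longrightarrow> finite (set_pmf (vec_pmf (Matrix.row A i)))"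
  by (rule finite_subset[of _ "{..<n}"]) (auto simp: set_col set_row)

lemma expect_row: "expect (row_pmf A) f = (\<Sum>i<m. (nsq n (a i) / F2) *\<^sub>R f i)"
  by (subst integral_measure_pmf[of "{..<m}"]) (auto simp: set_row pmf_row)

lemma expect_col: "i < m \<Longrightarrow> nsq n (a i) \<noteq> 0 \<Longrightarrow> expect (vec_pmf (Matrix.row A i)) f = (\<Sum>j<n. ((cmod (a i j))\<^sup>2 / nsq n (a i)) *\<^sub>R f j)"
  by (subst integral_measure_pmf[of "{..<n}"]) (auto simp: set_col pmf_col)

abbreviation "rowsP \<equiv> Pi_pmf {..<r} 0 (\<lambda>_. row_pmf A)"
abbreviation "colsP i \<equiv> Pi_pmf {..<r} 0 (\<lambda>k. vec_pmf (Matrix.row A (i k)))"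

text \<open>Importance sampling for sums over rows, used for the Gram matrix, with
  \<open>c i\<close> the squared norm of row \<open>i\<close>, and for the vector, with
  \<open>c i\<close> the squared modulus of \<open>b i\<close>. A zero row is never drawn, so its
  term has to vanish for the mean to be right; this is \<open>X0\<close>.\<close>

lemma row_estimate:
  fixes X :: "nat \<Rightarrow> 'c \<Rightarrow> complex"
  assumes X: "\<And>i. i < m \<Longrightarrow> (\<Sum>t\<in>T. (cmod (X i t))\<^sup>2) \<le> nsq n (a i) * c i"
    and X0: "\<And>i t. i < m \<Longrightarrow> t \<in> T \<Longrightarrow> nsq n (a i) = 0 \<Longrightarrow> X i t = 0" and c: "\<And>i. i < m \<Longrightarrow> c i \<ge> 0"
  shows "expect rowsP (\<lambda>\<omega>. \<Sum>t\<in>T. (cmod ((\<Sum>k<r. of_real (F2 / (real r * nsq n (a (\<omega> k)))) * X (\<omega> k) t) - (\<Sum>i<m. X i t)))\<^sup>2)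
    \<le> F2 / real r * (\<Sum>i<m. c i)"
proof -
  let ?\<phi> = "\<lambda>(k::nat) i t. of_real (F2 / (real r * nsq n (a i))) * X i t"
  have "expect rowsP (\<lambda>\<omega>. \<Sum>t\<in>T. (cmod ((\<Sum>k<r. ?\<phi> k (\<omega> k) t) - (\<Sum>i<m. X i t)))\<^sup>2)
    \<le> (\<Sum>k<r. expect (row_pmf A) (\<lambda>i. \<Sum>t\<in>T. (cmod (?\<phi> k i t))\<^sup>2))"
  proof (rule Pi_pmf_mean_square_error)
    fix t assume t: "t \<in> T"
    have "expect (row_pmf A) (\<lambda>i. ?\<phi> k i t) = (\<Sum>i<m. X i t / of_nat r)" for k
      unfolding expect_row using F2 X0[OF _ t]
      by (intro sum.cong refl) (auto simp: scaleR_conv_of_real field_simps)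
    then show "(\<Sum>k<r. expect (row_pmf A) (\<lambda>i. ?\<phi> k i t)) = (\<Sum>i<m. X i t)"
      using r by (simp add: sum_divide_distrib[symmetric])
  qed (auto simp: finite_row)
  also have "\<dots> \<le> (\<Sum>k<r. F2 / (real r)\<^sup>2 * (\<Sum>i<m. c i))"
  proof (rule sum_mono)
    fix k
    have "expect (row_pmf A) (\<lambda>i. \<Sum>t\<in>T. (cmod (?\<phi> k i t))\<^sup>2)
       = (\<Sum>i<m. nsq n (a i) / F2 * ((F2 / (real r * nsq n (a i)))\<^sup>2 * (\<Sum>t\<in>T. (cmod (X i t))\<^sup>2)))"
      using F2 unfolding expect_row norm_mult norm_of_real power_mult_distrib by (simp add: sum_distrib_left)
    also have "\<dots> \<le> (\<Sum>i<m. F2 / (real r)\<^sup>2 * c i)"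
    proof (rule sum_mono)
      fix i assume "i \<in> {..<m}"
      then have i: "i < m" by simp
      show "nsq n (a i) / F2 * ((F2 / (real r * nsq n (a i)))\<^sup>2 * (\<Sum>t\<in>T. (cmod (X i t))\<^sup>2)) \<le> F2 / (real r)\<^sup>2 * c i"
      proof (cases "nsq n (a i) = 0")
        case False
        then have p: "nsq n (a i) > 0" using nsq_nonneg[of n "a i"] by linarith
        have "nsq n (a i) / F2 * ((F2 / (real r * nsq n (a i)))\<^sup>2 * (\<Sum>t\<in>T. (cmod (X i t))\<^sup>2))
          \<le> nsq n (a i) / F2 * ((F2 / (real r * nsq n (a i)))\<^sup>2 * (nsq n (a i) * c i))"
          using F2 p by (intro mult_left_mono X[OF i]) auto
        also have "\<dots> = F2 / (real r)\<^sup>2 * c i" using F2 p r by (simp add: field_simps power2_eq_square)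
        finally show ?thesis .
      qed (use F2 c[OF i] in simp)
    qed
    finally show "expect (row_pmf A) (\<lambda>i. \<Sum>t\<in>T. (cmod (?\<phi> k i t))\<^sup>2) \<le> F2 / (real r)\<^sup>2 * (\<Sum>i<m. c i)"
      by (simp add: sum_distrib_left)
  qed
  also have "\<dots> = F2 / real r * (\<Sum>i<m. c i)" using r by (simp add: power2_eq_square)
  finally show ?thesis .
qed

lemma finite_rows: "finite (set_pmf rowsP)"
  by (rule finite_set_Pi_pmf) (auto simp: finite_row)

lemma rowsD: "i \<in> set_pmf rowsP \<Longrightarrow> k < r \<Longrightarrow> i k < m \<and> nsq n (a (i k)) > 0"
proof -
  assume "i \<in> set_pmf rowsP" "k < r"
  then have "i k \<in> set_pmf (row_pmf A)" by (auto simp: set_Pi_pmf PiE_dflt_def)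
  then show ?thesis using nsq_nonneg[of n "a (i k)"] by (auto simp: set_row less_le)
qed

lemma finite_cols: "i \<in> set_pmf rowsP \<Longrightarrow> finite (set_pmf (colsP i))"
  by (rule finite_set_Pi_pmf) (auto dest!: rowsD intro!: finite_col simp: set_row)

abbreviation "S i \<equiv> scaled_rows n r F2 a i"
abbreviation "W i j \<equiv> scaled_columns r F2 (S i) j"
abbreviation "bs b i \<equiv> scaled_entries n r F2 a b i"

lemma scale_sq: "x > 0 \<Longrightarrow> complex_of_real (sqrt (F2 / (real r * x))) * complex_of_real (sqrt (F2 / (real r * x))) = complex_of_real (F2 / (real r * x))"
  using F2 by (simp flip: of_real_mult)

lemma nsq_S: "i \<in> set_pmf rowsP \<Longrightarrow> k < r \<Longrightarrow> nsq n (S i k) = F2 / real r"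
  using F2 rowsD[of i k] unfolding scaled_rows_def nsq_scale by simp

lemma fsq_S: "i \<in> set_pmf rowsP \<Longrightarrow> fsq r n (S i) = F2"
  using r unfolding fsq_def by (simp add: nsq_S)

lemma gram_estimate:
  "expect rowsP (\<lambda>i. fsq n n (\<lambda>j j'. gram m a j j' - gram r (S i) j j')) \<le> F2\<^sup>2 / real r"
proof -
  let ?X = "\<lambda>i (j, j'). cnj (a i j) * a i j'"
  let ?T = "{..<n} \<times> {..<n}"
  have "expect rowsP (\<lambda>i. fsq n n (\<lambda>j j'. gram m a j j' - gram r (S i) j j'))
    = expect rowsP (\<lambda>\<omega>. \<Sum>t\<in>?T. (cmod ((\<Sum>k<r. of_real (F2 / (real r * nsq n (a (\<omega> k)))) * ?X (\<omega> k) t) - (\<Sum>i<m. ?X i t)))\<^sup>2)"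
  proof (rule expect_cong)
    fix i assume i: "i \<in> set_pmf rowsP"
    have "gram r (S i) j j' = (\<Sum>k<r. of_real (F2 / (real r * nsq n (a (i k)))) * (cnj (a (i k) j) * a (i k) j'))" for j j'
      unfolding gram_def
    proof (rule sum.cong[OF refl])
      fix k assume "k \<in> {..<r}"
      then have "nsq n (a (i k)) > 0" using rowsD[OF i] by simp
      from real_scalar_product(1)[OF scale_sq[OF this]]
      show "cnj (S i k j) * S i k j' = of_real (F2 / (real r * nsq n (a (i k)))) * (cnj (a (i k) j) * a (i k) j')"
        unfolding scaled_rows_def .
    qed
    then show "fsq n n (\<lambda>j j'. gram m a j j' - gram r (S i) j j') =
       (\<Sum>t\<in>?T. (cmod ((\<Sum>k<r. of_real (F2 / (real r * nsq n (a (i k)))) * ?X (i k) t) - (\<Sum>i<m. ?X i t)))\<^sup>2)"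
      by (simp add: fsq_def nsq_def sum.cartesian_product gram_def norm_minus_commute case_prod_beta)
  qed
  also have "\<dots> \<le> F2 / real r * (\<Sum>i<m. nsq n (a i))"
  proof (rule row_estimate)
    fix i
    have "(\<Sum>t\<in>?T. (cmod (?X i t))\<^sup>2) = nsq n (a i) * nsq n (a i)"
      by (simp add: nsq_def sum_product sum.cartesian_product norm_mult power_mult_distrib case_prod_beta)
    then show "(\<Sum>t\<in>?T. (cmod (?X i t))\<^sup>2) \<le> nsq n (a i) * nsq n (a i)" by simp
  qed (auto simp: nsq_eq_0)
  also have "(\<Sum>i<m. nsq n (a i)) = F2" by (simp add: F2_def fsq_def)
  finally show ?thesis by (simp add: power2_eq_square)
qed

lemma vector_estimate:
  "expect rowsP (\<lambda>i. nsq n (\<lambda>j. mop m (adj a) b j - mop r (adj (S i)) (bs b i) j)) \<le> F2 / real r * nsq m b"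
proof -
  let ?X = "\<lambda>i j. cnj (a i j) * b i"
  have "expect rowsP (\<lambda>i. nsq n (\<lambda>j. mop m (adj a) b j - mop r (adj (S i)) (bs b i) j))
    = expect rowsP (\<lambda>\<omega>. \<Sum>t\<in>{..<n}. (cmod ((\<Sum>k<r. of_real (F2 / (real r * nsq n (a (\<omega> k)))) * ?X (\<omega> k) t) - (\<Sum>i<m. ?X i t)))\<^sup>2)"
  proof (rule expect_cong)
    fix i assume i: "i \<in> set_pmf rowsP"
    have "mop r (adj (S i)) (bs b i) j = (\<Sum>k<r. of_real (F2 / (real r * nsq n (a (i k)))) * (cnj (a (i k) j) * b (i k)))" for j
      unfolding mop_def
    proof (rule sum.cong[OF refl])
      fix k assume "k \<in> {..<r}"
      then have "nsq n (a (i k)) > 0" using rowsD[OF i] by simp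
      from real_scalar_product(1)[OF scale_sq[OF this]]
      show "adj (S i) j k * bs b i k = of_real (F2 / (real r * nsq n (a (i k)))) * (cnj (a (i k) j) * b (i k))"
        unfolding scaled_rows_def scaled_entries_def adj_def .
    qed
    then show "nsq n (\<lambda>j. mop m (adj a) b j - mop r (adj (S i)) (bs b i) j) =
       (\<Sum>t<n. (cmod ((\<Sum>k<r. of_real (F2 / (real r * nsq n (a (i k)))) * ?X (i k) t) - (\<Sum>i<m. ?X i t)))\<^sup>2)"
      by (simp add: nsq_def mop_def[of m] adj_def norm_minus_commute)
  qed
  also have "\<dots> \<le> F2 / real r * (\<Sum>i<m. (cmod (b i))\<^sup>2)"
  proof (rule row_estimate)
    fix i
    show "(\<Sum>t<n. (cmod (?X i t))\<^sup>2) \<le> nsq n (a i) * (cmod (b i))\<^sup>2"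
      by (simp add: nsq_def norm_mult power_mult_distrib sum_distrib_right)
  qed (auto simp: nsq_eq_0)
  finally show ?thesis by (simp add: nsq_def)
qed

text \<open>An inequality only, because entries of \<open>b\<close> that meet zero rows of
  \<open>A\<close> are never drawn.\<close>

lemma entries_estimate: "expect rowsP (\<lambda>i. nsq r (bs b i)) \<le> nsq m b"
proof -
  have "expect rowsP (\<lambda>i. nsq r (bs b i)) = (\<Sum>k<r. expect (row_pmf A) (\<lambda>i. F2 / (real r * nsq n (a i)) * (cmod (b i))\<^sup>2))"
    unfolding nsq_def[of r] expect_sum[OF finite_rows]
  proof (rule sum.cong[OF refl])
    fix k assume k: "k \<in> {..<r}"
    have "(cmod (bs b i k))\<^sup>2 = (\<lambda>i. F2 / (real r * nsq n (a i)) * (cmod (b i))\<^sup>2) (i k)" for i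
      using F2 unfolding scaled_entries_def norm_mult norm_of_real power_mult_distrib by simp
    then show "expect rowsP (\<lambda>i. (cmod (bs b i k))\<^sup>2) = expect (row_pmf A) (\<lambda>i. F2 / (real r * nsq n (a i)) * (cmod (b i))\<^sup>2)"
      using k by (simp only:) (rule expect_Pi_component, auto)
  qed
  also have "\<dots> \<le> (\<Sum>k<r. nsq m b / real r)"
  proof (rule sum_mono)
    fix k
    have "expect (row_pmf A) (\<lambda>i. F2 / (real r * nsq n (a i)) * (cmod (b i))\<^sup>2)
      \<le> (\<Sum>i<m. (cmod (b i))\<^sup>2 / real r)"
      unfolding expect_row
      using F2 r by (intro sum_mono) (auto simp: field_simps)
    then show "expect (row_pmf A) (\<lambda>i. F2 / (real r * nsq n (a i)) * (cmod (b i))\<^sup>2) \<le> nsq m b / real r"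
      by (simp add: nsq_def sum_divide_distrib)
  qed
  also have "\<dots> = nsq m b" using r by simp
  finally show ?thesis .
qed

lemma col_weight:
  assumes "i \<in> set_pmf rowsP" "l < r"
  shows "(cmod (a (i l) j))\<^sup>2 / nsq n (a (i l)) = (cmod (S i l j))\<^sup>2 * real r / F2"
  using F2 r rowsD[OF assms] unfolding scaled_rows_def norm_mult norm_of_real power_mult_distrib
  by (simp add: field_simps)

lemma colsD: "i \<in> set_pmf rowsP \<Longrightarrow> j \<in> set_pmf (colsP i) \<Longrightarrow> l < r \<Longrightarrow> j l < n \<and> S i l (j l) \<noteq> 0"
proof -
  assume *: "i \<in> set_pmf rowsP" "j \<in> set_pmf (colsP i)" "l < r"
  then have "j l \<in> set_pmf (vec_pmf (Matrix.row A (i l)))" by (auto simp: set_Pi_pmf PiE_dflt_def)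
  then show ?thesis using rowsD[OF *(1,3)] F2 r by (auto simp: set_col scaled_rows_def)
qed

lemma col_norm_pos: "i \<in> set_pmf rowsP \<Longrightarrow> j \<in> set_pmf (colsP i) \<Longrightarrow> l < r \<Longrightarrow> nsq r (\<lambda>k. S i k (j l)) > 0"
  using colsD[of i j l] nsq_nonneg[of r "\<lambda>k. S i k (j l)"] nsq_eq_0[of r "\<lambda>k. S i k (j l)"] by (auto simp: less_le)

lemma fsq_W:
  assumes "i \<in> set_pmf rowsP" "j \<in> set_pmf (colsP i)"
  shows "fsq r r (W i j) = F2"
proof -
  have "fsq r r (W i j) = (\<Sum>l<r. nsq r (\<lambda>k. W i j k l))"
    unfolding fsq_def nsq_def by (rule sum.swap)
  also have "\<dots> = (\<Sum>l<r. F2 / real r)"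
  proof (rule sum.cong[OF refl])
    fix l assume "l \<in> {..<r}"
    then have "nsq r (\<lambda>k. S i k (j l)) > 0" using col_norm_pos[OF assms] by simp
    then show "nsq r (\<lambda>k. W i j k l) = F2 / real r" using F2 by (simp add: scaled_columns_def nsq_scale)
  qed
  finally show ?thesis using r by simp
qed

text \<open>All rows of \<open>S\<close> have the same norm, so draw \<open>l\<close> picks column
  \<open>j\<close> with probability \<open>r / F2\<close> times the squared modulus of
  \<open>S i l j\<close>. A single draw is biased, but over all \<open>l\<close> the laws average to
  squared-length sampling of the columns, and each draw uses nothing but a stored row of
  \<open>A\<close>.\<close>

lemma column_estimate:
  assumes i: "i \<in> set_pmf rowsP"
  shows "expect (colsP i) (\<lambda>j. fsq r r (\<lambda>k k'. gram n (adj (S i)) k k' - gram r (adj (W i j)) k k')) \<le> F2\<^sup>2 / real r"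
proof -
  let ?N = "\<lambda>j. nsq r (\<lambda>k. S i k j)"
  let ?\<phi> = "\<lambda>(l::nat) j (k, k'). of_real (F2 / (real r * ?N j)) * (S i k j * cnj (S i k' j))"
  let ?T = "{..<r} \<times> {..<r}"
  let ?\<mu> = "\<lambda>(k, k'). gram n (adj (S i)) k k'"
  have N0: "S i k j = 0" if "?N j = 0" "k < r" for j k using that by (simp add: nsq_eq_0)
  have ec: "expect (vec_pmf (Matrix.row A (i l))) f = (\<Sum>j<n. ((cmod (S i l j))\<^sup>2 * real r / F2) *\<^sub>R f j)" if "l < r" for l and f :: "nat \<Rightarrow> 'x::{banach, second_countable_topology}"
    using rowsD[OF i that] by (simp add: expect_col col_weight[OF i that])
  have "expect (colsP i) (\<lambda>j. fsq r r (\<lambda>k k'. gram n (adj (S i)) k k' - gram r (adj (W i j)) k k'))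
    = expect (colsP i) (\<lambda>j. \<Sum>t\<in>?T. (cmod ((\<Sum>l<r. ?\<phi> l (j l) t) - ?\<mu> t))\<^sup>2)"
  proof (rule expect_cong)
    fix j assume j: "j \<in> set_pmf (colsP i)"
    have "gram r (adj (W i j)) k k' = (\<Sum>l<r. of_real (F2 / (real r * ?N (j l))) * (S i k (j l) * cnj (S i k' (j l))))" for k k'
      unfolding gram_def adj_def
    proof (rule sum.cong[OF refl])
      fix l assume "l \<in> {..<r}"
      then have "?N (j l) > 0" using col_norm_pos[OF i j] by simp
      from real_scalar_product(2)[OF scale_sq[OF this]]
      show "cnj (cnj (W i j k l)) * cnj (W i j k' l) = of_real (F2 / (real r * ?N (j l))) * (S i k (j l) * cnj (S i k' (j l)))"
        unfolding scaled_columns_def .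
    qed
    then show "fsq r r (\<lambda>k k'. gram n (adj (S i)) k k' - gram r (adj (W i j)) k k')
      = (\<Sum>t\<in>?T. (cmod ((\<Sum>l<r. ?\<phi> l (j l) t) - ?\<mu> t))\<^sup>2)"
      by (simp add: fsq_def nsq_def[of r "\<lambda>k'. _ k' - _ k'"] sum.cartesian_product norm_minus_commute case_prod_beta)
  qed
  also have "\<dots> \<le> (\<Sum>l<r. expect (vec_pmf (Matrix.row A (i l))) (\<lambda>j. \<Sum>t\<in>?T. (cmod (?\<phi> l j t))\<^sup>2))"
  proof (rule Pi_pmf_mean_square_error)
    show "finite (set_pmf (vec_pmf (Matrix.row A (i k))))" if "k \<in> {..<r}" for k
      using rowsD[OF i, of k] that by (intro finite_col) (auto simp: set_row)
    fix t assume "t \<in> ?T"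
    then obtain k k' where t: "t = (k, k')" "k < r" "k' < r" by auto
    have "(\<Sum>l<r. expect (vec_pmf (Matrix.row A (i l))) (\<lambda>j. ?\<phi> l j t))
       = (\<Sum>l<r. \<Sum>j<n. of_real ((cmod (S i l j))\<^sup>2) * (of_real (1 / ?N j) * (S i k j * cnj (S i k' j))))"
      using F2 r by (intro sum.cong refl) (simp add: ec t scaleR_conv_of_real)
    also have "\<dots> = (\<Sum>j<n. of_real (?N j) * (of_real (1 / ?N j) * (S i k j * cnj (S i k' j))))"
      by (subst sum.swap) (simp only: nsq_def of_real_sum sum_distrib_right)
    also have "\<dots> = (\<Sum>j<n. S i k j * cnj (S i k' j))"
      using N0[OF _ t(2)] by (intro sum.cong refl) auto
    finally show "(\<Sum>l<r. expect (vec_pmf (Matrix.row A (i l))) (\<lambda>j. ?\<phi> l j t)) = ?\<mu> t"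
      by (simp add: t gram_def adj_def)
  qed simp
  also have "\<dots> = (\<Sum>l<r. \<Sum>j<n. (cmod (S i l j))\<^sup>2 * real r / F2 * ((F2 / (real r * ?N j))\<^sup>2 * (?N j)\<^sup>2))"
  proof (intro sum.cong refl)
    fix l assume "l \<in> {..<r}"
    have "(\<Sum>t\<in>?T. (cmod (?\<phi> l j t))\<^sup>2) = (F2 / (real r * ?N j))\<^sup>2 * (?N j)\<^sup>2" for j
    proof -
      have "(\<Sum>t\<in>?T. (cmod (?\<phi> l j t))\<^sup>2) = (\<Sum>(k, k')\<in>?T. (F2 / (real r * ?N j))\<^sup>2 * ((cmod (S i k j))\<^sup>2 * (cmod (S i k' j))\<^sup>2))"
        by (intro sum.cong refl) (simp only: case_prod_beta norm_mult norm_of_real power_mult_distrib power2_abs complex_mod_cnj)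
      also have "\<dots> = (F2 / (real r * ?N j))\<^sup>2 * (?N j)\<^sup>2"
      proof -
        have "(?N j)\<^sup>2 = (\<Sum>(k, k')\<in>?T. (cmod (S i k j))\<^sup>2 * (cmod (S i k' j))\<^sup>2)"
          by (subst power2_eq_square, unfold nsq_def sum_product, rule sum.cartesian_product)
        then show ?thesis by (simp only: sum_distrib_left case_prod_beta')
      qed
      finally show ?thesis .
    qed
    then show "expect (vec_pmf (Matrix.row A (i l))) (\<lambda>j. \<Sum>t\<in>?T. (cmod (?\<phi> l j t))\<^sup>2) = (\<Sum>j<n. (cmod (S i l j))\<^sup>2 * real r / F2 * ((F2 / (real r * ?N j))\<^sup>2 * (?N j)\<^sup>2))"
      using \<open>l \<in> _\<close> by (simp add: ec)
  qed
  also have "\<dots> \<le> (\<Sum>l<r. \<Sum>j<n. (cmod (S i l j))\<^sup>2 * (F2 / real r))"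
    using F2 r by (intro sum_mono) (auto simp: field_simps power2_eq_square)
  also have "\<dots> = F2 / real r * fsq r n (S i)"
    by (simp add: fsq_def nsq_def sum_distrib_left mult.commute)
  finally show ?thesis by (simp add: fsq_S[OF i] power2_eq_square)
qed

text \<open>Each threshold is \<open>4 / \<eta>\<close> times the bound on the corresponding mean:
  four quantities share one failure probability.\<close>

definition "good b \<eta> = {(i, j). i \<in> set_pmf rowsP \<and> j \<in> set_pmf (colsP i) \<and>
   fsq n n (\<lambda>k k'. gram m a k k' - gram r (S i) k k') \<le> 4 * F2\<^sup>2 / (real r * \<eta>) \<and>
   nsq n (\<lambda>k. mop m (adj a) b k - mop r (adj (S i)) (bs b i) k) \<le> 4 * F2 * nsq m b / (real r * \<eta>) \<and>
   nsq r (bs b i) \<le> 4 * nsq m b / \<eta> \<and>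
   fsq r r (\<lambda>k k'. gram n (adj (S i)) k k' - gram r (adj (W i j)) k k') \<le> 4 * F2\<^sup>2 / (real r * \<eta>)}"

text \<open>Divided by the bounds on their means, the four errors are non-negative with expectation
  at most 1; Markov's inequality for their sum at level \<open>4 / \<eta>\<close> controls all of
  them at once.\<close>

lemma good_probability:
  assumes b: "nsq m b > 0" and \<eta>: "\<eta> > 0"
  shows "measure_pmf.prob (bind_pmf rowsP (\<lambda>i. map_pmf (Pair i) (colsP i))) (good b \<eta>) \<ge> 1 - \<eta>"
proof -
  let ?D = "bind_pmf rowsP (\<lambda>i. map_pmf (Pair i) (colsP i))"
  let ?Z1 = "\<lambda>i. real r / F2\<^sup>2 * fsq n n (\<lambda>k k'. gram m a k k' - gram r (S i) k k')"
  let ?Z2 = "\<lambda>i. real r / (F2 * nsq m b) * nsq n (\<lambda>k. mop m (adj a) b k - mop r (adj (S i)) (bs b i) k)"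
  let ?Z3 = "\<lambda>i. 1 / nsq m b * nsq r (bs b i)"
  let ?Z4 = "\<lambda>i j. real r / F2\<^sup>2 * fsq r r (\<lambda>k k'. gram n (adj (S i)) k k' - gram r (adj (W i j)) k k')"
  define Z where "Z = (\<lambda>(i, j). ?Z1 i + ?Z2 i + ?Z3 i + ?Z4 i j)"
  have finD: "finite (set_pmf ?D)" using finite_rows finite_cols by auto
  have pos: "?Z1 i \<ge> 0" "?Z2 i \<ge> 0" "?Z3 i \<ge> 0" "?Z4 i j \<ge> 0" for i j using F2 b by auto
  have "expect ?D Z = expect rowsP (\<lambda>i. expect (colsP i) (\<lambda>j. Z (i, j)))"
    using finite_rows finite_cols by (subst expect_bind) auto
  also have "\<dots> \<le> expect rowsP (\<lambda>i. ?Z1 i + ?Z2 i + ?Z3 i + 1)"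
  proof (rule expect_mono[OF finite_rows])
    fix i assume i: "i \<in> set_pmf rowsP"
    have "expect (colsP i) (\<lambda>j. Z (i, j)) = (?Z1 i + ?Z2 i + ?Z3 i) + real r / F2\<^sup>2 * expect (colsP i) (\<lambda>j. fsq r r (\<lambda>k k'. gram n (adj (S i)) k k' - gram r (adj (W i j)) k k'))"
      unfolding Z_def by (simp add: expect_add[OF finite_cols[OF i]])
    also have "\<dots> \<le> (?Z1 i + ?Z2 i + ?Z3 i) + real r / F2\<^sup>2 * (F2\<^sup>2 / real r)"
      by (intro add_left_mono mult_left_mono column_estimate[OF i]) simp
    finally show "expect (colsP i) (\<lambda>j. Z (i, j)) \<le> ?Z1 i + ?Z2 i + ?Z3 i + 1" using r F2 by simp
  qed
  also have "\<dots> = real r / F2\<^sup>2 * expect rowsP (\<lambda>i. fsq n n (\<lambda>k k'. gram m a k k' - gram r (S i) k k'))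
      + real r / (F2 * nsq m b) * expect rowsP (\<lambda>i. nsq n (\<lambda>k. mop m (adj a) b k - mop r (adj (S i)) (bs b i) k))
      + 1 / nsq m b * expect rowsP (\<lambda>i. nsq r (bs b i)) + 1"
    by (simp add: expect_add[OF finite_rows])
  also have "\<dots> \<le> real r / F2\<^sup>2 * (F2\<^sup>2 / real r) + real r / (F2 * nsq m b) * (F2 / real r * nsq m b) + 1 / nsq m b * nsq m b + 1"
    using F2 b by (intro add_mono mult_left_mono gram_estimate vector_estimate entries_estimate) auto
  also have "\<dots> = 4" using F2 b r by simp
  finally have EZ: "expect ?D Z \<le> 4" .
  have "measure_pmf.prob ?D {x\<in>space (measure_pmf ?D). Z x \<ge> 4 / \<eta>} \<le> expect ?D Z / (4 / \<eta>)"
    using \<eta> pos by (intro integral_Markov_inequality_measure[where A = UNIV] integrable_measure_pmf_finite[OF finD])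
      (auto simp: AE_measure_pmf_iff Z_def)
  also have "\<dots> \<le> \<eta>" using EZ \<eta> by (simp add: field_simps)
  finally have bad: "measure_pmf.prob ?D {x. Z x \<ge> 4 / \<eta>} \<le> \<eta>" by simp
  have sub: "set_pmf ?D - {x. Z x \<ge> 4 / \<eta>} \<subseteq> good b \<eta>"
  proof
    fix x assume x: "x \<in> set_pmf ?D - {x. Z x \<ge> 4 / \<eta>}"
    then have "x \<in> set_pmf ?D" by (rule DiffD1)
    then obtain i j where ij: "x = (i, j)" "i \<in> set_pmf rowsP" "j \<in> set_pmf (colsP i)"
      unfolding set_bind_pmf set_map_pmf by blast
    have "\<not> 4 / \<eta> \<le> Z (i, j)" using x ij(1) by blast
    then have "Z (i, j) < 4 / \<eta>" by (rule not_le_imp_less)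
    then have "?Z1 i + ?Z2 i + ?Z3 i + ?Z4 i j < 4 / \<eta>" unfolding Z_def prod.case .
    note Z = four_summands[OF this pos(1-3) pos(4)]
    have sc: "x \<le> 4 * c / (p * \<eta>)" if "p / c * x \<le> 4 / \<eta>" "p > 0" "c > 0" for x c p :: real
      using that \<eta> by (simp add: field_simps)
    have "F2\<^sup>2 > 0" "F2 * nsq m b > 0" "real r > 0" using F2 b r by auto
    then show "x \<in> good b \<eta>" unfolding good_def ij(1)
      using ij(2,3) sc[OF Z(1)] sc[OF Z(2)] sc[OF Z(3)] sc[OF Z(4)] b by (simp add: mult.assoc)
  qed
  have "1 - \<eta> \<le> 1 - measure_pmf.prob ?D {x. Z x \<ge> 4 / \<eta>}" using bad by simp
  also have "\<dots> = measure_pmf.prob ?D (- {x. Z x \<ge> 4 / \<eta>})"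
    by (subst measure_pmf.prob_compl[symmetric]) (auto simp: Compl_eq_Diff_UNIV)
  also have "\<dots> = measure_pmf.prob ?D (set_pmf ?D - {x. Z x \<ge> 4 / \<eta>})"
    by (rule measure_pmf.finite_measure_eq_AE) (auto simp: AE_measure_pmf_iff)
  also have "\<dots> \<le> measure_pmf.prob ?D (good b \<eta>)"
    by (rule measure_pmf.finite_measure_mono[OF sub]) simp
  finally show ?thesis .
qed

end

section \<open>Program logic\<close>

text \<open>Values as functions of the two memories alone, so that assertions do not mention the
  resource counters of a state.\<close>

primrec nv :: "(nat \<Rightarrow> nat) \<Rightarrow> nexp \<Rightarrow> nat" where
  "nv nm (NConst k) = k"
| "nv nm (NMem a) = nm (nv nm a)"
| "nv nm (NAdd a b) = nv nm a + nv nm b"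
| "nv nm (NSub a b) = nv nm a - nv nm b"
| "nv nm (NMul a b) = nv nm a * nv nm b"

primrec cv :: "(real \<Rightarrow> real) \<Rightarrow> (nat \<Rightarrow> nat) \<Rightarrow> (nat \<Rightarrow> complex) \<Rightarrow> cexp \<Rightarrow> complex" where
  "cv f nm cm (COfNat a) = of_nat (nv nm a)"
| "cv f nm cm (CMem a) = cm (nv nm a)"
| "cv f nm cm (CAdd x y) = cv f nm cm x + cv f nm cm y"
| "cv f nm cm (CSub x y) = cv f nm cm x - cv f nm cm y"
| "cv f nm cm (CMul x y) = cv f nm cm x * cv f nm cm y"
| "cv f nm cm (CDiv x y) = cv f nm cm x / cv f nm cm y"
| "cv f nm cm (CConj x) = cnj (cv f nm cm x)"
| "cv f nm cm (CSqrt x) = csqrt (cv f nm cm x)"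
| "cv f nm cm (CFun x) = complex_of_real (f \<bar>Re (cv f nm cm x)\<bar>)"

primrec bv :: "(real \<Rightarrow> real) \<Rightarrow> (nat \<Rightarrow> nat) \<Rightarrow> (nat \<Rightarrow> complex) \<Rightarrow> bexp \<Rightarrow> bool" where
  "bv f nm cm (BNatLess a b) \<longleftrightarrow> nv nm a < nv nm b"
| "bv f nm cm (BReLess x y) \<longleftrightarrow> Re (cv f nm cm x) < Re (cv f nm cm y)"
| "bv f nm cm (BNot x) \<longleftrightarrow> \<not> bv f nm cm x"
| "bv f nm cm (BAnd x y) \<longleftrightarrow> bv f nm cm x \<and> bv f nm cm y"

lemma nval_nv: "nval s e = nv (nmem s) e"
  by (induction e) simp_all

lemma cval_cv: "cval f s e = cv f (nmem s) (cmem s) e"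
  by (induction e) (simp_all add: nval_nv)

lemma bval_bv: "bval f s g = bv f (nmem s) (cmem s) g"
  by (induction g) (simp_all add: nval_nv cval_cv)

lemma charge_sel [simp]:
  "nmem (charge t s) = nmem s" "cmem (charge t s) = cmem s"
  "samples_used (charge t s) = samples_used s" "time_used (charge t s) = time_used s + t"
  by (simp_all add: charge_def)

lemma count_sample_sel [simp]:
  "nmem (count_sample s) = nmem s" "cmem (count_sample s) = cmem s"
  "samples_used (count_sample s) = Suc (samples_used s)" "time_used (count_sample s) = time_used s"
  by (simp_all add: count_sample_def)

lemma nput_sel [simp]:
  "nmem (nput a x s) = (nmem s)(a := x)" "cmem (nput a x s) = cmem s"
  "samples_used (nput a x s) = samples_used s" "time_used (nput a x s) = time_used s"
  by (simp_all add: nput_def)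

lemma cput_sel [simp]:
  "nmem (cput a x s) = nmem s" "cmem (cput a x s) = (cmem s)(a := x)"
  "samples_used (cput a x s) = samples_used s" "time_used (cput a x s) = time_used s"
  by (simp_all add: cput_def)

lemma ncost_nonneg [simp]: "0 \<le> ncost e" by (induction e) simp_all
lemma ccost_nonneg [simp]: "0 \<le> ccost e" by (induction e) simp_all
lemma bcost_nonneg [simp]: "0 \<le> bcost e" by (induction e) simp_all

text \<open>A total-correctness triple for runs without randomness, with \<open>c\<close> an upper
  bound on the time. It holds from every state with the given memories, whatever its counters, and
  the postcondition sees the memories only; hence costs compose by addition.\<close>

definition dtr :: "(real \<Rightarrow> real) \<Rightarrow> (source \<Rightarrow> complex mat) \<Rightarrow> com \<Rightarrow> real \<Rightarrow> (nat \<Rightarrow> nat) \<Rightarrow> (nat \<Rightarrow> complex)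
    \<Rightarrow> ((nat \<Rightarrow> nat) \<Rightarrow> (nat \<Rightarrow> complex) \<Rightarrow> bool) \<Rightarrow> bool" where
  "dtr f M P c nm cm Q \<longleftrightarrow> (\<forall>s::state. nmem s = nm \<and> cmem s = cm \<longrightarrow>
     (\<exists>s'. exec f M P s (return_pmf s') \<and> time_used s' \<le> time_used s + c \<and> samples_used s' = samples_used s \<and>
        Q (nmem s') (cmem s')))"

text \<open>A run is described by a coupling \<open>q\<close> of an abstract sample distribution \<open>p\<close> with the
  distribution of the final state.\<close>

definition samp :: "(real \<Rightarrow> real) \<Rightarrow> (source \<Rightarrow> complex mat) \<Rightarrow> com \<Rightarrow> state \<Rightarrow> 'a pmf \<Rightarrow> ('a \<Rightarrow> state \<Rightarrow> bool) \<Rightarrow> bool" where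
  "samp f M P s p Q \<longleftrightarrow> (\<exists>q. exec f M P s (map_pmf snd q) \<and> map_pmf fst q = p \<and> (\<forall>z\<in>set_pmf q. Q (fst z) (snd z)))"

lemma dtr_weaken:
  "dtr f M P c nm cm Q \<Longrightarrow> (\<And>nm' cm'. Q nm' cm' \<Longrightarrow> Q' nm' cm') \<Longrightarrow> c \<le> c' \<Longrightarrow> dtr f M P c' nm cm Q'"
  unfolding dtr_def
proof (intro allI impI)
  fix s :: state
  assume Q: "\<And>nm' cm'. Q nm' cm' \<Longrightarrow> Q' nm' cm'" and c: "c \<le> c'" and s: "nmem s = nm \<and> cmem s = cm"
    and D: "\<forall>s. nmem s = nm \<and> cmem s = cm \<longrightarrow> (\<exists>s'. exec f M P s (return_pmf s') \<and> time_used s' \<le> time_used s + c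
      \<and> samples_used s' = samples_used s \<and> Q (nmem s') (cmem s'))"
  obtain s' where "exec f M P s (return_pmf s')" "time_used s' \<le> time_used s + c"
    "samples_used s' = samples_used s" "Q (nmem s') (cmem s')" using D s by blast
  then show "\<exists>s'. exec f M P s (return_pmf s') \<and> time_used s' \<le> time_used s + c'
      \<and> samples_used s' = samples_used s \<and> Q' (nmem s') (cmem s')"
    using Q c by (intro exI[of _ s']) auto
qed

lemma dtr_cost: "dtr f M P c nm cm Q \<Longrightarrow> c \<le> c' \<Longrightarrow> dtr f M P c' nm cm Q"
  by (rule dtr_weaken)

lemma dtr_Skip: "Q nm cm \<Longrightarrow> dtr f M Skip 0 nm cm Q"
  unfolding dtr_def by (auto intro: exec.Skip)

lemma dtr_NAssign: "Q (nm(nv nm a := nv nm e)) cm \<Longrightarrow> dtr f M (NAssign a e) (1 + ncost a + ncost e) nm cm Q"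
  unfolding dtr_def by (intro allI impI exI conjI, rule exec.NAssign) (auto simp: nval_nv)

lemma dtr_CAssign: "Q nm (cm(nv nm a := cv f nm cm e)) \<Longrightarrow> dtr f M (CAssign a e) (1 + ncost a + ccost e) nm cm Q"
  unfolding dtr_def by (intro allI impI exI conjI, rule exec.CAssign) (auto simp: nval_nv cval_cv)

lemma dtr_GetFrob: "Q nm (cm(nv nm a := complex_of_real ((frob_norm (M h))\<^sup>2))) \<Longrightarrow> dtr f M (GetFrob h a) (1 + ncost a) nm cm Q"
  unfolding dtr_def by (intro allI impI exI conjI, rule exec.GetFrob) (auto simp: nval_nv)

lemma dtr_GetEntry:
  "nv nm i < dim_row (M h) \<Longrightarrow> nv nm j < dim_col (M h) \<Longrightarrow> Q nm (cm(nv nm a := M h $$ (nv nm i, nv nm j))) \<Longrightarrow>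
    dtr f M (GetEntry h i j a) (entry_cost (M h) + ncost i + ncost j + ncost a) nm cm Q"
  unfolding dtr_def by (intro allI impI exI conjI, rule exec.GetEntry) (auto simp: nval_nv)

lemma dtr_GetRowNorm:
  "nv nm i < dim_row (M h) \<Longrightarrow> Q nm (cm(nv nm a := complex_of_real (eucl_norm (Matrix.row (M h) (nv nm i))))) \<Longrightarrow>
    dtr f M (GetRowNorm h i a) (row_cost (M h) + ncost i + ncost a) nm cm Q"
  unfolding dtr_def by (intro allI impI exI conjI, rule exec.GetRowNorm) (auto simp: nval_nv)

lemma exec_Seq_return:
  "exec f M P s (return_pmf s1) \<Longrightarrow> exec f M R s1 D \<Longrightarrow> exec f M (Seq P R) s D"
  using exec.Seq[of f M P s "return_pmf s1" R "\<lambda>_. D"] by (simp add: bind_return_pmf)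

lemma dtr_Seq:
  assumes "dtr f M P c1 nm cm (\<lambda>nm' cm'. dtr f M R c2 nm' cm' Q)"
  shows "dtr f M (Seq P R) (c1 + c2) nm cm Q"
  unfolding dtr_def
proof (intro allI impI)
  fix s :: state assume "nmem s = nm \<and> cmem s = cm"
  then obtain s1 where 1: "exec f M P s (return_pmf s1)" "time_used s1 \<le> time_used s + c1"
    "samples_used s1 = samples_used s" "dtr f M R c2 (nmem s1) (cmem s1) Q"
    using assms unfolding dtr_def[of f M P] by blast
  then obtain s2 where "exec f M R s1 (return_pmf s2)" "time_used s2 \<le> time_used s1 + c2"
    "samples_used s2 = samples_used s1" "Q (nmem s2) (cmem s2)"
    unfolding dtr_def by blast
  with 1 show "\<exists>s'. exec f M (Seq P R) s (return_pmf s') \<and> time_used s' \<le> time_used s + (c1 + c2)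
      \<and> samples_used s' = samples_used s \<and> Q (nmem s') (cmem s')"
    by (intro exI[of _ s2] conjI exec_Seq_return[of f M P s s1]) auto
qed

lemma dtr_then:
  assumes "dtr f M P c1 nm cm Q" "\<And>nm' cm'. Q nm' cm' \<Longrightarrow> dtr f M R c2 nm' cm' Q'"
  shows "dtr f M (Seq P R) (c1 + c2) nm cm Q'"
  by (rule dtr_Seq, rule dtr_weaken[OF assms(1) _ order.refl], rule assms(2))

lemma dtr_If:
  assumes "bv f nm cm g \<Longrightarrow> dtr f M P c1 nm cm Q" "\<not> bv f nm cm g \<Longrightarrow> dtr f M R c2 nm cm Q"
  shows "dtr f M (If g P R) (bcost g + max c1 c2) nm cm Q"
  unfolding dtr_def
proof (intro allI impI)
  fix s :: state assume s: "nmem s = nm \<and> cmem s = cm"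
  let ?s = "charge (bcost g) s"
  show "\<exists>s'. exec f M (If g P R) s (return_pmf s') \<and> time_used s' \<le> time_used s + (bcost g + max c1 c2)
      \<and> samples_used s' = samples_used s \<and> Q (nmem s') (cmem s')"
  proof (cases "bval f s g")
    case True
    then have "dtr f M P c1 (nmem ?s) (cmem ?s) Q" using assms s by (simp add: bval_bv)
    then obtain s' where "exec f M P ?s (return_pmf s')" "time_used s' \<le> time_used ?s + c1"
      "samples_used s' = samples_used ?s" "Q (nmem s') (cmem s')" unfolding dtr_def by blast
    then show ?thesis using exec.IfTrue[OF True] by (intro exI[of _ s']) auto
  next
    case False
    then have "dtr f M R c2 (nmem ?s) (cmem ?s) Q" using assms s by (simp add: bval_bv)
    then obtain s' where "exec f M R ?s (return_pmf s')" "time_used s' \<le> time_used ?s + c2"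
      "samples_used s' = samples_used ?s" "Q (nmem s') (cmem s')" unfolding dtr_def by blast
    then show ?thesis using exec.IfFalse[OF False] by (intro exI[of _ s']) auto
  qed
qed

lemma dtr_WhileFalse: "\<not> bv f nm cm g \<Longrightarrow> Q nm cm \<Longrightarrow> dtr f M (While g P) (bcost g) nm cm Q"
  unfolding dtr_def by (intro allI impI exI conjI, rule exec.WhileFalse) (auto simp: bval_bv)

lemma dtr_WhileTrue:
  assumes "bv f nm cm g" "dtr f M P c1 nm cm (\<lambda>nm' cm'. dtr f M (While g P) c2 nm' cm' Q)"
  shows "dtr f M (While g P) (bcost g + c1 + c2) nm cm Q"
  unfolding dtr_def
proof (intro allI impI)
  fix s :: state assume s: "nmem s = nm \<and> cmem s = cm"
  let ?s = "charge (bcost g) s"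
  have "dtr f M (Seq P (While g P)) (c1 + c2) (nmem ?s) (cmem ?s) Q" using dtr_Seq[OF assms(2)] s by simp
  then obtain s' where "exec f M (Seq P (While g P)) ?s (return_pmf s')" "time_used s' \<le> time_used ?s + (c1 + c2)"
      "samples_used s' = samples_used ?s" "Q (nmem s') (cmem s')" unfolding dtr_def by blast
  moreover have "bval f s g" using assms(1) s by (simp add: bval_bv)
  ultimately show "\<exists>s'. exec f M (While g P) s (return_pmf s') \<and> time_used s' \<le> time_used s + (bcost g + c1 + c2)
      \<and> samples_used s' = samples_used s \<and> Q (nmem s') (cmem s')"
    using exec.WhileTrue[of f s g M P] by (intro exI[of _ s']) auto
qed

text \<open>The number of rounds is bounded through the invariant: whenever the guard holds, the
  invariant has to force \<open>i < n\<close>. This is how the Lanczos loop, whose length is not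
  known in advance, gets its bound.\<close>

lemma dtr_While:
  assumes I0: "I 0 nm cm" and c: "0 \<le> c"
    and step: "\<And>i nm cm. I i nm cm \<Longrightarrow> bv f nm cm g \<Longrightarrow> i < n \<and> dtr f M P c nm cm (I (Suc i))"
    and fin: "\<And>i nm cm. I i nm cm \<Longrightarrow> i \<le> n \<Longrightarrow> \<not> bv f nm cm g \<Longrightarrow> Q nm cm"
  shows "dtr f M (While g P) (real n * (bcost g + c) + bcost g) nm cm Q"
proof -
  have "I i nm cm \<Longrightarrow> i \<le> n \<Longrightarrow> dtr f M (While g P) (real (n - i) * (bcost g + c) + bcost g) nm cm Q" for i nm cm
  proof (induction "n - i" arbitrary: i nm cm)
    case 0
    then have "\<not> bv f nm cm g" using step by fastforce
    from dtr_WhileFalse[of f nm cm g Q, OF this fin[OF 0(2,3) this]] 0 show ?case by simp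
  next
    case (Suc k)
    show ?case
    proof (cases "bv f nm cm g")
      case True
      have i: "i < n" and body: "dtr f M P c nm cm (I (Suc i))" using step[OF Suc.prems(1) True] by auto
      have "dtr f M (While g P) (bcost g + c + (real (n - Suc i) * (bcost g + c) + bcost g)) nm cm Q"
      proof (rule dtr_WhileTrue[OF True], rule dtr_weaken[OF body _ order.refl])
        show "dtr f M (While g P) (real (n - Suc i) * (bcost g + c) + bcost g) nm' cm' Q" if "I (Suc i) nm' cm'" for nm' cm'
          by (rule Suc.hyps(1)) (use Suc.hyps(2) i that in auto)
      qed
      moreover have "real (n - i) = 1 + real (n - Suc i)" using i by simp
      ultimately show ?thesis by (simp add: algebra_simps)
    next
      case False
      show ?thesis
        by (rule dtr_cost[OF dtr_WhileFalse[of f nm cm g Q, OF False fin[OF Suc.prems False]]]) (use c in simp)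
    qed
  qed
  from this[of 0] I0 show ?thesis by simp
qed

section \<open>Memory layout and counting loops\<close>

text \<open>Sixty-four arrays interleaved in one memory: the tag is the remainder and the index the
  quotient, so arrays of unknown length never collide.\<close>

definition adr :: "nat \<Rightarrow> nat \<Rightarrow> nat" where "adr g i = 64 * i + g"
definition pr :: "nat \<Rightarrow> nat \<Rightarrow> nat" where "pr k l = (k + l) * (k + l) + k"

lemma adr_eq [simp]:
  assumes "g < 64" "g' < 64"
  shows "adr g i = adr g' i' \<longleftrightarrow> g = g' \<and> i = i'"
proof
  assume eq: "adr g i = adr g' i'"
  have "adr g i mod 64 = g" "adr g' i' mod 64 = g'" "adr g i div 64 = i" "adr g' i' div 64 = i'"
    using assms by (simp_all add: adr_def)
  then show "g = g' \<and> i = i'" using eq by simp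
qed simp

text \<open>Pairs with sum \<open>s\<close> occupy values from \<open>s^2\<close> to
  \<open>s^2 + s\<close>, all below \<open>(s + 1)^2\<close>. Such a polynomial code can be computed
  by the expression language, which has no division of naturals.\<close>

lemma pr_eq [simp]: "pr k l = pr k' l' \<longleftrightarrow> k = k' \<and> l = l'"
proof -
  have "k + l = k' + l'" if eq: "pr k l = pr k' l'" for k l k' l'
  proof (rule ccontr)
    have less: False if "pr k l = pr k' l'" "k + l < k' + l'" for k l k' l'
    proof -
      have "(k + l + 1) * (k + l + 1) \<le> (k' + l') * (k' + l')" using that(2) by (intro mult_le_mono) auto
      then show False using that(1) by (simp add: pr_def algebra_simps)
    qed
    assume "k + l \<noteq> k' + l'"
    then show False using less[OF eq] less[OF eq[symmetric]] by linarith
  qed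
  note sum = this
  show ?thesis
  proof
    assume eq: "pr k l = pr k' l'"
    have "k = k'" using eq unfolding pr_def sum[OF eq] by (rule add_left_imp_eq)
    then show "k = k' \<and> l = l'" using sum[OF eq] by simp
  qed simp
qed

definition nA :: "nat \<Rightarrow> nexp \<Rightarrow> nexp" where "nA g e = NAdd (NMul (NConst 64) e) (NConst g)"
definition nR :: "nat \<Rightarrow> nexp \<Rightarrow> nexp" where "nR g e = NMem (nA g e)"
definition cR :: "nat \<Rightarrow> nexp \<Rightarrow> cexp" where "cR g e = CMem (nA g e)"
definition pE :: "nexp \<Rightarrow> nexp \<Rightarrow> nexp" where "pE k l = NAdd (NMul (NAdd k l) (NAdd k l)) k"

abbreviation "nS g \<equiv> nR g (NConst 0)"
abbreviation "cS g \<equiv> cR g (NConst 0)"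
abbreviation "nL g \<equiv> nA g (NConst 0)"

lemma access_values [simp]:
  "nv nm (nA g e) = adr g (nv nm e)" "nv nm (nR g e) = nm (adr g (nv nm e))"
  "cv f nm cm (cR g e) = cm (adr g (nv nm e))" "nv nm (pE k l) = pr (nv nm k) (nv nm l)"
  by (simp_all add: nA_def nR_def cR_def pE_def adr_def pr_def)

lemma access_costs [simp]:
  "ncost (nA g e) = 4 + ncost e" "ncost (nR g e) = 5 + ncost e"
  "ccost (cR g e) = 5 + ncost e" "ncost (pE k l) = 4 + 3 * ncost k + 2 * ncost l"
  by (simp_all add: nA_def nR_def cR_def pE_def)

definition For :: "nat \<Rightarrow> nexp \<Rightarrow> com \<Rightarrow> com" where
  "For g e P = Seq (NAssign (nL g) (NConst 0))
     (While (BNatLess (nS g) e) (Seq P (NAssign (nL g) (NAdd (nS g) (NConst 1)))))"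

lemma dtr_For:
  assumes I0: "I 0 (nm(adr g 0 := 0)) cm" and c: "0 \<le> c"
    and ev: "\<And>i nm cm. I i nm cm \<Longrightarrow> nm (adr g 0) = i \<and> nv nm e = n"
    and step: "\<And>i nm cm. i < n \<Longrightarrow> I i nm cm \<Longrightarrow>
      dtr f M P c nm cm (\<lambda>nm' cm'. nm' (adr g 0) = i \<and> I (Suc i) (nm'(adr g 0 := Suc i)) cm')"
    and fin: "\<And>nm cm. I n nm cm \<Longrightarrow> Q nm cm"
  shows "dtr f M (For g e P) (real n * (c + 21 + ncost e) + 14 + ncost e) nm cm Q"
proof -
  let ?g = "BNatLess (nS g) e"
  let ?inc = "NAssign (nL g) (NAdd (nS g) (NConst 1))"
  let ?J = "\<lambda>i nm cm. i \<le> n \<and> I i nm cm"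
  have step': "i < n \<and> dtr f M (Seq P ?inc) (c + 14) nm cm (?J (Suc i))" if "?J i nm cm" "bv f nm cm ?g" for i nm cm
  proof -
    have i: "i < n" using that ev[of i nm cm] by simp
    have "dtr f M (Seq P ?inc) (c + (1 + ncost (nL g) + ncost (NAdd (nS g) (NConst 1)))) nm cm (?J (Suc i))"
      by (rule dtr_Seq, rule dtr_weaken[OF step[OF i conjunct2[OF that(1)]] _ order.refl], rule dtr_NAssign) (use i in simp)
    then show ?thesis using i by (auto elim: dtr_cost)
  qed
  have "dtr f M (While ?g (Seq P ?inc)) (real n * (bcost ?g + (c + 14)) + bcost ?g) (nm(adr g 0 := 0)) cm Q"
  proof (rule dtr_While[where I = ?J])
    show "Q nm cm" if "?J i nm cm" "i \<le> n" "\<not> bv f nm cm ?g" for i nm cm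
      using that ev[of i nm cm] by (intro fin) (auto simp: not_less)
  qed (use I0 c step' in auto)
  then have "dtr f M (For g e P) (1 + ncost (nL g) + ncost (NConst 0) + (real n * (bcost ?g + (c + 14)) + bcost ?g)) nm cm Q"
    unfolding For_def by (intro dtr_Seq dtr_NAssign) simp
  then show ?thesis by (rule dtr_cost) (simp add: algebra_simps)
qed

text \<open>Keeps costs in the form of a constant times a product of parameters that are at least 1:
  a loop multiplies by its length and adds \<open>35 + 2 k\<close> to the constant, which absorbs
  the overhead of counter and guard.\<close>

lemma loop_bound:
  fixes N B C c k :: real
  assumes "1 \<le> N" "1 \<le> B" "c \<le> C * B" "0 \<le> k"
  shows "N * (c + 21 + k) + 14 + k \<le> (C + 35 + 2 * k) * (N * B)"
proof -
  have NB: "1 \<le> N * B" using mult_mono[of 1 N 1 B] assms by simp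
  have "21 + k \<le> (21 + k) * B" using mult_left_mono[of 1 B "21 + k"] assms by simp
  from add_mono[OF assms(3) this] have "c + 21 + k \<le> C * B + (21 + k) * B" by (simp add: add.assoc)
  then have "N * (c + 21 + k) \<le> N * (C * B + (21 + k) * B)" using assms(1) by (intro mult_left_mono) auto
  moreover have "(14 + k) * 1 \<le> (14 + k) * (N * B)" using assms NB by (intro mult_left_mono) auto
  ultimately show ?thesis by (simp add: algebra_simps)
qed

lemma dtr_For_bound:
  assumes I0: "I 0 (nm(adr g 0 := 0)) cm" and c: "0 \<le> c"
    and ev: "\<And>i nm cm. I i nm cm \<Longrightarrow> nm (adr g 0) = i \<and> nv nm e = n"
    and step: "\<And>i nm cm. i < n \<Longrightarrow> I i nm cm \<Longrightarrow>
      dtr f M P c nm cm (\<lambda>nm' cm'. nm' (adr g 0) = i \<and> I (Suc i) (nm'(adr g 0 := Suc i)) cm')"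
    and fin: "\<And>nm cm. I n nm cm \<Longrightarrow> Q nm cm"
    and bound: "real n \<le> N" "1 \<le> N" "1 \<le> B" "c \<le> C * B" "C + 35 + 2 * ncost e \<le> C'"
  shows "dtr f M (For g e P) (C' * (N * B)) nm cm Q"
proof -
  have "real n * (c + 21 + ncost e) \<le> N * (c + 21 + ncost e)"
    using bound(1) c ncost_nonneg[of e] by (intro mult_right_mono) auto
  moreover have "N * (c + 21 + ncost e) + 14 + ncost e \<le> (C + 35 + 2 * ncost e) * (N * B)"
    using bound by (intro loop_bound) auto
  moreover have "(C + 35 + 2 * ncost e) * (N * B) \<le> C' * (N * B)"
    using bound by (intro mult_right_mono) auto
  ultimately show ?thesis by (intro dtr_cost[OF dtr_For[OF I0 c ev step fin]]) auto
qed

definition Acc :: "nat \<Rightarrow> nexp \<Rightarrow> nexp \<Rightarrow> cexp \<Rightarrow> com" where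
  "Acc v len a e = Seq (CAssign a (COfNat (NConst 0))) (For v len (CAssign a (CAdd (CMem a) e)))"

text \<open>The premise on \<open>e\<close> quantifies over the content \<open>z\<close> of the
  accumulator cell: the summand has the same value whatever has been accumulated so far.\<close>

lemma dtr_Acc:
  assumes x: "nv nm a = x" "\<And>i. nv (nm(adr v 0 := i)) a = x" and len: "\<And>i. nv (nm(adr v 0 := i)) len = n"
    and e: "\<And>i z. i < n \<Longrightarrow> cv f (nm(adr v 0 := i)) (cm(x := z)) e = g i"
    and Q: "Q (nm(adr v 0 := n)) (cm(x := (\<Sum>i<n. g i)))"
  shows "dtr f M (Acc v len a e) (real n * (3 + 2 * ncost a + ccost e + 21 + ncost len) + 17 + ncost len + ncost a) nm cm Q"
proof -
  let ?P = "CAssign a (CAdd (CMem a) e)"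
  have "dtr f M (For v len ?P) (real n * ((1 + ncost a + ccost (CAdd (CMem a) e)) + 21 + ncost len) + 14 + ncost len) nm (cm(x := 0)) Q"
  proof (rule dtr_For[where I = "\<lambda>i nm' cm'. nm' = nm(adr v 0 := i) \<and> cm' = cm(x := (\<Sum>i<i. g i))"])
    fix i nm' cm' assume i: "i < n" and I: "nm' = nm(adr v 0 := i) \<and> cm' = cm(x := (\<Sum>i<i. g i))"
    show "dtr f M ?P (1 + ncost a + ccost (CAdd (CMem a) e)) nm' cm'
       (\<lambda>nm' cm'. nm' (adr v 0) = i \<and> nm'(adr v 0 := Suc i) = nm(adr v 0 := Suc i) \<and> cm' = cm(x := (\<Sum>i<Suc i. g i)))"
      by (rule dtr_CAssign) (use I x len e[OF i] in simp)
  qed (use x len Q in simp_all)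
  then have "dtr f M (Acc v len a e) (1 + ncost a + ccost (COfNat (NConst 0)) + (real n * ((1 + ncost a + ccost (CAdd (CMem a) e)) + 21 + ncost len) + 14 + ncost len)) nm cm Q"
    unfolding Acc_def by (intro dtr_Seq dtr_CAssign) (simp add: x(1))
  then show ?thesis by (rule dtr_cost) (simp add: algebra_simps)
qed

section \<open>Random runs as couplings\<close>

lemma samp_weaken:
  assumes "samp f M P s p Q" and Q: "\<And>x u. x \<in> set_pmf p \<Longrightarrow> Q x u \<Longrightarrow> Q' x u"
  shows "samp f M P s p Q'"
proof -
  obtain c where c: "exec f M P s (map_pmf snd c)" "map_pmf fst c = p" "\<forall>z\<in>set_pmf c. Q (fst z) (snd z)"
    using assms(1) unfolding samp_def by blast
  have "Q' (fst z) (snd z)" if "z \<in> set_pmf c" for z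
    by (rule Q) (use that c(3) in \<open>simp_all add: c(2)[symmetric]\<close>)
  then show ?thesis unfolding samp_def by (intro exI[of _ c] conjI c ballI)
qed

lemma samp_intro:
  assumes "exec f M P s (map_pmf st p)" "\<And>x. x \<in> set_pmf p \<Longrightarrow> Q x (st x)"
  shows "samp f M P s p Q"
  unfolding samp_def
  by (rule exI[of _ "map_pmf (\<lambda>x. (x, st x)) p"]) (use assms in \<open>simp add: pmf.map_comp o_def\<close>)

lemma samp_dtr:
  assumes "dtr f M P c (nmem s) (cmem s) Q"
  shows "samp f M P s (return_pmf ()) (\<lambda>_ u. time_used u \<le> time_used s + c \<and> samples_used u = samples_used s \<and> Q (nmem u) (cmem u))"
proof -
  obtain s1 where "exec f M P s (return_pmf s1)" "time_used s1 \<le> time_used s + c" "samples_used s1 = samples_used s" "Q (nmem s1) (cmem s1)"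
    using assms unfolding dtr_def by blast
  then show ?thesis by (intro samp_intro[where st = "\<lambda>_. s1"]) simp_all
qed

text \<open>The rule for sequences wants one final distribution per intermediate state, while a
  coupling may reach the same state from several abstract outcomes. Determinism of
  \<open>exec\<close> makes the choices agree, so \<open>E\<close> can be defined as the unique
  distribution.\<close>

lemma samp_Seq:
  assumes P: "samp f M P s p Q" and R: "\<And>x u. x \<in> set_pmf p \<Longrightarrow> Q x u \<Longrightarrow> samp f M R u (q x) (Q' x)"
  shows "samp f M (Seq P R) s (bind_pmf p (\<lambda>x. map_pmf (Pair x) (q x))) (\<lambda>(x, y) u. Q' x y u)"
proof -
  obtain c where c: "exec f M P s (map_pmf snd c)" "map_pmf fst c = p" "\<forall>z\<in>set_pmf c. Q (fst z) (snd z)"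
    using P unfolding samp_def by blast
  have "\<forall>z\<in>set_pmf c. \<exists>d. exec f M R (snd z) (map_pmf snd d) \<and> map_pmf fst d = q (fst z) \<and> (\<forall>y\<in>set_pmf d. Q' (fst z) (fst y) (snd y))"
  proof
    fix z assume z: "z \<in> set_pmf c"
    have "fst z \<in> set_pmf p" using z by (simp add: c(2)[symmetric])
    from R[OF this bspec[OF c(3) z]]
    show "\<exists>d. exec f M R (snd z) (map_pmf snd d) \<and> map_pmf fst d = q (fst z) \<and> (\<forall>y\<in>set_pmf d. Q' (fst z) (fst y) (snd y))"
      unfolding samp_def .
  qed
  from bchoice[OF this] obtain d where D: "\<forall>z\<in>set_pmf c. exec f M R (snd z) (map_pmf snd (d z)) \<and> map_pmf fst (d z) = q (fst z)
      \<and> (\<forall>y\<in>set_pmf (d z). Q' (fst z) (fst y) (snd y))" ..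
  have d: "\<And>z. z \<in> set_pmf c \<Longrightarrow> exec f M R (snd z) (map_pmf snd (d z))"
    "\<And>z. z \<in> set_pmf c \<Longrightarrow> map_pmf fst (d z) = q (fst z)"
    "\<And>z y. z \<in> set_pmf c \<Longrightarrow> y \<in> set_pmf (d z) \<Longrightarrow> Q' (fst z) (fst y) (snd y)"
    using D by blast+
  define E where "E = (\<lambda>t. THE D. exec f M R t D)"
  have E: "E (snd z) = map_pmf snd (d z)" if "z \<in> set_pmf c" for z
    unfolding E_def by (rule the_equality, rule d(1)[OF that], rule exec_deterministic[OF d(1)[OF that]])
  define e where "e = bind_pmf c (\<lambda>z. map_pmf (\<lambda>y. ((fst z, fst y), snd y)) (d z))"
  have "exec f M (Seq P R) s (bind_pmf (map_pmf snd c) E)"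
  proof (rule exec.Seq[OF c(1)], rule ballI)
    fix t assume "t \<in> set_pmf (map_pmf snd c)"
    then obtain z where z: "z \<in> set_pmf c" "t = snd z" by auto
    show "exec f M R t (E t)" unfolding z(2) E[OF z(1)] by (rule d(1)[OF z(1)])
  qed
  also have "bind_pmf (map_pmf snd c) E = bind_pmf c (\<lambda>z. map_pmf snd (d z))"
    unfolding bind_map_pmf by (intro bind_pmf_cong refl) (simp add: E)
  also have "\<dots> = map_pmf snd e"
    by (simp add: e_def map_bind_pmf pmf.map_comp o_def)
  finally have 1: "exec f M (Seq P R) s (map_pmf snd e)" .
  have "map_pmf fst e = bind_pmf c (\<lambda>z. map_pmf (\<lambda>y. (fst z, y)) (map_pmf fst (d z)))"
    by (simp add: e_def map_bind_pmf pmf.map_comp o_def)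
  also have "\<dots> = bind_pmf c (\<lambda>z. map_pmf (Pair (fst z)) (q (fst z)))"
    by (intro bind_pmf_cong refl) (simp add: d(2))
  also have "\<dots> = bind_pmf p (\<lambda>x. map_pmf (Pair x) (q x))"
    unfolding c(2)[symmetric] bind_map_pmf ..
  finally have 2: "map_pmf fst e = bind_pmf p (\<lambda>x. map_pmf (Pair x) (q x))" .
  have 3: "\<forall>z\<in>set_pmf e. (\<lambda>(x, y) u. Q' x y u) (fst z) (snd z)"
    using d(3) by (auto simp: e_def)
  show ?thesis unfolding samp_def using 1 2 3 by blast
qed

lemma samp_map:
  assumes "samp f M P s p (\<lambda>x. Q (h x))"
  shows "samp f M P s (map_pmf h p) Q"
proof -
  obtain c where c: "exec f M P s (map_pmf snd c)" "map_pmf fst c = p" "\<forall>z\<in>set_pmf c. Q (h (fst z)) (snd z)"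
    using assms unfolding samp_def by blast
  then show ?thesis unfolding samp_def
    by (intro exI[of _ "map_pmf (\<lambda>z. (h (fst z), snd z)) c"])
      (simp add: pmf.map_comp o_def c(2)[symmetric])
qed

lemma samp_dtr_Seq:
  assumes "dtr f M P c (nmem s) (cmem s) Q"
    and "\<And>u. time_used u \<le> time_used s + c \<Longrightarrow> samples_used u = samples_used s \<Longrightarrow> Q (nmem u) (cmem u) \<Longrightarrow> samp f M R u p Q'"
  shows "samp f M (Seq P R) s p Q'"
proof -
  obtain s1 where "exec f M P s (return_pmf s1)" "time_used s1 \<le> time_used s + c" "samples_used s1 = samples_used s" "Q (nmem s1) (cmem s1)"
    using assms(1) unfolding dtr_def by blast
  note s1 = this
  obtain c where "exec f M R s1 (map_pmf snd c)" "map_pmf fst c = p" "\<forall>z\<in>set_pmf c. Q' (fst z) (snd z)"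
    using assms(2)[OF s1(2-4)] unfolding samp_def by blast
  then show ?thesis unfolding samp_def by (intro exI[of _ c] conjI exec_Seq_return[OF s1(1)])
qed

lemma samp_Seq_dtr:
  assumes P: "samp f M P s p Q"
    and R: "\<And>x u. x \<in> set_pmf p \<Longrightarrow> Q x u \<Longrightarrow> dtr f M R c (nmem u) (cmem u) (Q' x)"
  shows "samp f M (Seq P R) s p (\<lambda>x u. \<exists>u0. Q x u0 \<and> time_used u \<le> time_used u0 + c \<and> samples_used u = samples_used u0 \<and> Q' x (nmem u) (cmem u))"
proof -
  have "samp f M (Seq P R) s (bind_pmf p (\<lambda>x. map_pmf (Pair x) (return_pmf ()))) (\<lambda>(x, y) u. \<exists>u0. Q x u0 \<and> time_used u \<le> time_used u0 + c \<and> samples_used u = samples_used u0 \<and> Q' x (nmem u) (cmem u))"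
  proof (rule samp_Seq[OF P])
    fix x u assume x: "x \<in> set_pmf p" "Q x u"
    show "samp f M R u (return_pmf ()) (\<lambda>_ v. \<exists>u0. Q x u0 \<and> time_used v \<le> time_used u0 + c \<and> samples_used v = samples_used u0 \<and> Q' x (nmem v) (cmem v))"
      by (rule samp_weaken[OF samp_dtr[OF R[OF x]]]) (use x in blast)
  qed
  then have "samp f M (Seq P R) s (map_pmf fst (bind_pmf p (\<lambda>x. map_pmf (Pair x) (return_pmf ())))) (\<lambda>x u. \<exists>u0. Q x u0 \<and> time_used u \<le> time_used u0 + c \<and> samples_used u = samples_used u0 \<and> Q' x (nmem u) (cmem u))"
    by (intro samp_map) (simp add: case_prod_beta')
  then show ?thesis by (simp add: map_bind_pmf bind_return_pmf')
qed

lemma samp_SampleRow: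
  assumes "frob_norm (M h) \<noteq> 0" "\<And>i. i \<in> set_pmf (row_pmf (M h)) \<Longrightarrow>
     Q i (count_sample (charge (entry_cost (M h) + ncost a) (nput (nv (nmem s) a) i s)))"
  shows "samp f M (SampleRow h a) s (row_pmf (M h)) Q"
  using exec.SampleRow[of M h f a s, OF assms(1)] assms(2)
  by (intro samp_intro[where st = "\<lambda>i. count_sample (charge (entry_cost (M h) + ncost a) (nput (nv (nmem s) a) i s))"]) (simp_all add: nval_nv)

lemma samp_SampleCol:
  assumes "nv (nmem s) i < dim_row (M h)" "eucl_norm (Matrix.row (M h) (nv (nmem s) i)) \<noteq> 0"
    "\<And>j. j \<in> set_pmf (vec_pmf (Matrix.row (M h) (nv (nmem s) i))) \<Longrightarrow>
     Q j (count_sample (charge (entry_cost (M h) + ncost i + ncost a) (nput (nv (nmem s) a) j s)))"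
  shows "samp f M (SampleCol h i a) s (vec_pmf (Matrix.row (M h) (nv (nmem s) i))) Q"
  using exec.SampleCol[of s i M h f a] assms
  by (intro samp_intro[where st = "\<lambda>j. count_sample (charge (entry_cost (M h) + ncost i + ncost a) (nput (nv (nmem s) a) j s))"]) (simp_all add: nval_nv)

lemma samp_Coin:
  assumes "\<And>x. Q x (charge (1 + ncost a + ccost e) (nput (nv (nmem s) a) (of_bool x) s))"
  shows "samp f M (Coin a e) s (bernoulli_pmf (max 0 (min 1 (Re (cv f (nmem s) (cmem s) e))))) Q"
  using exec.Coin[of f M a e s] assms
  by (intro samp_intro[where st = "\<lambda>x. charge (1 + ncost a + ccost e) (nput (nv (nmem s) a) (of_bool x) s)"]) (simp_all add: nval_nv cval_cv)

lemma samp_WhileFalse: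
  assumes "\<not> bv f (nmem s) (cmem s) g" "Q x (charge (bcost g) s)"
  shows "samp f M (While g P) s (return_pmf x) Q"
  using exec.WhileFalse[of f s g M P] assms
  by (intro samp_intro[where st = "\<lambda>_. charge (bcost g) s"]) (simp_all add: bval_bv)

lemma samp_WhileTrue:
  "bv f (nmem s) (cmem s) g \<Longrightarrow> samp f M (Seq P (While g P)) (charge (bcost g) s) p Q \<Longrightarrow> samp f M (While g P) s p Q"
  unfolding samp_def bval_bv[symmetric] using exec.WhileTrue[of f s g M P] by blast

lemma samp_bind:
  assumes P: "samp f M P s p Q" and R: "\<And>x u. x \<in> set_pmf p \<Longrightarrow> Q x u \<Longrightarrow> samp f M R u (q x) Q'"
  shows "samp f M (Seq P R) s (bind_pmf p q) Q'"
  using samp_map[of f M "Seq P R" s "bind_pmf p (\<lambda>x. map_pmf (Pair x) (q x))" Q' snd] samp_Seq[OF P R]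
  by (simp add: map_bind_pmf pmf.map_comp o_def case_prod_beta')

section \<open>The preparation program\<close>

definition ARR :: "nat \<Rightarrow> nat set \<Rightarrow> (nat \<Rightarrow> 'v) \<Rightarrow> (nat \<Rightarrow> 'v) \<Rightarrow> bool" where
  "ARR g K v mem \<longleftrightarrow> (\<forall>k\<in>K. mem (adr g k) = v k)"

definition ARR2 :: "nat \<Rightarrow> (nat \<times> nat) set \<Rightarrow> (nat \<Rightarrow> nat \<Rightarrow> 'v) \<Rightarrow> (nat \<Rightarrow> 'v) \<Rightarrow> bool" where
  "ARR2 g K v mem \<longleftrightarrow> (\<forall>(k, l)\<in>K. mem (adr g (pr k l)) = v k l)"

lemma ARR_D: "ARR g K v mem \<Longrightarrow> k \<in> K \<Longrightarrow> mem (adr g k) = v k"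
  by (simp add: ARR_def)

lemma ARR2_D: "ARR2 g K v mem \<Longrightarrow> (k, l) \<in> K \<Longrightarrow> mem (adr g (pr k l)) = v k l"
  by (auto simp: ARR2_def)

lemma ARR_other [simp]: "g < 64 \<Longrightarrow> g' < 64 \<Longrightarrow> g \<noteq> g' \<Longrightarrow> ARR g K v (mem(adr g' i := x)) = ARR g K v mem"
  by (simp add: ARR_def)

lemma ARR2_other [simp]: "g < 64 \<Longrightarrow> g' < 64 \<Longrightarrow> g \<noteq> g' \<Longrightarrow> ARR2 g K v (mem(adr g' i := x)) = ARR2 g K v mem"
  by (simp add: ARR2_def)

lemma ARR_empty [simp]: "ARR g {} v mem" by (simp add: ARR_def)

lemma ARR_outside: "g < 64 \<Longrightarrow> i \<notin> K \<Longrightarrow> ARR g K v (mem(adr g i := x)) = ARR g K v mem"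
  by (auto simp: ARR_def)

lemma ARR_insert: "g < 64 \<Longrightarrow> ARR g K v mem \<Longrightarrow> x = v i \<Longrightarrow> ARR g (insert i K) v (mem(adr g i := x))"
  by (auto simp: ARR_def)

lemma ARR_Suc: "g < 64 \<Longrightarrow> ARR g {..<i} v mem \<Longrightarrow> x = v i \<Longrightarrow> ARR g {..<Suc i} v (mem(adr g i := x))"
  unfolding lessThan_Suc by (rule ARR_insert)

lemma ARR2_update:
  assumes "g < 64" "ARR2 g K v mem" "x = v' k l" "\<And>k' l'. (k', l') \<in> K' \<Longrightarrow> (k', l') \<noteq> (k, l) \<Longrightarrow> (k', l') \<in> K \<and> v' k' l' = v k' l'"
  shows "ARR2 g K' v' (mem(adr g (pr k l) := x))"
  using assms by (fastforce simp: ARR2_def)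

lemma ARR2_mono: "ARR2 g K v mem \<Longrightarrow> (\<And>k l. (k, l) \<in> K' \<Longrightarrow> (k, l) \<in> K \<and> v k l = v' k l) \<Longrightarrow> ARR2 g K' v' mem"
  by (fastforce simp: ARR2_def)

definition INP :: "(nat \<Rightarrow> complex) \<Rightarrow> (nat \<Rightarrow> complex) \<Rightarrow> bool" where
  "INP x cm \<longleftrightarrow> (\<forall>g<10. cm (adr g 0) = x g)"

lemma INP_other [simp]: "10 \<le> g \<Longrightarrow> g < 64 \<Longrightarrow> INP x (cm(adr g i := v)) = INP x cm"
  by (simp add: INP_def)

lemma INP_D: "INP x cm \<Longrightarrow> g < 10 \<Longrightarrow> cm (adr g 0) = x g"
  by (simp add: INP_def)

definition NE :: "nat \<Rightarrow> (nat \<Rightarrow> nat) \<Rightarrow> (nat \<Rightarrow> nat) \<Rightarrow> (nat \<Rightarrow> nat) \<Rightarrow> bool" where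
  "NE r i j nm \<longleftrightarrow> nm (adr 2 0) = r \<and> ARR 8 {..<r} i nm \<and> ARR 9 {..<r} j nm"

lemma NE_other [simp]: "g < 64 \<Longrightarrow> g \<notin> {2, 8, 9} \<Longrightarrow> NE r i j (nm(adr g k := v)) = NE r i j nm"
  by (simp add: NE_def)

lemma NE_D:
  "NE r i j nm \<Longrightarrow> nm (adr 2 0) = r" "NE r i j nm \<Longrightarrow> k < r \<Longrightarrow> nm (adr 8 k) = i k"
  "NE r i j nm \<Longrightarrow> k < r \<Longrightarrow> nm (adr 9 k) = j k"
  by (auto simp: NE_def ARR_def)

text \<open>Array tags.  Natural numbers: 2 sample size, 3, 4, 6 loop counters, 5 index of the current
  Lanczos vector, 8 sampled rows, 9 sampled columns.  Complex numbers: 0 to 7 the inputs, 8 the squared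
  Frobenius norm, 9 the real number whose ceiling is the sample size, 10 row norms, 11 the vector divided
  by them, 12 the sampled submatrix divided by them, 13 its squared column norms, 14 Lanczos vectors,
  16 their squared norms, 17 and 18 the tridiagonal coefficients, 19 the de Casteljau table with its
  differences in 20, 21 the coefficient vector of the answer and 22 its squared norm.  The sampling
  program uses 10 to 14 (natural) and 23 to 26 (complex) as registers.\<close>

definition rowsC :: com where "rowsC = For 3 (nS 2) (SampleRow SrcMat (nA 8 (nS 3)))"
definition colsC :: com where "colsC = For 3 (nS 2) (SampleCol SrcMat (nR 8 (nS 3)) (nA 9 (nS 3)))"

text \<open>Entries are divided by the row norm only. The factor \<open>sqrt (F2 / r)\<close>,
  common to \<open>S\<close> and to the sampled vector, is left out: it cancels in the normalised
  operator and in the final distribution.\<close>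

definition matrixC :: com where "matrixC = For 3 (nS 2)
  (Seq (GetRowNorm SrcMat (nR 8 (nS 3)) (nA 10 (nS 3)))
  (Seq (GetEntry SrcVec (nR 8 (nS 3)) (NConst 0) (nA 11 (nS 3)))
  (Seq (CAssign (nA 11 (nS 3)) (CDiv (cR 11 (nS 3)) (cR 10 (nS 3))))
  (For 4 (nS 2)
    (Seq (GetEntry SrcMat (nR 8 (nS 3)) (nR 9 (nS 4)) (nA 12 (pE (nS 3) (nS 4))))
         (CAssign (nA 12 (pE (nS 3) (nS 4))) (CDiv (cR 12 (pE (nS 3) (nS 4))) (cR 10 (nS 3)))))))))"

definition normsC :: com where "normsC = For 4 (nS 2)
  (Acc 3 (nS 2) (nA 13 (nS 4)) (CMul (cR 12 (pE (nS 3) (nS 4))) (CConj (cR 12 (pE (nS 3) (nS 4))))))"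

text \<open>\<open>Lg\<close> dominates the cost of every access at once. It is the polylogarithmic
  factor of the final bounds and the reason for its exponent 2.\<close>

locale access_model =
  fixes f :: "real \<Rightarrow> real" and A :: "complex mat" and b :: "complex vec" and m n :: nat and Lg :: real
  assumes A: "A \<in> carrier_mat m n" and b: "b \<in> carrier_vec m" and mn: "0 < m" "0 < n"
  defines "Lg \<equiv> (1 + ln (real (m * n)))\<^sup>2"
begin

abbreviation "M \<equiv> access A b"

lemma access_simps [simp]:
  "M SrcMat = A" "dim_row (M SrcVec) = m" "dim_col (M SrcVec) = 1" "dim_row A = m" "dim_col A = n"
  using A b by (auto simp: access_def)

lemma access_vec [simp]: "i < m \<Longrightarrow> M SrcVec $$ (i, 0) = b $ i"
  using b by (auto simp: access_def mat_of_cols_def)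

lemma costs: "entry_cost A \<le> Lg" "entry_cost (M SrcVec) \<le> Lg" "row_cost A \<le> Lg" "1 \<le> Lg"
proof -
  have mn': "1 \<le> real m" "1 \<le> real (m * n)"
    unfolding real_of_nat_ge_one_iff using mn by auto
  then have 1: "0 \<le> ln (real m)" "0 \<le> ln (real (m * n))" by (auto simp del: of_nat_mult)
  have "ln (real m) \<le> ln (real (m * n))" using mn' mn by (intro ln_mono) auto
  then have 2: "(ln (real m))\<^sup>2 \<le> (ln (real (m * n)))\<^sup>2" using 1 by (intro power_mono) auto
  have 3: "1 + (ln (real (m * n)))\<^sup>2 \<le> Lg" unfolding Lg_def using 1 by (simp add: power2_eq_square algebra_simps)
  show "entry_cost A \<le> Lg" using 3 by (simp add: entry_cost_def)
  show "entry_cost (M SrcVec) \<le> Lg" using 2 3 by (simp add: entry_cost_def)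
  show "row_cost A \<le> Lg" using 2 3 by (simp add: row_cost_def)
  show "1 \<le> Lg" using 3 zero_le_power2[of "ln (real (m * n))"] by linarith
qed

abbreviation "rn i \<equiv> complex_of_real (eucl_norm (Matrix.row A i))"

text \<open>The \<open>r^2\<close> entry accesses dominate. The numerals in this and the following
  costs are generous roundings of sums of expression sizes.\<close>

lemma matrixC:
  assumes NE: "NE r i j nm" and INP: "INP x cm" and ij: "\<And>k. k < r \<Longrightarrow> i k < m" "\<And>k. k < r \<Longrightarrow> j k < n" and r: "1 \<le> r"
  shows "dtr f M matrixC (599 * (real r * real r * Lg)) nm cm (\<lambda>nm cm. NE r i j nm \<and> INP x cm \<and>
     ARR 10 {..<r} (\<lambda>k. rn (i k)) cm \<and> ARR 11 {..<r} (\<lambda>k. b $ (i k) / rn (i k)) cm \<and>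
     ARR2 12 ({..<r} \<times> {..<r}) (\<lambda>k l. A $$ (i k, j l) / rn (i k)) cm)"
proof -
  let ?I = "\<lambda>k nm cm. nm (adr 3 0) = k \<and> NE r i j nm \<and> INP x cm \<and> ARR 10 {..<k} (\<lambda>k. rn (i k)) cm \<and>
    ARR 11 {..<k} (\<lambda>k. b $ (i k) / rn (i k)) cm \<and> ARR2 12 ({..<k} \<times> {..<r}) (\<lambda>k l. A $$ (i k, j l) / rn (i k)) cm"
  have body: "dtr f M (For 4 (nS 2)
    (Seq (GetEntry SrcMat (nR 8 (nS 3)) (nR 9 (nS 4)) (nA 12 (pE (nS 3) (nS 4))))
         (CAssign (nA 12 (pE (nS 3) (nS 4))) (CDiv (cR 12 (pE (nS 3) (nS 4))) (cR 10 (nS 3))))))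
     (real r * (Lg + 300 + 21 + ncost (nS 2)) + 14 + ncost (nS 2)) nm cm
     (\<lambda>nm' cm'. nm' (adr 3 0) = k \<and> ?I (Suc k) (nm'(adr 3 0 := Suc k)) cm')"
    if k: "k < r" and I: "nm (adr 3 0) = k \<and> NE r i j nm \<and> INP x cm \<and> ARR 10 {..<Suc k} (\<lambda>k. rn (i k)) cm \<and>
      ARR 11 {..<Suc k} (\<lambda>k. b $ (i k) / rn (i k)) cm \<and> ARR2 12 ({..<k} \<times> {..<r}) (\<lambda>k l. A $$ (i k, j l) / rn (i k)) cm" for k nm cm
  proof (rule dtr_For[where n = r and I = "\<lambda>l nm cm. nm (adr 4 0) = l \<and> nm (adr 3 0) = k \<and> NE r i j nm \<and> INP x cm \<and> ARR 10 {..<Suc k} (\<lambda>k. rn (i k)) cm \<and>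
      ARR 11 {..<Suc k} (\<lambda>k. b $ (i k) / rn (i k)) cm \<and> ARR2 12 ({..<k} \<times> {..<r} \<union> {k} \<times> {..<l}) (\<lambda>k l. A $$ (i k, j l) / rn (i k)) cm"])
    fix l nm cm assume l: "l < r" and J: "nm (adr 4 0) = l \<and> nm (adr 3 0) = k \<and> NE r i j nm \<and> INP x cm \<and> ARR 10 {..<Suc k} (\<lambda>k. rn (i k)) cm \<and>
      ARR 11 {..<Suc k} (\<lambda>k. b $ (i k) / rn (i k)) cm \<and> ARR2 12 ({..<k} \<times> {..<r} \<union> {k} \<times> {..<l}) (\<lambda>k l. A $$ (i k, j l) / rn (i k)) cm"
    have v: "nm (adr 8 k) = i k" "nm (adr 9 l) = j l" "cm (adr 10 k) = rn (i k)" "i k < m" "j l < n"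
      using J k l ij by (auto simp: NE_D ARR_D)
    show "dtr f M (Seq (GetEntry SrcMat (nR 8 (nS 3)) (nR 9 (nS 4)) (nA 12 (pE (nS 3) (nS 4))))
         (CAssign (nA 12 (pE (nS 3) (nS 4))) (CDiv (cR 12 (pE (nS 3) (nS 4))) (cR 10 (nS 3))))) (Lg + 300) nm cm
       (\<lambda>nm' cm'. nm' (adr 4 0) = l \<and> (nm'(adr 4 0 := Suc l)) (adr 4 0) = Suc l \<and> (nm'(adr 4 0 := Suc l)) (adr 3 0) = k \<and> NE r i j (nm'(adr 4 0 := Suc l)) \<and> INP x cm' \<and> ARR 10 {..<Suc k} (\<lambda>k. rn (i k)) cm' \<and>
      ARR 11 {..<Suc k} (\<lambda>k. b $ (i k) / rn (i k)) cm' \<and> ARR2 12 ({..<k} \<times> {..<r} \<union> {k} \<times> {..<Suc l}) (\<lambda>k l. A $$ (i k, j l) / rn (i k)) cm')"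
      apply (rule dtr_cost, rule dtr_Seq, rule dtr_GetEntry)
         apply (use J v in simp)
        apply (use J v in simp)
       apply (rule dtr_CAssign)
       apply (use J v in \<open>simp\<close>)
       apply (rule ARR2_update, simp, rule J[THEN conjunct2, THEN conjunct2, THEN conjunct2, THEN conjunct2, THEN conjunct2, THEN conjunct2])
      using costs(1) by auto
  next
    fix nm' cm' assume J: "nm' (adr 4 0) = r \<and> nm' (adr 3 0) = k \<and> NE r i j nm' \<and> INP x cm' \<and> ARR 10 {..<Suc k} (\<lambda>k. rn (i k)) cm' \<and>
      ARR 11 {..<Suc k} (\<lambda>k. b $ (i k) / rn (i k)) cm' \<and> ARR2 12 ({..<k} \<times> {..<r} \<union> {k} \<times> {..<r}) (\<lambda>k l. A $$ (i k, j l) / rn (i k)) cm'"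
    moreover have "ARR2 12 ({..<Suc k} \<times> {..<r}) (\<lambda>k l. A $$ (i k, j l) / rn (i k)) cm'"
      by (rule ARR2_mono[of 12 "{..<k} \<times> {..<r} \<union> {k} \<times> {..<r}"]) (use J in \<open>auto simp: less_Suc_eq\<close>)
    ultimately show "nm' (adr 3 0) = k \<and> ?I (Suc k) (nm'(adr 3 0 := Suc k)) cm'" by simp
  qed (use I costs(4) in \<open>auto simp: NE_D\<close>)
  have "dtr f M matrixC (real r * ((2 * Lg + 200 + (real r * (Lg + 300 + 21 + ncost (nS 2)) + 14 + ncost (nS 2))) + 21 + ncost (nS 2)) + 14 + ncost (nS 2)) nm cm (?I r)"
    unfolding matrixC_def
  proof (rule dtr_For[where n = r and I = "?I"])
    fix k nm cm assume k: "k < r" and I: "?I k nm cm"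
    have v: "nm (adr 8 k) = i k" "i k < m" using I k ij by (auto simp: NE_D)
    show "dtr f M (Seq (GetRowNorm SrcMat (nR 8 (nS 3)) (nA 10 (nS 3)))
  (Seq (GetEntry SrcVec (nR 8 (nS 3)) (NConst 0) (nA 11 (nS 3)))
  (Seq (CAssign (nA 11 (nS 3)) (CDiv (cR 11 (nS 3)) (cR 10 (nS 3))))
  (For 4 (nS 2)
    (Seq (GetEntry SrcMat (nR 8 (nS 3)) (nR 9 (nS 4)) (nA 12 (pE (nS 3) (nS 4))))
         (CAssign (nA 12 (pE (nS 3) (nS 4))) (CDiv (cR 12 (pE (nS 3) (nS 4))) (cR 10 (nS 3)))))))))
       (2 * Lg + 200 + (real r * (Lg + 300 + 21 + ncost (nS 2)) + 14 + ncost (nS 2))) nm cm (\<lambda>nm' cm'. nm' (adr 3 0) = k \<and> ?I (Suc k) (nm'(adr 3 0 := Suc k)) cm')"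
      apply (rule dtr_cost, rule dtr_Seq, rule dtr_GetRowNorm)
        apply (use I v in simp)
       apply (rule dtr_Seq, rule dtr_GetEntry)
         apply (use I v in simp)
        apply (use I v in simp)
       apply (rule dtr_Seq, rule dtr_CAssign)
       apply (rule body[OF k])
       apply (use I v in \<open>simp add: ARR_Suc\<close>)
      apply (use costs(2,3) in simp)
      done
  qed (use NE INP costs(4) in \<open>auto simp: NE_D ARR2_def\<close>)
  then show ?thesis
  proof (rule dtr_weaken)
    have r1: "1 \<le> real r" using r by simp
    have "1 * Lg \<le> real r * Lg" using costs(4) r1 by (intro mult_right_mono) auto
    then have rL: "Lg \<le> real r * Lg" "1 \<le> real r * Lg" using costs(4) by linarith+
    have "real r * (Lg + 300 + 21 + ncost (nS 2)) + 14 + ncost (nS 2) \<le> (301 + 35 + 2 * ncost (nS 2)) * (real r * Lg)"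
      using costs(4) r1 by (intro loop_bound) auto
    then have "2 * Lg + 200 + (real r * (Lg + 300 + 21 + ncost (nS 2)) + 14 + ncost (nS 2)) \<le> 552 * (real r * Lg)"
      using rL by simp
    from loop_bound[OF r1 rL(2) this, of "ncost (nS 2)"] rL
    show "real r * ((2 * Lg + 200 + (real r * (Lg + 300 + 21 + ncost (nS 2)) + 14 + ncost (nS 2))) + 21 + ncost (nS 2)) + 14 + ncost (nS 2) \<le> 599 * (real r * real r * Lg)"
      by (simp add: mult.assoc)
  qed simp
qed

end

section \<open>The Lanczos recurrence as a program\<close>

definition mulC :: com where "mulC = For 4 (nS 2)
  (Seq (Acc 3 (nS 2) (nA 15 (nS 4)) (CMul (CConj (cR 12 (pE (nS 3) (nS 4)))) (cR 14 (pE (nS 5) (nS 3)))))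
       (CAssign (nA 15 (nS 4)) (CDiv (cR 15 (nS 4)) (CMul (COfNat (nS 2)) (cR 13 (nS 4))))))"

definition mulC' :: com where "mulC' = For 3 (nS 2)
  (Acc 4 (nS 2) (nA 24 (nS 3)) (CMul (cR 12 (pE (nS 3) (nS 4))) (cR 15 (nS 4))))"

definition nextC :: com where "nextC = For 3 (nS 2)
  (CAssign (nA 14 (pE (NAdd (nS 5) (NConst 1)) (nS 3)))
    (CSub (CSub (cR 24 (nS 3)) (CMul (cR 17 (nS 5)) (cR 14 (pE (nS 5) (nS 3)))))
       (CMul (cR 18 (nS 5)) (cR 14 (pE (NSub (nS 5) (NConst 1)) (nS 3))))))"

definition normC :: com where "normC =
  Acc 3 (nS 2) (nA 16 (nS 5)) (CMul (cR 14 (pE (nS 5) (nS 3))) (CConj (cR 14 (pE (nS 5) (nS 3)))))"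

definition stepC :: com where "stepC =
  Seq mulC (Seq mulC'
  (Seq (Acc 3 (nS 2) (nA 17 (nS 5)) (CMul (cR 24 (nS 3)) (CConj (cR 14 (pE (nS 5) (nS 3))))))
  (Seq (CAssign (nA 17 (nS 5)) (CDiv (cR 17 (nS 5)) (cR 16 (nS 5))))
  (Seq (CAssign (nA 18 (nS 5)) (CDiv (cR 16 (nS 5)) (cR 16 (NSub (nS 5) (NConst 1)))))
  (Seq nextC
  (Seq (NAssign (nL 5) (NAdd (nS 5) (NConst 1))) normC))))))"

definition lanczosC :: com where "lanczosC =
  Seq (For 3 (nS 2) (Seq (CAssign (nA 14 (pE (NConst 0) (nS 3))) (COfNat (NConst 0)))
        (CAssign (nA 14 (pE (NConst 1) (nS 3))) (cR 11 (nS 3)))))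
  (Seq (Seq (CAssign (nL 16) (COfNat (NConst 0))) (Seq (NAssign (nL 5) (NConst 1)) normC))
  (While (BReLess (COfNat (NConst 0)) (cR 16 (nS 5))) stepC))"

text \<open>The unnormalised form: it has no square roots, and the coefficient of the last but one
  vector is a quotient of squared norms. The zero vector at index 0 makes the recurrence uniform; in
  the first step its coefficient is a division by zero, hence 0.\<close>

fun lanczos :: "nat \<Rightarrow> ((nat \<Rightarrow> complex) \<Rightarrow> nat \<Rightarrow> complex) \<Rightarrow> (nat \<Rightarrow> complex) \<Rightarrow> nat \<Rightarrow> nat \<Rightarrow> complex" where
  "lanczos r T v 0 = (\<lambda>_. 0)"
| "lanczos r T v (Suc 0) = v"
| "lanczos r T v (Suc (Suc k)) = (let q = lanczos r T v (Suc k); p = lanczos r T v k in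
     (\<lambda>a. T q a - ip r (T q) q / ip r q q * q a - ip r q q / ip r p p * p a))"

locale memory_env =
  fixes r :: nat and i j :: "nat \<Rightarrow> nat" and x t bh :: "nat \<Rightarrow> complex" and Mh :: "nat \<Rightarrow> nat \<Rightarrow> complex" and nn :: "nat \<Rightarrow> complex"
    and f :: "real \<Rightarrow> real" and M :: "source \<Rightarrow> complex mat"
  assumes r: "1 \<le> r"
begin

definition ENV :: "(nat \<Rightarrow> nat) \<Rightarrow> (nat \<Rightarrow> complex) \<Rightarrow> bool" where
  "ENV nm cm \<longleftrightarrow> NE r i j nm \<and> INP x cm \<and> ARR 10 {..<r} t cm \<and> ARR 11 {..<r} bh cm \<and>
     ARR2 12 ({..<r} \<times> {..<r}) Mh cm \<and> ARR 13 {..<r} nn cm"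

lemma ENV_nm [simp]: "g < 64 \<Longrightarrow> g \<notin> {2, 8, 9} \<Longrightarrow> ENV (nm(adr g k := v)) cm = ENV nm cm"
  by (simp add: ENV_def)

lemma ENV_cm [simp]: "14 \<le> g \<Longrightarrow> g < 64 \<Longrightarrow> ENV nm (cm(adr g k := v)) = ENV nm cm"
  by (simp add: ENV_def)

lemma ENV_D:
  "ENV nm cm \<Longrightarrow> nm (adr 2 0) = r" "ENV nm cm \<Longrightarrow> g < 10 \<Longrightarrow> cm (adr g 0) = x g"
  "ENV nm cm \<Longrightarrow> k < r \<Longrightarrow> cm (adr 11 k) = bh k" "ENV nm cm \<Longrightarrow> k < r \<Longrightarrow> l < r \<Longrightarrow> cm (adr 12 (pr k l)) = Mh k l"
  "ENV nm cm \<Longrightarrow> k < r \<Longrightarrow> cm (adr 13 k) = nn k" "ENV nm cm \<Longrightarrow> k < r \<Longrightarrow> cm (adr 10 k) = t k"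
  "ENV nm cm \<Longrightarrow> k < r \<Longrightarrow> nm (adr 8 k) = i k"
  by (auto simp: ENV_def ARR_def ARR2_def NE_def INP_def)

definition adjmul :: "(nat \<Rightarrow> complex) \<Rightarrow> nat \<Rightarrow> complex" where
  "adjmul w l = (\<Sum>a<r. cnj (Mh a l) * w a) / (of_nat r * nn l)"

text \<open>For the stored data this is \<open>W\<close> times its adjoint, divided by
  \<open>F2\<close>. Going through \<open>adjmul\<close> takes two passes over the \<open>r\<close>
  by \<open>r\<close> array, whereas forming the product matrix would take about \<open>r^3\<close>
  steps.\<close>

definition top :: "(nat \<Rightarrow> complex) \<Rightarrow> nat \<Rightarrow> complex" where
  "top w = (\<lambda>a. if a < r then \<Sum>l<r. Mh a l * adjmul w l else 0)"

abbreviation "rr \<equiv> real r"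

lemma rr: "1 \<le> rr" "rr \<le> rr * rr" "1 \<le> rr * rr" "0 \<le> rr" "0 \<le> rr * rr"
proof -
  show 1: "1 \<le> rr" using r by simp
  then show "rr \<le> rr * rr" "0 \<le> rr" "0 \<le> rr * rr" using mult_right_mono[of 1 rr rr] by auto
  then show "1 \<le> rr * rr" using 1 by linarith
qed

text \<open>The predicate \<open>R\<close> is a frame: whatever is insensitive to the two loop
  counters and to the scratch array survives the call.\<close>

lemma mulC:
  assumes E: "ENV nm cm" "ARR2 14 K q cm" "nm (adr 5 0) = d" "\<And>a. a < r \<Longrightarrow> (d, a) \<in> K"
    and R: "\<And>nm cm l g z. R nm cm \<Longrightarrow> g \<in> {3, 4} \<Longrightarrow> R (nm(adr g 0 := l)) cm"
           "\<And>nm cm l z. R nm cm \<Longrightarrow> R nm (cm(adr 15 l := z))" "R nm cm"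
  shows "dtr f M mulC (447 * (rr * rr)) nm cm (\<lambda>nm cm. ENV nm cm \<and> ARR2 14 K q cm \<and> nm (adr 5 0) = d \<and> R nm cm \<and> ARR 15 {..<r} (adjmul (q d)) cm)"
proof -
  let ?J = "\<lambda>l nm cm. nm (adr 4 0) = l \<and> ENV nm cm \<and> ARR2 14 K q cm \<and> nm (adr 5 0) = d \<and> R nm cm \<and> ARR 15 {..<l} (adjmul (q d)) cm"
  have "dtr f M mulC (rr * (400 * rr + 21 + ncost (nS 2)) + 14 + ncost (nS 2)) nm cm (?J r)"
    unfolding mulC_def
  proof (rule dtr_For[where n = r and I = "?J"])
    fix l nm cm assume l: "l < r" and J: "?J l nm cm"
    have v: "\<And>k. k < r \<Longrightarrow> cm (adr 12 (pr k l)) = Mh k l" "cm (adr 13 l) = nn l" "nm (adr 2 0) = r"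
       "\<And>a. a < r \<Longrightarrow> cm (adr 14 (pr d a)) = q d a"
      using J l E(4) by (auto simp: ENV_D ARR2_D)
    have R': "R (nm(adr 3 0 := r, adr 4 0 := Suc l)) (cm(adr 15 l := z, adr 15 l := z'))" for z z'
      using J by (intro R(1,2)) auto
    show "dtr f M (Seq (Acc 3 (nS 2) (nA 15 (nS 4)) (CMul (CConj (cR 12 (pE (nS 3) (nS 4)))) (cR 14 (pE (nS 5) (nS 3)))))
       (CAssign (nA 15 (nS 4)) (CDiv (cR 15 (nS 4)) (CMul (COfNat (nS 2)) (cR 13 (nS 4)))))) (400 * rr) nm cm (\<lambda>nm' cm'. nm' (adr 4 0) = l \<and> ?J (Suc l) (nm'(adr 4 0 := Suc l)) cm')"
      apply (rule dtr_cost, rule dtr_Seq, rule dtr_Acc[where x = "adr 15 l" and n = r and g = "\<lambda>a. cnj (Mh a l) * q d a"])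
           apply (use J v l in simp_all)[4]
       apply (rule dtr_CAssign)
       apply (use J v l R' in \<open>simp add: ARR_Suc ARR_outside adjmul_def\<close>)
      apply (use rr in simp)
      done
  qed (use E R rr in \<open>auto simp: ENV_D\<close>)
  then show ?thesis
    by (rule dtr_weaken) (simp, use loop_bound[OF rr(1) rr(1) order.refl, of "ncost (nS 2)" 400] in simp)
qed

lemma mulC':
  assumes E: "ENV nm cm" "ARR2 14 K q cm" "nm (adr 5 0) = d"
    and R: "\<And>nm cm l g z. R nm cm \<Longrightarrow> g \<in> {3, 4} \<Longrightarrow> R (nm(adr g 0 := l)) cm"
           "\<And>nm cm l z. R nm cm \<Longrightarrow> R nm (cm(adr 24 l := z))" "R nm cm" and Z: "ARR 15 {..<r} (adjmul w) cm"
  shows "dtr f M mulC' (347 * (rr * rr)) nm cm (\<lambda>nm cm. ENV nm cm \<and> ARR2 14 K q cm \<and> nm (adr 5 0) = d \<and> R nm cm \<and> ARR 24 {..<r} (top w) cm)"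
proof -
  let ?J = "\<lambda>l nm cm. nm (adr 3 0) = l \<and> ENV nm cm \<and> ARR2 14 K q cm \<and> nm (adr 5 0) = d \<and> R nm cm \<and> ARR 15 {..<r} (adjmul w) cm \<and> ARR 24 {..<l} (top w) cm"
  have "dtr f M mulC' (rr * (300 * rr + 21 + ncost (nS 2)) + 14 + ncost (nS 2)) nm cm (?J r)"
    unfolding mulC'_def
  proof (rule dtr_For[where n = r and I = "?J"])
    fix l nm cm assume l: "l < r" and J: "?J l nm cm"
    have v: "\<And>k. k < r \<Longrightarrow> cm (adr 12 (pr l k)) = Mh l k" "nm (adr 2 0) = r"
       "\<And>a. a < r \<Longrightarrow> cm (adr 15 a) = adjmul w a"
      using J l by (auto simp: ENV_D ARR_D)
    have R': "R (nm(adr 4 0 := r, adr 3 0 := Suc l)) (cm(adr 24 l := z))" for z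
      using J by (intro R(1,2)) auto
    show "dtr f M (Acc 4 (nS 2) (nA 24 (nS 3)) (CMul (cR 12 (pE (nS 3) (nS 4))) (cR 15 (nS 4)))) (300 * rr) nm cm (\<lambda>nm' cm'. nm' (adr 3 0) = l \<and> ?J (Suc l) (nm'(adr 3 0 := Suc l)) cm')"
      apply (rule dtr_cost, rule dtr_Acc[where x = "adr 24 l" and n = r and g = "\<lambda>k. Mh l k * adjmul w k"])
           apply (use J v l in simp_all)[4]
       apply (use J v l R' in \<open>simp add: ARR_Suc ARR_outside top_def\<close>)
      apply (use rr in simp)
      done
  qed (use E R Z rr in \<open>auto simp: ENV_D\<close>)
  then show ?thesis
    by (rule dtr_weaken) (simp, use loop_bound[OF rr(1) rr(1) order.refl, of "ncost (nS 2)" 300] in simp)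
qed

abbreviation "lz \<equiv> lanczos r top bh"
definition "gg k = ip r (lz k) (lz k)"
definition "al k = ip r (top (lz k)) (lz k) / gg k"
definition "be k = gg k / gg (k - 1)"

lemma lz_Suc: "1 \<le> d \<Longrightarrow> lz (Suc d) a = top (lz d) a - al d * lz d a - be d * lz (d - 1) a"
  by (cases d) (simp_all add: Let_def al_def be_def gg_def)

definition LZ :: "nat \<Rightarrow> (nat \<Rightarrow> nat) \<Rightarrow> (nat \<Rightarrow> complex) \<Rightarrow> bool" where
  "LZ d nm cm \<longleftrightarrow> ENV nm cm \<and> nm (adr 5 0) = d \<and> ARR2 14 ({..d} \<times> {..<r}) lz cm \<and> ARR 16 {..d} gg cm \<and>
     ARR 17 {1..<d} al cm \<and> ARR 18 {1..<d} be cm"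

lemma nextC:
  assumes d: "1 \<le> d" and E: "ENV nm cm" "ARR2 14 ({..d} \<times> {..<r}) lz cm" "nm (adr 5 0) = d" "ARR 16 {..d} gg cm"
    "ARR 17 {1..<Suc d} al cm" "ARR 18 {1..<Suc d} be cm" "ARR 24 {..<r} (top (lz d)) cm"
  shows "dtr f M nextC (347 * (rr * rr)) nm cm (\<lambda>nm cm. ENV nm cm \<and> ARR2 14 ({..Suc d} \<times> {..<r}) lz cm \<and> nm (adr 5 0) = d \<and>
     ARR 16 {..d} gg cm \<and> ARR 17 {1..<Suc d} al cm \<and> ARR 18 {1..<Suc d} be cm)"
proof -
  let ?J = "\<lambda>a nm cm. nm (adr 3 0) = a \<and> ENV nm cm \<and> ARR2 14 ({..d} \<times> {..<r} \<union> {Suc d} \<times> {..<a}) lz cm \<and> nm (adr 5 0) = d \<and>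
    ARR 16 {..d} gg cm \<and> ARR 17 {1..<Suc d} al cm \<and> ARR 18 {1..<Suc d} be cm \<and> ARR 24 {..<r} (top (lz d)) cm"
  have "dtr f M nextC (rr * (300 * rr + 21 + ncost (nS 2)) + 14 + ncost (nS 2)) nm cm (?J r)"
    unfolding nextC_def
  proof (rule dtr_For[where n = r and I = "?J"])
    fix a nm cm assume a: "a < r" and J: "?J a nm cm"
    have v: "cm (adr 14 (pr d a)) = lz d a" "cm (adr 14 (pr (d - Suc 0) a)) = lz (d - 1) a"
       "cm (adr 24 a) = top (lz d) a" "cm (adr 17 d) = al d" "cm (adr 18 d) = be d"
      using J a d by (auto simp: ARR_D ARR2_D)
    have A: "ARR2 14 ({..d} \<times> {..<r} \<union> {Suc d} \<times> {..<Suc a}) lz (cm(adr 14 (pr (Suc d) a) := top (lz d) a - al d * lz d a - be d * lz (d - Suc 0) a))"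
      by (rule ARR2_update[of 14 "{..d} \<times> {..<r} \<union> {Suc d} \<times> {..<a}" lz]) (use J d in \<open>auto simp: lz_Suc less_Suc_eq\<close>)
    show "dtr f M (CAssign (nA 14 (pE (NAdd (nS 5) (NConst 1)) (nS 3)))
    (CSub (CSub (cR 24 (nS 3)) (CMul (cR 17 (nS 5)) (cR 14 (pE (nS 5) (nS 3)))))
       (CMul (cR 18 (nS 5)) (cR 14 (pE (NSub (nS 5) (NConst 1)) (nS 3)))))) (300 * rr) nm cm (\<lambda>nm' cm'. nm' (adr 3 0) = a \<and> ?J (Suc a) (nm'(adr 3 0 := Suc a)) cm')"
      apply (rule dtr_cost, rule dtr_CAssign)
       apply (use J v A in simp)
      apply (use rr in simp)
      done
  qed (use E rr in \<open>auto simp: ENV_D\<close>)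
  then show ?thesis
  proof (rule dtr_weaken)
    show "ENV nm cm \<and> ARR2 14 ({..Suc d} \<times> {..<r}) lz cm \<and> nm (adr 5 0) = d \<and>
     ARR 16 {..d} gg cm \<and> ARR 17 {1..<Suc d} al cm \<and> ARR 18 {1..<Suc d} be cm" if "?J r nm cm" for nm cm
      using that by (auto intro!: ARR2_mono[of 14 "{..d} \<times> {..<r} \<union> {Suc d} \<times> {..<r}" lz] simp: le_Suc_eq)
  qed (use loop_bound[OF rr(1) rr(1) order.refl, of "ncost (nS 2)" 300] in simp)
qed

lemma normC:
  assumes E: "ENV nm cm" "ARR2 14 ({..d} \<times> {..<r}) lz cm" "nm (adr 5 0) = d"
    and Q: "Q (nm(adr 3 0 := r)) (cm(adr 16 d := gg d))"
  shows "dtr f M normC (300 * rr) nm cm Q"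
  unfolding normC_def
  apply (rule dtr_cost, rule dtr_Acc[where x = "adr 16 d" and n = r and g = "\<lambda>a. lz d a * cnj (lz d a)"])
       apply (use E in \<open>simp_all add: ENV_D ARR2_D\<close>)[4]
   apply (use Q in \<open>simp add: gg_def ip_def\<close>)
  apply (use rr in simp)
  done

lemma stepC:
  assumes d: "1 \<le> d" and L: "LZ d nm cm"
  shows "dtr f M stepC (2200 * (rr * rr)) nm cm (LZ (Suc d))"
proof -
  let ?R = "\<lambda>nm cm. ARR 16 {..d} gg cm \<and> ARR 17 {1..<d} al cm \<and> ARR 18 {1..<d} be cm"
  let ?B = "\<lambda>nm cm. ENV nm cm \<and> ARR2 14 ({..d} \<times> {..<r}) lz cm \<and> nm (adr 5 0) = d \<and> ?R nm cm"
  have 1: "dtr f M mulC (447 * (rr * rr)) nm cm (\<lambda>nm cm. ENV nm cm \<and> ARR2 14 ({..d} \<times> {..<r}) lz cm \<and> nm (adr 5 0) = d \<and> ?R nm cm \<and> ARR 15 {..<r} (adjmul (lz d)) cm)"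
    by (rule mulC[where R = "?R"]) (use L in \<open>auto simp: LZ_def\<close>)
  have 2: "dtr f M mulC' (347 * (rr * rr)) nm cm (\<lambda>nm cm. ENV nm cm \<and> ARR2 14 ({..d} \<times> {..<r}) lz cm \<and> nm (adr 5 0) = d \<and> ?R nm cm \<and> ARR 24 {..<r} (top (lz d)) cm)"
    if "ENV nm cm \<and> ARR2 14 ({..d} \<times> {..<r}) lz cm \<and> nm (adr 5 0) = d \<and> ?R nm cm \<and> ARR 15 {..<r} (adjmul (lz d)) cm" for nm cm
    by (rule mulC'[where R = "?R"]) (use that in auto)
  have 3: "dtr f M (Acc 3 (nS 2) (nA 17 (nS 5)) (CMul (cR 24 (nS 3)) (CConj (cR 14 (pE (nS 5) (nS 3)))))) (300 * rr) nm cm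
     (\<lambda>nm cm. ?B nm cm \<and> ARR 24 {..<r} (top (lz d)) cm \<and> cm (adr 17 d) = ip r (top (lz d)) (lz d))"
    if "?B nm cm \<and> ARR 24 {..<r} (top (lz d)) cm" for nm cm
  proof -
    have v: "nm (adr 2 0) = r" "\<And>a. a < r \<Longrightarrow> cm (adr 24 a) = top (lz d) a" "\<And>a. a < r \<Longrightarrow> cm (adr 14 (pr d a)) = lz d a"
      using that by (auto simp: ENV_D ARR2_D ARR_D)
    show ?thesis
      apply (rule dtr_cost, rule dtr_Acc[where x = "adr 17 d" and n = r and g = "\<lambda>a. top (lz d) a * cnj (lz d a)"])
           apply (use that v in simp_all)[4]
       apply (use that in \<open>simp add: ip_def ARR_outside\<close>)
      apply (use rr in simp)
      done
  qed
  have ins: "{1..<Suc d} = insert d {1..<d}" "{..Suc d} = insert (Suc d) {..d}" using d by auto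
  let ?C = "\<lambda>nm cm. ENV nm cm \<and> ARR2 14 ({..d} \<times> {..<r}) lz cm \<and> nm (adr 5 0) = d \<and> ARR 16 {..d} gg cm \<and> ARR 24 {..<r} (top (lz d)) cm"
  have 4: "dtr f M (CAssign (nA 17 (nS 5)) (CDiv (cR 17 (nS 5)) (cR 16 (nS 5)))) 40 nm cm
     (\<lambda>nm cm. ?C nm cm \<and> ARR 17 {1..<Suc d} al cm \<and> ARR 18 {1..<d} be cm)"
    if P: "?B nm cm \<and> ARR 24 {..<r} (top (lz d)) cm \<and> cm (adr 17 d) = ip r (top (lz d)) (lz d)" for nm cm
  proof -
    have v: "cm (adr 16 d) = gg d" using P by (auto simp: ARR_D)
    have "ARR 17 {1..<Suc d} al (cm(adr 17 d := al d))" unfolding ins(1) by (rule ARR_insert) (use P in auto)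
    then show ?thesis
      by (intro dtr_cost[OF dtr_CAssign]) (use P v in \<open>simp_all add: al_def[of d]\<close>)
  qed
  have 5: "dtr f M (CAssign (nA 18 (nS 5)) (CDiv (cR 16 (nS 5)) (cR 16 (NSub (nS 5) (NConst 1))))) 50 nm cm
     (\<lambda>nm cm. ?C nm cm \<and> ARR 17 {1..<Suc d} al cm \<and> ARR 18 {1..<Suc d} be cm)"
    if P: "?C nm cm \<and> ARR 17 {1..<Suc d} al cm \<and> ARR 18 {1..<d} be cm" for nm cm
  proof -
    have v: "cm (adr 16 d) = gg d" "cm (adr 16 (d - Suc 0)) = gg (d - Suc 0)" using P by (auto simp: ARR_D)
    have "ARR 18 {1..<Suc d} be (cm(adr 18 d := be d))" unfolding ins(1) by (rule ARR_insert) (use P in auto)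
    then show ?thesis
      by (intro dtr_cost[OF dtr_CAssign]) (use P v in \<open>simp_all add: be_def[of d]\<close>)
  qed
  have 6: "dtr f M nextC (347 * (rr * rr)) nm cm (\<lambda>nm cm. ENV nm cm \<and> ARR2 14 ({..Suc d} \<times> {..<r}) lz cm \<and> nm (adr 5 0) = d \<and>
     ARR 16 {..d} gg cm \<and> ARR 17 {1..<Suc d} al cm \<and> ARR 18 {1..<Suc d} be cm)"
    if "?C nm cm \<and> ARR 17 {1..<Suc d} al cm \<and> ARR 18 {1..<Suc d} be cm" for nm cm
    by (rule nextC[OF d]) (use that in auto)
  have 7: "dtr f M (Seq (NAssign (nL 5) (NAdd (nS 5) (NConst 1))) normC) (330 * rr) nm cm (LZ (Suc d))"
    if P: "ENV nm cm \<and> ARR2 14 ({..Suc d} \<times> {..<r}) lz cm \<and> nm (adr 5 0) = d \<and>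
       ARR 16 {..d} gg cm \<and> ARR 17 {1..<Suc d} al cm \<and> ARR 18 {1..<Suc d} be cm" for nm cm
  proof -
    have "ARR 16 {..Suc d} gg (cm(adr 16 (Suc d) := gg (Suc d)))" unfolding ins(2) by (rule ARR_insert) (use P in auto)
    then have Q: "LZ (Suc d) (nm(adr 5 0 := Suc d, adr 3 0 := r)) (cm(adr 16 (Suc d) := gg (Suc d)))"
      using P by (simp add: LZ_def)
    show ?thesis
      by (rule dtr_cost, rule dtr_Seq, rule dtr_NAssign, rule normC[where d = "Suc d"]) (use P Q rr in simp_all)
  qed
  show ?thesis
    unfolding stepC_def
    by (rule dtr_cost, rule dtr_then[OF 1], rule dtr_then[OF 2], assumption, rule dtr_then[OF 3], simp, rule dtr_then[OF 4], assumption,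
        rule dtr_then[OF 5], assumption, rule dtr_then[OF 6], assumption, erule 7, insert rr, linarith)
qed

text \<open>The bound \<open>dmax\<close> on the number of nonzero Lanczos vectors enters as a
  hypothesis, to be supplied by a rank argument. The loop ends at the first index \<open>K\<close>
  whose vector vanishes, and this vanishing closes the Krylov space.\<close>

lemma lanczosC:
  assumes E: "ENV nm cm" and fin: "\<And>d. (\<And>k. 1 \<le> k \<Longrightarrow> k \<le> d \<Longrightarrow> nsq r (lz k) \<noteq> 0) \<Longrightarrow> d \<le> dmax"
  shows "dtr f M lanczosC (4000 * (rr * rr * (real dmax + 1))) nm cm
    (\<lambda>nm cm. \<exists>K\<ge>1. K \<le> Suc dmax \<and> nsq r (lz K) = 0 \<and> LZ K nm cm)"
proof -
  let ?J = "\<lambda>a nm cm. nm (adr 3 0) = a \<and> ENV nm cm \<and> ARR2 14 ({..1} \<times> {..<a}) lz cm"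
  have "dtr f M (For 3 (nS 2) (Seq (CAssign (nA 14 (pE (NConst 0) (nS 3))) (COfNat (NConst 0)))
        (CAssign (nA 14 (pE (NConst 1) (nS 3))) (cR 11 (nS 3))))) (rr * (300 * 1 + 21 + ncost (nS 2)) + 14 + ncost (nS 2)) nm cm (?J r)"
  proof (rule dtr_For[where n = r and I = "?J"])
    fix a nm cm assume a: "a < r" and J: "?J a nm cm"
    have v: "cm (adr 11 a) = bh a" using J a by (auto simp: ENV_D)
    have S: "ARR2 14 ({..1} \<times> {..<Suc a}) lz (cm(adr 14 (pr 0 a) := 0, adr 14 (pr (Suc 0) a) := bh a))"
      using J unfolding ARR2_def by (auto simp: less_Suc_eq le_Suc_eq)
    show "dtr f M (Seq (CAssign (nA 14 (pE (NConst 0) (nS 3))) (COfNat (NConst 0)))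
        (CAssign (nA 14 (pE (NConst 1) (nS 3))) (cR 11 (nS 3)))) (300 * 1) nm cm (\<lambda>nm' cm'. nm' (adr 3 0) = a \<and> ?J (Suc a) (nm'(adr 3 0 := Suc a)) cm')"
      by (rule dtr_cost, rule dtr_Seq, rule dtr_CAssign, rule dtr_CAssign) (use J v S in simp_all)
  qed (use E in \<open>auto simp: ENV_D ARR2_def\<close>)
  then have 1: "dtr f M (For 3 (nS 2) (Seq (CAssign (nA 14 (pE (NConst 0) (nS 3))) (COfNat (NConst 0)))
        (CAssign (nA 14 (pE (NConst 1) (nS 3))) (cR 11 (nS 3))))) (400 * rr) nm cm (?J r)"
    by (rule dtr_cost) (use rr in simp)
  have 2: "dtr f M (Seq (CAssign (nL 16) (COfNat (NConst 0))) (Seq (NAssign (nL 5) (NConst 1)) normC)) (400 * rr) nm cm (LZ 1)"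
    if P: "?J r nm cm" for nm cm
  proof -
    have "gg 0 = 0" by (simp add: gg_def ip_def)
    then have "ARR 16 {..1} gg (cm(adr 16 0 := 0, adr 16 1 := gg 1))" by (auto simp: ARR_def le_Suc_eq)
    then have Q: "LZ 1 (nm(adr 5 0 := 1, adr 3 0 := r)) (cm(adr 16 0 := 0, adr 16 1 := gg 1))"
      using P by (simp add: LZ_def)
    show ?thesis
      by (rule dtr_cost, rule dtr_Seq, rule dtr_CAssign, rule dtr_Seq, rule dtr_NAssign, rule normC[where d = 1]) (use P Q rr in simp_all)
  qed
  let ?g = "BReLess (COfNat (NConst 0)) (cR 16 (nS 5))"
  \<comment> \<open>Round \<open>k\<close> starts with vectors computed up to index
    \<open>Suc k\<close> and nonzero before it; a true guard adds the last one, and then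
    \<open>fin\<close> gives \<open>Suc k \<le> dmax\<close>.\<close>
  let ?I = "\<lambda>k nm cm. LZ (Suc k) nm cm \<and> (\<forall>k'. 1 \<le> k' \<and> k' \<le> k \<longrightarrow> nsq r (lz k') \<noteq> 0)"
  have 3: "dtr f M (While ?g stepC) (real dmax * (bcost ?g + 2200 * (rr * rr)) + bcost ?g) nm cm
     (\<lambda>nm cm. \<exists>K\<ge>1. K \<le> Suc dmax \<and> nsq r (lz K) = 0 \<and> LZ K nm cm)" if "LZ 1 nm cm" for nm cm
  proof (rule dtr_While[where I = "?I"])
    show "?I 0 nm cm" using that by simp
    show "0 \<le> 2200 * (rr * rr)" by simp
    have guard: "bv f nm cm ?g \<longleftrightarrow> nsq r (lz (Suc k)) \<noteq> 0" if "LZ (Suc k) nm cm" for k nm cm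
    proof -
      have "nm (adr 5 0) = Suc k" "cm (adr 16 (Suc k)) = complex_of_real (nsq r (lz (Suc k)))"
        using that by (auto simp: LZ_def ARR_D gg_def ip_self)
      then show ?thesis using nsq_nonneg[of r "lz (Suc k)"] by (auto simp: less_le)
    qed
    show "k < dmax \<and> dtr f M stepC (2200 * (rr * rr)) nm cm (?I (Suc k))" if I: "?I k nm cm" and g: "bv f nm cm ?g" for k nm cm
    proof -
      have nz: "nsq r (lz k') \<noteq> 0" if "1 \<le> k'" "k' \<le> Suc k" for k'
        using I g guard[of k nm cm] that by (cases "k' = Suc k") auto
      then have "Suc k \<le> dmax" by (intro fin) auto
      moreover have "dtr f M stepC (2200 * (rr * rr)) nm cm (?I (Suc k))"
        by (rule dtr_weaken[OF stepC[where d = "Suc k"] _ order.refl]) (use I nz in auto)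
      ultimately show ?thesis by simp
    qed
    show "\<exists>K\<ge>1. K \<le> Suc dmax \<and> nsq r (lz K) = 0 \<and> LZ K nm cm" if "?I k nm cm" "k \<le> dmax" "\<not> bv f nm cm ?g" for k nm cm
      using that guard[of k nm cm] by (intro exI[of _ "Suc k"]) auto
  qed
  have c: "400 * rr + (400 * rr + (real dmax * (bcost ?g + 2200 * (rr * rr)) + bcost ?g)) \<le> 4000 * (rr * rr * (real dmax + 1))"
  proof -
    have "bcost ?g * 1 \<le> bcost ?g * (rr * rr)" by (rule mult_left_mono[OF rr(3)]) simp
    then have "real dmax * (bcost ?g + 2200 * (rr * rr)) \<le> real dmax * (2250 * (rr * rr))"
      by (intro mult_left_mono) simp_all
    then show ?thesis using rr(2,3) by (simp add: algebra_simps)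
  qed
  show ?thesis unfolding lanczosC_def
    by (rule dtr_cost[OF dtr_then[OF 1 dtr_then[OF 2 3]] c])
qed

end

section \<open>Sample size, Bernstein heights and the de Casteljau table\<close>

text \<open>The braces of the sample bound, called \<open>G\<close> in the analysis.
  \<open>sizeC\<close> then evaluates to \<open>128 \<Theta> / \<eta>\<close>, and its square is the
  real number whose ceiling is the sample size.\<close>

definition paramC :: cexp where "paramC =
  CAdd (CDiv (cS 6) (cS 7)) (CMul (CMul (CMul (COfNat (NConst 3)) (CSqrt (COfNat (NConst 2)))) (CDiv (cS 5) (cS 7))) (CDiv (cS 4) (cS 3)))"

definition sizeC :: cexp where "sizeC =
  CDiv (CMul (COfNat (NConst 128)) (CDiv (CMul (CMul (cS 4) (cS 4)) (CMul paramC (cS 8))) (CMul (CMul (cS 3) (cS 1)) (cS 2)))) (cS 0)"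

text \<open>Without a rounding operation, the ceiling is found by counting up with one comparison
  per step, at a cost linear in the sample size.\<close>

definition prepC :: com where "prepC =
  Seq (GetFrob SrcMat (nL 8)) (Seq (CAssign (nL 9) (CMul sizeC sizeC)) (Seq (NAssign (nL 2) (NConst 0))
    (While (BReLess (COfNat (nS 2)) (cS 9)) (NAssign (nL 2) (NAdd (nS 2) (NConst 1))))))"

text \<open>The value of \<open>ramp\<close> at the grid point numbered by counter 3. It goes to
  column 1 of the table because the start vector is the Lanczos vector with index 1.\<close>

definition heightC :: com where "heightC =
  Seq (CAssign (nL 26) (CDiv (CMul (cS 8) (COfNat (nS 3))) (COfNat (nS 2))))
  (Seq (CAssign (nL 27) (cS 26))
  (Seq (If (BReLess (CAdd (CMul (cS 3) (cS 3)) (cS 25)) (cS 27)) (CAssign (nL 27) (CAdd (CMul (cS 3) (cS 3)) (cS 25))) Skip)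
  (Seq (If (BReLess (cS 27) (cS 25)) (CAssign (nL 27) (cS 25)) Skip)
  (Seq (CAssign (nL 28) (CSqrt (cS 27)))
  (Seq (CAssign (nL 29) (CDiv (CFun (cS 28)) (cS 28)))
  (Seq (CAssign (nL 30) (CDiv (cS 26) (cS 25)))
  (Seq (If (BReLess (COfNat (NConst 1)) (cS 30)) (CAssign (nL 30) (COfNat (NConst 1))) Skip)
  (CAssign (nA 19 (pE (nS 3) (NConst 1))) (CMul (cS 29) (cS 30)))))))))) "

definition initC :: com where "initC =
  Seq (CAssign (nL 25) (CDiv (CMul (cS 3) (cS 3)) (CMul (COfNat (NConst 2)) (CMul (cS 4) (cS 4)))))
  (For 3 (NAdd (nS 2) (NConst 1))
    (Seq (For 4 (nS 5) (CAssign (nA 19 (pE (nS 3) (nS 4))) (COfNat (NConst 0)))) heightC))"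

definition diffC :: com where "diffC = For 4 (nS 5)
  (CAssign (nA 20 (nS 4)) (CSub (cR 19 (pE (NAdd (nS 3) (NConst 1)) (nS 4))) (cR 19 (pE (nS 3) (nS 4)))))"

definition addC :: com where "addC = For 4 (NSub (nS 5) (NConst 1))
  (CAssign (nA 19 (pE (nS 3) (NAdd (nS 4) (NConst 1))))
    (CAdd (cR 19 (pE (nS 3) (NAdd (nS 4) (NConst 1))))
      (CAdd (CAdd (CMul (cR 17 (NAdd (nS 4) (NConst 1))) (cR 20 (NAdd (nS 4) (NConst 1)))) (cR 20 (nS 4)))
         (CMul (cR 18 (NAdd (nS 4) (NConst 2))) (cR 20 (NAdd (nS 4) (NConst 2)))))))"

text \<open>Cell \<open>K\<close> of array 20 is cleared once. When the last coefficient is updated,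
  \<open>addC\<close> reads this cell as the coefficient after it, next to an entry of array 18 of
  which nothing is known; the product is then 0.\<close>

definition roundsC :: com where "roundsC =
  Seq (CAssign (nA 20 (nS 5)) (COfNat (NConst 0)))
  (For 6 (nS 2) (For 3 (NSub (nS 2) (nS 6)) (Seq diffC addC)))"

definition outC :: com where "outC =
  Seq (For 3 (nS 2) (Acc 4 (nS 5) (nA 21 (nS 3)) (CMul (cR 19 (pE (NConst 0) (nS 4))) (cR 14 (pE (nS 4) (nS 3))))))
    (Acc 3 (nS 2) (nL 22) (CMul (cR 21 (nS 3)) (CConj (cR 21 (nS 3)))))"

lemma normsC:
  assumes E: "NE r i j nm" "INP x cm" "ARR 10 {..<r} t cm" "ARR 11 {..<r} bh cm" "ARR2 12 ({..<r} \<times> {..<r}) Mh cm" and r: "1 \<le> r"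
  shows "dtr f M normsC (347 * (real r * real r)) nm cm (memory_env.ENV r i j x t bh Mh (\<lambda>l. \<Sum>k<r. Mh k l * cnj (Mh k l)))"
proof -
  let ?nn = "\<lambda>l. \<Sum>k<r. Mh k l * cnj (Mh k l)"
  interpret memory_env r i j x t bh Mh ?nn f M by unfold_locales (rule r)
  let ?J = "\<lambda>l nm cm. nm (adr 4 0) = l \<and> NE r i j nm \<and> INP x cm \<and> ARR 10 {..<r} t cm \<and> ARR 11 {..<r} bh cm \<and>
     ARR2 12 ({..<r} \<times> {..<r}) Mh cm \<and> ARR 13 {..<l} ?nn cm"
  show ?thesis unfolding normsC_def
  proof (rule dtr_For_bound[where n = r and I = "?J" and c = "300 * rr" and C = 300])
    fix l nm cm assume l: "l < r" and J: "?J l nm cm"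
    have v: "\<And>k. k < r \<Longrightarrow> cm (adr 12 (pr k l)) = Mh k l" "nm (adr 2 0) = r" using J l by (auto simp: ARR2_D NE_D)
    show "dtr f M (Acc 3 (nS 2) (nA 13 (nS 4)) (CMul (cR 12 (pE (nS 3) (nS 4))) (CConj (cR 12 (pE (nS 3) (nS 4)))))) (300 * rr) nm cm
       (\<lambda>nm' cm'. nm' (adr 4 0) = l \<and> ?J (Suc l) (nm'(adr 4 0 := Suc l)) cm')"
      apply (rule dtr_cost, rule dtr_Acc[where x = "adr 13 l" and n = r and g = "\<lambda>k. Mh k l * cnj (Mh k l)"])
           apply (use J v l in simp_all)[4]
       apply (use J v l in \<open>simp add: ARR_Suc ARR_outside\<close>)
      apply (use rr in simp)
      done
  qed (use E rr(1) in \<open>auto simp: NE_D ENV_def\<close>)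
qed

lemma prepC:
  assumes r0: "0 < r0" and INP: "\<forall>g<8. cm (adr g 0) = x g" "x 8 = complex_of_real ((frob_norm (M SrcMat))\<^sup>2)" "x 9 = complex_of_real r0"
    and R: "\<And>nm. cv f nm (cm(adr 8 0 := x 8)) (CMul sizeC sizeC) = complex_of_real r0"
  shows "dtr f M prepC (2000 * real (nat \<lceil>r0\<rceil>)) nm cm (\<lambda>nm' cm'. nm' (adr 2 0) = nat \<lceil>r0\<rceil> \<and> INP x cm')"
proof -
  let ?r = "nat \<lceil>r0\<rceil>" and ?g = "BReLess (COfNat (nS 2)) (cS 9)"
  have r1: "1 \<le> real ?r" using r0 by (simp add: le_nat_iff)
  have W: "dtr f M (While ?g (NAssign (nL 2) (NAdd (nS 2) (NConst 1)))) (real ?r * (bcost ?g + 20) + bcost ?g) nm cm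
     (\<lambda>nm' cm'. nm' (adr 2 0) = ?r \<and> INP x cm')" if "nm (adr 2 0) = 0" "INP x cm" for nm cm
  proof (rule dtr_While[where I = "\<lambda>k nm cm. nm (adr 2 0) = k \<and> INP x cm"])
    fix k and nm :: "nat \<Rightarrow> nat" and cm assume I: "nm (adr 2 0) = k \<and> INP x cm"
    then have g: "bv f nm cm ?g \<longleftrightarrow> real k < r0" using INP(3) INP_D[of x cm 9] by simp
    show "k < ?r \<and> dtr f M (NAssign (nL 2) (NAdd (nS 2) (NConst 1))) 20 nm cm (\<lambda>nm cm. nm (adr 2 0) = Suc k \<and> INP x cm)" if "bv f nm cm ?g"
    proof
      have "real k < r0" using g that by simp
      then show "k < ?r" by linarith
      show "dtr f M (NAssign (nL 2) (NAdd (nS 2) (NConst 1))) 20 nm cm (\<lambda>nm cm. nm (adr 2 0) = Suc k \<and> INP x cm)"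
        by (rule dtr_cost, rule dtr_NAssign) (use I in simp_all)
    qed
    show "nm (adr 2 0) = ?r \<and> INP x cm" if "k \<le> ?r" "\<not> bv f nm cm ?g"
      using that g I by (auto intro!: antisym)
  qed (use that in simp_all)
  show ?thesis unfolding prepC_def
    apply (rule dtr_cost, rule dtr_Seq, rule dtr_GetFrob)
     apply (rule dtr_Seq, rule dtr_CAssign)
     apply (rule dtr_Seq, rule dtr_NAssign)
     apply (rule W)
      apply simp
     apply (use R[unfolded INP(2)] INP in \<open>auto simp: INP_def less_Suc_eq numeral_eq_Suc\<close>)[1]
    apply (use r1 in \<open>simp add: sizeC_def paramC_def\<close>)
    done
qed

context memory_env
begin

lemma LZ_nm [simp]: "g < 64 \<Longrightarrow> g \<notin> {2, 5, 8, 9} \<Longrightarrow> LZ K (nm(adr g k := v)) cm = LZ K nm cm"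
  by (simp add: LZ_def)

lemma LZ_cm [simp]: "19 \<le> g \<Longrightarrow> g < 64 \<Longrightarrow> LZ K nm (cm(adr g k := v)) = LZ K nm cm"
  by (simp add: LZ_def)

lemma LZ_D:
  "LZ K nm cm \<Longrightarrow> nm (adr 2 0) = r" "LZ K nm cm \<Longrightarrow> nm (adr 5 0) = K" "LZ K nm cm \<Longrightarrow> ENV nm cm"
  "LZ K nm cm \<Longrightarrow> k \<le> K \<Longrightarrow> a < r \<Longrightarrow> cm (adr 14 (pr k a)) = lz k a"
  "LZ K nm cm \<Longrightarrow> 1 \<le> k \<Longrightarrow> k < K \<Longrightarrow> cm (adr 17 k) = al k" "LZ K nm cm \<Longrightarrow> 1 \<le> k \<Longrightarrow> k < K \<Longrightarrow> cm (adr 18 k) = be k"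
  by (auto simp: LZ_def ENV_D ARR_D ARR2_D)

text \<open>Matrix of \<open>top\<close> in the basis \<open>lz 1, ..., lz (K - 1)\<close>, read off
  from the recurrence: column \<open>k\<close> has 1 below the diagonal, \<open>al k\<close> on it
  and \<open>be k\<close> above it. Index 0 belongs to the zero vector and stays empty.\<close>

definition tri :: "nat \<Rightarrow> (nat \<Rightarrow> complex) \<Rightarrow> nat \<Rightarrow> complex" where
  "tri K c k = (if 1 \<le> k \<and> k < K then al k * c k + (if 2 \<le> k then c (k - 1) else 0) + (if Suc k < K then be (Suc k) * c (Suc k) else 0) else 0)"

definition e1 :: "nat \<Rightarrow> complex" where "e1 = (\<lambda>k. if k = 1 then 1 else 0)"
abbreviation "cs K h jj ii \<equiv> castel (tri K) h jj ii e1"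

lemma cs_0: "cs K h jj ii 0 = 0"
  by (induction jj arbitrary: ii) (simp_all add: tri_def e1_def)

lemma csqrt_of_nonneg: "0 \<le> z \<Longrightarrow> csqrt (complex_of_real z) = complex_of_real (sqrt z)"
  by simp

text \<open>The three conditionals of the program are the minimum with the upper end, the maximum
  with the lower end, and the cut-off factor of \<open>ramp\<close>.\<close>

lemma initC:
  assumes L: "LZ K nm cm" and K: "1 \<le> K" and x: "x 3 = complex_of_real N" "x 4 = complex_of_real \<kappa>" "x 8 = complex_of_real F2"
    and s2: "s2 = N * N / (2 * (\<kappa> * \<kappa>))" "0 < s2"
    and f: "\<And>z. 0 \<le> z \<Longrightarrow> f z \<ge> 0"
  defines "h \<equiv> \<lambda>i. ramp f s2 (N * N + s2) (F2 * real i / rr)"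
  shows "dtr f M initC (2300 * (rr * real K)) nm cm (\<lambda>nm cm. LZ K nm cm \<and> ARR2 19 ({..r} \<times> {..<K}) (cs K h 0) cm)"
proof -
  have K1: "1 \<le> real K" using K by simp
  let ?J = "\<lambda>a nm cm. nm (adr 3 0) = a \<and> LZ K nm cm \<and> cm (adr 25 0) = of_real s2 \<and> ARR2 19 ({..<a} \<times> {..<K}) (cs K h 0) cm"
  let ?Z = "For 4 (nS 5) (CAssign (nA 19 (pE (nS 3) (nS 4))) (COfNat (NConst 0)))"
  have Z: "dtr f M ?Z (147 * (real K * 1)) nm cm (\<lambda>nm cm. ?J a nm cm \<and> ARR2 19 ({a} \<times> {..<K}) (\<lambda>_ _. 0) cm)"
    if J: "?J a nm cm" for a nm cm
  proof (rule dtr_For_bound[where n = K and I = "\<lambda>k nm cm. nm (adr 4 0) = k \<and> ?J a nm cm \<and> ARR2 19 ({a} \<times> {..<k}) (\<lambda>_ _. 0) cm" and c = 100 and C = 100])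
    fix k nm cm assume k: "k < K" and I: "nm (adr 4 0) = k \<and> ?J a nm cm \<and> ARR2 19 ({a} \<times> {..<k}) (\<lambda>_ _. 0) cm"
    have "ARR2 19 ({..<a} \<times> {..<K}) (cs K h 0) (cm(adr 19 (pr a k) := 0))" "ARR2 19 ({a} \<times> {..<Suc k}) (\<lambda>_ _. 0) (cm(adr 19 (pr a k) := 0))"
      using I by (auto simp: ARR2_def less_Suc_eq)
    then show "dtr f M (CAssign (nA 19 (pE (nS 3) (nS 4))) (COfNat (NConst 0))) 100 nm cm
      (\<lambda>nm' cm'. nm' (adr 4 0) = k \<and> (nm'(adr 4 0 := Suc k)) (adr 4 0) = Suc k \<and> ?J a (nm'(adr 4 0 := Suc k)) cm' \<and> ARR2 19 ({a} \<times> {..<Suc k}) (\<lambda>_ _. 0) cm')"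
      by (intro dtr_cost[OF dtr_CAssign]) (use I in simp_all)
  qed (use J K1 in \<open>auto simp: LZ_D ARR2_def\<close>)
  have H: "dtr f M heightC 800 nm cm (\<lambda>nm' cm'. nm' (adr 3 0) = a \<and> ?J (Suc a) (nm'(adr 3 0 := Suc a)) cm')"
    if J: "?J a nm cm \<and> ARR2 19 ({a} \<times> {..<K}) (\<lambda>_ _. 0) cm" for a nm cm
  proof -
    have v: "cm (adr 3 0) = of_real N" "cm (adr 8 0) = of_real F2" "nm (adr 2 0) = r" "nm (adr 3 0) = a" "cm (adr 25 0) = of_real s2"
      using J x by (auto simp: LZ_D ENV_D(2)[OF LZ_D(3)])
    define X where "X = F2 * real a / rr"
    let ?b = "N * N + s2"
    define Y where "Y = clip s2 ?b X"
    have Y0: "0 < Y" using s2 by (simp add: Y_def clip_def less_max_iff_disj)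
    have X: "complex_of_real F2 * of_nat a / of_nat r = of_real X" by (simp add: X_def)
    have S: "csqrt (of_real Y) = of_real (sqrt Y)" using Y0 by (intro csqrt_of_nonneg) simp
    have ha: "h a = f (sqrt Y) / sqrt Y * min 1 (X / s2)" by (simp add: h_def ramp_def Y_def X_def)
    have c1: "?b < X \<Longrightarrow> min X ?b = ?b" "\<not> ?b < X \<Longrightarrow> min X ?b = X" by auto
    have c2: "min X ?b < s2 \<Longrightarrow> Y = s2" "\<not> min X ?b < s2 \<Longrightarrow> Y = min X ?b"
      using zero_le_square[of N] by (auto simp: Y_def clip_def max_def min_def split: if_splits)
    have c3: "1 < X / s2 \<Longrightarrow> min 1 (X / s2) = 1" "\<not> 1 < X / s2 \<Longrightarrow> min 1 (X / s2) = X / s2" by auto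
    have Q: "?J (Suc a) (nm(adr 3 0 := Suc a)) (cm'(adr 19 (pr a (Suc 0)) := of_real (h a)))"
      if "LZ K nm cm'" "cm' (adr 25 0) = of_real s2" "ARR2 19 ({..<a} \<times> {..<K}) (cs K h 0) cm'" "ARR2 19 ({a} \<times> {..<K}) (\<lambda>_ _. 0) cm'" for cm'
      using that by (auto simp: ARR2_def less_Suc_eq e1_def)
    let ?P = "\<lambda>nm' cm'. nm' = nm \<and> LZ K nm cm' \<and> cm' (adr 25 0) = of_real s2 \<and> ARR2 19 ({..<a} \<times> {..<K}) (cs K h 0) cm' \<and> ARR2 19 ({a} \<times> {..<K}) (\<lambda>_ _. 0) cm' \<and> cm' (adr 3 0) = of_real N \<and> cm' (adr 26 0) = of_real X"
    let ?b' = "CAdd (CMul (cS 3) (cS 3)) (cS 25)"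
    have 1: "dtr f M (CAssign (nL 26) (CDiv (CMul (cS 8) (COfNat (nS 3))) (COfNat (nS 2)))) 50 nm cm ?P"
      by (rule dtr_cost, rule dtr_CAssign) (use J v X in simp_all)
    have 2: "dtr f M (CAssign (nL 27) (cS 26)) 20 nm' cm' (\<lambda>nm' cm'. ?P nm' cm' \<and> cm' (adr 27 0) = of_real X)"
      if "?P nm' cm'" for nm' cm'
      by (rule dtr_cost, rule dtr_CAssign) (use that in simp_all)
    have 3: "dtr f M (If (BReLess ?b' (cS 27)) (CAssign (nL 27) ?b') Skip) 60 nm' cm' (\<lambda>nm' cm'. ?P nm' cm' \<and> cm' (adr 27 0) = of_real (min X ?b))"
      if "?P nm' cm' \<and> cm' (adr 27 0) = of_real X" for nm' cm'
      by (rule dtr_cost, rule dtr_If, rule dtr_CAssign) (use that c1 in \<open>auto intro!: dtr_Skip\<close>)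
    have 4: "dtr f M (If (BReLess (cS 27) (cS 25)) (CAssign (nL 27) (cS 25)) Skip) 60 nm' cm' (\<lambda>nm' cm'. ?P nm' cm' \<and> cm' (adr 27 0) = of_real Y)"
      if "?P nm' cm' \<and> cm' (adr 27 0) = of_real (min X ?b)" for nm' cm'
      by (rule dtr_cost, rule dtr_If, rule dtr_CAssign) (use that c2 in \<open>auto intro!: dtr_Skip\<close>)
    have 5: "dtr f M (CAssign (nL 28) (CSqrt (cS 27))) 20 nm' cm' (\<lambda>nm' cm'. ?P nm' cm' \<and> cm' (adr 28 0) = of_real (sqrt Y))"
      if "?P nm' cm' \<and> cm' (adr 27 0) = of_real Y" for nm' cm'
      by (rule dtr_cost, rule dtr_CAssign) (use that S in simp_all)
    have 6: "dtr f M (CAssign (nL 29) (CDiv (CFun (cS 28)) (cS 28))) 30 nm' cm' (\<lambda>nm' cm'. ?P nm' cm' \<and> cm' (adr 29 0) = of_real (f (sqrt Y) / sqrt Y))"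
      if "?P nm' cm' \<and> cm' (adr 28 0) = of_real (sqrt Y)" for nm' cm'
      by (rule dtr_cost, rule dtr_CAssign) (use that Y0 in simp_all)
    have 7: "dtr f M (CAssign (nL 30) (CDiv (cS 26) (cS 25))) 30 nm' cm' (\<lambda>nm' cm'. ?P nm' cm' \<and> cm' (adr 29 0) = of_real (f (sqrt Y) / sqrt Y) \<and> cm' (adr 30 0) = of_real (X / s2))"
      if "?P nm' cm' \<and> cm' (adr 29 0) = of_real (f (sqrt Y) / sqrt Y)" for nm' cm'
      by (rule dtr_cost, rule dtr_CAssign) (use that in simp_all)
    have 8: "dtr f M (If (BReLess (COfNat (NConst 1)) (cS 30)) (CAssign (nL 30) (COfNat (NConst 1))) Skip) 60 nm' cm'
       (\<lambda>nm' cm'. ?P nm' cm' \<and> cm' (adr 29 0) = of_real (f (sqrt Y) / sqrt Y) \<and> cm' (adr 30 0) = of_real (min 1 (X / s2)))"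
      if I: "?P nm' cm' \<and> cm' (adr 29 0) = of_real (f (sqrt Y) / sqrt Y) \<and> cm' (adr 30 0) = of_real (X / s2)" for nm' cm'
    proof -
      have g: "bv f nm' cm' (BReLess (COfNat (NConst 1)) (cS 30)) \<longleftrightarrow> 1 < X / s2"
        using I by (simp del: of_real_divide)
      show ?thesis
        by (rule dtr_cost, rule dtr_If, rule dtr_CAssign) (use I g c3 in \<open>auto intro!: dtr_Skip simp del: of_real_divide bv.simps\<close>)
    qed
    have 9: "dtr f M (CAssign (nA 19 (pE (nS 3) (NConst 1))) (CMul (cS 29) (cS 30))) 60 nm' cm'
       (\<lambda>nm' cm'. nm' (adr 3 0) = a \<and> ?J (Suc a) (nm'(adr 3 0 := Suc a)) cm')"
      if I: "?P nm' cm' \<and> cm' (adr 29 0) = of_real (f (sqrt Y) / sqrt Y) \<and> cm' (adr 30 0) = of_real (min 1 (X / s2))" for nm' cm'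
    proof -
      have e: "cm' (adr 29 0) * cm' (adr 30 0) = of_real (h a)" using I unfolding ha by (simp only: of_real_mult)
      show ?thesis by (rule dtr_cost, rule dtr_CAssign) (use I Q[of cm'] v e in simp_all)
    qed
    show ?thesis unfolding heightC_def
      by (rule dtr_cost, rule dtr_then[OF 1], rule dtr_then[OF 2], assumption, rule dtr_then[OF 3], assumption, rule dtr_then[OF 4], assumption,
          rule dtr_then[OF 5], assumption, rule dtr_then[OF 6], assumption, rule dtr_then[OF 7], assumption, rule dtr_then[OF 8], assumption, erule 9, simp)
  qed
  have loop: "dtr f M (For 3 (NAdd (nS 2) (NConst 1)) (Seq ?Z heightC)) ((1100) * (2 * rr * real K)) nm cm (\<lambda>nm cm. LZ K nm cm \<and> ARR2 19 ({..r} \<times> {..<K}) (cs K h 0) cm)"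
    if "?J 0 (nm(adr 3 0 := 0)) cm" for nm cm
  proof (rule dtr_For_bound[where n = "Suc r" and I = "?J" and c = "147 * (real K * 1) + 800" and C = 947])
    show "dtr f M (Seq ?Z heightC) (147 * (real K * 1) + 800) nm cm (\<lambda>nm' cm'. nm' (adr 3 0) = a \<and> ?J (Suc a) (nm'(adr 3 0 := Suc a)) cm')"
      if "?J a nm cm" for a nm cm
      by (rule dtr_then[OF Z[OF that] H])
    show "147 * (real K * 1) + 800 \<le> 947 * real K" using K1 by simp
  qed (use that rr(1) K1 in \<open>auto simp: LZ_D lessThan_Suc_atMost\<close>)
  show ?thesis unfolding initC_def
  proof (rule dtr_cost, rule dtr_Seq, rule dtr_CAssign, rule loop)
    have "1 \<le> rr * real K" using mult_mono[of 1 rr 1 "real K"] rr(1) K1 by simp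
    then show "1 + ncost (nL 25) + ccost (CDiv (CMul (cS 3) (cS 3)) (CMul (COfNat (NConst 2)) (CMul (cS 4) (cS 4)))) + 1100 * (2 * rr * real K) \<le> 2300 * (rr * real K)"
      by (simp add: mult.commute[of "real K"])
  qed (use L x s2 in \<open>auto simp: ENV_D(2)[OF LZ_D(3)] ARR2_def\<close>)
qed

lemma diffC:
  assumes P: "LZ K nm cm" "nm (adr 3 0) = a" "nm (adr 6 0) = jj" "ARR2 19 S c cm" "cm (adr 20 K) = 0"
    and S: "\<And>k. k < K \<Longrightarrow> (a, k) \<in> S \<and> (Suc a, k) \<in> S" and K: "1 \<le> K"
  shows "dtr f M diffC (247 * (real K * 1)) nm cm (\<lambda>nm cm. LZ K nm cm \<and> nm (adr 3 0) = a \<and> nm (adr 6 0) = jj \<and>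
     ARR2 19 S c cm \<and> cm (adr 20 K) = 0 \<and> ARR 20 {..<K} (\<lambda>k. c (Suc a) k - c a k) cm)"
  unfolding diffC_def
proof (rule dtr_For_bound[where n = K and c = 200 and C = 200 and I = "\<lambda>k nm cm. nm (adr 4 0) = k \<and> LZ K nm cm \<and> nm (adr 3 0) = a \<and> nm (adr 6 0) = jj \<and>
     ARR2 19 S c cm \<and> cm (adr 20 K) = 0 \<and> ARR 20 {..<k} (\<lambda>k. c (Suc a) k - c a k) cm"])
  fix k nm cm assume k: "k < K" and I: "nm (adr 4 0) = k \<and> LZ K nm cm \<and> nm (adr 3 0) = a \<and> nm (adr 6 0) = jj \<and>
     ARR2 19 S c cm \<and> cm (adr 20 K) = 0 \<and> ARR 20 {..<k} (\<lambda>k. c (Suc a) k - c a k) cm"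
  have v: "cm (adr 19 (pr a k)) = c a k" "cm (adr 19 (pr (Suc a) k)) = c (Suc a) k" using I S[OF k] by (auto simp: ARR2_D)
  show "dtr f M (CAssign (nA 20 (nS 4)) (CSub (cR 19 (pE (NAdd (nS 3) (NConst 1)) (nS 4))) (cR 19 (pE (nS 3) (nS 4))))) 200 nm cm
    (\<lambda>nm' cm'. nm' (adr 4 0) = k \<and> (nm'(adr 4 0 := Suc k)) (adr 4 0) = Suc k \<and> LZ K (nm'(adr 4 0 := Suc k)) cm' \<and> (nm'(adr 4 0 := Suc k)) (adr 3 0) = a \<and> (nm'(adr 4 0 := Suc k)) (adr 6 0) = jj \<and>
     ARR2 19 S c cm' \<and> cm' (adr 20 K) = 0 \<and> ARR 20 {..<Suc k} (\<lambda>k. c (Suc a) k - c a k) cm')"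
    by (rule dtr_cost, rule dtr_CAssign) (use I v k in \<open>simp_all add: ARR_Suc\<close>)
qed (use P K in \<open>auto simp: LZ_D\<close>)

text \<open>Updating in place is sound because all differences were saved in array 20 beforehand: a
  new coefficient depends on its own old value and on nothing that this pass overwrites.\<close>

lemma addC:
  assumes P: "LZ K nm cm" "nm (adr 3 0) = a" "nm (adr 6 0) = jj" "cm (adr 20 K) = 0" "ARR 20 {..<K} e cm"
      "ARR2 19 S c cm" and e0: "e 0 = 0" and S: "\<And>k. k < K \<Longrightarrow> (a, k) \<in> S"
      and K: "1 \<le> K"
  shows "dtr f M addC (547 * (real K * 1)) nm cm (\<lambda>nm cm. LZ K nm cm \<and> nm (adr 3 0) = a \<and> nm (adr 6 0) = jj \<and> cm (adr 20 K) = 0 \<and>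
     ARR2 19 S (\<lambda>i' k. if i' = a \<and> 1 \<le> k \<and> k < K then c a k + tri K e k else c i' k) cm)"
  unfolding addC_def
proof -
  let ?c = "\<lambda>b i' k. if i' = a \<and> 1 \<le> k \<and> k < b then c a k + tri K e k else c i' k"
  let ?I = "\<lambda>k nm cm. nm (adr 4 0) = k \<and> LZ K nm cm \<and> nm (adr 3 0) = a \<and> nm (adr 6 0) = jj \<and> cm (adr 20 K) = 0 \<and> ARR 20 {..<K} e cm \<and>
     ARR2 19 S (?c (Suc k)) cm"
  let ?A = "CAssign (nA 19 (pE (nS 3) (NAdd (nS 4) (NConst 1))))
    (CAdd (cR 19 (pE (nS 3) (NAdd (nS 4) (NConst 1))))
      (CAdd (CAdd (CMul (cR 17 (NAdd (nS 4) (NConst 1))) (cR 20 (NAdd (nS 4) (NConst 1)))) (cR 20 (nS 4)))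
         (CMul (cR 18 (NAdd (nS 4) (NConst 2))) (cR 20 (NAdd (nS 4) (NConst 2))))))"
  show "dtr f M (For 4 (NSub (nS 5) (NConst 1)) ?A) (547 * (real K * 1)) nm cm (\<lambda>nm cm. LZ K nm cm \<and> nm (adr 3 0) = a \<and> nm (adr 6 0) = jj \<and> cm (adr 20 K) = 0 \<and>
     ARR2 19 S (?c K) cm)"
  proof (rule dtr_For_bound[where n = "K - 1" and c = 400 and C = 400 and I = ?I])
    fix k nm cm assume k: "k < K - 1" and I: "?I k nm cm"
    have sk: "(a, Suc k) \<in> S" using S k by auto
    have c: "cm (adr 19 (pr a (Suc k))) = c a (Suc k)" using I ARR2_D[of 19 S "?c (Suc k)" cm a "Suc k"] sk by simp
    have e: "cm (adr 20 k) = e k" "cm (adr 20 (Suc k)) = e (Suc k)" using I k by (auto simp: ARR_D)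
    have e2: "cm (adr 18 (Suc (Suc k))) * cm (adr 20 (Suc (Suc k))) = (if Suc (Suc k) < K then be (Suc (Suc k)) * e (Suc (Suc k)) else 0)"
    proof (cases "Suc (Suc k) < K")
      case True
      have L: "LZ K nm cm" and E: "ARR 20 {..<K} e cm" using I by blast+
      show ?thesis using LZ_D(6)[OF L _ True] ARR_D[OF E, of "Suc (Suc k)"] True by simp
    next
      case False
      then have "Suc (Suc k) = K" using k by simp
      then show ?thesis using I by simp
    qed
    have L: "LZ K nm cm" using I by blast
    have al: "cm (adr 17 (Suc k)) = al (Suc k)" using LZ_D(5)[OF L, of "Suc k"] k by simp
    \<comment> \<open>\<open>tri\<close> leaves out the neighbour with index 0, while the program
      always adds the lower neighbour; \<open>e 0 = 0\<close> reconciles them.\<close>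
    have t: "al (Suc k) * e (Suc k) + e k + (if Suc (Suc k) < K then be (Suc (Suc k)) * e (Suc (Suc k)) else 0) = tri K e (Suc k)"
      using k e0 by (cases k) (auto simp: tri_def)
    have A: "ARR2 19 S (?c (Suc (Suc k))) (cm(adr 19 (pr a (Suc k)) := c a (Suc k) + tri K e (Suc k)))"
      by (rule ARR2_update[of 19 S "?c (Suc k)"]) (use I k in \<open>auto simp: less_Suc_eq\<close>)
    show "dtr f M ?A 400 nm cm (\<lambda>nm' cm'. nm' (adr 4 0) = k \<and> ?I (Suc k) (nm'(adr 4 0 := Suc k)) cm')"
      by (rule dtr_cost, rule dtr_CAssign) (use I A c e al e2 t in simp_all)
  next
    have "ARR2 19 S (?c (Suc 0)) cm" using P(6) by (rule ARR2_mono) auto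
    then show "?I 0 (nm(adr 4 0 := 0)) cm" using P by simp
    fix nm cm assume I: "?I (K - 1) nm cm"
    moreover have "Suc (K - 1) = K" using K by simp
    ultimately show "LZ K nm cm \<and> nm (adr 3 0) = a \<and> nm (adr 6 0) = jj \<and> cm (adr 20 K) = 0 \<and> ARR2 19 S (?c K) cm" by simp
  qed (use K in \<open>auto simp: LZ_D\<close>)
qed

text \<open>The table is overwritten within a round: with counter \<open>a\<close>, rows below
  \<open>a\<close> already belong to level \<open>jj + 1\<close> and the others to level
  \<open>jj\<close>. Row \<open>a\<close> is computed from the old rows \<open>a\<close> and
  \<open>a + 1\<close>, so increasing order works, and each level has one row less.\<close>

lemma roundsC:
  assumes P: "LZ K nm cm" "ARR2 19 ({..r} \<times> {..<K}) (cs K h 0) cm" and K: "1 \<le> K"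
  shows "dtr f M roundsC (1000 * (rr * (rr * real K))) nm cm (\<lambda>nm cm. LZ K nm cm \<and> ARR2 19 ({0} \<times> {..<K}) (cs K h r) cm)"
proof -
  have K1: "1 \<le> real K" using K by simp
  have rK: "1 \<le> rr * real K" using mult_mono[of 1 rr 1 "real K"] rr(1) K1 by simp
  let ?S = "\<lambda>jj. {(i', k). i' + jj \<le> r \<and> k < K}"
  let ?O = "\<lambda>jj nm cm. nm (adr 6 0) = jj \<and> LZ K nm cm \<and> cm (adr 20 K) = 0 \<and> ARR2 19 (?S jj) (cs K h jj) cm"
  let ?c = "\<lambda>jj a i' k. if i' < a then cs K h (Suc jj) i' k else cs K h jj i' k"
  let ?I = "\<lambda>jj a nm cm. nm (adr 3 0) = a \<and> nm (adr 6 0) = jj \<and> LZ K nm cm \<and> cm (adr 20 K) = 0 \<and> ARR2 19 (?S jj) (?c jj a) cm"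
  have inner: "dtr f M (For 3 (NSub (nS 2) (nS 6)) (Seq diffC addC)) (900 * (rr * real K)) nm cm (\<lambda>nm' cm'. nm' (adr 6 0) = jj \<and> ?O (Suc jj) (nm'(adr 6 0 := Suc jj)) cm')"
    if jj: "jj < r" and O: "?O jj nm cm" for jj nm cm
  proof (rule dtr_For_bound[where n = "r - jj" and I = "?I jj" and c = "794 * real K" and C = 794])
    fix a nm cm assume a: "a < r - jj" and I: "?I jj a nm cm"
    have S: "(a, k) \<in> ?S jj \<and> (Suc a, k) \<in> ?S jj" if "k < K" for k using a that by auto
    let ?e = "\<lambda>k. ?c jj a (Suc a) k - ?c jj a a k"
    have "dtr f M (Seq diffC addC) (247 * (real K * 1) + 547 * (real K * 1)) nm cm (\<lambda>nm cm. LZ K nm cm \<and> nm (adr 3 0) = a \<and> nm (adr 6 0) = jj \<and> cm (adr 20 K) = 0 \<and>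
       ARR2 19 (?S jj) (\<lambda>i' k. if i' = a \<and> 1 \<le> k \<and> k < K then ?c jj a a k + tri K ?e k else ?c jj a i' k) cm)"
      by (rule dtr_then[OF diffC[where S = "?S jj" and c = "?c jj a" and a = a and jj = jj]], (use I S K in auto)[7], rule addC)
         (use S K in \<open>auto simp: cs_0\<close>)
    then show "dtr f M (Seq diffC addC) (794 * real K) nm cm (\<lambda>nm' cm'. nm' (adr 3 0) = a \<and> ?I jj (Suc a) (nm'(adr 3 0 := Suc a)) cm')"
    proof (rule dtr_weaken)
      fix nm cm assume B: "LZ K nm cm \<and> nm (adr 3 0) = a \<and> nm (adr 6 0) = jj \<and> cm (adr 20 K) = 0 \<and>
       ARR2 19 (?S jj) (\<lambda>i' k. if i' = a \<and> 1 \<le> k \<and> k < K then ?c jj a a k + tri K ?e k else ?c jj a i' k) cm"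
      have "ARR2 19 (?S jj) (?c jj (Suc a)) cm"
        by (rule ARR2_mono[of 19 "?S jj" "\<lambda>i' k. if i' = a \<and> 1 \<le> k \<and> k < K then ?c jj a a k + tri K ?e k else ?c jj a i' k"])
           (use B cs_0 in \<open>auto simp: less_Suc_eq tri_def\<close>)
      then show "nm (adr 3 0) = a \<and> ?I jj (Suc a) (nm(adr 3 0 := Suc a)) cm" using B by simp
    qed simp
  next
    show "?I jj 0 (nm(adr 3 0 := 0)) cm" using O by simp
    fix nm cm assume I: "?I jj (r - jj) nm cm"
    have "ARR2 19 (?S (Suc jj)) (cs K h (Suc jj)) cm"
      by (rule ARR2_mono[of 19 "?S jj" "?c jj (r - jj)"]) (use I in auto)
    then show "nm (adr 6 0) = jj \<and> ?O (Suc jj) (nm(adr 6 0 := Suc jj)) cm" using I by simp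
  qed (use rr(1) K1 in \<open>auto simp: LZ_D\<close>)
  have "dtr f M (For 6 (nS 2) (For 3 (NSub (nS 2) (nS 6)) (Seq diffC addC))) (950 * (rr * (rr * real K))) nm cm (?O r)" if "?O 0 (nm(adr 6 0 := 0)) cm" for nm cm
    by (rule dtr_For_bound[where n = r and I = ?O and c = "900 * (rr * real K)" and C = 900]) (use that inner rr(1) rK in \<open>auto simp: LZ_D\<close>)
  note outer = this
  have S0: "ARR2 19 (?S 0) (cs K h 0) (cm(adr 20 K := 0))" using ARR2_mono[OF P(2), of "?S 0" "cs K h 0"] by auto
  have S1: "?O 0 (nm(adr 6 0 := 0)) (cm(adr 20 K := 0))" using S0 P(1) by simp
  have fin: "LZ K nm cm \<and> ARR2 19 ({0} \<times> {..<K}) (cs K h r) cm" if "?O r nm cm" for nm cm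
    using that ARR2_mono[of 19 "?S r" "cs K h r" cm "{0} \<times> {..<K}" "cs K h r"] by auto
  have "1 \<le> rr * (rr * real K)" using mult_mono[of 1 rr 1 "rr * real K"] rr(1) rK by simp
  then have c: "30 + 950 * (rr * (rr * real K)) \<le> 1000 * (rr * (rr * real K))" by linarith
  have first: "dtr f M (CAssign (nA 20 (nS 5)) (COfNat (NConst 0))) 30 nm cm (\<lambda>nm' cm'. nm' = nm \<and> cm' = cm(adr 20 K := 0))"
    by (rule dtr_cost, rule dtr_CAssign) (use LZ_D(2)[OF P(1)] in simp_all)
  have second: "dtr f M (For 6 (nS 2) (For 3 (NSub (nS 2) (nS 6)) (Seq diffC addC))) (950 * (rr * (rr * real K))) nm' cm'
     (\<lambda>nm cm. LZ K nm cm \<and> ARR2 19 ({0} \<times> {..<K}) (cs K h r) cm)" if "nm' = nm \<and> cm' = cm(adr 20 K := 0)" for nm' cm'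
    by (rule dtr_weaken[OF outer fin order.refl]) (use S1 that in simp_all)
  show ?thesis unfolding roundsC_def
    by (rule dtr_cost[OF dtr_then[OF first second] c])
qed

definition yy :: "nat \<Rightarrow> (nat \<Rightarrow> real) \<Rightarrow> nat \<Rightarrow> complex" where
  "yy K h a = (\<Sum>k<K. cs K h r 0 k * lz k a)"

lemma outC:
  assumes P: "LZ K nm cm" "ARR2 19 ({0} \<times> {..<K}) (cs K h r) cm" and K: "1 \<le> K"
  shows "dtr f M outC (700 * (rr * real K)) nm cm (\<lambda>nm cm. ENV nm cm \<and> ARR 21 {..<r} (yy K h) cm \<and> cm (adr 22 0) = complex_of_real (nsq r (yy K h)))"
proof -
  have K1: "1 \<le> real K" using K by simp
  let ?J = "\<lambda>a nm cm. nm (adr 3 0) = a \<and> LZ K nm cm \<and> ARR2 19 ({0} \<times> {..<K}) (cs K h r) cm \<and> ARR 21 {..<a} (yy K h) cm"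
  have 1: "dtr f M (For 3 (nS 2) (Acc 4 (nS 5) (nA 21 (nS 3)) (CMul (cR 19 (pE (NConst 0) (nS 4))) (cR 14 (pE (nS 4) (nS 3)))))) (350 * (rr * real K)) nm cm (?J r)"
  proof (rule dtr_For_bound[where n = r and I = ?J and c = "300 * real K" and C = 300])
    fix a nm cm assume a: "a < r" and J: "?J a nm cm"
    have v: "\<And>k. k < K \<Longrightarrow> cm (adr 19 (pr 0 k)) = cs K h r 0 k" "\<And>k. k < K \<Longrightarrow> cm (adr 14 (pr k a)) = lz k a" "nm (adr 5 0) = K"
      using J a by (auto simp: ARR2_D LZ_D)
    show "dtr f M (Acc 4 (nS 5) (nA 21 (nS 3)) (CMul (cR 19 (pE (NConst 0) (nS 4))) (cR 14 (pE (nS 4) (nS 3))))) (300 * real K) nm cm (\<lambda>nm' cm'. nm' (adr 3 0) = a \<and> ?J (Suc a) (nm'(adr 3 0 := Suc a)) cm')"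
      apply (rule dtr_cost, rule dtr_Acc[where x = "adr 21 a" and n = K and g = "\<lambda>k. cs K h r 0 k * lz k a"])
           apply (use J v a in simp_all)[4]
       apply (use J v a in \<open>simp add: ARR_Suc ARR_outside yy_def\<close>)
      apply (use K1 in simp)
      done
  qed (use P rr(1) K1 in \<open>auto simp: LZ_D\<close>)
  have 2: "dtr f M (Acc 3 (nS 2) (nL 22) (CMul (cR 21 (nS 3)) (CConj (cR 21 (nS 3))))) (300 * rr) nm cm
     (\<lambda>nm cm. ENV nm cm \<and> ARR 21 {..<r} (yy K h) cm \<and> cm (adr 22 0) = complex_of_real (nsq r (yy K h)))" if J: "?J r nm cm" for nm cm
  proof -
    have v: "\<And>a. a < r \<Longrightarrow> cm (adr 21 a) = yy K h a" "nm (adr 2 0) = r" "ENV nm cm"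
      using J LZ_D(1,3)[of K nm cm] ARR_D[of 21 "{..<r}" "yy K h" cm] by blast+
    show ?thesis
      apply (rule dtr_cost, rule dtr_Acc[where x = "adr 22 0" and n = r and g = "\<lambda>a. yy K h a * cnj (yy K h a)"])
           apply (use v in simp_all)[4]
       apply (use J v in \<open>simp add: ip_self[symmetric] ip_def\<close>)
      apply (use rr in simp)
      done
  qed
  have "300 * rr * 1 \<le> 300 * rr * real K" using K1 rr(1) by (intro mult_left_mono) auto
  then show ?thesis unfolding outC_def by (intro dtr_cost[OF dtr_then[OF 1 2]]) (simp_all add: algebra_simps)
qed

end

text \<open>A loop that makes one draw per round produces the product law. The invariant carries the
  tuple \<open>F\<close> of the draws so far; beyond the current round it is 0, which is the default
  value of the product law.\<close>

lemma samp_For: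
  fixes p :: "nat \<Rightarrow> nat pmf"
  assumes I0: "I 0 (\<lambda>_. 0) ((nmem s)(adr g 0 := 0)) (cmem s)"
    and ev: "\<And>i F nm cm. I i F nm cm \<Longrightarrow> nm (adr g 0) = i \<and> nv nm e = n"
    and step: "\<And>i F u. i < n \<Longrightarrow> I i F (nmem u) (cmem u) \<Longrightarrow>
      samp f M P u (p i) (\<lambda>v w. time_used w \<le> time_used u + c \<and> samples_used w = Suc (samples_used u) \<and>
        nmem w (adr g 0) = i \<and> I (Suc i) (F(i := v)) ((nmem w)(adr g 0 := Suc i)) (cmem w))"
  shows "samp f M (For g e P) s (Pi_pmf {..<n} 0 p) (\<lambda>F w. time_used w \<le> time_used s + (real n * (c + 21 + ncost e) + 14 + ncost e) \<and>
     samples_used w = samples_used s + n \<and> I n F (nmem w) (cmem w))"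
proof -
  let ?g = "BNatLess (nS g) e" and ?inc = "NAssign (nL g) (NAdd (nS g) (NConst 1))"
  \<comment> \<open>Law of the completed tuple when the draws before round \<open>i\<close> are
    fixed to those in \<open>F\<close>.\<close>
  let ?q = "\<lambda>i F. map_pmf (\<lambda>G k. if k \<in> {i..<n} then G k else F k) (Pi_pmf {i..<n} 0 p)"
  have W: "samp f M (While ?g (Seq P ?inc)) u (?q i F) (\<lambda>F w. time_used w \<le> time_used u + (real (n - i) * (c + 21 + ncost e) + 7 + ncost e) \<and>
     samples_used w = samples_used u + (n - i) \<and> I n F (nmem w) (cmem w))" if "I i F (nmem u) (cmem u)" "i \<le> n" for i F u
    using that
  proof (induction "n - i" arbitrary: i F u)
    case 0
    then have i: "i = n" by simp
    have "\<not> bv f (nmem u) (cmem u) ?g" using ev[OF 0(2)] i by simp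
    from samp_WhileFalse[of f u ?g "\<lambda>F w. time_used w \<le> time_used u + (real (n - i) * (c + 21 + ncost e) + 7 + ncost e) \<and>
     samples_used w = samples_used u + (n - i) \<and> I n F (nmem w) (cmem w)" F M "Seq P ?inc", OF this] 0(2)
    show ?case unfolding i by simp
  next
    case (Suc d)
    then have i: "i < n" by simp
    have g: "bv f (nmem u) (cmem u) ?g" using ev[OF Suc.prems(1)] i by simp
    let ?u = "charge (bcost ?g) u"
    have S: "samp f M P ?u (p i) (\<lambda>v w. time_used w \<le> time_used ?u + c \<and> samples_used w = Suc (samples_used u) \<and>
        nmem w (adr g 0) = i \<and> I (Suc i) (F(i := v)) ((nmem w)(adr g 0 := Suc i)) (cmem w))"
      using step[OF i, of F ?u] Suc.prems(1) by simp
    have body: "samp f M (Seq P ?inc) ?u (p i) (\<lambda>v w. time_used w \<le> time_used ?u + (c + 14) \<and> samples_used w = Suc (samples_used u) \<and>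
        I (Suc i) (F(i := v)) (nmem w) (cmem w))"
    proof (rule samp_weaken[OF samp_Seq_dtr[OF S, where c = 14 and Q' = "\<lambda>v. I (Suc i) (F(i := v))"]])
      fix v and w :: state assume "time_used w \<le> time_used ?u + c \<and> samples_used w = Suc (samples_used u) \<and>
        nmem w (adr g 0) = i \<and> I (Suc i) (F(i := v)) ((nmem w)(adr g 0 := Suc i)) (cmem w)"
      then show "dtr f M ?inc 14 (nmem w) (cmem w) (I (Suc i) (F(i := v)))"
        by (intro dtr_cost[OF dtr_NAssign]) simp_all
    qed auto
    have Q: "?q i F = bind_pmf (p i) (\<lambda>v. ?q (Suc i) (F(i := v)))"
    proof -
      have ins: "{i..<n} = insert i {Suc i..<n}" using i by auto
      have "Pi_pmf {i..<n} 0 p = bind_pmf (p i) (\<lambda>v. map_pmf (\<lambda>G. G(i := v)) (Pi_pmf {Suc i..<n} 0 p))"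
        unfolding ins by (subst Pi_pmf_insert') (simp_all add: map_pmf_def)
      then show ?thesis
        by (simp add: map_bind_pmf pmf.map_comp o_def) (intro bind_pmf_cong refl map_pmf_cong ext, use i in auto)
    qed
    show ?case unfolding Q
    proof (rule samp_WhileTrue[OF g], rule samp_bind[OF body])
      fix v and w :: state assume w: "time_used w \<le> time_used ?u + (c + 14) \<and> samples_used w = Suc (samples_used u) \<and> I (Suc i) (F(i := v)) (nmem w) (cmem w)"
      have n: "real (n - i) = 1 + real (n - Suc i)" "n - i = Suc (n - Suc i)" using i by auto
      have I: "I (Suc i) (F(i := v)) (nmem w) (cmem w)" using w by blast
      show "samp f M (While ?g (Seq P ?inc)) w (?q (Suc i) (F(i := v)))
         (\<lambda>F w. time_used w \<le> time_used u + (real (n - i) * (c + 21 + ncost e) + 7 + ncost e) \<and>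
           samples_used w = samples_used u + (n - i) \<and> I n F (nmem w) (cmem w))"
        by (rule samp_weaken[OF Suc.hyps(1)[OF _ I]]) (use w Suc.hyps(2) i n in \<open>auto simp: algebra_simps\<close>)
    qed
  qed
  have Q0: "?q 0 (\<lambda>_. 0) = Pi_pmf {..<n} 0 p"
  proof -
    have "?q 0 (\<lambda>_. 0) = map_pmf (\<lambda>G. G) (Pi_pmf {..<n} 0 p)"
      unfolding atLeast0LessThan
    proof (rule map_pmf_cong[OF refl], rule ext)
      fix G k assume "G \<in> set_pmf (Pi_pmf {..<n} (0::nat) p)"
      then show "(if k \<in> {..<n} then G k else 0) = G k" by (auto simp: set_Pi_pmf PiE_dflt_def)
    qed
    then show ?thesis by simp
  qed
  have first: "dtr f M (NAssign (nL g) (NConst 0)) 7 (nmem s) (cmem s) (\<lambda>nm cm. nm = (nmem s)(adr g 0 := 0) \<and> cm = cmem s)"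
    by (rule dtr_cost, rule dtr_NAssign) simp_all
  show ?thesis unfolding For_def Q0[symmetric]
  proof (rule samp_dtr_Seq[OF first])
    fix u :: state assume u: "time_used u \<le> time_used s + 7" "samples_used u = samples_used s" "nmem u = (nmem s)(adr g 0 := 0) \<and> cmem u = cmem s"
    have I: "I 0 (\<lambda>_. 0) (nmem u) (cmem u)" using u(3) I0 by simp
    show "samp f M (While ?g (Seq P ?inc)) u (?q 0 (\<lambda>_. 0)) (\<lambda>F w. time_used w \<le> time_used s + (real n * (c + 21 + ncost e) + 14 + ncost e) \<and>
     samples_used w = samples_used s + n \<and> I n F (nmem w) (cmem w))"
      by (rule samp_weaken[OF W[OF I]]) (use u in auto)
  qed
qed

definition restC :: com where "restC = Seq matrixC (Seq normsC (Seq lanczosC (Seq initC (Seq roundsC outC))))"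
definition prepareC :: com where "prepareC = Seq prepC (Seq (Seq rowsC colsC) restC)"

locale sampling_program = access_model f A b m n Lg + row_sampling m n r A a F2
  for f A b m n Lg r a F2
begin

abbreviation "Mh i j \<equiv> \<lambda>k l. A $$ (i k, j l) / rn (i k)"
abbreviation "nh i j \<equiv> \<lambda>l. \<Sum>k<r. Mh i j k l * cnj (Mh i j k l)"
abbreviation "bh i \<equiv> \<lambda>k. b $ (i k) / rn (i k)"
abbreviation "tops i j \<equiv> memory_env.top r (Mh i j) (nh i j)"
abbreviation "lzs i j \<equiv> lanczos r (tops i j) (bh i)"
abbreviation "ys i j K h \<equiv> memory_env.yy r (bh i) (Mh i j) (nh i j) K h"

lemma samp_rowsC:
  assumes INP: "INP x (cmem s)" and r2: "nmem s (adr 2 0) = r"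
  shows "samp f M rowsC s rowsP (\<lambda>i w. time_used w \<le> time_used s + 100 * (real r * Lg) \<and> samples_used w = samples_used s + r \<and>
    INP x (cmem w) \<and> nmem w (adr 2 0) = r \<and> ARR 8 {..<r} i (nmem w))"
proof -
  let ?I = "\<lambda>k i nm cm. nm (adr 3 0) = k \<and> nm (adr 2 0) = r \<and> INP x cm \<and> ARR 8 {..<k} i nm"
  have F: "frob_norm A \<noteq> 0" using frob F2 by auto
  have r1: "1 \<le> real r" using r by simp
  have "samp f M rowsC s rowsP (\<lambda>i w. time_used w \<le> time_used s + (real r * ((Lg + 20) + 21 + ncost (nS 2)) + 14 + ncost (nS 2)) \<and> samples_used w = samples_used s + r \<and>
    ?I r i (nmem w) (cmem w))"
    unfolding rowsC_def
  proof (rule samp_For[where I = ?I])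
    fix k i and u :: state assume k: "k < r" and I: "?I k i (nmem u) (cmem u)"
    have A: "ARR 8 {..<Suc k} (i(k := v)) ((nmem u)(adr 8 k := v))" for v
      using I by (auto simp: ARR_def less_Suc_eq)
    have "samp f M (SampleRow SrcMat (nA 8 (nS 3))) u (row_pmf (M SrcMat)) (\<lambda>v w. time_used w \<le> time_used u + (Lg + 20) \<and> samples_used w = Suc (samples_used u) \<and>
        nmem w (adr 3 0) = k \<and> ?I (Suc k) (i(k := v)) ((nmem w)(adr 3 0 := Suc k)) (cmem w))"
      by (rule samp_SampleRow) (use F I A costs(1) in \<open>auto simp: nput_def\<close>)
    then show "samp f M (SampleRow SrcMat (nA 8 (nS 3))) u (row_pmf A) (\<lambda>v w. time_used w \<le> time_used u + (Lg + 20) \<and> samples_used w = Suc (samples_used u) \<and>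
        nmem w (adr 3 0) = k \<and> ?I (Suc k) (i(k := v)) ((nmem w)(adr 3 0 := Suc k)) (cmem w))" by simp
  qed (use INP r2 in auto)
  then show ?thesis
  proof (rule samp_weaken)
    have "real r * ((Lg + 20) + 21 + ncost (nS 2)) + 14 + ncost (nS 2) \<le> (21 + 35 + 2 * ncost (nS 2)) * (real r * Lg)"
      using costs(4) r1 by (intro loop_bound) auto
    moreover have "0 \<le> real r * Lg" using costs(4) by simp
    ultimately have c: "real r * ((Lg + 20) + 21 + ncost (nS 2)) + 14 + ncost (nS 2) \<le> 100 * (real r * Lg)" by simp
    show "time_used w \<le> time_used s + 100 * (real r * Lg) \<and> samples_used w = samples_used s + r \<and>
      INP x (cmem w) \<and> nmem w (adr 2 0) = r \<and> ARR 8 {..<r} i (nmem w)"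
      if "time_used w \<le> time_used s + (real r * ((Lg + 20) + 21 + ncost (nS 2)) + 14 + ncost (nS 2)) \<and> samples_used w = samples_used s + r \<and> ?I r i (nmem w) (cmem w)" for i w
      using that c by auto
  qed
qed

lemma samp_colsC:
  assumes INP: "INP x (cmem s)" and r2: "nmem s (adr 2 0) = r" and i: "i \<in> set_pmf rowsP" "ARR 8 {..<r} i (nmem s)"
  shows "samp f M colsC s (colsP i) (\<lambda>j w. time_used w \<le> time_used s + 100 * (real r * Lg) \<and> samples_used w = samples_used s + r \<and>
    INP x (cmem w) \<and> NE r i j (nmem w))"
proof -
  let ?I = "\<lambda>k j nm cm. nm (adr 3 0) = k \<and> nm (adr 2 0) = r \<and> INP x cm \<and> ARR 8 {..<r} i nm \<and> ARR 9 {..<k} j nm"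
  have r1: "1 \<le> real r" using r by simp
  have "samp f M colsC s (colsP i) (\<lambda>j w. time_used w \<le> time_used s + (real r * ((Lg + 40) + 21 + ncost (nS 2)) + 14 + ncost (nS 2)) \<and> samples_used w = samples_used s + r \<and>
    ?I r j (nmem w) (cmem w))"
    unfolding colsC_def
  proof (rule samp_For[where I = ?I])
    fix k j and u :: state assume k: "k < r" and I: "?I k j (nmem u) (cmem u)"
    have A: "ARR 9 {..<Suc k} (j(k := v)) ((nmem u)(adr 9 k := v))" for v
      using I by (auto simp: ARR_def less_Suc_eq)
    have ik: "i k < m" "eucl_norm (Matrix.row A (i k)) \<noteq> 0" "nmem u (adr 8 k) = i k"
      using rowsD[OF i(1) k] row_norm[of "i k"] I k by (auto simp: ARR_D)
    have "samp f M (SampleCol SrcMat (nR 8 (nS 3)) (nA 9 (nS 3))) u (vec_pmf (Matrix.row (M SrcMat) (nv (nmem u) (nR 8 (nS 3))))) (\<lambda>v w. time_used w \<le> time_used u + (Lg + 40) \<and> samples_used w = Suc (samples_used u) \<and>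
        nmem w (adr 3 0) = k \<and> ?I (Suc k) (j(k := v)) ((nmem w)(adr 3 0 := Suc k)) (cmem w))"
      by (rule samp_SampleCol) (use ik I A costs(1) in \<open>auto simp: nput_def\<close>)
    then show "samp f M (SampleCol SrcMat (nR 8 (nS 3)) (nA 9 (nS 3))) u (vec_pmf (Matrix.row A (i k))) (\<lambda>v w. time_used w \<le> time_used u + (Lg + 40) \<and> samples_used w = Suc (samples_used u) \<and>
        nmem w (adr 3 0) = k \<and> ?I (Suc k) (j(k := v)) ((nmem w)(adr 3 0 := Suc k)) (cmem w))" using ik I by simp
  qed (use INP r2 i in auto)
  then show ?thesis
  proof (rule samp_weaken)
    have "real r * ((Lg + 40) + 21 + ncost (nS 2)) + 14 + ncost (nS 2) \<le> (41 + 35 + 2 * ncost (nS 2)) * (real r * Lg)"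
      using costs(4) r1 by (intro loop_bound) auto
    moreover have "0 \<le> real r * Lg" using costs(4) by simp
    ultimately have c: "real r * ((Lg + 40) + 21 + ncost (nS 2)) + 14 + ncost (nS 2) \<le> 100 * (real r * Lg)" by simp
    show "time_used w \<le> time_used s + 100 * (real r * Lg) \<and> samples_used w = samples_used s + r \<and> INP x (cmem w) \<and> NE r i j (nmem w)"
      if "time_used w \<le> time_used s + (real r * ((Lg + 40) + 21 + ncost (nS 2)) + 14 + ncost (nS 2)) \<and> samples_used w = samples_used s + r \<and> ?I r j (nmem w) (cmem w)" for j w
      using that c by (auto simp: NE_def)
  qed
qed

text \<open>What the sampling program relies on. The length \<open>K\<close> of the recurrence is
  remembered through its existence, since the stored vector is described by Krylov coordinates of
  that length.\<close>

definition prepared :: "nat \<Rightarrow> (nat \<Rightarrow> real) \<Rightarrow> (nat \<Rightarrow> nat) \<Rightarrow> (nat \<Rightarrow> nat) \<Rightarrow> (nat \<Rightarrow> nat) \<Rightarrow> (nat \<Rightarrow> complex) \<Rightarrow> bool" where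
  "prepared dmax h i j nm cm \<longleftrightarrow> (\<exists>K\<ge>1. K \<le> Suc dmax \<and> nsq r (lzs i j K) = 0 \<and> nm (adr 2 0) = r \<and> ARR 8 {..<r} i nm \<and>
     ARR 10 {..<r} (\<lambda>k. rn (i k)) cm \<and> ARR 21 {..<r} (ys i j K h) cm \<and> cm (adr 22 0) = complex_of_real (nsq r (ys i j K h)))"

lemma restC:
  assumes NE: "NE r i j nm" and INP: "INP x cm" and ij: "i \<in> set_pmf rowsP" "j \<in> set_pmf (colsP i)"
    and x: "x 3 = complex_of_real N" "x 4 = complex_of_real \<kappa>" "x 8 = complex_of_real F2"
    and s2: "s2 = N * N / (2 * (\<kappa> * \<kappa>))" "0 < s2"
    and f: "\<And>z. 0 \<le> z \<Longrightarrow> f z \<ge> 0"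
    and fin: "\<And>d. (\<And>k. 1 \<le> k \<Longrightarrow> k \<le> d \<Longrightarrow> nsq r (lzs i j k) \<noteq> 0) \<Longrightarrow> d \<le> dmax"
  shows "dtr f M restC (9000 * (real r * real r * (real dmax + 1) * Lg)) nm cm
     (prepared dmax (\<lambda>k. ramp f s2 (N * N + s2) (F2 * real k / real r)) i j)"
proof -
  let ?h = "\<lambda>k. ramp f s2 (N * N + s2) (F2 * real k / real r)"
  interpret memory_env r i j x "\<lambda>k. rn (i k)" "bh i" "Mh i j" "nh i j" f M by unfold_locales (use r in simp)
  let ?d = "real dmax + 1"
  have d1: "1 \<le> ?d" by simp
  have bound: "i k < m" "j k < n" if "k < r" for k using rowsD[OF ij(1) that] colsD[OF ij that] by auto
  have m1: "rr * y \<le> rr * y'" if "y \<le> y'" for y y' using that rr(4) by (rule mult_left_mono)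
  have rd: "rr * rr \<le> rr * rr * ?d" "rr * ?d \<le> (rr * rr) * ?d"
    using mult_left_mono[OF d1 rr(5)] rr(2) d1 by (auto intro!: mult_right_mono)
  let ?U = "rr * rr * ?d * Lg"
  have LU: "y \<le> ?U" if "y \<le> rr * rr * ?d" for y
    using mult_left_mono[OF costs(4), of "rr * rr * ?d"] that by simp
  have U: "rr * rr * Lg \<le> ?U" "rr * rr \<le> ?U" "rr * rr * ?d \<le> ?U"
    using mult_right_mono[OF rd(1), of Lg] LU[OF rd(1)] LU[OF order.refl] costs(4) by linarith+
  have sum: "599 * y1 + (347 * y2 + (4000 * y3 + 4000 * y)) \<le> 9000 * y" if "y1 \<le> y" "y2 \<le> y" "y3 \<le> y" "y2 \<ge> 0" for y1 y2 y3 y :: real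
    using that by linarith
  have K: "dtr f M (Seq initC (Seq roundsC outC)) (4000 * ?U) nm cm (prepared dmax ?h i j)"
    if k: "1 \<le> K" "K \<le> Suc dmax" "nsq r (lz K) = 0" "LZ K nm cm" for K nm cm
  proof -
    have Kd: "real K \<le> ?d" using k(2) by simp
    have 0: "rr * real K \<le> rr * rr * ?d" using order.trans[OF m1[OF Kd] rd(2)] .
    have 1: "rr * real K \<le> ?U" using LU[OF 0] .
    have 2: "rr * (rr * real K) \<le> ?U" by (rule LU) (use m1[OF m1[OF Kd]] in \<open>simp add: mult.assoc\<close>)
    show ?thesis
    proof (rule dtr_cost, rule dtr_then[OF initC[OF k(4,1) x s2 f]], assumption, erule conjE, rule dtr_then[OF roundsC], assumption, assumption, rule k(1),
        erule conjE, rule dtr_weaken[OF outC[OF _ _ k(1)] _ order.refl], assumption, assumption)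
      show "prepared dmax ?h i j nm' cm'" if "ENV nm' cm' \<and> ARR 21 {..<r} (yy K ?h) cm' \<and> cm' (adr 22 0) = complex_of_real (nsq r (yy K ?h))" for nm' cm'
        using that k unfolding prepared_def ENV_def NE_def by blast
      show "2300 * (rr * real K) + (1000 * (rr * (rr * real K)) + 700 * (rr * real K)) \<le> 4000 * ?U" using 1 2 by linarith
    qed
  qed
  show ?thesis unfolding restC_def
  proof (rule dtr_cost, rule dtr_then[OF matrixC[OF NE INP]], rule bound(1), assumption, rule bound(2), assumption, use r in simp,
      elim conjE, rule dtr_then[OF normsC], assumption, assumption, assumption, assumption, assumption, use r in simp,
      rule dtr_then[OF lanczosC], assumption, rule fin, blast, elim exE conjE, rule K, assumption, assumption, assumption, assumption)
    show "599 * (rr * rr * Lg) + (347 * (rr * rr) + (4000 * (rr * rr * ?d) + 4000 * ?U)) \<le> 9000 * ?U" by (rule sum[OF U rr(5)])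
  qed
qed

lemma samp_prepareC:
  assumes r0: "0 < r0" "nat \<lceil>r0\<rceil> = r" and INP: "\<forall>g<8. cmem s (adr g 0) = x g" "x 8 = complex_of_real F2" "x 9 = complex_of_real r0"
    and R: "\<And>nm. cv f nm ((cmem s)(adr 8 0 := x 8)) (CMul sizeC sizeC) = complex_of_real r0"
    and x: "x 3 = complex_of_real N" "x 4 = complex_of_real \<kappa>"
    and s2: "s2 = N * N / (2 * (\<kappa> * \<kappa>))" "0 < s2"
    and f: "\<And>z. 0 \<le> z \<Longrightarrow> f z \<ge> 0"
    and fin: "\<And>i j d. i \<in> set_pmf rowsP \<Longrightarrow> j \<in> set_pmf (colsP i) \<Longrightarrow> (\<And>k. 1 \<le> k \<Longrightarrow> k \<le> d \<Longrightarrow> nsq r (lzs i j k) \<noteq> 0) \<Longrightarrow> d \<le> dmax"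
  shows "samp f M prepareC s (bind_pmf rowsP (\<lambda>i. map_pmf (Pair i) (colsP i)))
    (\<lambda>(i, j) w. time_used w \<le> time_used s + 12000 * (real r * real r * (real dmax + 1) * Lg) \<and> samples_used w = samples_used s + 2 * r \<and>
       prepared dmax (\<lambda>k. ramp f s2 (N * N + s2) (F2 * real k / real r)) i j (nmem w) (cmem w))"
proof -
  let ?h = "\<lambda>k. ramp f s2 (N * N + s2) (F2 * real k / real r)" and ?U = "real r * real r * (real dmax + 1) * Lg"
  have r1: "1 \<le> real r" using r by simp
  have rL: "real r * Lg \<le> ?U" "real r \<le> real r * Lg"
  proof -
    have "1 * 1 \<le> real r * (real dmax + 1)" by (rule mult_mono) (use r1 in auto)
    then have "(real r * Lg) * 1 \<le> (real r * Lg) * (real r * (real dmax + 1))"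
      using costs(4) r1 by (intro mult_left_mono) auto
    then show "real r * Lg \<le> ?U" by (simp add: mult_ac)
    show "real r \<le> real r * Lg" using mult_left_mono[OF costs(4), of "real r"] by simp
  qed
  have P: "dtr f M prepC (2000 * real r) (nmem s) (cmem s) (\<lambda>nm' cm'. nm' (adr 2 0) = r \<and> INP x cm')"
    using prepC[of r0 "cmem s" x M f "nmem s", OF r0(1) INP(1) _ INP(3) R] INP(2) frob r0(2) by simp
  show ?thesis unfolding prepareC_def
  proof (rule samp_dtr_Seq[OF P])
    fix u :: state assume u: "time_used u \<le> time_used s + 2000 * real r" "samples_used u = samples_used s" "nmem u (adr 2 0) = r \<and> INP x (cmem u)"
    have RC: "samp f M (Seq rowsC colsC) u (bind_pmf rowsP (\<lambda>i. map_pmf (Pair i) (colsP i)))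
       (\<lambda>(i, j) w. (time_used w \<le> time_used u + 200 * (real r * Lg) \<and> samples_used w = samples_used u + 2 * r \<and> INP x (cmem w) \<and> NE r i j (nmem w)))"
    proof (rule samp_weaken[OF samp_Seq[OF samp_rowsC[where x = x], where Q' = "\<lambda>i j w. time_used w \<le> time_used u + 200 * (real r * Lg) \<and> samples_used w = samples_used u + 2 * r \<and> INP x (cmem w) \<and> NE r i j (nmem w)"]])
      fix i and w :: state assume i: "i \<in> set_pmf rowsP" and w: "time_used w \<le> time_used u + 100 * (real r * Lg) \<and> samples_used w = samples_used u + r \<and>
        INP x (cmem w) \<and> nmem w (adr 2 0) = r \<and> ARR 8 {..<r} i (nmem w)"
      show "samp f M colsC w (colsP i) (\<lambda>j w. time_used w \<le> time_used u + 200 * (real r * Lg) \<and> samples_used w = samples_used u + 2 * r \<and> INP x (cmem w) \<and> NE r i j (nmem w))"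
        by (rule samp_weaken[OF samp_colsC[where x = x]]) (use w i in auto)
    qed (use u in auto)
    show "samp f M (Seq (Seq rowsC colsC) restC) u (bind_pmf rowsP (\<lambda>i. map_pmf (Pair i) (colsP i)))
     (\<lambda>(i, j) w. time_used w \<le> time_used s + 12000 * ?U \<and> samples_used w = samples_used s + 2 * r \<and> prepared dmax ?h i j (nmem w) (cmem w))"
    proof (rule samp_weaken[OF samp_Seq_dtr[OF RC, where c = "9000 * ?U" and Q' = "\<lambda>(i, j). prepared dmax ?h i j"]])
      fix z and w :: state assume z: "z \<in> set_pmf (bind_pmf rowsP (\<lambda>i. map_pmf (Pair i) (colsP i)))"
        and w: "(case z of (i, j) \<Rightarrow> \<lambda>w. time_used w \<le> time_used u + 200 * (real r * Lg) \<and> samples_used w = samples_used u + 2 * r \<and> INP x (cmem w) \<and> NE r i j (nmem w)) w"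
      show "dtr f M restC (9000 * ?U) (nmem w) (cmem w) (case z of (i, j) \<Rightarrow> prepared dmax ?h i j)"
      proof (cases z)
        case (Pair i j)
        have ij: "i \<in> set_pmf rowsP" "j \<in> set_pmf (colsP i)" using z unfolding Pair by auto
        have NE: "NE r i j (nmem w)" "INP x (cmem w)" using w unfolding Pair by auto
        have "dtr f M restC (9000 * ?U) (nmem w) (cmem w) (prepared dmax ?h i j)"
          by (rule restC[OF NE ij x INP(2) s2 f fin[OF ij]])
        then show ?thesis unfolding Pair by simp
      qed
    next
      fix z and w :: state assume "\<exists>u0. (case z of (i, j) \<Rightarrow> \<lambda>w. time_used w \<le> time_used u + 200 * (real r * Lg) \<and> samples_used w = samples_used u + 2 * r \<and> INP x (cmem w) \<and> NE r i j (nmem w)) u0 \<and>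
         time_used w \<le> time_used u0 + 9000 * ?U \<and> samples_used w = samples_used u0 \<and> (case z of (i, j) \<Rightarrow> prepared dmax ?h i j) (nmem w) (cmem w)"
      then show "(case z of (i, j) \<Rightarrow> \<lambda>w. time_used w \<le> time_used s + 12000 * ?U \<and> samples_used w = samples_used s + 2 * r \<and> prepared dmax ?h i j (nmem w) (cmem w)) w"
        using u rL by (cases z) auto
    qed
  qed
qed

end

section \<open>The sampling program\<close>

definition weightC :: cexp where "weightC = CMul (cR 21 (nS 13)) (CConj (cR 21 (nS 13)))"

text \<open>A row is drawn according to the squared moduli of the coefficients by successive coins,
  each with the conditional probability of stopping given that no earlier index was taken; complex
  register 23 holds the remaining mass. The last index is taken without a coin.\<close>

definition pickstepC :: com where "pickstepC =
  Seq (Coin (nL 12) (CDiv weightC (cS 23)))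
    (If (BNatLess (nS 12) (NConst 1)) (Seq (CAssign (nL 23) (CSub (cS 23) weightC)) (NAssign (nL 13) (NAdd (nS 13) (NConst 1)))) Skip)"

definition pickloopC :: com where "pickloopC =
  While (BAnd (BNatLess (nS 12) (NConst 1)) (BNatLess (NAdd (nS 13) (NConst 1)) (nS 2))) pickstepC"

definition pickC :: com where "pickC =
  Seq (Seq (NAssign (nL 13) (NConst 0)) (Seq (NAssign (nL 12) (NConst 0)) (CAssign (nL 23) (cS 22)))) pickloopC"

definition evalC :: com where "evalC =
  Seq (CAssign (nL 24) (COfNat (NConst 0))) (Seq (CAssign (nL 25) (COfNat (NConst 0)))
  (For 3 (nS 2) (Seq (GetEntry SrcMat (nR 8 (nS 3)) (nS 14) (nL 26)) (Seq (CAssign (nL 26) (CDiv (cS 26) (cR 10 (nS 3))))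
    (Seq (CAssign (nL 24) (CAdd (cS 24) (CMul (CConj (cS 26)) (cR 21 (nS 3)))))
      (CAssign (nL 25) (CAdd (cS 25) (CMul (CMul (cS 26) (CConj (cS 26))) (CMul (cR 21 (nS 3)) (CConj (cR 21 (nS 3))))))))))))"

text \<open>The proposal is \<open>l\<close> with probability \<open>den l / nsq r y\<close>. The
  coin accepts it with probability \<open>|num l|^2 / (r den l)\<close>, which is at most 1 by
  Cauchy-Schwarz. Accepted values therefore follow the law proportional to
  \<open>|num l|^2\<close>.\<close>

definition trialC :: com where "trialC =
  Seq pickC (Seq (SampleCol SrcMat (nR 8 (nS 13)) (nL 14)) (Seq evalC
    (Seq (Coin (nL 10) (CDiv (CMul (cS 24) (CConj (cS 24))) (CMul (COfNat (nS 2)) (cS 25))))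
      (Seq (NAssign (NConst 0) (nS 14)) (NAssign (nL 11) (NAdd (nS 11) (NConst 1)))))))"

text \<open>At most \<open>r\<close> trials, so that every run obeys the resource bounds. When all
  of them fail, the last rejected proposal is returned, which uses up part of the accuracy.\<close>

definition drawloopC :: com where "drawloopC =
  While (BAnd (BNatLess (nS 11) (nS 2)) (BNatLess (nS 10) (NConst 1))) trialC"

definition drawC :: com where "drawC =
  Seq (Seq (NAssign (nL 10) (NConst 0)) (NAssign (nL 11) (NConst 0))) drawloopC"

definition flip :: "real \<Rightarrow> bool pmf" where "flip p = bernoulli_pmf (max 0 (min 1 p))"

definition tail :: "nat \<Rightarrow> (nat \<Rightarrow> complex) \<Rightarrow> nat \<Rightarrow> real" where "tail r y k = (\<Sum>l\<in>{k..<r}. (cmod (y l))\<^sup>2)"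

primrec pick_from :: "nat \<Rightarrow> (nat \<Rightarrow> complex) \<Rightarrow> nat \<Rightarrow> nat \<Rightarrow> nat pmf" where
  "pick_from r y 0 k = return_pmf k"
| "pick_from r y (Suc d) k = bind_pmf (flip ((cmod (y k))\<^sup>2 / tail r y k)) (\<lambda>c. if c then return_pmf k else pick_from r y d (Suc k))"

primrec repeat_trial :: "(nat \<times> bool) pmf \<Rightarrow> nat \<Rightarrow> nat \<Rightarrow> nat pmf" where
  "repeat_trial T 0 z = return_pmf z"
| "repeat_trial T (Suc d) z = bind_pmf T (\<lambda>x. if snd x then return_pmf (fst x) else repeat_trial T d (fst x))"

lemma tail_Suc: "k < r \<Longrightarrow> tail r y k = (cmod (y k))\<^sup>2 + tail r y (Suc k)"
  unfolding tail_def by (rule sum.atLeast_Suc_lessThan)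

lemma tail_nonneg: "0 \<le> tail r y k"
  unfolding tail_def by (intro sum_nonneg) simp

lemma pmf_flip: "pmf (flip p) c = (if c then max 0 (min 1 p) else 1 - max 0 (min 1 p))"
  by (cases c) (simp_all add: flip_def)

lemma pmf_bind_flip: "pmf (bind_pmf (flip p) q) z = max 0 (min 1 p) * pmf (q True) z + (1 - max 0 (min 1 p)) * pmf (q False) z"
  unfolding flip_def pmf_bind by (subst integral_bernoulli_pmf) auto

text \<open>The conditional probabilities telescope. If the mass after \<open>k\<close> is 0, the
  coin at \<open>k\<close> is certain, and the rest of the recursion, where the quotients
  degenerate, has weight 0.\<close>

lemma pmf_pick_from:
  assumes "k + d + 1 = r" "0 < tail r y k"
  shows "pmf (pick_from r y d k) z = (if k \<le> z \<and> z < r then (cmod (y z))\<^sup>2 / tail r y k else 0)"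
  using assms
proof (induction d arbitrary: k)
  case 0
  then have "tail r y k = (cmod (y k))\<^sup>2" by (simp add: tail_Suc) (simp add: tail_def)
  moreover have "k \<le> z \<and> z < r \<longleftrightarrow> z = k" using 0 by auto
  ultimately show ?case using 0(2) by (auto simp: pmf_return indicator_def)
next
  case (Suc d)
  have k: "k < r" using Suc.prems by simp
  note t = tail_Suc[OF k, of y] and nn = tail_nonneg[of r y "Suc k"]
  define p where "p = (cmod (y k))\<^sup>2 / tail r y k"
  have p: "max 0 (min 1 p) = p" using Suc.prems(2) t nn by (auto simp: p_def)
  have q: "1 - p = tail r y (Suc k) / tail r y k" using Suc.prems(2) t by (simp add: p_def field_simps)
  have rec: "pmf (pick_from r y (Suc d) k) z = p * pmf (return_pmf k) z + (1 - p) * pmf (pick_from r y d (Suc k)) z"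
    unfolding pick_from.simps pmf_bind_flip p_def[symmetric] p by simp
  show ?case
  proof (cases "tail r y (Suc k) = 0")
    case True
    then have "\<forall>l\<in>{Suc k..<r}. (cmod (y l))\<^sup>2 = 0" unfolding tail_def by (subst (asm) sum_nonneg_eq_0_iff) auto
    then have "z = k \<or> (if k \<le> z \<and> z < r then (cmod (y z))\<^sup>2 / tail r y k else 0) = 0" by auto
    moreover have "p = 1" using q True by simp
    ultimately show ?thesis unfolding rec using k p_def by (auto simp: pmf_return indicator_def)
  next
    case False
    then have "0 < tail r y (Suc k)" using nn by simp
    from Suc.IH[OF _ this] Suc.prems have IH: "pmf (pick_from r y d (Suc k)) z = (if Suc k \<le> z \<and> z < r then (cmod (y z))\<^sup>2 / tail r y (Suc k) else 0)" by simp
    have zk: "z = k" if "\<not> Suc k \<le> z" "k \<le> z" using that by simp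
    show ?thesis unfolding rec q IH using k False Suc.prems(2) by (cases "z = k") (auto simp: pmf_return indicator_def p_def dest: zk)
  qed
qed

text \<open>With probability \<open>1 - (1 - p)^d\<close> some trial is accepted, and the accepted
  value has law \<open>w\<close>; the contribution of complete failure is discarded. For total
  variation such a one-sided bound is enough, as \<open>tv_dist_le\<close> shows.\<close>

lemma pmf_repeat_trial:
  assumes T: "\<And>z. pmf T (z, True) = p * w z" and w: "\<And>z. 0 \<le> w z" and p: "\<And>d. 0 \<le> p" "p \<le> 1" and acc: "pmf (map_pmf snd T) True = p"
  shows "(1 - (1 - p) ^ d) * w z \<le> pmf (repeat_trial T d z0) z"
proof (induction d arbitrary: z0)
  case (Suc d)
  let ?c = "(1 - (1 - p) ^ d) * w z"
  have pow: "0 \<le> (1 - p) ^ d" "(1 - p) ^ d \<le> 1" using p by (auto intro: power_le_one)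
  have False_prob: "measure_pmf.prob T {x. \<not> snd x} = 1 - p"
  proof -
    have "pmf (map_pmf snd T) True + pmf (map_pmf snd T) False = 1"
      using pmf_False_conv_True[of "map_pmf snd T"] by simp
    moreover have "pmf (map_pmf snd T) False = measure_pmf.prob T {x. \<not> snd x}"
      unfolding pmf_map by (rule arg_cong[where f = "measure_pmf.prob T"]) auto
    ultimately show ?thesis using acc by simp
  qed
  have le: "indicator {(z, True)} x + ?c * indicator {x. \<not> snd x} x
     \<le> pmf (if snd x then return_pmf (fst x) else repeat_trial T d (fst x)) z" for x
    using Suc.IH by (cases x) (auto simp: indicator_def)
  have "p * w z + ?c * (1 - p) = measure_pmf.expectation T (\<lambda>x. indicator {(z, True)} x + ?c * indicator {x. \<not> snd x} x)"
    using False_prob T by (subst Bochner_Integration.integral_add)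
      (auto simp: measure_pmf_single intro!: integrable_mult_right integrable_real_indicator simp: less_top[symmetric])
  also have "\<dots> \<le> measure_pmf.expectation T (\<lambda>x. pmf (if snd x then return_pmf (fst x) else repeat_trial T d (fst x)) z)"
    by (intro integral_mono le Bochner_Integration.integrable_add integrable_mult_right integrable_real_indicator
        measure_pmf.integrable_const_bound[where B = 1]) (auto simp: pmf_le_1 less_top[symmetric])
  also have "\<dots> = pmf (repeat_trial T (Suc d) z0) z" by (simp add: pmf_bind)
  finally show ?case by (simp add: algebra_simps)
qed (simp add: w)

section \<open>The rejection sampler and its law\<close>

locale drawing = access_model f A b m n Lg for f A b m n Lg +
  fixes r :: nat and i :: "nat \<Rightarrow> nat" and y :: "nat \<Rightarrow> complex"
  assumes r: "1 \<le> r" and rows: "\<And>k. k < r \<Longrightarrow> i k < m \<and> eucl_norm (Matrix.row A (i k)) \<noteq> 0"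
begin

definition DE :: "(nat \<Rightarrow> nat) \<Rightarrow> (nat \<Rightarrow> complex) \<Rightarrow> bool" where
  "DE nm cm \<longleftrightarrow> nm (adr 2 0) = r \<and> ARR 8 {..<r} i nm \<and> ARR 10 {..<r} (\<lambda>k. rn (i k)) cm \<and> ARR 21 {..<r} y cm \<and> cm (adr 22 0) = complex_of_real (nsq r y)"

lemma DE_nm [simp]: "g < 64 \<Longrightarrow> g \<notin> {2, 8} \<Longrightarrow> DE (nm(adr g k := v)) cm = DE nm cm"
  by (simp add: DE_def)

lemma DE_cm [simp]: "g < 64 \<Longrightarrow> g \<notin> {10, 21, 22} \<Longrightarrow> DE nm (cm(adr g k := v)) = DE nm cm"
  by (simp add: DE_def)

lemma DE_nm0 [simp]: "DE (nm(0 := v)) cm = DE nm cm"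
  using DE_nm[of 0 nm 0 v cm] by (simp add: adr_def)

lemma DE_D:
  "DE nm cm \<Longrightarrow> nm (adr 2 0) = r" "DE nm cm \<Longrightarrow> k < r \<Longrightarrow> nm (adr 8 k) = i k" "DE nm cm \<Longrightarrow> k < r \<Longrightarrow> cm (adr 10 k) = rn (i k)"
  "DE nm cm \<Longrightarrow> k < r \<Longrightarrow> cm (adr 21 k) = y k" "DE nm cm \<Longrightarrow> cm (adr 22 0) = complex_of_real (nsq r y)"
  by (auto simp: DE_def ARR_D)

abbreviation "Sh \<equiv> \<lambda>k l. A $$ (i k, l) / rn (i k)"
definition "num l = (\<Sum>k<r. cnj (Sh k l) * y k)"
definition "den l = (\<Sum>k<r. (cmod (Sh k l))\<^sup>2 * (cmod (y k))\<^sup>2)"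
definition "acc l = flip ((cmod (num l))\<^sup>2 / (real r * den l))"
definition "trial = bind_pmf (pick_from r y (r - 1) 0) (\<lambda>k. bind_pmf (vec_pmf (Matrix.row A (i k))) (\<lambda>l. map_pmf (Pair l) (acc l)))"

lemma samp_pickloopC:
  assumes "DE (nmem s) (cmem s)" "nmem s (adr 13 0) = k" "nmem s (adr 12 0) = 0" "nmem s (adr 11 0) = z" "cmem s (adr 23 0) = complex_of_real (tail r y k)" "k + d + 1 = r"
  shows "samp f M pickloopC s (pick_from r y d k) (\<lambda>x w. time_used w \<le> time_used s + (150 * real d + 50) \<and> samples_used w = samples_used s \<and>
    DE (nmem w) (cmem w) \<and> nmem w (adr 13 0) = x \<and> x < r \<and> nmem w (adr 11 0) = z)"
  using assms
proof (induction d arbitrary: k s)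
  case 0
  let ?g = "BAnd (BNatLess (nS 12) (NConst 1)) (BNatLess (NAdd (nS 13) (NConst 1)) (nS 2))"
  have "\<not> bv f (nmem s) (cmem s) ?g" using 0 by (simp add: DE_D)
  then show ?case unfolding pickloopC_def pick_from.simps by (rule samp_WhileFalse) (use 0 in simp)
next
  case (Suc d)
  let ?g = "BAnd (BNatLess (nS 12) (NConst 1)) (BNatLess (NAdd (nS 13) (NConst 1)) (nS 2))"
  let ?s = "charge (bcost ?g) s"
  have k: "k < r" "Suc k < r" using Suc.prems by auto
  have g: "bv f (nmem s) (cmem s) ?g" using Suc.prems k by (simp add: DE_D)
  have yk: "cmem s (adr 21 k) = y k" using DE_D(4)[OF Suc.prems(1) k(1)] .
  have wt: "y k * cnj (y k) = complex_of_real ((cmod (y k))\<^sup>2)" by (rule cmod_sq[symmetric])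
  let ?Q = "\<lambda>c w. time_used w \<le> time_used ?s + 60 \<and> samples_used w = samples_used s \<and> DE (nmem w) (cmem w) \<and>
      nmem w (adr 13 0) = k \<and> nmem w (adr 12 0) = of_bool c \<and> nmem w (adr 11 0) = z \<and> cmem w (adr 23 0) = complex_of_real (tail r y k)"
  have p: "Re (cv f (nmem ?s) (cmem ?s) (CDiv weightC (cS 23))) = (cmod (y k))\<^sup>2 / tail r y k"
    unfolding weightC_def using Suc.prems(2,5) yk wt by simp
  have coin: "samp f M (Coin (nL 12) (CDiv weightC (cS 23))) ?s (flip ((cmod (y k))\<^sup>2 / tail r y k)) ?Q"
    unfolding flip_def p[symmetric] by (rule samp_Coin) (use Suc.prems in \<open>simp add: nput_def weightC_def charge_def\<close>)
  let ?Q' = "\<lambda>c nm cm. DE nm cm \<and> nm (adr 13 0) = (if c then k else Suc k) \<and> nm (adr 12 0) = of_bool c \<and> nm (adr 11 0) = z \<and> (\<not> c \<longrightarrow> cm (adr 23 0) = complex_of_real (tail r y (Suc k)))"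
  have step: "samp f M pickstepC ?s (flip ((cmod (y k))\<^sup>2 / tail r y k)) (\<lambda>c w. time_used w \<le> time_used s + 150 \<and> samples_used w = samples_used s \<and> ?Q' c (nmem w) (cmem w))"
    unfolding pickstepC_def
  proof (rule samp_weaken[OF samp_Seq_dtr[OF coin, where c = 62 and Q' = ?Q']])
    fix c and w :: state assume w: "?Q c w"
    have y: "cmem w (adr 21 k) = y k" using DE_D(4)[of "nmem w" "cmem w" k] w k by blast
    have t: "complex_of_real (tail r y k) - complex_of_real ((cmod (y k))\<^sup>2) = complex_of_real (tail r y (Suc k))"
      using tail_Suc[OF k(1), of y] by simp
    show "dtr f M (If (BNatLess (nS 12) (NConst 1)) (Seq (CAssign (nL 23) (CSub (cS 23) weightC)) (NAssign (nL 13) (NAdd (nS 13) (NConst 1)))) Skip) 62 (nmem w) (cmem w) (?Q' c)"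
    proof (rule dtr_cost, rule dtr_If, rule dtr_Seq, rule dtr_CAssign, rule dtr_NAssign)
      show "dtr f M Skip 0 (nmem w) (cmem w) (?Q' c)" if "\<not> bv f (nmem w) (cmem w) (BNatLess (nS 12) (NConst 1))"
        by (rule dtr_Skip) (use that w in \<open>cases c; simp\<close>)
    qed (use w y t wt in \<open>cases c; simp add: weightC_def\<close>)+
  qed (use Suc.prems in auto)
  show ?case unfolding pickloopC_def pick_from.simps
  proof (rule samp_WhileTrue[OF g], rule samp_bind[OF step])
    fix c and w :: state assume w: "time_used w \<le> time_used s + 150 \<and> samples_used w = samples_used s \<and> ?Q' c (nmem w) (cmem w)"
    show "samp f M (While ?g pickstepC) w (if c then return_pmf k else pick_from r y d (Suc k)) (\<lambda>x w. time_used w \<le> time_used s + (150 * real (Suc d) + 50) \<and> samples_used w = samples_used s \<and>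
    DE (nmem w) (cmem w) \<and> nmem w (adr 13 0) = x \<and> x < r \<and> nmem w (adr 11 0) = z)"
    proof (cases c)
      case True
      have "\<not> bv f (nmem w) (cmem w) ?g" using w True by simp
      then have "samp f M (While ?g pickstepC) w (return_pmf k) (\<lambda>x w. time_used w \<le> time_used s + (150 * real (Suc d) + 50) \<and> samples_used w = samples_used s \<and>
    DE (nmem w) (cmem w) \<and> nmem w (adr 13 0) = x \<and> x < r \<and> nmem w (adr 11 0) = z)"
        by (rule samp_WhileFalse) (use w True k in simp)
      then show ?thesis using True by simp
    next
      case False
      have "samp f M pickloopC w (pick_from r y d (Suc k)) (\<lambda>x u. time_used u \<le> time_used w + (150 * real d + 50) \<and> samples_used u = samples_used w \<and>
    DE (nmem u) (cmem u) \<and> nmem u (adr 13 0) = x \<and> x < r \<and> nmem u (adr 11 0) = z)"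
        by (rule Suc.IH) (use w False Suc.prems in simp_all)
      then show ?thesis unfolding pickloopC_def using False w by (auto elim!: samp_weaken)
    qed
  qed
qed

lemma evalC:
  assumes P: "DE nm cm" "nm (adr 14 0) = l" "l < n" "nm (adr 11 0) = z"
  shows "dtr f M evalC (500 * (real r * Lg)) nm cm (\<lambda>nm cm. DE nm cm \<and> nm (adr 14 0) = l \<and> nm (adr 11 0) = z \<and> cm (adr 24 0) = num l \<and> cm (adr 25 0) = complex_of_real (den l))"
proof -
  let ?I = "\<lambda>k nm cm. nm (adr 3 0) = k \<and> DE nm cm \<and> nm (adr 14 0) = l \<and> nm (adr 11 0) = z \<and> cm (adr 24 0) = (\<Sum>k<k. cnj (Sh k l) * y k) \<and>
    cm (adr 25 0) = complex_of_real (\<Sum>k<k. (cmod (Sh k l))\<^sup>2 * (cmod (y k))\<^sup>2)"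
  let ?B = "Seq (GetEntry SrcMat (nR 8 (nS 3)) (nS 14) (nL 26)) (Seq (CAssign (nL 26) (CDiv (cS 26) (cR 10 (nS 3))))
    (Seq (CAssign (nL 24) (CAdd (cS 24) (CMul (CConj (cS 26)) (cR 21 (nS 3)))))
      (CAssign (nL 25) (CAdd (cS 25) (CMul (CMul (cS 26) (CConj (cS 26))) (CMul (cR 21 (nS 3)) (CConj (cR 21 (nS 3)))))))))"
  have r1: "1 \<le> real r" using r by simp
  have rL: "1 \<le> real r * Lg" using mult_mono[of 1 "real r" 1 Lg] r1 costs(4) by simp
  have L: "dtr f M (For 3 (nS 2) ?B) (450 * (real r * Lg)) nm cm (?I r)" if "?I 0 (nm(adr 3 0 := 0)) cm" for nm cm
  proof (rule dtr_For_bound[where n = r and I = ?I and c = "Lg + 300" and C = 301])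
    fix k nm cm assume k: "k < r" and I: "?I k nm cm"
    have v: "nm (adr 8 k) = i k" "i k < m" "cm (adr 10 k) = rn (i k)" "cm (adr 21 k) = y k" using I k rows by (auto simp: DE_D)
    have sq: "Sh k l * cnj (Sh k l) * (y k * cnj (y k)) = complex_of_real ((cmod (Sh k l))\<^sup>2 * (cmod (y k))\<^sup>2)"
      by (simp only: of_real_mult cmod_sq)
    have Q: "?I (Suc k) ((nm)(adr 3 0 := Suc k)) (cm(adr 26 0 := e1, adr 26 0 := Sh k l, adr 24 0 := cm (adr 24 0) + cnj (Sh k l) * y k,
        adr 25 0 := cm (adr 25 0) + Sh k l * cnj (Sh k l) * (y k * cnj (y k))))" for e1
      using I unfolding sq by simp
    show "dtr f M ?B (Lg + 300) nm cm (\<lambda>nm' cm'. nm' (adr 3 0) = k \<and> ?I (Suc k) (nm'(adr 3 0 := Suc k)) cm')"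
      by (rule dtr_cost, rule dtr_Seq, rule dtr_GetEntry, (use I v P in simp_all)[2], rule dtr_Seq, rule dtr_CAssign, rule dtr_Seq, rule dtr_CAssign, rule dtr_CAssign)
        (use I v Q[of "A $$ (i k, l)"] costs(1) in \<open>simp_all\<close>)
  qed (use that r1 costs(4) in \<open>auto simp: DE_D\<close>)
  show ?thesis unfolding evalC_def
    by (rule dtr_cost, rule dtr_Seq, rule dtr_CAssign, rule dtr_Seq, rule dtr_CAssign, rule dtr_weaken[OF L _ order.refl])
      (use P rL rL[unfolded mult.commute[of "real r" Lg]] in \<open>auto simp: num_def den_def\<close>)
qed

lemma samp_trialC:
  assumes s: "DE (nmem s) (cmem s)" "nmem s (adr 11 0) = z"
  shows "samp f M trialC s trial (\<lambda>x w. time_used w \<le> time_used s + 900 * (real r * Lg) \<and> samples_used w = Suc (samples_used s) \<and>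
    DE (nmem w) (cmem w) \<and> nmem w 0 = fst x \<and> nmem w (adr 10 0) = of_bool (snd x) \<and> nmem w (adr 11 0) = Suc z)"
  unfolding trialC_def trial_def
proof (rule samp_bind)
  have r1: "1 \<le> real r" using r by simp
  have rL: "1 \<le> real r * Lg" "real r \<le> real r * Lg" "Lg \<le> real r * Lg"
    using mult_mono[of 1 "real r" 1 Lg] mult_left_mono[OF costs(4), of "real r"] mult_right_mono[OF r1, of Lg] r1 costs(4) by auto
  have c1: "250 * real r + (16 + entry_cost A) \<le> 300 * (real r * Lg)" using rL costs(1) by linarith
  let ?P = "\<lambda>t w. time_used w \<le> time_used s + t \<and> samples_used w = samples_used s \<and> DE (nmem w) (cmem w) \<and> nmem w (adr 11 0) = z"
  show "samp f M pickC s (pick_from r y (r - 1) 0) (\<lambda>k w. ?P (250 * real r) w \<and> nmem w (adr 13 0) = k \<and> k < r)"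
    unfolding pickC_def
  proof (rule samp_dtr_Seq)
    show "dtr f M (Seq (NAssign (nL 13) (NConst 0)) (Seq (NAssign (nL 12) (NConst 0)) (CAssign (nL 23) (cS 22)))) 50 (nmem s) (cmem s)
       (\<lambda>nm cm. DE nm cm \<and> nm (adr 13 0) = 0 \<and> nm (adr 12 0) = 0 \<and> nm (adr 11 0) = z \<and> cm (adr 23 0) = complex_of_real (tail r y 0))"
      by (rule dtr_cost, rule dtr_Seq, rule dtr_NAssign, rule dtr_Seq, rule dtr_NAssign, rule dtr_CAssign)
        (use s in \<open>auto simp: DE_D(5) tail_def nsq_def atLeast0LessThan\<close>)
    fix u :: state assume u: "time_used u \<le> time_used s + 50" "samples_used u = samples_used s"
      "DE (nmem u) (cmem u) \<and> nmem u (adr 13 0) = 0 \<and> nmem u (adr 12 0) = 0 \<and> nmem u (adr 11 0) = z \<and> cmem u (adr 23 0) = complex_of_real (tail r y 0)"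
    show "samp f M pickloopC u (pick_from r y (r - 1) 0) (\<lambda>k w. ?P (250 * real r) w \<and> nmem w (adr 13 0) = k \<and> k < r)"
      by (rule samp_weaken[OF samp_pickloopC[where z = z]]) (use u r in \<open>auto simp: of_nat_diff\<close>)
  qed
  fix k and u :: state assume u: "?P (250 * real r) u \<and> nmem u (adr 13 0) = k \<and> k < r"
  have ik: "nmem u (adr 8 k) = i k" "i k < m" "eucl_norm (Matrix.row A (i k)) \<noteq> 0" using u rows by (auto simp: DE_D)
  let ?P' = "\<lambda>t w. time_used w \<le> time_used s + t \<and> samples_used w = Suc (samples_used s) \<and> DE (nmem w) (cmem w) \<and> nmem w (adr 11 0) = z"
  let ?F = "\<lambda>x w. time_used w \<le> time_used s + 900 * (real r * Lg) \<and> samples_used w = Suc (samples_used s) \<and>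
    DE (nmem w) (cmem w) \<and> nmem w 0 = fst x \<and> nmem w (adr 10 0) = of_bool (snd x) \<and> nmem w (adr 11 0) = Suc z"
  show "samp f M (Seq (SampleCol SrcMat (nR 8 (nS 13)) (nL 14)) (Seq evalC
    (Seq (Coin (nL 10) (CDiv (CMul (cS 24) (CConj (cS 24))) (CMul (COfNat (nS 2)) (cS 25))))
      (Seq (NAssign (NConst 0) (nS 14)) (NAssign (nL 11) (NAdd (nS 11) (NConst 1))))))) u (bind_pmf (vec_pmf (Matrix.row A (i k))) (\<lambda>l. map_pmf (Pair l) (acc l))) ?F"
  proof (rule samp_bind)
    have "samp f M (SampleCol SrcMat (nR 8 (nS 13)) (nL 14)) u (vec_pmf (Matrix.row (M SrcMat) (nv (nmem u) (nR 8 (nS 13))))) (\<lambda>l w. ?P' (300 * (real r * Lg)) w \<and> nmem w (adr 14 0) = l \<and> l < n)"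
    proof (rule samp_SampleCol)
      show "nv (nmem u) (nR 8 (nS 13)) < dim_row (M SrcMat)" "eucl_norm (Matrix.row (M SrcMat) (nv (nmem u) (nR 8 (nS 13)))) \<noteq> 0" using u ik by simp_all
      fix l assume "l \<in> set_pmf (vec_pmf (Matrix.row (M SrcMat) (nv (nmem u) (nR 8 (nS 13)))))"
      then have "l \<in> set_pmf (vec_pmf (Matrix.row A (i k)))" using u ik by simp
      then have "l < n" unfolding set_pmf_iff pmf_vec_pmf[OF ik(3)] by (auto split: if_splits)
      then show "?P' (300 * (real r * Lg)) (count_sample (charge (entry_cost (M SrcMat) + ncost (nR 8 (nS 13)) + ncost (nL 14)) (nput (nv (nmem u) (nL 14)) l u))) \<and>
        nmem (count_sample (charge (entry_cost (M SrcMat) + ncost (nR 8 (nS 13)) + ncost (nL 14)) (nput (nv (nmem u) (nL 14)) l u))) (adr 14 0) = l \<and> l < n"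
        using u ik c1 by (auto simp: nput_def)
    qed
    then show "samp f M (SampleCol SrcMat (nR 8 (nS 13)) (nL 14)) u (vec_pmf (Matrix.row A (i k))) (\<lambda>l w. ?P' (300 * (real r * Lg)) w \<and> nmem w (adr 14 0) = l \<and> l < n)"
      using u ik by simp
    fix l and w :: state assume w: "?P' (300 * (real r * Lg)) w \<and> nmem w (adr 14 0) = l \<and> l < n"
    let ?e = "CDiv (CMul (cS 24) (CConj (cS 24))) (CMul (COfNat (nS 2)) (cS 25))"
    show "samp f M (Seq evalC (Seq (Coin (nL 10) ?e) (Seq (NAssign (NConst 0) (nS 14)) (NAssign (nL 11) (NAdd (nS 11) (NConst 1)))))) w (map_pmf (Pair l) (acc l)) ?F"
    proof (rule samp_map, rule samp_dtr_Seq[OF evalC[where l = l and z = z]])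
      fix v :: state assume v: "time_used v \<le> time_used w + 500 * (real r * Lg)" "samples_used v = samples_used w"
        "DE (nmem v) (cmem v) \<and> nmem v (adr 14 0) = l \<and> nmem v (adr 11 0) = z \<and> cmem v (adr 24 0) = num l \<and> cmem v (adr 25 0) = complex_of_real (den l)"
      have "cv f (nmem v) (cmem v) ?e = complex_of_real ((cmod (num l))\<^sup>2 / (real r * den l))"
        using v DE_D(1)[of "nmem v" "cmem v"] by (simp add: cmod_sq[symmetric])
      then have p: "Re (cv f (nmem v) (cmem v) ?e) = (cmod (num l))\<^sup>2 / (real r * den l)" by (simp only: Re_complex_of_real)
      have c: "samp f M (Coin (nL 10) ?e) v (acc l) (\<lambda>c u. ?P' (800 * (real r * Lg) + 50) u \<and> nmem u (adr 14 0) = l \<and> nmem u (adr 10 0) = of_bool c)"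
        unfolding acc_def flip_def p[symmetric] by (rule samp_Coin) (use v w in \<open>simp add: nput_def charge_def\<close>)
      show "samp f M (Seq (Coin (nL 10) ?e) (Seq (NAssign (NConst 0) (nS 14)) (NAssign (nL 11) (NAdd (nS 11) (NConst 1))))) v (acc l) (\<lambda>c. ?F (l, c))"
      proof (rule samp_weaken[OF samp_Seq_dtr[OF c, where c = 30 and Q' = "\<lambda>c nm cm. DE nm cm \<and> nm 0 = l \<and> nm (adr 10 0) = of_bool c \<and> nm (adr 11 0) = Suc z"]])
        fix c and u :: state assume u: "?P' (800 * (real r * Lg) + 50) u \<and> nmem u (adr 14 0) = l \<and> nmem u (adr 10 0) = of_bool c"
        have ne: "adr g 0 \<noteq> 0" if "0 < g" for g using that by (simp add: adr_def)
        show "dtr f M (Seq (NAssign (NConst 0) (nS 14)) (NAssign (nL 11) (NAdd (nS 11) (NConst 1)))) 30 (nmem u) (cmem u) (\<lambda>nm cm. DE nm cm \<and> nm 0 = l \<and> nm (adr 10 0) = of_bool c \<and> nm (adr 11 0) = Suc z)"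
          by (rule dtr_cost, rule dtr_Seq, rule dtr_NAssign, rule dtr_NAssign) (use u ne[of 10] ne[of 11] in simp_all)
      next
        fix c and u :: state
        assume "\<exists>u0. (?P' (800 * (real r * Lg) + 50) u0 \<and> nmem u0 (adr 14 0) = l \<and> nmem u0 (adr 10 0) = of_bool c) \<and> time_used u \<le> time_used u0 + 30 \<and>
          samples_used u = samples_used u0 \<and> DE (nmem u) (cmem u) \<and> nmem u 0 = l \<and> nmem u (adr 10 0) = of_bool c \<and> nmem u (adr 11 0) = Suc z"
        then show "?F (l, c) u" using rL by auto
      qed
    qed (use w in auto)
  qed
qed

lemma samp_drawloopC:
  assumes "DE (nmem s) (cmem s)" "nmem s (adr 10 0) = 0" "nmem s (adr 11 0) = z" "z + d = r" "nmem s 0 = x0"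
  shows "samp f M drawloopC s (repeat_trial trial d x0) (\<lambda>x w. time_used w \<le> time_used s + (real d * (1000 * (real r * Lg)) + 50) \<and> samples_used w \<le> samples_used s + d \<and> nmem w 0 = x)"
  using assms
proof (induction d arbitrary: z s x0)
  case 0
  let ?g = "BAnd (BNatLess (nS 11) (nS 2)) (BNatLess (nS 10) (NConst 1))"
  have "\<not> bv f (nmem s) (cmem s) ?g" using 0 by (simp add: DE_D)
  then show ?case unfolding drawloopC_def repeat_trial.simps by (rule samp_WhileFalse) (use 0 in simp)
next
  case (Suc d)
  let ?g = "BAnd (BNatLess (nS 11) (nS 2)) (BNatLess (nS 10) (NConst 1))"
  have g: "bv f (nmem s) (cmem s) ?g" using Suc.prems by (simp add: DE_D)
  have r1: "1 \<le> real r" using r by simp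
  have rL: "1 \<le> real r * Lg" using mult_mono[of 1 "real r" 1 Lg] r1 costs(4) by simp
  let ?s = "charge (bcost ?g) s"
  have T: "samp f M trialC ?s trial (\<lambda>x w. time_used w \<le> time_used ?s + 900 * (real r * Lg) \<and> samples_used w = Suc (samples_used ?s) \<and>
    DE (nmem w) (cmem w) \<and> nmem w 0 = fst x \<and> nmem w (adr 10 0) = of_bool (snd x) \<and> nmem w (adr 11 0) = Suc z)"
    by (rule samp_trialC) (use Suc.prems in simp_all)
  show ?case unfolding drawloopC_def repeat_trial.simps
  proof (rule samp_WhileTrue[OF g], rule samp_bind[OF T])
    fix x and w :: state assume w: "time_used w \<le> time_used ?s + 900 * (real r * Lg) \<and> samples_used w = Suc (samples_used ?s) \<and>
      DE (nmem w) (cmem w) \<and> nmem w 0 = fst x \<and> nmem w (adr 10 0) = of_bool (snd x) \<and> nmem w (adr 11 0) = Suc z"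
    let ?Q = "\<lambda>x w. time_used w \<le> time_used s + (real (Suc d) * (1000 * (real r * Lg)) + 50) \<and> samples_used w \<le> samples_used s + Suc d \<and> nmem w 0 = x"
    have t: "time_used w + (real d * (1000 * (real r * Lg)) + 50) \<le> time_used s + (real (Suc d) * (1000 * (real r * Lg)) + 50)"
      using w rL by (simp add: algebra_simps)
    show "samp f M (While ?g trialC) w (if snd x then return_pmf (fst x) else repeat_trial trial d (fst x)) ?Q"
    proof (cases "snd x")
      case True
      have "\<not> bv f (nmem w) (cmem w) ?g" using w True by simp
      moreover have "0 \<le> real d * (1000 * (real r * Lg))" using rL by simp
      then have t2: "time_used w + 50 \<le> time_used s + (real (Suc d) * (1000 * (real r * Lg)) + 50)" using t by linarith
      ultimately have "samp f M (While ?g trialC) w (return_pmf (fst x)) ?Q"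
        by (intro samp_WhileFalse) (use w t2 in simp_all)
      then show ?thesis using True by simp
    next
      case False
      have e: "Suc z + d = r" using Suc.prems(4) by simp
      have "samp f M drawloopC w (repeat_trial trial d (fst x)) (\<lambda>x u. time_used u \<le> time_used w + (real d * (1000 * (real r * Lg)) + 50) \<and> samples_used u \<le> samples_used w + d \<and> nmem u 0 = x)"
        by (rule Suc.IH[OF _ _ _ e]) (use w False in simp_all)
      from samp_weaken[OF this, of ?Q] show ?thesis unfolding drawloopC_def using False w t by simp
    qed
  qed
qed

lemma samp_drawC:
  assumes "DE (nmem s) (cmem s)"
  shows "\<exists>x0. samp f M drawC s (repeat_trial trial r x0) (\<lambda>x w. time_used w \<le> time_used s + 1100 * (real r * real r * Lg) \<and> samples_used w \<le> samples_used s + r \<and> nmem w 0 = x)"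
proof (rule exI[of _ "nmem s 0"], unfold drawC_def, rule samp_dtr_Seq)
  have r1: "1 \<le> real r" using r by simp
  have rL: "1 \<le> real r * Lg" using mult_mono[of 1 "real r" 1 Lg] r1 costs(4) by simp
  have rrL: "1 \<le> real r * (real r * Lg)" using mult_mono[of 1 "real r" 1 "real r * Lg"] r1 rL by simp
  have ne: "adr g 0 \<noteq> 0" if "0 < g" for g using that by (simp add: adr_def)
  show "dtr f M (Seq (NAssign (nL 10) (NConst 0)) (NAssign (nL 11) (NConst 0))) 20 (nmem s) (cmem s) (\<lambda>nm cm. DE nm cm \<and> nm (adr 10 0) = 0 \<and> nm (adr 11 0) = 0 \<and> nm 0 = nmem s 0)"
    by (rule dtr_cost, rule dtr_Seq, rule dtr_NAssign, rule dtr_NAssign) (use assms ne[of 10] ne[of 11] in simp_all)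
  fix u :: state assume u: "time_used u \<le> time_used s + 20" "samples_used u = samples_used s" "DE (nmem u) (cmem u) \<and> nmem u (adr 10 0) = 0 \<and> nmem u (adr 11 0) = 0 \<and> nmem u 0 = nmem s 0"
  show "samp f M drawloopC u (repeat_trial trial r (nmem s 0)) (\<lambda>x w. time_used w \<le> time_used s + 1100 * (real r * real r * Lg) \<and> samples_used w \<le> samples_used s + r \<and> nmem w 0 = x)"
    by (rule samp_weaken[OF samp_drawloopC[where z = 0 and d = r]]) (use u rrL in \<open>auto simp: algebra_simps\<close>)
qed

text \<open>Cauchy-Schwarz against the all-ones vector, whence the factor \<open>r\<close>.\<close>

lemma den_num: "(cmod (num l))\<^sup>2 \<le> real r * den l"
proof -
  have "(cmod (num l))\<^sup>2 = (cmod (ip r (\<lambda>k. cnj (Sh k l) * y k) (\<lambda>_. 1)))\<^sup>2" by (simp add: num_def ip_def)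
  also have "\<dots> \<le> nsq r (\<lambda>k. cnj (Sh k l) * y k) * nsq r (\<lambda>_. 1)" by (rule ip_cauchy_schwarz)
  also have "\<dots> = real r * den l" by (simp add: nsq_def den_def norm_mult norm_divide power_mult_distrib power_divide)
  finally show ?thesis .
qed

text \<open>The factor \<open>den\<close> of the proposal cancels against the acceptance
  probability, so a value is proposed and accepted with probability \<open>p\<close> times its
  target weight, and \<open>p\<close> is the total acceptance probability.\<close>

lemma repeat_trial_law:
  assumes y: "0 < nsq r y" and num: "0 < nsq n num"
  defines "p \<equiv> nsq n num / (real r * nsq r y)"
  shows "0 < p" "p \<le> 1" "(1 - (1 - p) ^ d) * (if z < n then (cmod (num z))\<^sup>2 / nsq n num else 0) \<le> pmf (repeat_trial trial d z0) z"
proof -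
  have r1: "0 < real r" using r by simp
  have tail0: "tail r y 0 = nsq r y" by (simp add: tail_def nsq_def atLeast0LessThan)
  have pk: "pmf (pick_from r y (r - 1) 0) k = (if k < r then (cmod (y k))\<^sup>2 / nsq r y else 0)" for k
    using pmf_pick_from[of 0 "r - 1" r y k] r y by (simp add: tail0)
  have set_pk: "set_pmf (pick_from r y (r - 1) 0) \<subseteq> {..<r}" by (auto simp: set_pmf_iff pk[unfolded One_nat_def] split: if_splits)
  have row: "pmf (vec_pmf (Matrix.row A (i k))) l = (if l < n then (cmod (Sh k l))\<^sup>2 else 0)" if "k < r" for k l
    using pmf_vec_pmf[of "Matrix.row A (i k)" l] rows[OF that] by (simp add: norm_divide power_divide)
  \<comment> \<open>Where \<open>den l = 0\<close>, also \<open>num l = 0\<close>, so the equation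
    survives the degenerate quotient.\<close>
  have acc: "pmf (acc l) True * den l = (cmod (num l))\<^sup>2 / real r" for l
  proof (cases "den l = 0")
    case True
    then show ?thesis using den_num[of l] by simp
  next
    case False
    have "0 \<le> den l" unfolding den_def by (intro sum_nonneg) simp
    then have d: "0 < real r * den l" using False r1 by simp
    then have "(cmod (num l))\<^sup>2 / (real r * den l) \<le> 1" using den_num[of l] by simp
    then have "pmf (acc l) True = (cmod (num l))\<^sup>2 / (real r * den l)" unfolding acc_def pmf_flip using d by simp
    then show ?thesis using False r1 by simp
  qed
  have T0: "pmf (bind_pmf (vec_pmf (Matrix.row A (i k))) (\<lambda>l. map_pmf (Pair l) (acc l))) (z, True)
      = (if z < n then (cmod (Sh k z))\<^sup>2 * pmf (acc z) True else 0)" if k: "k < r" for k z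
  proof -
    have fin: "set_pmf (vec_pmf (Matrix.row A (i k))) \<subseteq> {..<n}" by (auto simp: set_pmf_iff row[OF k] split: if_splits)
    have pr: "pmf (map_pmf (Pair l) (acc l)) (z, True) = (if l = z then pmf (acc z) True else 0)" for l
    proof (cases "l = z")
      case True
      then show ?thesis using pmf_map_inj'[of "Pair z" "acc z" True] by (simp add: inj_on_def)
    next
      case False
      then have "(z, True) \<notin> set_pmf (map_pmf (Pair l) (acc l))" by auto
      then show ?thesis using False by (simp add: pmf_eq_0_set_pmf del: set_map_pmf)
    qed
    have "pmf (bind_pmf (vec_pmf (Matrix.row A (i k))) (\<lambda>l. map_pmf (Pair l) (acc l))) (z, True)
        = (\<Sum>l<n. (if l = z then pmf (acc z) True else 0) * pmf (vec_pmf (Matrix.row A (i k))) l)"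
      unfolding pmf_bind pr by (rule integral_measure_pmf_real) (use fin in auto)
    also have "\<dots> = (\<Sum>l<n. if l = z then (cmod (Sh k z))\<^sup>2 * pmf (acc z) True else 0)"
      by (intro sum.cong refl) (simp add: row[OF k])
    finally show ?thesis by simp
  qed
  have T: "pmf trial (z, True) = p * (if z < n then (cmod (num z))\<^sup>2 / nsq n num else 0)" for z
  proof -
    have "pmf trial (z, True) = (\<Sum>k<r. pmf (bind_pmf (vec_pmf (Matrix.row A (i k))) (\<lambda>l. map_pmf (Pair l) (acc l))) (z, True) * pmf (pick_from r y (r - 1) 0) k)"
      unfolding trial_def pmf_bind[of "pick_from r y (r - 1) 0"] by (rule integral_measure_pmf_real) (use set_pk in auto)
    also have "\<dots> = (\<Sum>k<r. (if z < n then (cmod (Sh k z))\<^sup>2 * pmf (acc z) True else 0) * ((cmod (y k))\<^sup>2 / nsq r y))"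
      by (intro sum.cong refl) (simp only: T0 pk lessThan_iff if_True)
    also have "\<dots> = (if z < n then pmf (acc z) True * den z / nsq r y else 0)"
      by (simp add: den_def sum_distrib_left sum_distrib_right sum_divide_distrib mult_ac)
    also have "\<dots> = p * (if z < n then (cmod (num z))\<^sup>2 / nsq n num else 0)"
      unfolding acc p_def using num y r1 by (simp add: field_simps)
    finally show ?thesis .
  qed
  have acc_total: "pmf (map_pmf snd trial) True = p"
  proof -
    have sub: "set_pmf trial \<subseteq> {..<n} \<times> UNIV"
      unfolding trial_def using set_pk by (auto simp: set_pmf_iff row split: if_splits)
    have "pmf (map_pmf snd trial) True = measure_pmf.prob trial (snd -` {True})" by (simp add: pmf_map)
    also have "\<dots> = measure_pmf.prob trial ((\<lambda>z. (z, True)) ` {..<n})"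
      by (rule measure_pmf.finite_measure_eq_AE) (use sub in \<open>auto simp: AE_measure_pmf_iff image_iff\<close>)
    also have "\<dots> = (\<Sum>z<n. pmf trial (z, True))"
      by (subst measure_measure_pmf_finite) (auto simp: sum.reindex inj_on_def)
    also have "\<dots> = p * (nsq n num / nsq n num)"
    proof -
      have "(\<Sum>z<n. pmf trial (z, True)) = (\<Sum>z<n. p * ((cmod (num z))\<^sup>2 / nsq n num))" by (intro sum.cong) (simp_all add: T)
      then show ?thesis by (simp only: sum_distrib_left[symmetric] sum_divide_distrib[symmetric] nsq_def[of n num, symmetric])
    qed
    finally show ?thesis using num by simp
  qed
  show p0: "0 < p" unfolding p_def using num y r1 by simp
  show p1: "p \<le> 1" unfolding acc_total[symmetric] by (rule pmf_le_1)
  show "(1 - (1 - p) ^ d) * (if z < n then (cmod (num z))\<^sup>2 / nsq n num else 0) \<le> pmf (repeat_trial trial d z0) z"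
    by (rule pmf_repeat_trial[OF T _ _ p1 acc_total]) (use p0 in \<open>auto intro: divide_nonneg_nonneg\<close>)
qed

end

section \<open>The Lanczos recurrence\<close>

context memory_env
begin

lemma top_cong: "(\<And>a. a < r \<Longrightarrow> w a = w' a) \<Longrightarrow> top w = top w'"
  unfolding top_def adjmul_def by (intro ext if_cong sum.cong refl arg_cong2[where f = times] arg_cong2[where f = divide]) auto

lemma top_sum: "a < r \<Longrightarrow> top (\<lambda>b. \<Sum>k\<in>I. c k * w k b) a = (\<Sum>k\<in>I. c k * top (w k) a)"
proof -
  assume a: "a < r"
  have "adjmul (\<lambda>b. \<Sum>k\<in>I. c k * w k b) l = (\<Sum>k\<in>I. c k * adjmul (w k) l)" for l
  proof -
    have "(\<Sum>b<r. cnj (Mh b l) * (\<Sum>k\<in>I. c k * w k b)) = (\<Sum>k\<in>I. c k * (\<Sum>b<r. cnj (Mh b l) * w k b))"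
      unfolding sum_distrib_left by (subst sum.swap) (simp add: mult_ac)
    then show ?thesis unfolding adjmul_def sum_divide_distrib[of _ I] by (simp add: sum_divide_distrib[of _ I])
  qed
  then have "top (\<lambda>b. \<Sum>k\<in>I. c k * w k b) a = (\<Sum>l<r. \<Sum>k\<in>I. Mh a l * (c k * adjmul (w k) l))"
    using a by (simp add: top_def sum_distrib_left)
  also have "\<dots> = (\<Sum>k\<in>I. c k * top (w k) a)"
    using a by (subst sum.swap) (simp add: top_def sum_distrib_left mult_ac)
  finally show ?thesis .
qed

lemma top_entry: "k < r \<Longrightarrow> top w k = (\<Sum>k'<r. (\<Sum>l<r. Mh k l * cnj (Mh k' l) / (of_nat r * nn l)) * w k')"
  unfolding sum_distrib_right by (subst sum.swap) (simp add: top_def adjmul_def sum_distrib_left sum_divide_distrib mult_ac)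

text \<open>The range of \<open>top\<close> lies in the column space of the stored array, so a
  factorisation of that array through \<open>I\<close> bounds its dimension by the size of
  \<open>I\<close>.\<close>

lemma top_span:
  assumes "\<And>k z. k < r \<Longrightarrow> z < r \<Longrightarrow> Mh k z = (\<Sum>t\<in>I. C t z * B t k)"
  shows "\<exists>c. \<forall>k<r. top w k = (\<Sum>t\<in>I. c t * B t k)"
proof (intro exI allI impI)
  fix k assume k: "k < r"
  have "top w k = (\<Sum>z<r. \<Sum>t\<in>I. adjmul w z * C t z * B t k)"
    using k by (auto simp: top_def assms sum_distrib_left sum_distrib_right mult_ac intro!: sum.cong)
  also have "\<dots> = (\<Sum>t\<in>I. (\<Sum>z<r. adjmul w z * C t z) * B t k)"
    by (subst sum.swap) (simp add: sum_distrib_right)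
  finally show "top w k = (\<Sum>t\<in>I. (\<Sum>z<r. adjmul w z * C t z) * B t k)" .
qed

lemma top_selfadjoint:
  assumes nn: "\<forall>l<r. cnj (nn l) = nn l"
  shows "ip r (top p) q = ip r p (top q)"
proof -
  have L: "ip r (top p) q = (\<Sum>l<r. (\<Sum>a<r. cnj (Mh a l) * p a) * cnj (\<Sum>a<r. cnj (Mh a l) * q a) / (of_nat r * nn l))" for p q
  proof -
    have "ip r (top p) q = (\<Sum>a<r. \<Sum>l<r. Mh a l * adjmul p l * cnj (q a))" by (simp add: ip_def top_def sum_distrib_right)
    also have "\<dots> = (\<Sum>l<r. adjmul p l * cnj (\<Sum>a<r. cnj (Mh a l) * q a))"
      by (subst sum.swap) (simp add: sum_distrib_left mult_ac)
    finally show ?thesis by (simp add: adjmul_def)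
  qed
  have "ip r p (top q) = cnj (ip r (top q) p)" by (rule ip_cnj)
  also have "\<dots> = ip r (top p) q" unfolding L cnj_sum by (intro sum.cong refl) (simp add: nn mult.commute)
  finally show ?thesis by simp
qed

lemma top_lz: "1 \<le> k \<Longrightarrow> top (lz k) a = lz (Suc k) a + al k * lz k a + be k * lz (k - 1) a"
  by (simp add: lz_Suc)

lemma ip_top_lz: "1 \<le> k \<Longrightarrow> ip r (top (lz k)) q = ip r (lz (Suc k)) q + al k * ip r (lz k) q + be k * ip r (lz (k - 1)) q"
  unfolding ip_def by (simp add: top_lz algebra_simps sum.distrib sum_distrib_left)

lemma ip_lz_top:
  assumes nn: "\<forall>l<r. cnj (nn l) = nn l" and k: "1 \<le> k"
  shows "ip r (top p) (lz k) = cnj (ip r (lz (Suc k)) p + al k * ip r (lz k) p + be k * ip r (lz (k - 1)) p)"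
proof -
  have "ip r (top p) (lz k) = ip r p (top (lz k))" by (rule top_selfadjoint[OF nn])
  also have "\<dots> = cnj (ip r (top (lz k)) p)" by (rule ip_cnj)
  finally show ?thesis unfolding ip_top_lz[OF k] .
qed

lemma gg_real: "cnj (gg k) = gg k" by (simp add: gg_def ip_self)

text \<open>\<open>top\<close> is self-adjoint, so it can be moved to the vector with smaller index,
  where the recurrence produces vectors that are orthogonal by induction. Non-vanishing up to
  \<open>d\<close> gives orthogonality up to \<open>d + 1\<close>, which covers the first vector
  that may be zero.\<close>

lemma lz_orthogonal:
  assumes nn: "\<forall>l<r. cnj (nn l) = nn l" and nz: "\<And>k. 1 \<le> k \<Longrightarrow> k \<le> d \<Longrightarrow> gg k \<noteq> 0"
  shows "e \<le> Suc d \<Longrightarrow> k < e \<Longrightarrow> ip r (lz e) (lz k) = 0"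
proof (induction e arbitrary: k rule: less_induct)
  case (less e)
  have lz0: "ip r p (lz 0) = 0" "ip r (lz 0) p = 0" for p by (simp_all add: ip_def)
  show ?case
  proof (cases "k = 0 \<or> e = 1")
    case True
    then show ?thesis using less.prems lz0 by auto
  next
    case False
    define q where "q = e - 1"
    have q: "e = Suc q" "1 \<le> q" "q \<le> d" "1 \<le> k" "k \<le> q" using False less.prems by (auto simp: q_def)
    have ih: "ip r (lz x) (lz z) = 0" if "x \<le> q" "z < x" for x z using less.IH[of x z] that q less.prems(1) by simp
    have ih': "ip r (lz z) (lz x) = 0" if "x \<le> q" "z < x" for x z using ih[OF that] ip_cnj[of r "lz z" "lz x"] by simp
    have E: "ip r (lz e) (lz k) = ip r (top (lz q)) (lz k) - al q * ip r (lz q) (lz k) - be q * ip r (lz (q - 1)) (lz k)"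
      unfolding q(1) ip_top_lz[OF q(2)] by simp
    \<comment> \<open>The choice of \<open>al\<close> removes the component along the last vector
      and that of \<open>be\<close> the one before it; all earlier components vanish by
      self-adjointness.\<close>
    consider "k = q" | "k = q - 1" "k < q" | "k < q - 1" using q by linarith
    then show ?thesis
    proof cases
      case 1
      have "ip r (lz (q - 1)) (lz q) = 0" using ih'[of q "q - 1"] q by simp
      moreover have "al q * gg q = ip r (top (lz q)) (lz q)" unfolding al_def using nz[OF q(2,3)] by simp
      ultimately show ?thesis unfolding E using 1 by (simp add: gg_def)
    next
      case 2
      have sk: "Suc k = q" using 2 by simp
      have "ip r (top (lz q)) (lz k) = cnj (gg q)"
        unfolding ip_lz_top[OF nn q(4)] using ih'[of q k] ih'[of q "k - 1"] 2 sk ih[of q k] ih[of q "k - 1"] by (simp add: gg_def)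
      moreover have "be q * ip r (lz (q - 1)) (lz k) = gg q"
        using 2 nz[of k] q by (simp add: be_def gg_def[symmetric])
      ultimately show ?thesis unfolding E using ih[of q k] 2 by (simp add: gg_real)
    next
      case 3
      have "ip r (top (lz q)) (lz k) = 0"
        unfolding ip_lz_top[OF nn q(4)] using ih'[of q "Suc k"] ih'[of q k] ih'[of q "k - 1"] 3 by simp
      then show ?thesis unfolding E using ih[of q k] ih[of "q - 1" k] 3 by simp
    qed
  qed
qed

text \<open>The vectors \<open>top (lz 1), \<dots>, top (lz (d - 1))\<close> are linearly independent, because each of them
  involves a Lanczos vector that none of its predecessors involves.\<close>

lemma lanczos_terminates:
  assumes nn: "\<forall>l<r. cnj (nn l) = nn l" and I: "finite I"
    and span: "\<And>w. \<exists>c. \<forall>a<r. top w a = (\<Sum>t\<in>I. c t * B t a)"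
    and nz: "\<And>k. 1 \<le> k \<Longrightarrow> k \<le> d \<Longrightarrow> nsq r (lz k) \<noteq> 0"
  shows "d \<le> card I + 1"
proof (rule ccontr)
  assume "\<not> ?thesis"
  then have d: "card I < d - 1" by simp
  have gz: "gg k \<noteq> 0" if "1 \<le> k" "k \<le> d" for k using nz[OF that] by (simp add: gg_def ip_self)
  have "\<forall>k. \<exists>c. \<forall>a<r. top (lz k) a = (\<Sum>t\<in>I. c t * B t a)" using span by blast
  from choice[OF this] obtain c where c: "\<forall>k. \<forall>a<r. top (lz k) a = (\<Sum>t\<in>I. c k t * B t a)" ..
  obtain g where g: "\<exists>k\<in>{1..<d}. g k \<noteq> 0" "\<forall>t\<in>I. (\<Sum>k\<in>{1..<d}. g k * c k t) = 0"
    using homogeneous_system[of I "{1..<d}" c] I d by auto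
  define e where "e = Max {k \<in> {1..<d}. g k \<noteq> 0}"
  have "e \<in> {k \<in> {1..<d}. g k \<noteq> 0}" unfolding e_def by (rule Max_in) (use g(1) in auto)
  then have e: "1 \<le> e" "e < d" "g e \<noteq> 0" by auto
  have emax: "g k = 0" if "k \<in> {1..<d}" "e < k" for k
  proof (rule ccontr)
    assume "g k \<noteq> 0"
    then have "k \<le> e" unfolding e_def using that by (intro Max_ge) auto
    then show False using that by simp
  qed
  have zero: "(\<Sum>k\<in>{1..<d}. g k * top (lz k) a) = 0" if "a < r" for a
  proof -
    have "(\<Sum>k\<in>{1..<d}. g k * top (lz k) a) = (\<Sum>k\<in>{1..<d}. \<Sum>t\<in>I. g k * (c k t * B t a))" using c that by (simp add: sum_distrib_left)
    also have "\<dots> = (\<Sum>t\<in>I. (\<Sum>k\<in>{1..<d}. g k * c k t) * B t a)" by (subst sum.swap) (simp add: sum_distrib_right mult.assoc)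
    finally show ?thesis using g(2) by simp
  qed
  have orth: "ip r (lz x) (lz (Suc e)) = 0" if "x < Suc e" for x
    using lz_orthogonal[of d "Suc e" x, OF nn gz] that e ip_cnj[of r "lz x" "lz (Suc e)"] by simp
  have "0 = ip r (\<lambda>a. \<Sum>k\<in>{1..<d}. g k * top (lz k) a) (lz (Suc e))" by (simp add: ip_def zero[unfolded One_nat_def])
  also have "\<dots> = (\<Sum>k\<in>{1..<d}. g k * ip r (top (lz k)) (lz (Suc e)))" by (rule ip_sum_left)
  also have "\<dots> = (\<Sum>k\<in>{1..<d}. if k = e then g e * gg (Suc e) else 0)"
  proof (intro sum.cong refl)
    fix k assume k: "k \<in> {1..<d}"
    consider "e < k" | "k = e" | "k < e" by linarith
    then show "g k * ip r (top (lz k)) (lz (Suc e)) = (if k = e then g e * gg (Suc e) else 0)"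
    proof cases
      case 1
      then show ?thesis using emax[OF k] by simp
    next
      case 2
      then show ?thesis using e orth[of e] orth[of "e - 1"] by (simp add: ip_top_lz gg_def)
    next
      case 3
      then show ?thesis using k orth[of "Suc k"] orth[of k] orth[of "k - 1"] by (simp add: ip_top_lz)
    qed
  qed
  also have "\<dots> = g e * gg (Suc e)" using e by simp
  finally show False using e gz[of "Suc e"] by simp
qed

definition restrict :: "(nat \<Rightarrow> complex) \<Rightarrow> nat \<Rightarrow> complex" where "restrict w = (\<lambda>a. if a < r then w a else 0)"

text \<open>Scaling the start vector and cutting it off at \<open>r\<close> pass through the scheme.
  This allows vectors that agree below \<open>r\<close> to be exchanged, although the scheme
  compares whole functions.\<close>

lemma castel_restrict:
  "castel top h jj ii (\<lambda>a. restrict (\<lambda>a. c * w a) a) = restrict (\<lambda>a. c * castel top h jj ii w a)"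
proof -
  have 1: "top (restrict (\<lambda>a. c * w a)) = restrict (\<lambda>a. c * top w a)" for w
  proof
    fix a
    have "top (restrict (\<lambda>a. c * w a)) = top (\<lambda>a. \<Sum>k\<in>{()}. c * w a)" by (rule top_cong) (simp add: restrict_def)
    then show "top (restrict (\<lambda>a. c * w a)) a = restrict (\<lambda>a. c * top w a) a"
      using top_sum[where a = a and I = "{()}" and c = "\<lambda>_. c" and w = "\<lambda>_. w"] by (cases "a < r") (simp_all add: restrict_def top_def)
  qed
  show ?thesis
    by (rule castel_intertwine[where L = "\<lambda>w. restrict (\<lambda>a. c * w a)" and T = top and T' = top, symmetric])
      (rule 1[symmetric] | simp add: restrict_def fun_eq_iff algebra_simps)+
qed

text \<open>Summation by index shifts: the tridiagonal matrix acts on the coefficients, its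
  transpose on the values \<open>F k\<close>. The boundary terms vanish because \<open>F\<close> is
  0 at both ends; for Lanczos vectors these are the zero vector at index 0 and the vanishing one at
  index \<open>K\<close>.\<close>

lemma tridiagonal_sum:
  fixes F w \<alpha> \<beta> :: "nat \<Rightarrow> complex"
  assumes F: "F 0 = 0" "F K = 0" and K: "1 \<le> K"
  shows "(\<Sum>k<K. (if 1 \<le> k \<and> k < K then \<alpha> k * w k + (if 2 \<le> k then w (k - 1) else 0) + (if Suc k < K then \<beta> (Suc k) * w (Suc k) else 0) else 0) * F k)
    = (\<Sum>k<K. if 1 \<le> k then w k * (F (Suc k) + \<alpha> k * F k + \<beta> k * F (k - 1)) else 0)"
proof -
  obtain K' where K': "K = Suc K'" using K by (cases K) auto
  have A: "(\<Sum>k<K. if Suc k < K then \<beta> (Suc k) * w (Suc k) * F k else 0) = (\<Sum>k<K. if 1 \<le> k then w k * (\<beta> k * F (k - 1)) else 0)"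
    unfolding K' by (subst sum.lessThan_Suc, subst sum.lessThan_Suc_shift) (simp add: mult_ac)
  have B: "(\<Sum>k<K. (if 2 \<le> k then w (k - 1) else 0) * F k) = (\<Sum>k<K. if 1 \<le> k then w k * F (Suc k) else 0)"
  proof -
    have "(\<Sum>k<K. (if 2 \<le> k then w (k - 1) else 0) * F k) = (\<Sum>k<K'. if 1 \<le> k then w k * F (Suc k) else 0)"
      unfolding K' by (subst sum.lessThan_Suc_shift) (auto intro!: sum.cong)
    also have "\<dots> = (\<Sum>k<K. if 1 \<le> k then w k * F (Suc k) else 0)" using F(2) unfolding K' by simp
    finally show ?thesis .
  qed
  have rhs: "(\<Sum>k<K. if 1 \<le> k then w k * (F (Suc k) + \<alpha> k * F k + \<beta> k * F (k - 1)) else 0)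
     = (\<Sum>k<K. if 1 \<le> k then w k * (\<alpha> k * F k) else 0) + ((\<Sum>k<K. if 1 \<le> k then w k * F (Suc k) else 0) + (\<Sum>k<K. if 1 \<le> k then w k * (\<beta> k * F (k - 1)) else 0))"
    unfolding sum.distrib[symmetric] by (intro sum.cong refl) (simp add: algebra_simps)
  have "(\<Sum>k<K. (if 1 \<le> k \<and> k < K then \<alpha> k * w k + (if 2 \<le> k then w (k - 1) else 0) + (if Suc k < K then \<beta> (Suc k) * w (Suc k) else 0) else 0) * F k)
     = (\<Sum>k<K. (if 1 \<le> k then w k * (\<alpha> k * F k) else 0) + ((if 2 \<le> k then w (k - 1) else 0) * F k + (if Suc k < K then \<beta> (Suc k) * w (Suc k) * F k else 0)))"
    using F(1) by (intro sum.cong refl) (auto simp: algebra_simps not_le)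
  also have "\<dots> = (\<Sum>k<K. if 1 \<le> k then w k * (F (Suc k) + \<alpha> k * F k + \<beta> k * F (k - 1)) else 0)"
    unfolding sum.distrib A B by (rule rhs[symmetric])
  finally show ?thesis .
qed

text \<open>The map from coefficients to combinations of Lanczos vectors intertwines
  \<open>tri\<close> with \<open>top\<close>, because the vanishing of \<open>lz K\<close> makes
  their span invariant. So the cheap tridiagonal table gives the full operator polynomial without
  error.\<close>

lemma lanczos_castel:
  assumes K: "1 \<le> K" "nsq r (lz K) = 0" and a: "a < r"
  shows "yy K h a = castel top h r 0 bh a"
proof -
  let ?L = "\<lambda>c. restrict (\<lambda>a. \<Sum>k<K. c k * lz k a)"
  have comm: "?L (tri K w) = top (?L w)" for w
  proof
    fix a
    show "?L (tri K w) a = top (?L w) a"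
    proof (cases "a < r")
      case True
      have "top (?L w) = top (\<lambda>a. \<Sum>k<K. w k * lz k a)" by (rule top_cong) (simp add: restrict_def)
      then have "top (?L w) a = (\<Sum>k<K. w k * top (lz k) a)" using top_sum[OF True] by simp
      also have "\<dots> = (\<Sum>k<K. if 1 \<le> k then w k * (lz (Suc k) a + al k * lz k a + be k * lz (k - 1) a) else 0)"
      proof (intro sum.cong refl)
        fix k
        have "top (lz 0) a = 0" by (simp add: top_def adjmul_def)
        then show "w k * top (lz k) a = (if 1 \<le> k then w k * (lz (Suc k) a + al k * lz k a + be k * lz (k - 1) a) else 0)"
          by (cases "k = 0") (simp_all add: top_lz)
      qed
      also have "\<dots> = ?L (tri K w) a"
        unfolding restrict_def tri_def using True K by (subst tridiagonal_sum[symmetric]) (auto simp: nsq_eq_0)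
      finally show ?thesis by simp
    qed (simp add: restrict_def top_def)
  qed
  have "?L (castel (tri K) h r 0 e1) = castel top h r 0 (?L e1)"
    by (rule castel_intertwine[where L = ?L]) (rule comm | simp add: restrict_def fun_eq_iff sum.distrib sum_subtractf sum_distrib_left algebra_simps)+
  moreover have "?L e1 = restrict (\<lambda>a. 1 * bh a)"
  proof
    fix a
    have "(\<Sum>k<K. e1 k * lz k a) = (if 1 < K then bh a else 0)"
      by (simp add: e1_def if_distrib[of "\<lambda>z. z * _"] sum.delta cong: if_cong)
    \<comment> \<open>\<open>K = 1\<close> means that the sampled vector is zero: there is no
      coefficient with index 1, and both sides are 0.\<close>
    moreover have "bh a = 0" if "\<not> 1 < K" "a < r" using K that by (auto simp: nsq_eq_0 le_less)
    ultimately show "?L e1 a = restrict (\<lambda>a. 1 * bh a) a" by (auto simp: restrict_def)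
  qed
  ultimately have "?L (castel (tri K) h r 0 e1) a = castel top h r 0 (restrict (\<lambda>a. 1 * bh a)) a" by simp
  also have "\<dots> = castel top h r 0 bh a" using castel_restrict[of h r 0 1 bh] a by (simp add: restrict_def)
  finally show ?thesis using a by (simp add: yy_def restrict_def)
qed

end

context sampling_program
begin

lemma scaled_forms:
  assumes i: "i \<in> set_pmf rowsP" and k: "k < r"
  shows "S i k l = complex_of_real (sqrt (F2 / real r)) * (A $$ (i k, l) / rn (i k))"
    "bs (\<lambda>z. b $ z) i k = complex_of_real (sqrt (F2 / real r)) * bh i k"
proof -
  have ik: "i k < m" "nsq n (a (i k)) > 0" using rowsD[OF i k] by auto
  have e: "eucl_norm (Matrix.row A (i k)) = sqrt (nsq n (a (i k)))"
    using row_norm[OF ik(1)] eucl_norm_nonneg by (metis real_sqrt_unique)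
  have q: "sqrt (F2 / (real r * nsq n (a (i k)))) = sqrt (F2 / real r) / eucl_norm (Matrix.row A (i k))"
    unfolding e by (simp add: real_sqrt_divide[symmetric])
  show "S i k l = complex_of_real (sqrt (F2 / real r)) * (A $$ (i k, l) / rn (i k))"
    unfolding scaled_rows_def q by (simp add: a_def)
  show "bs (\<lambda>z. b $ z) i k = complex_of_real (sqrt (F2 / real r)) * bh i k"
    unfolding scaled_entries_def q by simp
qed

lemma nh_real: "nh i j l = complex_of_real (nsq r (\<lambda>k. Mh i j k l))"
  by (simp add: ip_self[symmetric] ip_def)

text \<open>The omitted factor \<open>sqrt (F2 / r)\<close> multiplies the entries of
  \<open>S\<close> and its column norms alike, so it drops out of the scaled columns; the scale
  \<open>F2\<close> that remains in their products is the divisor of the normalised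
  operator.\<close>

lemma tops_sop:
  assumes i: "i \<in> set_pmf rowsP" and j: "j \<in> set_pmf (colsP i)"
  shows "tops i j = sop r (gram r (adj (W i j))) F2"
proof (intro ext)
  fix w k
  interpret memory_env r i j "\<lambda>_. 0" "\<lambda>k. rn (i k)" "bh i" "Mh i j" "nh i j" f M by unfold_locales (use r in simp)
  have r0: "0 < real r" using r by simp
  show "tops i j w k = sop r (gram r (adj (W i j))) F2 w k"
  proof (cases "k < r")
    case True
    have W: "W i j k l * cnj (W i j k' l) = complex_of_real F2 * (Mh i j k l * cnj (Mh i j k' l) / (of_nat r * nh i j l))" if l: "l < r" and k': "k' < r" for l k'
    proof -
      define q where "q = nsq r (\<lambda>k. Mh i j k l)"
      have c: "nsq r (\<lambda>k. S i k (j l)) = F2 / real r * q"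
      proof -
        have "nsq r (\<lambda>k. S i k (j l)) = nsq r (\<lambda>k. complex_of_real (sqrt (F2 / real r)) * Mh i j k l)"
          by (rule nsq_cong) (simp add: scaled_forms[OF i])
        also have "\<dots> = (cmod (complex_of_real (sqrt (F2 / real r))))\<^sup>2 * q" unfolding q_def by (rule nsq_scale)
        finally show ?thesis using F2 r0 by simp
      qed
      then have q0: "0 < q" using col_norm_pos[OF i j l] F2 r0 by (simp add: zero_less_mult_iff zero_less_divide_iff)
      have "sqrt (F2 / (real r * nsq r (\<lambda>k. S i k (j l)))) * sqrt (F2 / real r) = sqrt (F2 / (real r * q))"
        unfolding c using F2 r0 q0 by (simp add: real_sqrt_mult[symmetric])
      then have e: "W i j z l = complex_of_real (sqrt (F2 / (real r * q))) * Mh i j z l" if "z < r" for z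
        unfolding scaled_columns_def using that by (simp add: scaled_forms[OF i] mult.assoc[symmetric] del: of_real_mult flip: of_real_mult)
      have sq: "complex_of_real (sqrt (F2 / (real r * q))) * complex_of_real (sqrt (F2 / (real r * q))) = complex_of_real (F2 / (real r * q))"
        using F2 r0 q0 by (simp flip: of_real_mult)
      have "W i j k l * cnj (W i j k' l) = (complex_of_real (sqrt (F2 / (real r * q))) * complex_of_real (sqrt (F2 / (real r * q)))) * (Mh i j k l * cnj (Mh i j k' l))"
        unfolding e[OF True] e[OF k'] by simp
      then show ?thesis unfolding sq nh_real q_def[symmetric] by simp
    qed
    define E where "E = (\<lambda>k' l. Mh i j k l * cnj (Mh i j k' l) / (of_nat r * nh i j l))"
    have inner: "(\<Sum>l<r. W i j k l * cnj (W i j k' l)) = complex_of_real F2 * (\<Sum>l<r. E k' l)" if "k' < r" for k'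
      unfolding sum_distrib_left[of _ "E k'" "{..<r}"] by (intro sum.cong refl) (simp only: E_def lessThan_iff W that)
    have "sop r (gram r (adj (W i j))) F2 w k = (\<Sum>k'<r. (\<Sum>l<r. W i j k l * cnj (W i j k' l)) * w k') / complex_of_real F2"
      using True by (simp add: sop_def mop_def gram_def adj_def)
    also have "(\<Sum>k'<r. (\<Sum>l<r. W i j k l * cnj (W i j k' l)) * w k') = complex_of_real F2 * (\<Sum>k'<r. (\<Sum>l<r. E k' l) * w k')"
      unfolding sum_distrib_left[of _ "\<lambda>k'. (\<Sum>l<r. E k' l) * w k'" "{..<r}"] by (intro sum.cong refl) (simp only: inner lessThan_iff mult.assoc)
    also have "\<dots> / complex_of_real F2 = tops i j w k" unfolding top_entry[OF True] E_def using F2 by simp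
    finally show ?thesis by simp
  next
    case False
    then show ?thesis unfolding top_def sop_def by simp
  qed
qed

lemma prepared_vector:
  assumes i: "i \<in> set_pmf rowsP" and j: "j \<in> set_pmf (colsP i)" and K: "1 \<le> K" "nsq r (lzs i j K) = 0" and k: "k < r"
  shows "castel (sop r (gram r (adj (W i j))) F2) h r 0 (bs (\<lambda>z. b $ z) i) k = complex_of_real (sqrt (F2 / real r)) * ys i j K h k"
proof -
  interpret memory_env r i j "\<lambda>_. 0" "\<lambda>k. rn (i k)" "bh i" "Mh i j" "nh i j" f M by unfold_locales (use r in simp)
  let ?c = "complex_of_real (sqrt (F2 / real r))"
  have R: "restrict (\<lambda>z. 1 * bs (\<lambda>z. b $ z) i z) = restrict (\<lambda>z. ?c * bh i z)"
    by (auto simp: restrict_def fun_eq_iff scaled_forms(2)[OF i])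
  have "castel top h r 0 (bs (\<lambda>z. b $ z) i) k = castel top h r 0 (restrict (\<lambda>z. 1 * bs (\<lambda>z. b $ z) i z)) k"
    using castel_restrict[of h r 0 1 "bs (\<lambda>z. b $ z) i"] k by (simp add: restrict_def)
  also have "\<dots> = ?c * castel top h r 0 (bh i) k"
    unfolding R using castel_restrict[of h r 0 ?c "bh i"] k by (simp add: restrict_def)
  finally show ?thesis unfolding tops_sop[OF i j, symmetric] lanczos_castel[OF K k] .
qed

text \<open>The singular value decomposition factors the stored array through the nonzero singular
  values: sampling rows and columns cannot raise the rank.\<close>

lemma lanczos_rank:
  assumes i: "i \<in> set_pmf rowsP" and j: "j \<in> set_pmf (colsP i)" and s: "svd_data m n l A s u v"
    and nz: "\<And>k. 1 \<le> k \<Longrightarrow> k \<le> d \<Longrightarrow> nsq r (lzs i j k) \<noteq> 0"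
  shows "d \<le> card {t. t < l \<and> s t \<noteq> 0} + 1"
proof -
  interpret memory_env r i j "\<lambda>_. 0" "\<lambda>k. rn (i k)" "bh i" "Mh i j" "nh i j" f M by unfold_locales (use r in simp)
  let ?I = "{t. t < l \<and> s t \<noteq> 0}"
  have entry: "A $$ (i k, j z) = (\<Sum>t\<in>?I. complex_of_real (s t) * u t (i k) * cnj (v t (j z)))" if "k < r" "z < r" for k z
  proof -
    have "A $$ (i k, j z) = (\<Sum>t<l. complex_of_real (s t) * u t (i k) * cnj (v t (j z)))"
      by (rule svd_data.entry[OF s]) (use rowsD[OF i that(1)] colsD[OF i j that(2)] in auto)
    then show ?thesis by (simp only:) (rule sum.mono_neutral_right, auto)
  qed
  show ?thesis
  proof (rule lanczos_terminates[where B = "\<lambda>t k. u t (i k) / rn (i k)"])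
    show "\<forall>z<r. cnj (nh i j z) = nh i j z" unfolding nh_real by simp
    show "\<exists>c. \<forall>k<r. top w k = (\<Sum>t\<in>?I. c t * (u t (i k) / rn (i k)))" for w
    proof (rule top_span)
      fix k z assume "k < r" "z < r"
      from entry[OF this] show "Mh i j k z = (\<Sum>t\<in>?I. complex_of_real (s t) * cnj (v t (j z)) * (u t (i k) / rn (i k)))"
        by (simp only: sum_divide_distrib) (intro sum.cong refl, simp)
    qed
    show "finite ?I" by simp
    show "nsq r (lzs i j k) \<noteq> 0" if "1 \<le> k" "k \<le> d" for k by (rule nz[OF that])
  qed
qed

end

section \<open>Accuracy and cost\<close>

text \<open>The unnormalised weights change by at most \<open>2 \<rho> + \<rho>^2\<close> relative
  to their total, and so does the total itself; normalising therefore at most doubles the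
  change.\<close>

lemma normalized_weights_close:
  assumes x: "0 < nsq n x" and x': "0 < nsq n x'" and e: "nrm n (\<lambda>z. x z - x' z) \<le> \<rho> * nrm n x" and \<rho>: "0 < \<rho>"
  shows "(\<Sum>z<n. \<bar>(cmod (x z))\<^sup>2 / nsq n x - (cmod (x' z))\<^sup>2 / nsq n x'\<bar>) \<le> 4 * \<rho> + 2 * \<rho>\<^sup>2"
proof -
  define X X' D where "X = nsq n x" "X' = nsq n x'" "D = (\<Sum>z<n. \<bar>(cmod (x z))\<^sup>2 - (cmod (x' z))\<^sup>2\<bar>)"
  have X: "0 < X" "0 < X'" using x x' by (simp_all add: X_X'_D_def)
  have E: "nsq n (\<lambda>z. x z - x' z) \<le> \<rho>\<^sup>2 * X"
  proof -
    have "nsq n (\<lambda>z. x z - x' z) = (nrm n (\<lambda>z. x z - x' z))\<^sup>2" by (simp add: nrm_def)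
    also have "\<dots> \<le> (\<rho> * nrm n x)\<^sup>2" by (rule power_mono[OF e]) simp
    finally show ?thesis by (simp add: nrm_def power_mult_distrib X_X'_D_def)
  qed
  have pt: "\<bar>(cmod w)\<^sup>2 - (cmod w')\<^sup>2\<bar> \<le> (1 / \<rho> + 1) * (cmod (w - w'))\<^sup>2 + \<rho> * (cmod w)\<^sup>2" for w w'
  proof -
    define d where "d = cmod (w - w')"
    have d: "\<bar>cmod w - cmod w'\<bar> \<le> d" "cmod w' \<le> cmod w + d" "0 \<le> d"
      using norm_triangle_ineq3[of w w'] norm_triangle_ineq4[of w "w - w'"] by (simp_all add: d_def)
    have "(cmod w)\<^sup>2 - (cmod w')\<^sup>2 = (cmod w - cmod w') * (cmod w + cmod w')" by (simp add: power2_eq_square algebra_simps)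
    then have "\<bar>(cmod w)\<^sup>2 - (cmod w')\<^sup>2\<bar> = \<bar>cmod w - cmod w'\<bar> * (cmod w + cmod w')" by (simp add: abs_mult)
    also have "\<dots> \<le> d * (2 * cmod w + d)" using d by (intro mult_mono) auto
    also have "\<dots> \<le> (1 / \<rho> + 1) * d\<^sup>2 + \<rho> * (cmod w)\<^sup>2"
    proof -
      \<comment> \<open>Young's inequality, with the weight \<open>\<rho>\<close> at which both
        terms are of the same order for a perturbation of relative size
        \<open>\<rho>\<close>.\<close>
      have "0 \<le> (d - \<rho> * cmod w)\<^sup>2 / \<rho>" using \<rho> by simp
      also have "\<dots> = d\<^sup>2 / \<rho> - 2 * d * cmod w + \<rho> * (cmod w)\<^sup>2" using \<rho> by (simp add: field_simps power2_eq_square)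
      finally show ?thesis by (simp add: algebra_simps power2_eq_square)
    qed
    finally show ?thesis unfolding d_def .
  qed
  have "D \<le> (\<Sum>z<n. (1 / \<rho> + 1) * (cmod (x z - x' z))\<^sup>2 + \<rho> * (cmod (x z))\<^sup>2)"
    unfolding X_X'_D_def by (intro sum_mono pt)
  also have "\<dots> = (1 / \<rho> + 1) * nsq n (\<lambda>z. x z - x' z) + \<rho> * X"
    by (simp add: sum.distrib nsq_def X_X'_D_def sum_distrib_left)
  also have "\<dots> \<le> (1 / \<rho> + 1) * (\<rho>\<^sup>2 * X) + \<rho> * X" using E \<rho> by (intro add_right_mono mult_left_mono) auto
  also have "\<dots> = (2 * \<rho> + \<rho>\<^sup>2) * X" using \<rho> by (simp add: field_simps power2_eq_square)
  finally have D: "D \<le> (2 * \<rho> + \<rho>\<^sup>2) * X" .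
  have XX: "\<bar>X - X'\<bar> \<le> D" unfolding X_X'_D_def nsq_def sum_subtractf[symmetric] by (rule sum_abs)
  have "(\<Sum>z<n. \<bar>(cmod (x z))\<^sup>2 / X - (cmod (x' z))\<^sup>2 / X'\<bar>)
      \<le> (\<Sum>z<n. \<bar>(cmod (x z))\<^sup>2 - (cmod (x' z))\<^sup>2\<bar> / X + (cmod (x' z))\<^sup>2 * (\<bar>X - X'\<bar> / (X * X')))"
  proof (rule sum_mono)
    fix z
    have "(cmod (x z))\<^sup>2 / X - (cmod (x' z))\<^sup>2 / X' = ((cmod (x z))\<^sup>2 - (cmod (x' z))\<^sup>2) / X + (cmod (x' z))\<^sup>2 * ((X' - X) / (X * X'))"
      using X by (simp add: field_simps)
    also have "\<bar>\<dots>\<bar> \<le> \<bar>((cmod (x z))\<^sup>2 - (cmod (x' z))\<^sup>2) / X\<bar> + \<bar>(cmod (x' z))\<^sup>2 * ((X' - X) / (X * X'))\<bar>" by (rule abs_triangle_ineq)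
    also have "\<dots> = \<bar>(cmod (x z))\<^sup>2 - (cmod (x' z))\<^sup>2\<bar> / X + (cmod (x' z))\<^sup>2 * (\<bar>X - X'\<bar> / (X * X'))"
      using X by (simp add: abs_mult abs_minus_commute)
    finally show "\<bar>(cmod (x z))\<^sup>2 / X - (cmod (x' z))\<^sup>2 / X'\<bar> \<le> \<bar>(cmod (x z))\<^sup>2 - (cmod (x' z))\<^sup>2\<bar> / X + (cmod (x' z))\<^sup>2 * (\<bar>X - X'\<bar> / (X * X'))" .
  qed
  also have "\<dots> = D / X + X' * (\<bar>X - X'\<bar> / (X * X'))"
    unfolding sum.distrib by (simp only: sum_divide_distrib[symmetric] sum_distrib_right[symmetric] X_X'_D_def nsq_def)
  also have "\<dots> = (D + \<bar>X - X'\<bar>) / X" using X by (simp add: field_simps)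
  also have "\<dots> \<le> (2 * ((2 * \<rho> + \<rho>\<^sup>2) * X)) / X" using XX D X by (intro divide_right_mono) auto
  also have "\<dots> = 4 * \<rho> + 2 * \<rho>\<^sup>2" using X by simp
  finally show ?thesis unfolding X_X'_D_def .
qed

text \<open>Total variation is the total deficit of \<open>P\<close> against \<open>X\<close>, so a
  lower bound on \<open>P\<close> controls it; surplus mass of \<open>P\<close>, wherever it lies,
  is accounted for by the deficit.\<close>

lemma tv_dist_le:
  assumes fin: "finite (set_pmf P)" and X: "\<And>z. \<not> z < n \<Longrightarrow> pmf X z = 0"
    and low: "\<And>z. z < n \<Longrightarrow> (1 - \<delta>) * w z \<le> pmf P z" and \<delta>: "0 \<le> \<delta>" and w: "\<And>z. 0 \<le> w z" "(\<Sum>z<n. w z) = 1"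
    and close: "(\<Sum>z<n. \<bar>pmf X z - w z\<bar>) \<le> \<tau>"
  shows "tv_dist P X \<le> \<tau> + \<delta>"
proof -
  let ?T = "set_pmf P \<union> {..<n}"
  have fT: "finite ?T" using fin by simp
  have sX: "set_pmf X \<subseteq> {..<n}"
  proof
    fix z assume "z \<in> set_pmf X"
    then show "z \<in> {..<n}" using X[of z] by (auto simp: set_pmf_iff)
  qed
  have "(\<Sum>\<^sub>\<infinity>z. \<bar>pmf P z - pmf X z\<bar>) = (\<Sum>\<^sub>\<infinity>z\<in>?T. \<bar>pmf P z - pmf X z\<bar>)"
    by (rule infsum_cong_neutral) (auto simp: set_pmf_iff X)
  also have "\<dots> = (\<Sum>z\<in>?T. \<bar>pmf P z - pmf X z\<bar>)" by (rule infsum_finite[OF fT])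
  \<comment> \<open>The signed differences sum to 0 because both laws have total mass 1 on this
    set.\<close>
  also have "\<dots> = (\<Sum>z\<in>?T. (pmf P z - pmf X z) + 2 * max 0 (pmf X z - pmf P z))" by (intro sum.cong refl) (simp add: max_def abs_if)
  also have "\<dots> = 2 * (\<Sum>z\<in>?T. max 0 (pmf X z - pmf P z))"
    using sum_pmf_eq_1[of ?T P] sum_pmf_eq_1[of ?T X] fT sX by (auto simp: sum.distrib sum_subtractf sum_distrib_left)
  finally have "tv_dist P X = (\<Sum>z\<in>?T. max 0 (pmf X z - pmf P z))" by (simp add: tv_dist_def)
  also have "\<dots> = (\<Sum>z<n. max 0 (pmf X z - pmf P z))" by (rule sum.mono_neutral_right[OF fT]) (auto simp: X)
  also have "\<dots> \<le> (\<Sum>z<n. \<bar>pmf X z - w z\<bar> + \<delta> * w z)"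
  proof (rule sum_mono)
    fix z assume "z \<in> {..<n}"
    then have "pmf X z - pmf P z \<le> (pmf X z - w z) + \<delta> * w z" using low[of z] by (simp add: algebra_simps)
    moreover have "0 \<le> \<delta> * w z" using \<delta> w(1) by simp
    ultimately show "max 0 (pmf X z - pmf P z) \<le> \<bar>pmf X z - w z\<bar> + \<delta> * w z" by linarith
  qed
  also have "\<dots> \<le> \<tau> + \<delta>" using close w(2) by (simp add: sum.distrib sum_distrib_left[symmetric])
  finally show ?thesis .
qed

text \<open>Bernoulli's inequality for \<open>(1 + p)^d\<close>, combined with
  \<open>(1 - p) (1 + p) \<le> 1\<close>.\<close>

lemma power_complement_le:
  fixes p :: real
  assumes "0 < p" "p \<le> 1" "0 < \<delta>" "1 / \<delta> \<le> real d * p"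
  shows "(1 - p) ^ d \<le> \<delta>"
proof -
  have "1 / \<delta> \<le> 1 + real d * p" using assms by linarith
  also have "\<dots> \<le> (1 + p) ^ d" using Bernoulli_inequality[of p d] assms by simp
  finally have 1: "1 / \<delta> \<le> (1 + p) ^ d" .
  have "(1 - p) ^ d * (1 / \<delta>) \<le> (1 - p) ^ d * (1 + p) ^ d" using 1 assms by (intro mult_left_mono) auto
  also have "\<dots> = (1 - p\<^sup>2) ^ d" by (simp add: power_mult_distrib[symmetric] power2_eq_square algebra_simps)
  also have "\<dots> \<le> 1" using assms by (intro power_le_one) (auto simp: power_le_one)
  finally show ?thesis using assms by (simp add: field_simps)
qed

lemma set_pick_from: "set_pmf (pick_from r y d k) \<subseteq> {k..k + d}"
proof (induction d arbitrary: k)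
  case (Suc d)
  show ?case using Suc.IH[of "Suc k"] by (auto split: if_splits)
qed simp

context drawing
begin

lemma finite_repeat_trial: "finite (set_pmf (repeat_trial trial d z))"
proof -
  have "finite (set_pmf (vec_pmf (Matrix.row A (i k))))" if "k < r" for k
  proof (rule finite_subset)
    show "set_pmf (vec_pmf (Matrix.row A (i k))) \<subseteq> {..<n}" using rows[OF that] by (auto simp: set_pmf_iff pmf_vec_pmf split: if_splits)
  qed simp
  moreover have "set_pmf (pick_from r y (r - 1) 0) \<subseteq> {..<r}" "finite (set_pmf (pick_from r y (r - 1) 0))"
    using set_pick_from[of r y "r - 1" 0] r finite_subset[OF set_pick_from[of r y "r - 1" 0]] by fastforce+
  ultimately have "finite (set_pmf trial)" unfolding trial_def by (auto simp: subset_eq)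
  then show ?thesis by (induction d arbitrary: z) auto
qed

end

section \<open>Error and cost budget\<close>

locale parameters =
  fixes N \<kappa> \<Omega> \<phi> \<omega> \<epsilon> \<eta> c F :: real
  assumes N: "0 < N" and \<kappa>: "1 \<le> \<kappa>" and \<omega>: "0 < \<omega>" "\<omega> \<le> \<Omega>" and \<phi>: "0 \<le> \<phi>" and \<epsilon>: "0 < \<epsilon>" "\<epsilon> \<le> 1"
    and \<eta>: "0 < \<eta>" "\<epsilon> \<le> 1 / \<eta>" and c: "0 < c" "c \<le> 1" and F: "N \<le> F"
begin

definition "G = \<phi> / \<omega> + 3 * sqrt 2 * (\<Omega> / \<omega>) * (\<kappa> / N)"
text \<open>Ratio of the error scale \<open>N \<Lambda> F^2 \<beta>\<close> to the tolerance
  \<open>c \<omega> \<epsilon> \<beta>\<close>, with \<open>\<beta>\<close> the norm of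
  \<open>b\<close>. Sampling errors decay like \<open>1 / sqrt r\<close>, so the sample size has the
  order of its square.\<close>

definition "\<Theta> = \<kappa>\<^sup>2 * G * F\<^sup>2 / (N * \<epsilon> * c)"
definition "r0 = (128 * \<Theta> / \<eta>)\<^sup>2"
definition "s2 = N * N / (2 * (\<kappa> * \<kappa>))"
definition "\<Lambda> = \<phi> / (2 * s2) + 3 * \<Omega> / (2 * s2 * sqrt s2)"
definition "B = \<Omega> / sqrt s2"

lemma F0: "0 < F" using N F by simp

lemma sqrt_s2: "0 < s2" "sqrt s2 = N / (sqrt 2 * \<kappa>)"
proof -
  show "0 < s2" using N \<kappa> by (simp add: s2_def)
  have "s2 = (N / (sqrt 2 * \<kappa>))\<^sup>2" by (simp add: s2_def power2_eq_square)
  then show "sqrt s2 = N / (sqrt 2 * \<kappa>)" using N \<kappa> by simp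
qed

lemma \<Lambda>_eq: "\<Lambda> = \<kappa>\<^sup>2 * \<omega> * G / N\<^sup>2"
  unfolding \<Lambda>_def sqrt_s2(2) unfolding s2_def G_def using N \<kappa> \<omega> by (simp add: field_simps power2_eq_square)

lemma B_eq: "B = sqrt 2 * \<Omega> * \<kappa> / N"
  unfolding B_def sqrt_s2(2) using N \<kappa> by (simp add: field_simps)

lemma sqrt2: "1 < sqrt 2" "sqrt 2 < 3 / 2"
  by (simp, rule real_less_lsqrt) (simp_all add: power2_eq_square)

lemma G_ge: "4 * \<kappa> / N \<le> G" "0 < G" "3 * B \<le> \<omega> * G"
proof -
  have 1: "1 \<le> \<Omega> / \<omega>" using \<omega> by simp
  have "4 \<le> 3 * sqrt 2" using real_le_rsqrt[of "4 / 3" 2] by (simp add: power2_eq_square)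
  then have "4 * 1 \<le> 3 * sqrt 2 * (\<Omega> / \<omega>)" using 1 by (intro mult_mono) auto
  then have "4 * 1 * (\<kappa> / N) \<le> 3 * sqrt 2 * (\<Omega> / \<omega>) * (\<kappa> / N)" using N \<kappa> by (intro mult_right_mono) auto
  moreover have "0 \<le> \<phi> / \<omega>" using \<phi> \<omega> by simp
  ultimately show g: "4 * \<kappa> / N \<le> G" unfolding G_def by simp
  have "0 < 4 * \<kappa> / N" using N \<kappa> by simp
  then show "0 < G" using g by linarith
  have "\<omega> * G = \<phi> + 3 * B" unfolding G_def B_eq using \<omega> by (simp add: field_simps)
  then show "3 * B \<le> \<omega> * G" using \<phi> by simp
qed

lemma \<Theta>_ge: "G * F \<le> \<Theta> * (\<epsilon> * c)" "4 * F\<^sup>2 / N\<^sup>2 \<le> \<Theta>" "4 / \<epsilon> \<le> \<Theta>" "0 < \<Theta>"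
proof -
  have \<kappa>2: "1 \<le> \<kappa>\<^sup>2" using \<kappa> by simp
  have ec: "0 < \<epsilon> * c" "\<epsilon> * c \<le> 1" using \<epsilon> c mult_mono[of \<epsilon> 1 c 1] by auto
  have \<Theta>: "\<Theta> * (\<epsilon> * c) = \<kappa>\<^sup>2 * G * F\<^sup>2 / N" unfolding \<Theta>_def using \<epsilon> c by (simp add: field_simps)
  have "G * F * N \<le> G * F * F" using F G_ge(2) F0 by (intro mult_left_mono) auto
  also have "\<dots> \<le> \<kappa>\<^sup>2 * (G * F * F)" using \<kappa>2 G_ge(2) F0 mult_right_mono[of 1 "\<kappa>\<^sup>2" "G * F * F"] by simp
  finally show "G * F \<le> \<Theta> * (\<epsilon> * c)" unfolding \<Theta> using N by (simp add: field_simps power2_eq_square)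
  have "4 / N \<le> G" using G_ge(1) \<kappa> N divide_right_mono[of 4 "4 * \<kappa>" N] by simp
  then have "(4 / N) * F\<^sup>2 \<le> \<kappa>\<^sup>2 * G * F\<^sup>2" using mult_mono[OF \<kappa>2, of "4 / N" G] N by (intro mult_right_mono) auto
  then have a: "4 * F\<^sup>2 / N\<^sup>2 \<le> \<kappa>\<^sup>2 * G * F\<^sup>2 / N" using N by (simp add: field_simps power2_eq_square)
  have \<Theta>0: "0 < \<Theta>" unfolding \<Theta>_def using G_ge(2) \<kappa> F0 N \<epsilon> c by simp
  then show "0 < \<Theta>" .
  have b: "\<Theta> * (\<epsilon> * c) \<le> \<Theta>" using ec \<Theta>0 by (simp add: mult_le_cancel_left1)
  show "4 * F\<^sup>2 / N\<^sup>2 \<le> \<Theta>" using a b unfolding \<Theta> by linarith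
  have "N\<^sup>2 \<le> F\<^sup>2" using F N by (intro power_mono) auto
  then have "4 \<le> 4 * F\<^sup>2 / N\<^sup>2" using N by (simp add: field_simps)
  then have "4 \<le> \<Theta> * (\<epsilon> * c)" using a unfolding \<Theta> by linarith
  also have "\<dots> \<le> \<Theta> * \<epsilon>" using \<Theta>0 \<epsilon> c by (simp add: mult_le_cancel_left1)
  finally show "4 / \<epsilon> \<le> \<Theta>" using \<epsilon> by (simp add: field_simps)
qed

lemma r0_ge: "1 \<le> r0"
proof -
  have "\<eta> * \<epsilon> \<le> 1" using \<eta> by (simp add: field_simps)
  then have "1 \<le> 4 / (\<epsilon> * \<eta>)" using \<eta> \<epsilon> by (simp add: field_simps)
  also have "\<dots> \<le> \<Theta> / \<eta>" using divide_right_mono[OF \<Theta>_ge(3), of \<eta>] \<eta> by simp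
  finally have "1 \<le> 128 * \<Theta> / \<eta>" by simp
  then show ?thesis unfolding r0_def by simp
qed

lemma r_bounds: "r0 \<le> real (nat \<lceil>r0\<rceil>)" "real (nat \<lceil>r0\<rceil>) \<le> 2 * r0" "0 < nat \<lceil>r0\<rceil>" "128 * \<Theta> / \<eta> \<le> sqrt (real (nat \<lceil>r0\<rceil>))"
proof -
  show 1: "r0 \<le> real (nat \<lceil>r0\<rceil>)" by linarith
  show "real (nat \<lceil>r0\<rceil>) \<le> 2 * r0" using r0_ge by linarith
  show "0 < nat \<lceil>r0\<rceil>" using r0_ge by linarith
  show "128 * \<Theta> / \<eta> \<le> sqrt (real (nat \<lceil>r0\<rceil>))" using 1 unfolding r0_def by (rule real_le_rsqrt)
qed

text \<open>With \<open>U = c \<omega> \<epsilon> \<beta>\<close>, the four errors get 1, 2, 1 and 6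
  parts in 128 of \<open>U\<close>, together less than \<open>U / 12\<close>. Here \<open>q\<close>
  stands for \<open>sqrt r\<close> and \<open>h\<close> for \<open>sqrt \<eta>\<close>. The last
  error is the worst in \<open>h\<close>: its sampling error and the norm \<open>\<beta>'\<close>
  both carry a factor \<open>1 / h\<close>, which fixes the power of \<open>\<eta>\<close> in the
  sample size. The second claim is what keeps the norm of \<open>S\<close> below
  \<open>sqrt 2 N\<close>.\<close>

lemma error_budget:
  fixes q h \<beta> \<beta>' :: real
  assumes q: "128 * \<Theta> / h\<^sup>2 \<le> q" and h: "0 < h" "h \<le> 1" and \<beta>: "0 < \<beta>" "\<beta>' \<le> 2 * \<beta> / h" "0 \<le> \<beta>'"
  shows "N * \<Lambda> * F\<^sup>2 / q * \<beta> + \<Lambda> * (2 * F\<^sup>2 / (q * h)) * N * \<beta> + B * (2 * F * \<beta> / (q * h)) + sqrt 2 * N * \<Lambda> * (2 * F\<^sup>2 / (q * h)) * \<beta>'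
      \<le> \<epsilon> / 12 * (c * \<omega> * \<beta>)" "2 * F\<^sup>2 / (q * h) \<le> N\<^sup>2"
proof -
  define U where "U = c * \<omega> * \<epsilon> * \<beta>"
  have U0: "0 < U" using c \<omega> \<epsilon> \<beta> by (simp add: U_def)
  have q0: "0 < q" using q h \<Theta>_ge(4) by (intro less_le_trans[OF _ q]) simp
  have \<Lambda>0: "0 \<le> \<Lambda>" unfolding \<Lambda>_eq using \<omega> G_ge(2) by simp
  have NL: "N * \<Lambda> * F\<^sup>2 * \<beta> = \<Theta> * U" unfolding \<Lambda>_eq \<Theta>_def U_def using N \<epsilon> c by (simp add: field_simps power2_eq_square)
  have qh: "\<Theta> / (q * h\<^sup>2) \<le> 1 / 128" using q q0 h by (simp add: field_simps)
  have h2: "h\<^sup>2 \<le> h" "h \<le> 1" using h by (simp_all add: power2_eq_square mult_le_cancel_left1)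
  have T1: "\<Theta> / (q * h) \<le> 1 / 128"
  proof (rule order.trans[OF _ qh])
    show "\<Theta> / (q * h) \<le> \<Theta> / (q * h\<^sup>2)" using \<Theta>_ge(4) q0 h h2 by (intro divide_left_mono mult_left_mono) auto
  qed
  have T2: "\<Theta> / q \<le> 1 / 128"
  proof (rule order.trans[OF _ T1])
    show "\<Theta> / q \<le> \<Theta> / (q * h)" using \<Theta>_ge(4) q0 h mult_left_mono[OF h(2), of q] by (intro divide_left_mono) auto
  qed
  have e1: "N * \<Lambda> * F\<^sup>2 / q * \<beta> \<le> U / 128"
  proof -
    have "N * \<Lambda> * F\<^sup>2 / q * \<beta> = (\<Theta> / q) * U" using NL by (simp add: field_simps)
    then show ?thesis using mult_right_mono[OF T2 less_imp_le[OF U0]] by linarith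
  qed
  have e2: "\<Lambda> * (2 * F\<^sup>2 / (q * h)) * N * \<beta> \<le> 2 * U / 128"
  proof -
    have "\<Lambda> * (2 * F\<^sup>2 / (q * h)) * N * \<beta> = 2 * (N * \<Lambda> * F\<^sup>2 * \<beta>) / (q * h)" by simp
    also have "\<dots> = 2 * ((\<Theta> / (q * h)) * U)" unfolding NL by simp
    finally show ?thesis using mult_right_mono[OF T1 less_imp_le[OF U0]] by linarith
  qed
  have e3: "B * (2 * F * \<beta> / (q * h)) \<le> U / 128"
  proof -
    have "B * (2 * F * \<beta> / (q * h)) \<le> (\<omega> * G / 3) * (2 * F * \<beta> / (q * h))"
      using G_ge(3) F0 \<beta> q0 h by (intro mult_right_mono) auto
    also have "\<dots> = (2 / 3) * ((G * F) * (\<omega> * \<beta>) / (q * h))" by simp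
    also have "\<dots> \<le> (2 / 3) * ((\<Theta> * (\<epsilon> * c)) * (\<omega> * \<beta>) / (q * h))"
      using \<Theta>_ge(1) \<omega> \<beta> q0 h by (intro mult_left_mono divide_right_mono mult_right_mono) auto
    also have "\<dots> = (2 / 3) * ((\<Theta> / (q * h)) * U)" by (simp add: U_def)
    finally have le: "B * (2 * F * \<beta> / (q * h)) \<le> (2 / 3) * ((\<Theta> / (q * h)) * U)" .
    have "y \<le> U / 128" if "y \<le> (2 / 3) * t" "t \<le> 1 / 128 * U" for y t using that U0 by linarith
    from this[OF le mult_right_mono[OF T1 less_imp_le[OF U0]]] show ?thesis .
  qed
  have e4: "sqrt 2 * N * \<Lambda> * (2 * F\<^sup>2 / (q * h)) * \<beta>' \<le> 6 * U / 128"
  proof -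
    have "sqrt 2 * N * \<Lambda> * (2 * F\<^sup>2 / (q * h)) * \<beta>' \<le> sqrt 2 * N * \<Lambda> * (2 * F\<^sup>2 / (q * h)) * (2 * \<beta> / h)"
      using \<beta> N \<Lambda>0 q0 h by (intro mult_left_mono) auto
    also have "\<dots> = 4 * sqrt 2 * ((N * \<Lambda> * F\<^sup>2 * \<beta>) / (q * h\<^sup>2))" using h q0 by (simp add: field_simps power2_eq_square)
    also have "\<dots> = 4 * sqrt 2 * ((\<Theta> / (q * h\<^sup>2)) * U)" unfolding NL by simp
    also have "\<dots> \<le> 4 * sqrt 2 * (1 / 128 * U)" using mult_right_mono[OF qh less_imp_le[OF U0]] by (intro mult_left_mono) simp_all
    also have "\<dots> \<le> 6 * (1 / 128 * U)" using sqrt2 U0 by (intro mult_right_mono) auto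
    finally show ?thesis by simp
  qed
  show "N * \<Lambda> * F\<^sup>2 / q * \<beta> + \<Lambda> * (2 * F\<^sup>2 / (q * h)) * N * \<beta> + B * (2 * F * \<beta> / (q * h)) + sqrt 2 * N * \<Lambda> * (2 * F\<^sup>2 / (q * h)) * \<beta>'
      \<le> \<epsilon> / 12 * (c * \<omega> * \<beta>)"
  proof -
    have "\<epsilon> / 12 * (c * \<omega> * \<beta>) = U / 12" by (simp add: U_def)
    then show ?thesis using e1 e2 e3 e4 U0 by linarith
  qed
  have "4 * F\<^sup>2 / N\<^sup>2 / (q * h) \<le> 1 / 128" using order.trans[OF divide_right_mono[OF \<Theta>_ge(2), of "q * h"] T1] q0 h by simp
  then have "F\<^sup>2 / (q * h) \<le> N\<^sup>2 / 512" using N q0 h by (simp add: field_simps)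
  moreover have "0 \<le> N\<^sup>2" "2 * F\<^sup>2 / (q * h) = 2 * (F\<^sup>2 / (q * h))" by simp_all
  ultimately show "2 * F\<^sup>2 / (q * h) \<le> N\<^sup>2" by linarith
qed

text \<open>The perturbed vector keeps 11/12 of the guaranteed norm, and the coefficients are
  bounded through \<open>B\<close>, so \<open>r\<close> exceeds the expected number of trials by a
  factor \<open>2 / \<epsilon>\<close>. This brings the probability that all trials fail below
  \<open>\<epsilon> / 2\<close>.\<close>

lemma acceptance_budget:
  fixes X Y \<beta> r :: real
  assumes r: "(128 * \<Theta> / \<eta>)\<^sup>2 \<le> r" and \<eta>1: "\<eta> \<le> 1" and \<beta>: "0 < \<beta>" and X: "(11 / 12 * (c * \<omega> * \<beta>))\<^sup>2 \<le> X" and Y: "0 < Y" "Y \<le> B\<^sup>2 * (4 * \<beta>\<^sup>2 / \<eta>)"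
  shows "2 / \<epsilon> \<le> r * (X / (F\<^sup>2 * Y))"
proof -
  have B0: "0 < B" unfolding B_eq using \<omega> \<kappa> N by simp
  have ec: "0 < \<epsilon> * c" using \<epsilon> c by simp
  have T: "3 * B * F / (\<epsilon> * c * \<omega>) \<le> \<Theta>"
  proof -
    have "3 * B * F \<le> \<omega> * G * F" using G_ge(3) F0 by (intro mult_right_mono) auto
    also have "\<dots> \<le> \<omega> * (\<Theta> * (\<epsilon> * c))" using \<Theta>_ge(1) \<omega> by simp
    finally have "3 * B * F \<le> \<Theta> * (\<epsilon> * c * \<omega>)" by (simp add: mult_ac)
    then show ?thesis using ec \<omega> by (simp add: pos_divide_le_eq)
  qed
  define V where "V = 3 * B * F / (\<epsilon> * c * \<omega>)"
  have V0: "0 < V" using B0 F0 \<epsilon> c \<omega> by (simp add: V_def)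
  have "(128 * V / \<eta>)\<^sup>2 \<le> (128 * \<Theta> / \<eta>)\<^sup>2" using T V0 \<eta> unfolding V_def[symmetric] by (intro power_mono divide_right_mono) auto
  then have rV: "(128 * V / \<eta>)\<^sup>2 \<le> r" using r by linarith
  have X0: "0 < (11 / 12 * (c * \<omega> * \<beta>))\<^sup>2" using c \<omega> \<beta> by simp
  \<comment> \<open>The product in the following estimate has the constant 30976, so 2000 leaves
    ample room.\<close>
  have "2 / \<epsilon> \<le> 2000 / (\<epsilon> * \<epsilon> * \<eta>)"
    using \<epsilon> \<eta> \<eta>1 mult_mono[of \<epsilon> 1 \<eta> 1] by (simp add: field_simps)
  also have "\<dots> \<le> (128 * V / \<eta>)\<^sup>2 * ((11 / 12 * (c * \<omega> * \<beta>))\<^sup>2 / (F\<^sup>2 * (B\<^sup>2 * (4 * \<beta>\<^sup>2 / \<eta>))))"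
    unfolding V_def using B0 F0 \<epsilon> c \<omega> \<eta> \<beta> by (simp add: field_simps power2_eq_square)
  also have "\<dots> \<le> r * (X / (F\<^sup>2 * Y))"
  proof (rule mult_mono[OF rV])
    show "(11 / 12 * (c * \<omega> * \<beta>))\<^sup>2 / (F\<^sup>2 * (B\<^sup>2 * (4 * \<beta>\<^sup>2 / \<eta>))) \<le> X / (F\<^sup>2 * Y)"
    proof (rule frac_le)
      show "0 \<le> X" using X X0 by linarith
      show "(11 / 12 * (c * \<omega> * \<beta>))\<^sup>2 \<le> X" by (rule X)
      show "0 < F\<^sup>2 * Y" using F0 Y by simp
      show "F\<^sup>2 * Y \<le> F\<^sup>2 * (B\<^sup>2 * (4 * \<beta>\<^sup>2 / \<eta>))" by (rule mult_left_mono[OF Y(2)]) simp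
    qed
    show "0 \<le> r" using rV zero_le_power2[of "128 * V / \<eta>"] by linarith
    show "0 \<le> (11 / 12 * (c * \<omega> * \<beta>))\<^sup>2 / (F\<^sup>2 * (B\<^sup>2 * (4 * \<beta>\<^sup>2 / \<eta>)))" using F0 B0 \<beta> \<eta> X0 by simp
  qed
  finally show ?thesis .
qed

lemma r0_eq: "r0 = 16384 * (\<kappa>^4 * G\<^sup>2 * F^4) / (N\<^sup>2 * \<epsilon>\<^sup>2 * c\<^sup>2 * \<eta>\<^sup>2)"
  unfolding r0_def \<Theta>_def by (simp add: power_divide power_mult_distrib power_mult[symmetric])

lemma GF: "1 \<le> G\<^sup>2 * F\<^sup>2"
proof -
  have "1 \<le> 4 * \<kappa> / N * F" using N \<kappa> F mult_mono[of 1 \<kappa> N F] by (simp add: field_simps)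
  also have "\<dots> \<le> G * F" using G_ge(1) F0 by (intro mult_right_mono) auto
  finally have "1 \<le> (G * F)\<^sup>2" by simp
  then show ?thesis by (simp add: power_mult_distrib)
qed

text \<open>At most \<open>3 r\<close> samples are drawn and \<open>r \<le> 2 r0\<close>; the
  constant 98304 is 6 times the square of 128. The claimed bound exceeds \<open>r0\<close> by a
  product of factors that are at least 1, the least obvious being \<open>G F\<close>, where
  \<open>G \<ge> 4 \<kappa> / N\<close> and \<open>F \<ge> N\<close>.\<close>

lemma sample_budget:
  assumes "1 \<le> Lg"
  shows "6 * r0 \<le> 98304 / c\<^sup>2 * (F ^ 10 * \<kappa> ^ 14 / (\<epsilon> ^ 4 * \<eta>\<^sup>2 * N ^ 6) * (\<Omega> / \<omega>)\<^sup>2 * G ^ 4 * Lg)"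
proof -
  define Z where "Z = \<kappa>^4 * G\<^sup>2 * F^4 / (N\<^sup>2 * \<epsilon>\<^sup>2 * \<eta>\<^sup>2)"
  have Z0: "0 \<le> Z" unfolding Z_def by simp
  have F4: "1 \<le> F^4 / N^4" using power_mono[OF F, of 4] N by simp
  have \<kappa>10: "1 \<le> \<kappa>^10" using \<kappa> by simp
  have e: "1 \<le> 1 / \<epsilon>\<^sup>2" using \<epsilon> by (simp add: power_le_one)
  have O: "1 \<le> (\<Omega> / \<omega>)\<^sup>2" using \<omega> by simp
  have P: "1 \<le> (G\<^sup>2 * F\<^sup>2) * (F^4 / N^4) * \<kappa>^10 * (1 / \<epsilon>\<^sup>2) * (\<Omega> / \<omega>)\<^sup>2 * Lg"
  proof -
    have m: "1 \<le> x * y" if "1 \<le> x" "1 \<le> y" for x y :: real using mult_mono[OF that] that by simp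
    show ?thesis by (rule m[OF m[OF m[OF m[OF m[OF GF F4] \<kappa>10] e] O] assms])
  qed
  have "6 * r0 = 98304 / c\<^sup>2 * Z" unfolding r0_eq Z_def by simp
  also have "\<dots> \<le> 98304 / c\<^sup>2 * (Z * ((G\<^sup>2 * F\<^sup>2) * (F^4 / N^4) * \<kappa>^10 * (1 / \<epsilon>\<^sup>2) * (\<Omega> / \<omega>)\<^sup>2 * Lg))"
    using mult_left_mono[OF P Z0] by (intro mult_left_mono) auto
  also have "Z * ((G\<^sup>2 * F\<^sup>2) * (F^4 / N^4) * \<kappa>^10 * (1 / \<epsilon>\<^sup>2) * (\<Omega> / \<omega>)\<^sup>2 * Lg) = F ^ 10 * \<kappa> ^ 14 / (\<epsilon> ^ 4 * \<eta>\<^sup>2 * N ^ 6) * (\<Omega> / \<omega>)\<^sup>2 * G ^ 4 * Lg"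
  proof -
    have e: "Z * ((G\<^sup>2 * F\<^sup>2) * (F^4 / N^4) * \<kappa>^10 * (1 / \<epsilon>\<^sup>2)) = F ^ 10 * \<kappa> ^ 14 / (\<epsilon> ^ 4 * \<eta>\<^sup>2 * N ^ 6) * G ^ 4"
      unfolding Z_def by (simp add: mult_ac)
    have "Z * ((G\<^sup>2 * F\<^sup>2) * (F^4 / N^4) * \<kappa>^10 * (1 / \<epsilon>\<^sup>2) * (\<Omega> / \<omega>)\<^sup>2 * Lg)
      = Z * ((G\<^sup>2 * F\<^sup>2) * (F^4 / N^4) * \<kappa>^10 * (1 / \<epsilon>\<^sup>2)) * (\<Omega> / \<omega>)\<^sup>2 * Lg" by (simp only: mult.assoc)
    then show ?thesis unfolding e by (simp only: mult_ac)
  qed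
  finally show ?thesis .
qed

text \<open>The computed cost carries a factor \<open>1 / (N^6 \<eta>)\<close> that the claimed form
  lacks; smallness of \<open>\<epsilon>\<close> trades it for two of the six powers of
  \<open>1 / \<epsilon>\<close>. The constant collects 14000, the 3 of the rank bound, and the
  square of twice 16384.\<close>

lemma time_budget:
  assumes L: "1 \<le> Lg" and small: "\<epsilon>\<^sup>2 \<le> N ^ 6 * \<eta>" and G7: "G \<le> G7"
  shows "14000 * ((2 * r0)\<^sup>2 * (3 * (F\<^sup>2 / N\<^sup>2 * \<kappa>\<^sup>2)) * Lg) \<le> 168000 * 16384\<^sup>2 / c ^ 4 * (F ^ 12 * \<kappa> ^ 12 / (\<epsilon> ^ 6 * \<eta> ^ 3) * G7 ^ 6 * Lg)"
proof -
  define Z where "Z = \<kappa>^10 * G^4 * F^10 / (\<epsilon>^4 * \<eta>^3)"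
  have Z0: "0 \<le> Z" unfolding Z_def using \<kappa> \<eta> by simp
  have k2: "1 \<le> \<kappa>\<^sup>2" using \<kappa> by simp
  have "1 / (N^6 * \<eta>) \<le> 1 / \<epsilon>\<^sup>2" using small \<epsilon> N \<eta> by (intro divide_left_mono) auto
  also have "\<dots> \<le> (1 / \<epsilon>\<^sup>2) * ((G\<^sup>2 * F\<^sup>2) * \<kappa>\<^sup>2)"
  proof -
    have "1 \<le> (G\<^sup>2 * F\<^sup>2) * \<kappa>\<^sup>2" using mult_mono[OF GF k2] by simp
    then have "(1 / \<epsilon>\<^sup>2) * 1 \<le> (1 / \<epsilon>\<^sup>2) * ((G\<^sup>2 * F\<^sup>2) * \<kappa>\<^sup>2)" by (rule mult_left_mono) simp
    then show ?thesis by simp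
  qed
  finally have P: "1 / (N^6 * \<eta>) \<le> (1 / \<epsilon>\<^sup>2) * ((G\<^sup>2 * F\<^sup>2) * \<kappa>\<^sup>2)" .
  have "14000 * ((2 * r0)\<^sup>2 * (3 * (F\<^sup>2 / N\<^sup>2 * \<kappa>\<^sup>2)) * Lg) = 168000 * 16384\<^sup>2 / c^4 * (Z * (1 / (N^6 * \<eta>)) * Lg)"
  proof -
    have \<eta>4: "\<eta>^4 = \<eta>^3 * \<eta>" by (simp add: eval_nat_numeral)
    have "Z * (1 / (N^6 * \<eta>)) = \<kappa>^10 * G^4 * F^10 / (N^6 * \<epsilon>^4 * \<eta>^4)" unfolding Z_def \<eta>4 by (simp add: mult_ac)
    moreover have "r0\<^sup>2 * (F\<^sup>2 / N\<^sup>2 * \<kappa>\<^sup>2) = 16384\<^sup>2 / c^4 * (\<kappa>^10 * G^4 * F^10 / (N^6 * \<epsilon>^4 * \<eta>^4))"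
      unfolding r0_eq by (simp add: power_divide power_mult_distrib mult_ac)
    ultimately have e: "r0\<^sup>2 * (F\<^sup>2 / N\<^sup>2 * \<kappa>\<^sup>2) = 16384\<^sup>2 / c^4 * (Z * (1 / (N^6 * \<eta>)))" by simp
    have "14000 * ((2 * r0)\<^sup>2 * (3 * (F\<^sup>2 / N\<^sup>2 * \<kappa>\<^sup>2)) * Lg) = 168000 * (r0\<^sup>2 * (F\<^sup>2 / N\<^sup>2 * \<kappa>\<^sup>2)) * Lg"
      by (simp add: power_mult_distrib)
    then show ?thesis unfolding e by simp
  qed
  also have "\<dots> \<le> 168000 * 16384\<^sup>2 / c^4 * (Z * ((1 / \<epsilon>\<^sup>2) * ((G\<^sup>2 * F\<^sup>2) * \<kappa>\<^sup>2)) * Lg)"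
    using P Z0 L by (intro mult_left_mono mult_right_mono) auto
  also have "Z * ((1 / \<epsilon>\<^sup>2) * ((G\<^sup>2 * F\<^sup>2) * \<kappa>\<^sup>2)) = F ^ 12 * \<kappa> ^ 12 / (\<epsilon> ^ 6 * \<eta> ^ 3) * G ^ 6"
  proof -
    show ?thesis unfolding Z_def by (simp add: mult_ac)
  qed
  also have "168000 * 16384\<^sup>2 / c ^ 4 * (F ^ 12 * \<kappa> ^ 12 / (\<epsilon> ^ 6 * \<eta> ^ 3) * G ^ 6 * Lg) \<le> 168000 * 16384\<^sup>2 / c ^ 4 * (F ^ 12 * \<kappa> ^ 12 / (\<epsilon> ^ 6 * \<eta> ^ 3) * G7 ^ 6 * Lg)"
    using L \<eta> c G7 G_ge(2) \<kappa> F0 by (intro mult_left_mono mult_right_mono power_mono) auto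
  finally show ?thesis .
qed

end

section \<open>Assembly of the algorithm\<close>

lemma svt_carrier: "svt f M \<in> carrier_mat (dim_row M) (dim_col M)"
proof -
  have "\<exists>X s u v. is_svd M s u v \<and> X = rank_one_sum (dim_row M) (dim_col M) (\<lambda>i. f (s i)) u v"
    using svd_exists[of M] by blast
  from someI_ex[OF this, folded svt_def] show ?thesis by (auto simp: rank_one_sum_def)
qed

text \<open>Suprema and infima act as maxima and minima because they are attained: for
  \<open>f\<close> by continuity on a compact interval, for the derivative, which may be
  discontinuous, by hypothesis.\<close>

lemma interval_extrema:
  fixes f f' :: "real \<Rightarrow> real"
  assumes a: "0 < a" "a \<le> b" and pos: "\<And>x. x > 0 \<Longrightarrow> f x > 0"
    and d: "\<forall>\<sigma>\<in>{a..b}. (f has_real_derivative f' \<sigma>) (at \<sigma> within {a..b})"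
    and max: "\<exists>\<sigma>\<in>{a..b}. \<forall>\<tau>\<in>{a..b}. \<bar>f' \<tau>\<bar> \<le> \<bar>f' \<sigma>\<bar>"
  shows "\<sigma> \<in> {a..b} \<Longrightarrow> Inf ((\<lambda>\<sigma>. \<bar>f \<sigma>\<bar>) ` {a..b}) \<le> \<bar>f \<sigma>\<bar>" "\<sigma> \<in> {a..b} \<Longrightarrow> \<bar>f \<sigma>\<bar> \<le> Sup ((\<lambda>\<sigma>. \<bar>f \<sigma>\<bar>) ` {a..b})"
    "\<sigma> \<in> {a..b} \<Longrightarrow> \<bar>f' \<sigma>\<bar> \<le> Sup ((\<lambda>\<sigma>. \<bar>f' \<sigma>\<bar>) ` {a..b})"
    "0 < Inf ((\<lambda>\<sigma>. \<bar>f \<sigma>\<bar>) ` {a..b})" "Inf ((\<lambda>\<sigma>. \<bar>f \<sigma>\<bar>) ` {a..b}) \<le> Sup ((\<lambda>\<sigma>. \<bar>f \<sigma>\<bar>) ` {a..b})"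
    "0 \<le> Sup ((\<lambda>\<sigma>. \<bar>f' \<sigma>\<bar>) ` {a..b})"
proof -
  have cont: "continuous_on {a..b} (\<lambda>\<sigma>. \<bar>f \<sigma>\<bar>)"
    by (intro continuous_on_rabs DERIV_continuous_on[where D = f']) (use d in blast)
  have aL: "a \<in> {a..b}" using a by simp
  then have ne: "{a..b} \<noteq> {}" by blast
  obtain x1 where x1: "x1 \<in> {a..b}" "\<forall>y\<in>{a..b}. \<bar>f x1\<bar> \<le> \<bar>f y\<bar>" using continuous_attains_inf[OF compact_Icc ne cont] by blast
  obtain x2 where x2: "x2 \<in> {a..b}" "\<forall>y\<in>{a..b}. \<bar>f y\<bar> \<le> \<bar>f x2\<bar>" using continuous_attains_sup[OF compact_Icc ne cont] by blast
  obtain x3 where x3: "x3 \<in> {a..b}" "\<forall>y\<in>{a..b}. \<bar>f' y\<bar> \<le> \<bar>f' x3\<bar>" using max by blast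
  have I: "Inf ((\<lambda>\<sigma>. \<bar>f \<sigma>\<bar>) ` {a..b}) = \<bar>f x1\<bar>" by (rule cInf_eq_minimum) (use x1 in auto)
  have S: "Sup ((\<lambda>\<sigma>. \<bar>f \<sigma>\<bar>) ` {a..b}) = \<bar>f x2\<bar>" by (rule cSup_eq_maximum) (use x2 in auto)
  have S': "Sup ((\<lambda>\<sigma>. \<bar>f' \<sigma>\<bar>) ` {a..b}) = \<bar>f' x3\<bar>" by (rule cSup_eq_maximum) (use x3 in auto)
  show "\<sigma> \<in> {a..b} \<Longrightarrow> Inf ((\<lambda>\<sigma>. \<bar>f \<sigma>\<bar>) ` {a..b}) \<le> \<bar>f \<sigma>\<bar>" unfolding I using x1 by blast
  show "\<sigma> \<in> {a..b} \<Longrightarrow> \<bar>f \<sigma>\<bar> \<le> Sup ((\<lambda>\<sigma>. \<bar>f \<sigma>\<bar>) ` {a..b})" unfolding S using x2 by blast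
  show "\<sigma> \<in> {a..b} \<Longrightarrow> \<bar>f' \<sigma>\<bar> \<le> Sup ((\<lambda>\<sigma>. \<bar>f' \<sigma>\<bar>) ` {a..b})" unfolding S' using x3 by blast
  show "0 < Inf ((\<lambda>\<sigma>. \<bar>f \<sigma>\<bar>) ` {a..b})" unfolding I using pos[of x1] x1 a by simp
  show "Inf ((\<lambda>\<sigma>. \<bar>f \<sigma>\<bar>) ` {a..b}) \<le> Sup ((\<lambda>\<sigma>. \<bar>f \<sigma>\<bar>) ` {a..b})" unfolding I S using x2 x1 by blast
  show "0 \<le> Sup ((\<lambda>\<sigma>. \<bar>f' \<sigma>\<bar>) ` {a..b})" unfolding S' by simp
qed

text \<open>The output distribution is fixed before the target \<open>X\<close>, because a run
  within the resource bounds is needed also for bad samples, where no accuracy is claimed. The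
  vector \<open>x'\<close> is \<open>F2 / r\<close> times \<open>num\<close>, a factor that
  disappears on normalising.\<close>

lemma (in sampling_program) draw_correct:
  assumes ij: "i \<in> set_pmf rowsP" "j \<in> set_pmf (colsP i)" and P: "prepared dmax h i j (nmem t) (cmem t)"
  defines "y \<equiv> castel (sop r (gram r (adj (W i j))) F2) h r 0 (bs (\<lambda>z. b $ z) i)"
  defines "x' \<equiv> mop r (adj (S i)) y"
  shows "\<exists>D. exec f M drawC t D \<and>
    (\<forall>u\<in>set_pmf D. time_used u \<le> time_used t + 1100 * (real r * real r * Lg) \<and> samples_used u \<le> samples_used t + r) \<and>
    (\<forall>X \<delta> \<tau>. 0 < nsq n x' \<longrightarrow> 0 < \<delta> \<longrightarrow> 1 / \<delta> \<le> real r * (nsq n x' / (F2 * nsq r y)) \<longrightarrow> (\<forall>z. \<not> z < n \<longrightarrow> pmf X z = 0) \<longrightarrow>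
       (\<Sum>z<n. \<bar>pmf X z - (cmod (x' z))\<^sup>2 / nsq n x'\<bar>) \<le> \<tau> \<longrightarrow> tv_dist (map_pmf result D) X \<le> \<tau> + \<delta>)"
proof -
  obtain K where K: "1 \<le> K" "nsq r (lzs i j K) = 0" "nmem t (adr 2 0) = r" "ARR 8 {..<r} i (nmem t)"
    "ARR 10 {..<r} (\<lambda>k. rn (i k)) (cmem t)" "ARR 21 {..<r} (ys i j K h) (cmem t)" "cmem t (adr 22 0) = complex_of_real (nsq r (ys i j K h))"
    using P unfolding prepared_def by blast
  define yv where "yv = ys i j K h"
  have rowne: "i k < m \<and> eucl_norm (Matrix.row A (i k)) \<noteq> 0" if "k < r" for k
    using rowsD[OF ij(1) that] row_norm[of "i k"] by auto
  interpret d: drawing f A b m n Lg r i yv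
    by unfold_locales (use r rowne Lg_def in auto)
  have DE: "d.DE (nmem t) (cmem t)" unfolding d.DE_def by (intro conjI K(3-5) K(6,7)[folded yv_def])
  obtain x0 where sp: "samp f M drawC t (repeat_trial d.trial r x0) (\<lambda>x w. time_used w \<le> time_used t + 1100 * (real r * real r * Lg) \<and> samples_used w \<le> samples_used t + r \<and> nmem w 0 = x)"
    using d.samp_drawC[OF DE] by blast
  then obtain q where q: "exec f M drawC t (map_pmf snd q)" "map_pmf fst q = repeat_trial d.trial r x0"
    "\<forall>z\<in>set_pmf q. time_used (snd z) \<le> time_used t + 1100 * (real r * real r * Lg) \<and> samples_used (snd z) \<le> samples_used t + r \<and> nmem (snd z) 0 = fst z"
    unfolding samp_def by blast
  have res: "map_pmf result (map_pmf snd q) = repeat_trial d.trial r x0"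
    unfolding q(2)[symmetric] pmf.map_comp by (rule map_pmf_cong[OF refl]) (use q(3) in \<open>simp add: result_def\<close>)
  define c0 where "c0 = sqrt (F2 / real r)"
  have r0: "0 < real r" using r by simp
  have c0: "0 < c0" "c0\<^sup>2 = F2 / real r" using F2 r0 by (simp_all add: c0_def)
  have yk: "y k = complex_of_real c0 * yv k" if "k < r" for k
    unfolding y_def yv_def c0_def by (rule prepared_vector[OF ij K(1,2) that])
  have xz: "x' z = complex_of_real (F2 / real r) * d.num z" for z
  proof -
    have "x' z = (\<Sum>k<r. complex_of_real (c0\<^sup>2) * (cnj (A $$ (i k, z) / rn (i k)) * yv k))"
      unfolding x'_def mop_def adj_def
      by (intro sum.cong refl) (simp add: scaled_forms(1)[OF ij(1)] yk c0_def[symmetric] power2_eq_square)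
    then show ?thesis unfolding c0(2) d.num_def sum_distrib_left .
  qed
  have ny: "nsq r y = (F2 / real r) * nsq r yv"
  proof -
    have "nsq r y = nsq r (\<lambda>k. complex_of_real c0 * yv k)" by (rule nsq_cong) (rule yk)
    then show ?thesis unfolding nsq_scale c0(2)[symmetric] by simp
  qed
  have cn: "(cmod (complex_of_real (F2 / real r)))\<^sup>2 = (F2 / real r)\<^sup>2" by (simp only: norm_of_real power2_abs)
  have nx: "nsq n x' = (F2 / real r)\<^sup>2 * nsq n d.num"
  proof -
    have "nsq n x' = nsq n (\<lambda>z. complex_of_real (F2 / real r) * d.num z)" by (rule nsq_cong) (rule xz)
    then show ?thesis unfolding nsq_scale cn .
  qed
  have s0: "0 < F2 / real r" using F2 r0 by simp
  have "tv_dist (map_pmf result (map_pmf snd q)) X \<le> \<tau> + \<delta>"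
    if H: "0 < nsq n x'" "0 < \<delta>" "1 / \<delta> \<le> real r * (nsq n x' / (F2 * nsq r y))" "\<forall>z. \<not> z < n \<longrightarrow> pmf X z = 0"
      "(\<Sum>z<n. \<bar>pmf X z - (cmod (x' z))\<^sup>2 / nsq n x'\<bar>) \<le> \<tau>" for X \<delta> \<tau>
  proof -
    have num: "0 < nsq n d.num" using H(1) s0 unfolding nx by (simp add: zero_less_mult_iff)
    have yv: "0 < nsq r yv"
    proof (rule ccontr)
      assume "\<not> ?thesis"
      then have "nsq r yv = 0" using nsq_nonneg[of r yv] by linarith
      then have "\<forall>k<r. yv k = 0" by (simp add: nsq_eq_0)
      then have "d.num z = 0" for z by (simp add: d.num_def)
      then show False using num by (simp add: nsq_def)
    qed
    define p where "p = nsq n d.num / (real r * nsq r yv)"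
    have p: "nsq n x' / (F2 * nsq r y) = p"
      unfolding nx ny p_def using F2 r0 yv by (simp add: field_simps power2_eq_square)
    have ne: "(F2 / real r)\<^sup>2 \<noteq> 0" by (rule zero_less_power[OF s0, THEN less_imp_neq, THEN not_sym])
    have wt: "(if z < n then (cmod (d.num z))\<^sup>2 / nsq n d.num else 0) = (if z < n then (cmod (x' z))\<^sup>2 / nsq n x' else 0)" for z
      unfolding nx xz norm_mult power_mult_distrib cn by (simp only: mult_divide_mult_cancel_left[OF ne])
    note law = d.repeat_trial_law[OF yv num, folded p_def]
    have pw: "(1 - p) ^ r \<le> \<delta>" by (rule power_complement_le[OF law(1,2) H(2)]) (use H(3) p in simp)
    show ?thesis unfolding res
    proof (rule tv_dist_le[where w = "\<lambda>z. if z < n then (cmod (x' z))\<^sup>2 / nsq n x' else 0" and n = n])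
      show "finite (set_pmf (repeat_trial d.trial r x0))" by (rule d.finite_repeat_trial)
      show "pmf X z = 0" if "\<not> z < n" for z using H(4) that by blast
      show "0 \<le> \<delta>" using H(2) by simp
      show w0: "0 \<le> (if z < n then (cmod (x' z))\<^sup>2 / nsq n x' else 0)" for z by simp
      show "(1 - \<delta>) * (if z < n then (cmod (x' z))\<^sup>2 / nsq n x' else 0) \<le> pmf (repeat_trial d.trial r x0) z" for z
      proof -
        have "(1 - \<delta>) * (if z < n then (cmod (x' z))\<^sup>2 / nsq n x' else 0) \<le> (1 - (1 - p) ^ r) * (if z < n then (cmod (x' z))\<^sup>2 / nsq n x' else 0)"
          by (rule mult_right_mono[OF _ w0]) (use pw in simp)
        also have "\<dots> \<le> pmf (repeat_trial d.trial r x0) z" using law(3)[of r z x0] unfolding wt .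
        finally show ?thesis .
      qed
      have "(\<Sum>z<n. (cmod (x' z))\<^sup>2 / nsq n x') = nsq n x' / nsq n x'" by (simp only: sum_divide_distrib[symmetric] nsq_def[of n x', symmetric])
      then show "(\<Sum>z<n. if z < n then (cmod (x' z))\<^sup>2 / nsq n x' else 0) = 1" using H(1) by simp
      show "(\<Sum>z<n. \<bar>pmf X z - (if z < n then (cmod (x' z))\<^sup>2 / nsq n x' else 0)\<bar>) \<le> \<tau>" using H(5) by simp
    qed
  qed
  moreover have "time_used u \<le> time_used t + 1100 * (real r * real r * Lg) \<and> samples_used u \<le> samples_used t + r" if "u \<in> set_pmf (map_pmf snd q)" for u
    using that q(3) by auto
  ultimately show ?thesis using q(1) by (intro exI[of _ "map_pmf snd q"] conjI) blast+
qed

text \<open>Half of \<open>\<epsilon>\<close> is spent on the approximate vector, whose relative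
  error is \<open>\<epsilon> / 12\<close>, and half on cutting the rejection loop off after
  \<open>r\<close> trials.\<close>

lemma algorithm_correct:
  fixes f f' :: "real \<Rightarrow> real" and \<epsilon> \<eta> c C :: real
  defines "C1 \<equiv> 98304 / c\<^sup>2" and "C2 \<equiv> 168000 * 16384\<^sup>2 / c ^ 4"
  assumes f: "f 0 = 0" "\<And>x. x > 0 \<Longrightarrow> f x > 0" and c: "0 < c" and \<eta>: "0 < \<eta>" and C: "C1 \<le> C" "C2 \<le> C"
    and A: "A \<in> carrier_mat m n" and b: "b \<in> carrier_vec m"
  defines "F \<equiv> frob_norm A" and "N \<equiv> spectral_norm A" and "\<kappa> \<equiv> kappa2 A" and "L \<equiv> sv_interval A"
  defines "\<Omega> \<equiv> Sup ((\<lambda>\<sigma>. \<bar>f \<sigma>\<bar>) ` L)" and "\<phi> \<equiv> Sup ((\<lambda>\<sigma>. \<bar>f' \<sigma>\<bar>) ` L)" and "\<omega> \<equiv> Inf ((\<lambda>\<sigma>. \<bar>f \<sigma>\<bar>) ` L)"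
  assumes b0: "b \<noteq> 0\<^sub>v m" and \<epsilon>: "0 < \<epsilon>" "\<epsilon> \<le> 1" "\<epsilon> \<le> 1 / \<eta>" "0 < N \<Longrightarrow> \<epsilon>\<^sup>2 \<le> N ^ 6 * \<eta>"
    and d: "\<forall>\<sigma>\<in>L. (f has_real_derivative f' \<sigma>) (at \<sigma> within L)" and max: "\<exists>\<sigma>\<in>L. \<forall>\<tau>\<in>L. \<bar>f' \<tau>\<bar> \<le> \<bar>f' \<sigma>\<bar>"
    and proj: "c * eucl_norm b \<le> eucl_norm (svt_proj f A b)"
  shows "samples_from f (access A b) prepareC drawC (init_state [m, n] [\<eta>, \<epsilon>, c, N, \<kappa>, \<Omega>, \<phi>, \<omega>]) \<eta> \<epsilon>
     (vec_pmf (svt f (mat_adjoint A) *\<^sub>v b))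
     (C * (F ^ 10 * \<kappa> ^ 14 / (\<epsilon> ^ 4 * \<eta>\<^sup>2 * N ^ 6) * (\<Omega> / \<omega>)\<^sup>2 * (\<phi> / \<omega> + 3 * sqrt 2 * (\<Omega> / \<omega>) * (\<kappa> / N)) ^ 4 * (1 + ln (real (m * n)))\<^sup>2))
     (C * (F ^ 12 * \<kappa> ^ 12 / (\<epsilon> ^ 6 * \<eta> ^ 3) * (\<phi> / \<omega> + 7 * sqrt 2 * (\<Omega> / \<omega>) * (\<kappa> / N)) ^ 6 * (1 + ln (real (m * n)))\<^sup>2))"
proof -
  let ?l = "min m n" and ?b = "\<lambda>i. b $ i" and ?Lg = "(1 + ln (real (m * n)))\<^sup>2" and ?F2 = "fsq m n (\<lambda>i j. A $$ (i, j))"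
  obtain s u v where sv: "svd_data m n ?l A s u v" and svd: "\<exists>u' v'. is_svd A s u' v'"
    and form: "\<And>j. j < n \<Longrightarrow> (svt f (mat_adjoint A) *\<^sub>v b) $ j = (\<Sum>k<?l. complex_of_real (f (s k)) * ip m ?b (u k) * v k j)"
    and projb: "(eucl_norm (svt_proj f A b))\<^sup>2 \<le> (\<Sum>k<?l. if s k = 0 then 0 else (cmod (ip m ?b (u k)))\<^sup>2)"
  proof (rule svt_data[where f = f, OF A b f(1) f(2)])
    fix s u v assume "svd_data m n ?l A s u v" "\<exists>u' v'. is_svd A s u' v'"
      "\<And>j. j < n \<Longrightarrow> (svt f (mat_adjoint A) *\<^sub>v b) $ j = (\<Sum>k<?l. complex_of_real (f (s k)) * ip m ?b (u k) * v k j)"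
      "(eucl_norm (svt_proj f A b))\<^sup>2 \<le> (\<Sum>k<?l. if s k = 0 then 0 else (cmod (ip m ?b (u k)))\<^sup>2)"
    then show thesis by (rule that)
  qed
  interpret sv: svd_data m n ?l A s u v by (rule sv)
  define \<beta> where "\<beta> = nrm m ?b"
  have \<beta>: "eucl_norm b = \<beta>" using eucl_norm_nsq[of b m] b eucl_norm_nonneg[of b] unfolding \<beta>_def nrm_def by (metis carrier_vecD real_sqrt_unique)
  have nb: "0 < nsq m ?b"
  proof -
    have "nsq m ?b \<noteq> 0" using b0 b by (auto simp: nsq_eq_0 vec_eq_iff)
    then show ?thesis using nsq_nonneg[of m ?b] by linarith
  qed
  then have \<beta>0: "0 < \<beta>" "\<beta>\<^sup>2 = nsq m ?b" by (simp_all add: \<beta>_def nrm_def)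
  define P2 where "P2 = (\<Sum>k<?l. if s k = 0 then 0 else (cmod (ip m ?b (u k)))\<^sup>2)"
  have P2: "(c * \<beta>)\<^sup>2 \<le> P2"
    unfolding P2_def by (rule order.trans[OF power_mono[OF proj[unfolded \<beta>]] projb]) (use c \<beta>0 in simp)
  have P2b: "P2 \<le> \<beta>\<^sup>2"
  proof -
    have "P2 \<le> (\<Sum>k\<in>{..<?l}. (cmod (ip m ?b (u k)))\<^sup>2)" unfolding P2_def by (intro sum_mono) auto
    also have "\<dots> \<le> nsq m ?b" by (rule bessel[OF _ sv.ou]) simp
    finally show ?thesis unfolding \<beta>0(2) .
  qed
  \<comment> \<open>A projection does not lengthen vectors, so the hypothesis on \<open>c\<close>
    and the projection forces this.\<close>
  have c1: "c \<le> 1"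
  proof -
    have "c * \<beta> \<le> \<beta>" by (rule power2_le_imp_le[OF order.trans[OF P2 P2b]]) (use \<beta>0 in simp)
    then show ?thesis using \<beta>0 by simp
  qed
  have P2pos: "0 < P2" using P2 c \<beta>0 by (auto intro: less_le_trans[of 0 "(c * \<beta>)\<^sup>2"])
  \<comment> \<open>For a zero matrix the projection of \<open>b\<close> would be zero. This
    excludes the degenerate cases, including \<open>m = 0\<close> and \<open>n = 0\<close>.\<close>
  have nz: "\<exists>k<?l. s k \<noteq> 0"
  proof (rule ccontr)
    assume "\<not> ?thesis"
    then have "P2 = 0" unfolding P2_def by (intro sum.neutral) auto
    then show False using P2pos by simp
  qed
  then have l0: "0 < ?l" by auto
  then have mn: "0 < m" "0 < n" by auto
  obtain u' v' where "is_svd A s u' v'" using svd by blast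
  note sb = sv.singular_values_bounds[OF this nz, folded N_def \<kappa>_def]
  have sN: "s k \<le> N" if "k < ?l" for k unfolding N_def by (rule sv.s_le_spectral_norm[OF that])
  define FQ where "FQ = fsq m n (\<lambda>i j. A $$ (i, j))"
  have FF: "F\<^sup>2 = FQ" "0 \<le> F"
    unfolding F_def FQ_def frob_norm_sq fsq_def using A
    by (auto simp: eucl_norm_nsq[of _ n] frob_norm_def intro!: sum.cong nsq_cong real_sqrt_ge_zero sum_nonneg)
  have FQs: "FQ = (\<Sum>k<?l. (s k)\<^sup>2)" unfolding FQ_def by (rule sv.fsq_a)
  have NF: "N \<le> F" unfolding N_def
  proof (rule sv.spectral_norm_le[OF l0])
    fix k assume k: "k < ?l"
    have "(s k)\<^sup>2 \<le> F\<^sup>2" unfolding FF(1) FQs by (rule member_le_sum) (use k in auto)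
    then show "s k \<le> F" using FF(2) by (rule power2_le_imp_le)
  qed
  define s2 where "s2 = N * N / (2 * (\<kappa> * \<kappa>))"
  have s20: "0 < s2" "sqrt s2 = N / (sqrt 2 * \<kappa>)"
  proof -
    show "0 < s2" unfolding s2_def using sb by simp
    have "s2 = (N / (sqrt 2 * \<kappa>))\<^sup>2" by (simp add: s2_def power2_eq_square)
    then show "sqrt s2 = N / (sqrt 2 * \<kappa>)" using sb by simp
  qed
  define bb where "bb = N * N + s2"
  have bb: "s2 \<le> bb" "sqrt s2 \<le> sqrt bb" unfolding bb_def by (simp_all)
  have L: "L = {sqrt s2..sqrt bb}"
  proof -
    have "bb = s2 * (2 * \<kappa>\<^sup>2 + 1)" unfolding bb_def s2_def using sb by (simp add: field_simps power2_eq_square)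
    then have "sqrt bb = sqrt s2 * sqrt (2 * \<kappa>\<^sup>2 + 1)" by (simp add: real_sqrt_mult)
    then show ?thesis unfolding L_def sv_interval_def s20(2) N_def \<kappa>_def by simp
  qed
  have sqrt0: "0 < sqrt s2" using s20(1) by simp
  note ext = interval_extrema[of "sqrt s2" "sqrt bb" f f', OF sqrt0 bb(2) f(2) d[unfolded L] max[unfolded L], folded L, folded \<Omega>_def \<phi>_def \<omega>_def]
  interpret pa: parameters N \<kappa> \<Omega> \<phi> \<omega> \<epsilon> \<eta> c F
    by unfold_locales (use sb ext(4-6) \<epsilon> \<eta> c c1 NF in auto)
  have s2': "pa.s2 = s2" unfolding pa.s2_def s2_def ..
  define r where "r = nat \<lceil>pa.r0\<rceil>"
  note rb = pa.r_bounds[folded r_def]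
  have FQpos: "0 < FQ" using pa.F0 FF(1) by (metis zero_less_power)
  interpret sampling_program f A b m n ?Lg r "\<lambda>i j. A $$ (i, j)" "fsq m n (\<lambda>i j. A $$ (i, j))"
    by unfold_locales (use A b mn rb(3) FQpos FQ_def in auto)
  note FQd = FQ_def[symmetric]
  define I where "I = {t. t < ?l \<and> s t \<noteq> 0}"
  define dmax where "dmax = card I + 1"
  define h where "h = (\<lambda>k. ramp f s2 (N * N + s2) (FQ * real k / real r))"
  define xs where "xs = [\<eta>, \<epsilon>, c, N, \<kappa>, \<Omega>, \<phi>, \<omega>]"
  define x where "x = (\<lambda>g::nat. if g < 8 then complex_of_real (xs ! g) else if g = 8 then complex_of_real FQ else complex_of_real pa.r0)"
  let ?s = "init_state [m, n] xs"
  let ?U = "real r * real r * (real dmax + 1) * ?Lg"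
  have fnn: "0 \<le> f z" if "0 \<le> z" for z using f(1) f(2)[of z] that by (cases "z = 0") auto
  have in0: "cmem ?s (adr g 0) = x g" if "g < 8" for g using that by (simp add: init_state_def x_def adr_def xs_def)
  have R: "cv f nm ((cmem ?s)(adr 8 0 := x 8)) (CMul sizeC sizeC) = complex_of_real pa.r0" for nm
  proof -
    have sz: "cv f nm ((cmem ?s)(adr 8 0 := x 8)) sizeC = complex_of_real (128 * pa.\<Theta> / \<eta>)"
    proof -
      have xv: "x 0 = of_real \<eta>" "x (Suc 0) = of_real \<epsilon>" "x 1 = of_real \<epsilon>" "x 2 = of_real c" "x 3 = of_real N" "x 4 = of_real \<kappa>" "x 5 = of_real \<Omega>" "x 6 = of_real \<phi>" "x 7 = of_real \<omega>" "x 8 = of_real FQ"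
        by (simp_all add: x_def xs_def)
      have sq2: "csqrt 2 = complex_of_real (sqrt 2)" using csqrt_of_real_nonneg[of 2] by simp
      have "cv f nm ((cmem ?s)(adr 8 0 := x 8)) sizeC =
         of_real 128 * (of_real \<kappa> * of_real \<kappa> * ((of_real \<phi> / of_real \<omega> + of_real 3 * of_real (sqrt 2) * (of_real \<Omega> / of_real \<omega>) * (of_real \<kappa> / of_real N)) * of_real FQ) / (of_real N * of_real \<epsilon> * of_real c)) / of_real \<eta>"
        unfolding sizeC_def paramC_def by (simp add: in0 xv sq2)
      also have "\<dots> = complex_of_real (128 * (\<kappa> * \<kappa> * (pa.G * FQ) / (N * \<epsilon> * c)) / \<eta>)"
        unfolding pa.G_def by (simp only: of_real_mult of_real_divide of_real_add of_real_numeral)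
      also have "128 * (\<kappa> * \<kappa> * (pa.G * FQ) / (N * \<epsilon> * c)) / \<eta> = 128 * pa.\<Theta> / \<eta>"
        unfolding pa.\<Theta>_def FF(1) by (simp add: power2_eq_square)
      finally show ?thesis .
    qed
    show ?thesis unfolding cv.simps(5) sz pa.r0_def by (simp add: power2_eq_square)
  qed
  have prep: "samp f M prepareC ?s (bind_pmf rowsP (\<lambda>i. map_pmf (Pair i) (colsP i)))
    (\<lambda>(i, j) w. time_used w \<le> time_used ?s + 12000 * ?U \<and> samples_used w = samples_used ?s + 2 * r \<and> prepared dmax h i j (nmem w) (cmem w))"
    unfolding h_def FQ_def
  proof (rule samp_prepareC[where x = x and ?r0.0 = pa.r0])
    show "0 < pa.r0" using pa.r0_ge by simp
    show "nat \<lceil>pa.r0\<rceil> = r" by (simp add: r_def)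
    show "\<forall>g<8. cmem ?s (adr g 0) = x g" using in0 by blast
    show "x 8 = complex_of_real (fsq m n (\<lambda>i j. A $$ (i, j)))" by (simp add: x_def FQ_def)
    show "x 9 = complex_of_real pa.r0" "x 3 = complex_of_real N" "x 4 = complex_of_real \<kappa>" by (simp_all add: x_def xs_def)
    show "cv f nm ((cmem ?s)(adr 8 0 := x 8)) (CMul sizeC sizeC) = complex_of_real pa.r0" for nm by (rule R)
    show "s2 = N * N / (2 * (\<kappa> * \<kappa>))" by (rule s2_def)
    show "0 < s2" by (rule s20(1))
    show "0 \<le> f z" if "0 \<le> z" for z by (rule fnn[OF that])
    show "d \<le> dmax" if "i \<in> set_pmf rowsP" "j \<in> set_pmf (colsP i)" "\<And>k. 1 \<le> k \<Longrightarrow> k \<le> d \<Longrightarrow> nsq r (lzs i j k) \<noteq> 0" for i j d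
      unfolding dmax_def I_def by (rule lanczos_rank[OF that(1,2) sv that(3)])
  qed
  then obtain q where q: "exec f M prepareC ?s (map_pmf snd q)" "map_pmf fst q = bind_pmf rowsP (\<lambda>i. map_pmf (Pair i) (colsP i))"
    "\<forall>z\<in>set_pmf q. (\<lambda>(i, j) w. time_used w \<le> time_used ?s + 12000 * ?U \<and> samples_used w = samples_used ?s + 2 * r \<and> prepared dmax h i j (nmem w) (cmem w)) (fst z) (snd z)"
    unfolding samp_def by blast
  define X where "X = svt f (mat_adjoint A) *\<^sub>v b"
  have Xd: "dim_vec X = n"
    unfolding X_def using svt_carrier[of f "mat_adjoint A"] mat_adjoint_carrier[OF A] by auto
  let ?x = "\<lambda>z. X $ z"
  \<comment> \<open>Only components with nonzero singular value count for the projection, and on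
    those \<open>f\<close> is at least \<open>\<omega>\<close>.\<close>
  have nX: "(c * \<omega> * \<beta>)\<^sup>2 \<le> nsq n ?x"
  proof -
    have "nsq n ?x = nsq n (\<lambda>z. \<Sum>k<?l. (complex_of_real (f (s k)) * ip m ?b (u k)) * v k z)"
      by (rule nsq_cong) (simp add: X_def form)
    also have "\<dots> = (\<Sum>k<?l. (cmod (complex_of_real (f (s k)) * ip m ?b (u k)))\<^sup>2)" by (rule nsq_ortho_sum[OF _ sv.ov]) simp
    finally have e: "nsq n ?x = (\<Sum>k<?l. (f (s k))\<^sup>2 * (cmod (ip m ?b (u k)))\<^sup>2)" by (simp add: norm_mult power_mult_distrib)
    have "\<omega>\<^sup>2 * P2 \<le> nsq n ?x" unfolding e P2_def sum_distrib_left
    proof (rule sum_mono)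
      fix k assume "k \<in> {..<?l}"
      then have k: "k < ?l" by simp
      show "\<omega>\<^sup>2 * (if s k = 0 then 0 else (cmod (ip m ?b (u k)))\<^sup>2) \<le> (f (s k))\<^sup>2 * (cmod (ip m ?b (u k)))\<^sup>2"
      proof (cases "s k = 0")
        case False
        have "s k \<in> L"
        proof -
          \<comment> \<open>The interval begins a factor \<open>sqrt 2\<close> below the smallest
            nonzero singular value.\<close>
          have "N / (sqrt 2 * \<kappa>) \<le> N / (1 * \<kappa>)" using sb pa.sqrt2 by (intro divide_left_mono mult_right_mono) auto
          then have "sqrt s2 \<le> s k" unfolding s20(2) using sb(3)[OF k False] by simp
          moreover have "s k \<le> sqrt bb" unfolding bb_def
            using sN[OF k] sv.s_nonneg[OF k] s20(1) by (intro real_le_rsqrt) (auto simp: power2_eq_square intro: order.trans[OF mult_mono])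
          ultimately show ?thesis unfolding L by simp
        qed
        then have "\<omega>\<^sup>2 \<le> \<bar>f (s k)\<bar>\<^sup>2" using ext(1) ext(4) by (intro power_mono) auto
        then show ?thesis using False by (simp add: mult_right_mono)
      qed simp
    qed
    moreover have "\<omega>\<^sup>2 * (c * \<beta>)\<^sup>2 \<le> \<omega>\<^sup>2 * P2" using P2 by (rule mult_left_mono) simp
    ultimately show ?thesis by (simp add: power_mult_distrib mult_ac)
  qed
  have cw: "0 < c * \<omega> * \<beta>" using c ext(4) \<beta>0 by simp
  have nX0: "0 < nsq n ?x" by (rule less_le_trans[OF zero_less_power[OF cw] nX])
  have nrmX: "c * \<omega> * \<beta> \<le> nrm n ?x" unfolding nrm_def using nX by (rule real_le_rsqrt)
  have eX: "(eucl_norm X)\<^sup>2 = nsq n ?x" by (rule eucl_norm_nsq[OF Xd])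
  have pX: "pmf (vec_pmf X) z = (if z < n then (cmod (?x z))\<^sup>2 / nsq n ?x else 0)" for z
    by (subst pmf_vec_pmf) (use nX0 eX Xd in auto)
  define q0 h0 where "q0 = sqrt (real r)" "h0 = sqrt \<eta>"
  have qh: "0 < q0" "0 < h0" "q0\<^sup>2 = real r" "h0\<^sup>2 = \<eta>" using rb(3) \<eta> by (simp_all add: q0_h0_def)
  have tv: "tv_dist (map_pmf result D) (vec_pmf X) \<le> \<epsilon>"
    if ij: "(i, j) \<in> good ?b \<eta>" and \<eta>1: "\<eta> \<le> 1"
     and D: "\<forall>X \<delta> \<tau>. 0 < nsq n (mop r (adj (S i)) (castel (sop r (gram r (adj (W i j))) ?F2) h r 0 (bs ?b i))) \<longrightarrow> 0 < \<delta> \<longrightarrow>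
        1 / \<delta> \<le> real r * (nsq n (mop r (adj (S i)) (castel (sop r (gram r (adj (W i j))) ?F2) h r 0 (bs ?b i))) / (?F2 * nsq r (castel (sop r (gram r (adj (W i j))) ?F2) h r 0 (bs ?b i)))) \<longrightarrow> (\<forall>z. \<not> z < n \<longrightarrow> pmf X z = 0) \<longrightarrow>
       (\<Sum>z<n. \<bar>pmf X z - (cmod (mop r (adj (S i)) (castel (sop r (gram r (adj (W i j))) ?F2) h r 0 (bs ?b i)) z))\<^sup>2 / nsq n (mop r (adj (S i)) (castel (sop r (gram r (adj (W i j))) ?F2) h r 0 (bs ?b i)))\<bar>) \<le> \<tau> \<longrightarrow> tv_dist (map_pmf result D) X \<le> \<tau> + \<delta>" for i j D
  proof -
    define y where "y = castel (sop r (gram r (adj (W i j))) ?F2) h r 0 (bs ?b i)"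
    define x' where "x' = mop r (adj (S i)) y"
    have g: "i \<in> set_pmf rowsP" "j \<in> set_pmf (colsP i)"
      "fsq n n (\<lambda>k k'. gram m (\<lambda>i j. A $$ (i, j)) k k' - gram r (S i) k k') \<le> 4 * FQ\<^sup>2 / (real r * \<eta>)"
      "nsq n (\<lambda>k. mop m (adj (\<lambda>i j. A $$ (i, j))) ?b k - mop r (adj (S i)) (bs ?b i) k) \<le> 4 * FQ * nsq m ?b / (real r * \<eta>)"
      "nsq r (bs ?b i) \<le> 4 * nsq m ?b / \<eta>"
      "fsq r r (\<lambda>k k'. gram n (adj (S i)) k k' - gram r (adj (W i j)) k k') \<le> 4 * FQ\<^sup>2 / (real r * \<eta>)"
      using ij unfolding good_def FQ_def by auto
    have h1: "h0 \<le> 1" unfolding q0_h0_def using \<eta>1 by simp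
    have d1: "4 * FQ\<^sup>2 / (real r * \<eta>) = (2 * F\<^sup>2 / (q0 * h0))\<^sup>2" unfolding FF(1) by (simp add: power_divide power_mult_distrib qh)
    have d2: "4 * FQ * nsq m ?b / (real r * \<eta>) = (2 * F * \<beta> / (q0 * h0))\<^sup>2" unfolding FF(1)[symmetric] \<beta>0(2)[symmetric] by (simp add: power_divide power_mult_distrib qh)
    have \<beta>': "nrm r (bs ?b i) \<le> 2 * \<beta> / h0"
    proof -
      have "nsq r (bs ?b i) \<le> (2 * \<beta> / h0)\<^sup>2" using g(5) unfolding \<beta>0(2)[symmetric] by (simp add: power_divide power_mult_distrib qh)
      then show ?thesis unfolding nrm_def using \<beta>0 qh by (intro real_le_lsqrt) auto
    qed
    note eb = pa.error_budget[of h0 q0 \<beta> "nrm r (bs ?b i)", OF _ qh(2) h1 \<beta>0(1) \<beta>' nrm_nonneg, unfolded qh(4), OF rb(4)[folded q0_h0_def(1)]]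
    have lipd: "(f has_real_derivative f' \<sigma>) (at \<sigma> within {sqrt s2..sqrt bb})" "\<bar>f' \<sigma>\<bar> \<le> \<phi>" "\<bar>f \<sigma>\<bar> \<le> \<Omega>" if "\<sigma> \<in> {sqrt s2..sqrt bb}" for \<sigma>
      using that d ext(2,3)[of \<sigma>] unfolding L by auto
    have \<Lambda>B: "0 \<le> pa.\<Lambda>" "0 \<le> pa.B" using pa.\<Lambda>_eq pa.G_ge(2) ext(4) pa.B_eq ext(5) sb by (simp_all)
    have rg: "ramp f s2 bb ((s k)\<^sup>2) = f (s k) / s k" if k: "k < ?l" "s k \<noteq> 0" for k
    proof (rule ramp_on_spectrum[OF s20(1)])
      have "sqrt s2 \<le> N / \<kappa>" unfolding s20(2) using sb pa.sqrt2 by (intro divide_left_mono) (auto simp: mult_le_cancel_right1)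
      then have "sqrt s2 \<le> s k" using sb(3)[OF k] by linarith
      then show "s2 \<le> (s k)\<^sup>2" using power_mono[of "sqrt s2" "s k" 2] s20(1) by simp
      show "0 \<le> s k" by (rule sv.s_nonneg[OF k(1)])
      then show "(s k)\<^sup>2 \<le> bb" unfolding bb_def using mult_mono[OF sN[OF k(1)] sN[OF k(1)]] sb(1) s20(1) by (simp add: power2_eq_square)
    qed
    have rl: "\<bar>ramp f s2 bb z\<bar> \<le> pa.B" "\<bar>ramp f s2 bb z - ramp f s2 bb z'\<bar> \<le> pa.\<Lambda> * \<bar>z - z'\<bar>" if "0 \<le> z" "0 \<le> z'" for z z'
      using ramp_lipschitz[of s2 bb f f' \<phi> \<Omega>, OF s20(1) bb(1) lipd that] unfolding pa.\<Lambda>_def pa.B_def s2' by auto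
    have fS: "fsq r n (S i) = FQ" "fsq r r (W i j) = FQ" unfolding FQ_def by (rule fsq_S[OF g(1)], rule fsq_W[OF g(1,2)])
    have hb: "h = (\<lambda>i. ramp f s2 bb (FQ * real i / real r))" unfolding h_def bb_def ..
    have gB: "\<bar>ramp f s2 bb z\<bar> \<le> pa.B" if "0 \<le> z" for z using rl(1)[of z 0] that by simp
    have xf: "X $ z = (\<Sum>k<?l. complex_of_real (f (s k)) * ip m ?b (u k) * v k z)" if "z < n" for z unfolding X_def by (rule form[OF that])
    have \<delta>0: "0 \<le> 2 * F\<^sup>2 / (q0 * h0)" "0 \<le> 2 * F * \<beta> / (q0 * h0)" using qh \<beta>0 FF(2) by simp_all
    note ae = sv.approximation_error[where \<Lambda> = pa.\<Lambda> and B = pa.B and g = "ramp f s2 bb" and D = r and S = "S i" and W = "W i j" and bs = "bs ?b i" and b = ?b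
            and ?\<delta>1.0 = "2 * F\<^sup>2 / (q0 * h0)" and ?\<delta>2.0 = "2 * F * \<beta> / (q0 * h0)" and ?\<delta>3.0 = "2 * F\<^sup>2 / (q0 * h0)" and f = f and x = ?x,
        OF f(1) rb(3) FQpos[unfolded FQ_def] \<Lambda>B sb(1)[unfolded N_def] rg rl(2) gB xf fS[unfolded FQ_def] g(3)[unfolded d1] \<delta>0(1) eb(2)[unfolded N_def]
          g(4)[unfolded d2] \<delta>0(2) g(6)[unfolded d1] \<delta>0(1)]
    have FF': "F\<^sup>2 = ?F2" unfolding FF(1) FQ_def ..
    have hb': "(\<lambda>i. ramp f s2 bb (?F2 * real i / real r)) = h" unfolding hb FQ_def ..
    have err: "nrm n (\<lambda>z. ?x z - x' z) \<le> \<epsilon> / 12 * (c * \<omega> * \<beta>)"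
    proof (rule order.trans[OF _ eb(1)])
      show "nrm n (\<lambda>z. ?x z - x' z) \<le> N * pa.\<Lambda> * F\<^sup>2 / q0 * \<beta> + pa.\<Lambda> * (2 * F\<^sup>2 / (q0 * h0)) * N * \<beta>
          + pa.B * (2 * F * \<beta> / (q0 * h0)) + sqrt 2 * N * pa.\<Lambda> * (2 * F\<^sup>2 / (q0 * h0)) * nrm r (bs ?b i)"
        unfolding FF' by (rule ae(1)[unfolded hb' y_def[symmetric], unfolded x'_def[symmetric], unfolded N_def[symmetric] FF' q0_h0_def(1)[symmetric] \<beta>_def[symmetric]])
    qed
    have errY: "nsq r y \<le> pa.B\<^sup>2 * nsq r (bs ?b i)" by (rule ae(2)[unfolded hb' y_def[symmetric]])
    have err': "nrm n (\<lambda>z. ?x z - x' z) \<le> \<epsilon> / 12 * nrm n ?x"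
      using order.trans[OF err mult_left_mono[OF nrmX, of "\<epsilon> / 12"]] \<epsilon>(1) by linarith
    have low: "11 / 12 * (c * \<omega> * \<beta>) \<le> nrm n x'"
    proof -
      have "nrm n ?x \<le> nrm n (\<lambda>z. ?x z - x' z) + nrm n x'" using nrm_triangle[of n ?x "\<lambda>_. 0" x'] by simp
      moreover have "\<epsilon> / 12 * nrm n ?x \<le> 1 / 12 * nrm n ?x" using \<epsilon> by (intro mult_right_mono) auto
      ultimately have "11 / 12 * nrm n ?x \<le> nrm n x'" using err' by linarith
      then show ?thesis using nrmX by linarith
    qed
    have lowsq: "(11 / 12 * (c * \<omega> * \<beta>))\<^sup>2 \<le> nsq n x'"
      using power_mono[OF low, of 2] cw by (simp add: nrm_sq)
    have x'0: "0 < nsq n x'" by (rule less_le_trans[OF zero_less_power lowsq]) (use cw in simp)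
    have y0: "0 < nsq r y"
    proof (rule ccontr)
      assume "\<not> ?thesis"
      then have "nsq r y = 0" using nsq_nonneg[of r y] by linarith
      then have "\<forall>k<r. y k = 0" by (simp add: nsq_eq_0)
      then have "x' z = 0" for z by (simp add: x'_def mop_def)
      then show False using x'0 by (simp add: nsq_def)
    qed
    have yB: "nsq r y \<le> pa.B\<^sup>2 * (4 * \<beta>\<^sup>2 / \<eta>)"
      by (rule order.trans[OF errY mult_left_mono]) (use g(5) \<beta>0(2) in auto)
    have acc: "1 / (\<epsilon> / 2) \<le> real r * (nsq n x' / (?F2 * nsq r y))"
      using pa.acceptance_budget[OF _ \<eta>1 \<beta>0(1) lowsq y0 yB, of "real r"] rb(1) unfolding pa.r0_def[symmetric] FF(1) FQ_def by simp
    have close: "(\<Sum>z<n. \<bar>pmf (vec_pmf X) z - (cmod (x' z))\<^sup>2 / nsq n x'\<bar>) \<le> \<epsilon> / 2"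
    proof -
      have "(\<Sum>z<n. \<bar>pmf (vec_pmf X) z - (cmod (x' z))\<^sup>2 / nsq n x'\<bar>) = (\<Sum>z<n. \<bar>(cmod (?x z))\<^sup>2 / nsq n ?x - (cmod (x' z))\<^sup>2 / nsq n x'\<bar>)"
        by (intro sum.cong refl) (simp add: pX)
      also have "\<dots> \<le> 4 * (\<epsilon> / 12) + 2 * (\<epsilon> / 12)\<^sup>2"
        by (rule normalized_weights_close[OF nX0 x'0 err']) (use \<epsilon>(1) in simp)
      \<comment> \<open>The linear term takes \<open>\<epsilon> / 3\<close>, which leaves room for
        the quadratic one because \<open>\<epsilon> \<le> 1\<close>.\<close>
      also have "\<dots> \<le> \<epsilon> / 2"
      proof -
        have "\<epsilon> * \<epsilon> \<le> \<epsilon> * 1" using \<epsilon> by (intro mult_left_mono) auto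
        moreover have "2 * (\<epsilon> / 12)\<^sup>2 = \<epsilon> * \<epsilon> / 72" by (simp add: power2_eq_square)
        ultimately show ?thesis using \<epsilon>(1) by linarith
      qed
      finally show ?thesis .
    qed
    have "tv_dist (map_pmf result D) (vec_pmf X) \<le> \<epsilon> / 2 + \<epsilon> / 2"
      by (rule D[folded y_def, folded x'_def, rule_format, OF x'0 _ acc _ close]) (use \<epsilon>(1) pX in auto)
    then show ?thesis by simp
  qed
  have key: "\<exists>D. exec f M drawC (snd z) D \<and> (\<forall>w\<in>set_pmf D. time_used w \<le> 14000 * ?U \<and> samples_used w \<le> 3 * r) \<and>
      (fst z \<in> good ?b \<eta> \<and> \<eta> \<le> 1 \<longrightarrow> tv_dist (map_pmf result D) (vec_pmf X) \<le> \<epsilon>)" if z: "z \<in> set_pmf q" for z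
  proof -
    obtain i j t where zt: "z = ((i, j), t)" by (metis prod.exhaust)
    have "(i, j) \<in> set_pmf (map_pmf fst q)" using z zt by force
    then have ij: "i \<in> set_pmf rowsP" "j \<in> set_pmf (colsP i)" unfolding q(2) by auto
    have t: "time_used t \<le> 12000 * ?U" "samples_used t = 2 * r" "prepared dmax h i j (nmem t) (cmem t)"
      using bspec[OF q(3) z] unfolding zt by (simp_all add: init_state_def)
    obtain D where D: "exec f M drawC t D"
      "\<forall>w\<in>set_pmf D. time_used w \<le> time_used t + 1100 * (real r * real r * ?Lg) \<and> samples_used w \<le> samples_used t + r"
      "\<forall>X \<delta> \<tau>. 0 < nsq n (mop r (adj (S i)) (castel (sop r (gram r (adj (W i j))) ?F2) h r 0 (bs ?b i))) \<longrightarrow> 0 < \<delta> \<longrightarrow>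
        1 / \<delta> \<le> real r * (nsq n (mop r (adj (S i)) (castel (sop r (gram r (adj (W i j))) ?F2) h r 0 (bs ?b i))) / (?F2 * nsq r (castel (sop r (gram r (adj (W i j))) ?F2) h r 0 (bs ?b i)))) \<longrightarrow> (\<forall>z. \<not> z < n \<longrightarrow> pmf X z = 0) \<longrightarrow>
       (\<Sum>z<n. \<bar>pmf X z - (cmod (mop r (adj (S i)) (castel (sop r (gram r (adj (W i j))) ?F2) h r 0 (bs ?b i)) z))\<^sup>2 / nsq n (mop r (adj (S i)) (castel (sop r (gram r (adj (W i j))) ?F2) h r 0 (bs ?b i)))\<bar>) \<le> \<tau> \<longrightarrow> tv_dist (map_pmf result D) X \<le> \<tau> + \<delta>"
      using draw_correct[OF ij t(3)] by (elim exE conjE) (rule that)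
    have "1 * (real r * real r * ?Lg) \<le> (real dmax + 1) * (real r * real r * ?Lg)" using costs(4) by (intro mult_right_mono) auto
    then have RL: "real r * real r * ?Lg \<le> ?U" by (simp add: mult_ac)
    have RN: "0 \<le> real r * real r * ?Lg" using costs(4) by simp
    have "time_used w \<le> 14000 * ?U \<and> samples_used w \<le> 3 * r" if "w \<in> set_pmf D" for w
    proof -
      have w: "time_used w \<le> time_used t + 1100 * (real r * real r * ?Lg)" "samples_used w \<le> samples_used t + r"
        using bspec[OF D(2) that] by blast+
      have "time_used w \<le> 14000 * ?U" using w(1) t(1) RL RN by linarith
      moreover have "samples_used w \<le> 3 * r" using w(2) t(2) by linarith
      ultimately show ?thesis by blast
    qed
    moreover have "tv_dist (map_pmf result D) (vec_pmf X) \<le> \<epsilon>" if "(i, j) \<in> good ?b \<eta>" "\<eta> \<le> 1" by (rule tv[OF that D(3)])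
    ultimately show ?thesis using D(1) unfolding zt by (intro exI[of _ D]) auto
  qed
  \<comment> \<open>Accuracy was shown along the coupling; as a function of the state alone the
    final distribution is unique, so it can be named.\<close>
  define E where "E = (\<lambda>t. THE D. exec f M drawC t D)"
  have E: "exec f M drawC (snd z) (E (snd z)) \<and> (\<forall>w\<in>set_pmf (E (snd z)). time_used w \<le> 14000 * ?U \<and> samples_used w \<le> 3 * r) \<and>
      (fst z \<in> good ?b \<eta> \<and> \<eta> \<le> 1 \<longrightarrow> tv_dist (map_pmf result (E (snd z))) (vec_pmf X) \<le> \<epsilon>)" if z: "z \<in> set_pmf q" for z
  proof -
    obtain D where D: "exec f M drawC (snd z) D" "\<forall>w\<in>set_pmf D. time_used w \<le> 14000 * ?U \<and> samples_used w \<le> 3 * r"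
      "fst z \<in> good ?b \<eta> \<and> \<eta> \<le> 1 \<longrightarrow> tv_dist (map_pmf result D) (vec_pmf X) \<le> \<epsilon>" using key[OF z] by blast
    have "E (snd z) = D" unfolding E_def by (rule the_equality, rule D(1), rule exec_deterministic[OF D(1)])
    then show ?thesis using D by simp
  qed
  have prob: "1 - \<eta> \<le> measure_pmf.prob (map_pmf snd q) {t. tv_dist (map_pmf result (E t)) (vec_pmf X) \<le> \<epsilon>}"
  proof (cases "\<eta> \<le> 1")
    case True
    have "1 - \<eta> \<le> measure_pmf.prob (map_pmf fst q) (good ?b \<eta>)" unfolding q(2) by (rule good_probability[OF nb \<eta>])
    also have "\<dots> = measure_pmf.prob q (fst -` good ?b \<eta>)" by simp
    also have "\<dots> \<le> measure_pmf.prob q (snd -` {t. tv_dist (map_pmf result (E t)) (vec_pmf X) \<le> \<epsilon>})"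
      by (rule measure_pmf.finite_measure_mono_AE) (use E True in \<open>auto simp: AE_measure_pmf_iff\<close>)
    finally show ?thesis by simp
  next
    \<comment> \<open>For \<open>\<eta> > 1\<close> a probability is compared with a negative
      number.\<close>
    case False
    then show ?thesis using measure_nonneg[of "measure_pmf (map_pmf snd q)" "{t. tv_dist (map_pmf result (E t)) (vec_pmf X) \<le> \<epsilon>}"] by linarith
  qed
  \<comment> \<open>Each nonzero singular value is at least \<open>N / \<kappa>\<close>, and their
    squares sum to \<open>F^2\<close>. The two additional units are absorbed by the factor 3, since
    at least one singular value is nonzero.\<close>
  have rank: "real dmax + 1 \<le> 3 * (F\<^sup>2 / N\<^sup>2 * \<kappa>\<^sup>2)"
  proof -
    have "real (card I) * (N / \<kappa>)\<^sup>2 = (\<Sum>k\<in>I. (N / \<kappa>)\<^sup>2)" by simp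
    also have "\<dots> \<le> (\<Sum>k\<in>I. (s k)\<^sup>2)" using sb unfolding I_def by (intro sum_mono power_mono) auto
    also have "\<dots> \<le> FQ" unfolding FQs by (rule sum_mono2) (auto simp: I_def)
    finally have 1: "real (card I) \<le> F\<^sup>2 / N\<^sup>2 * \<kappa>\<^sup>2" unfolding FF(1)[symmetric] using sb by (simp add: field_simps)
    have "I \<noteq> {}" "finite I" using nz by (auto simp: I_def)
    then have "1 \<le> real (card I)" by (simp add: Suc_leI card_gt_0_iff)
    then show ?thesis using 1 unfolding dmax_def by simp
  qed
  let ?T = "F ^ 12 * \<kappa> ^ 12 / (\<epsilon> ^ 6 * \<eta> ^ 3) * (\<phi> / \<omega> + 7 * sqrt 2 * (\<Omega> / \<omega>) * (\<kappa> / N)) ^ 6 * ?Lg"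
  let ?X = "F ^ 10 * \<kappa> ^ 14 / (\<epsilon> ^ 4 * \<eta>\<^sup>2 * N ^ 6) * (\<Omega> / \<omega>)\<^sup>2 * (\<phi> / \<omega> + 3 * sqrt 2 * (\<Omega> / \<omega>) * (\<kappa> / N)) ^ 4 * ?Lg"
  have Cpos: "0 < C1" "0 < C2" using c by (simp_all add: C1_def C2_def)
  have samples: "real (3 * r) \<le> C * ?X"
  proof -
    have 1: "real (3 * r) \<le> 6 * pa.r0" using rb(2) by simp
    have 2: "6 * pa.r0 \<le> C1 * ?X" using pa.sample_budget[OF costs(4)] unfolding C1_def pa.G_def .
    have "0 \<le> C1 * ?X" using 2 pa.r0_ge by linarith
    then have "0 \<le> ?X" using Cpos(1) by (simp only: zero_le_mult_iff) auto
    then have "C1 * ?X \<le> C * ?X" using C(1) by (rule mult_right_mono[rotated])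
    then show ?thesis using 1 2 by linarith
  qed
  have time: "14000 * ?U \<le> C * ?T"
  proof -
    have G7: "pa.G \<le> \<phi> / \<omega> + 7 * sqrt 2 * (\<Omega> / \<omega>) * (\<kappa> / N)"
      unfolding pa.G_def using ext(4,5) sb by (intro add_left_mono mult_right_mono) auto
    have rr: "real r * real r \<le> (2 * pa.r0)\<^sup>2" using power_mono[OF rb(2), of 2] by (simp add: power2_eq_square)
    have "?U \<le> (2 * pa.r0)\<^sup>2 * (3 * (F\<^sup>2 / N\<^sup>2 * \<kappa>\<^sup>2)) * ?Lg"
      using rank rr costs(4) by (intro mult_right_mono mult_mono) auto
    then have 1: "14000 * ?U \<le> 14000 * ((2 * pa.r0)\<^sup>2 * (3 * (F\<^sup>2 / N\<^sup>2 * \<kappa>\<^sup>2)) * ?Lg)" by simp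
    have 2: "14000 * ((2 * pa.r0)\<^sup>2 * (3 * (F\<^sup>2 / N\<^sup>2 * \<kappa>\<^sup>2)) * ?Lg) \<le> C2 * ?T"
      using pa.time_budget[OF costs(4) \<epsilon>(4)[OF sb(1)] G7] unfolding C2_def .
    have "0 \<le> 14000 * ?U" using costs(4) by simp
    then have "0 \<le> C2 * ?T" using 1 2 by linarith
    then have "0 \<le> ?T" using Cpos(2) by (simp only: zero_le_mult_iff) auto
    then have "C2 * ?T \<le> C * ?T" using C(2) by (rule mult_right_mono[rotated])
    then show ?thesis using 1 2 by linarith
  qed
  have bounds: "real (samples_used w) \<le> C * ?X \<and> time_used w \<le> C * ?T" if "t \<in> set_pmf (map_pmf snd q)" "w \<in> set_pmf (E t)" for t w
  proof -
    have "t \<in> snd ` set_pmf q" using that(1) by simp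
    then obtain z where z: "t = snd z" "z \<in> set_pmf q" by (rule imageE)
    have w: "time_used w \<le> 14000 * ?U" "samples_used w \<le> 3 * r" using E[OF z(2)] that(2) unfolding z(1) by blast+
    then have "real (samples_used w) \<le> real (3 * r)" by (simp only: of_nat_le_iff)
    then show ?thesis using samples time w(1) by linarith
  qed
  have Q: "\<forall>t\<in>set_pmf (map_pmf snd q). exec f M drawC t (E t)" using E by auto
  show ?thesis unfolding samples_from_def X_def[symmetric] xs_def[symmetric]
    using q(1) Q prob bounds by (intro exI[of _ "map_pmf snd q"] exI[of _ E] conjI) blast+
qed

lemma small_square:
  fixes \<epsilon> x \<eta> :: real
  assumes "0 < \<epsilon>" "0 < \<eta>" "0 < x" "\<epsilon> < x ^ 3 * sqrt \<eta>"
  shows "\<epsilon>\<^sup>2 \<le> x ^ 6 * \<eta>"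
proof -
  have "\<epsilon>\<^sup>2 \<le> (x ^ 3 * sqrt \<eta>)\<^sup>2" using assms by (intro power_mono) auto
  then show ?thesis using assms by (simp add: power_mult_distrib)
qed

text \<open>One pair of programs serves all \<open>f\<close>, \<open>\<eta>\<close> and
  \<open>\<epsilon>2\<close>: the real data enter through the initial state and \<open>f\<close>
  through the evaluation instruction.\<close>

theorem theorem2:
  fixes c :: real
  assumes "c > 0"
  shows "\<exists>C>0. \<exists>k::nat.
    \<forall>(f :: real \<Rightarrow> real) (\<eta>::real). f 0 = 0 \<and> (\<forall>x>0. f x > 0) \<and> \<eta> > 0 \<longrightarrow>
    (\<exists>\<epsilon>0 :: real \<Rightarrow> real. (\<forall>x>0. \<epsilon>0 x > 0) \<and>
      (\<forall>\<epsilon>2>0. \<exists>P Q. \<forall>m n. \<forall>A\<in>carrier_mat m n. \<forall>b\<in>carrier_vec m. \<forall>f' :: real \<Rightarrow> real.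
        let F = frob_norm A; N = spectral_norm A; \<kappa> = kappa2 A; L = sv_interval A;
            \<Omega> = Sup ((\<lambda>\<sigma>. \<bar>f \<sigma>\<bar>) ` L);
            \<phi> = Sup ((\<lambda>\<sigma>. \<bar>f' \<sigma>\<bar>) ` L);
            \<omega> = Inf ((\<lambda>\<sigma>. \<bar>f \<sigma>\<bar>) ` L);
            polylog = (1 + ln (real (m * n))) ^ k
        in b \<noteq> 0\<^sub>v m \<and> \<epsilon>2 < \<epsilon>0 N \<and>
           (\<forall>\<sigma>\<in>L. (f has_real_derivative f' \<sigma>) (at \<sigma> within L)) \<and>
           (\<exists>\<sigma>\<in>L. \<forall>\<tau>\<in>L. \<bar>f' \<tau>\<bar> \<le> \<bar>f' \<sigma>\<bar>) \<and>
           eucl_norm (svt_proj f A b) \<ge> c * eucl_norm b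
           \<longrightarrow> samples_from f (access A b) P Q
                 (init_state [m, n] [\<eta>, \<epsilon>2, c, N, \<kappa>, \<Omega>, \<phi>, \<omega>]) \<eta> \<epsilon>2
                 (vec_pmf (svt f (mat_adjoint A) *\<^sub>v b))
                 (C * (F ^ 10 * \<kappa> ^ 14 / (\<epsilon>2 ^ 4 * \<eta>\<^sup>2 * N ^ 6) * (\<Omega> / \<omega>)\<^sup>2 *
                       (\<phi> / \<omega> + 3 * sqrt 2 * (\<Omega> / \<omega>) * (\<kappa> / N)) ^ 4 * polylog))
                 (C * (F ^ 12 * \<kappa> ^ 12 / (\<epsilon>2 ^ 6 * \<eta> ^ 3) *
                       (\<phi> / \<omega> + 7 * sqrt 2 * (\<Omega> / \<omega>) * (\<kappa> / N)) ^ 6 * polylog))))"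
proof -
  \<comment> \<open>The sample size is proportional to \<open>1 / c^2\<close>, and the time to its
    square.\<close>
  define C where "C = 98304 / c\<^sup>2 + 168000 * 16384\<^sup>2 / c ^ 4"
  have C: "98304 / c\<^sup>2 \<le> C" "168000 * 16384\<^sup>2 / c ^ 4 \<le> C" "0 < C" using assms by (simp_all add: C_def add_pos_pos)
  show ?thesis
  proof (rule exI[of _ C], intro conjI, rule C(3), rule exI[of _ 2], intro allI impI)
    fix f :: "real \<Rightarrow> real" and \<eta> :: real
    assume H: "f 0 = 0 \<and> (\<forall>x>0. f x > 0) \<and> \<eta> > 0"
    then have \<eta>: "0 < \<eta>" by blast
    \<comment> \<open>The bound \<open>1 / \<eta>\<close> keeps the real sample size at least 1, and
      \<open>1\<close> keeps the quadratic error terms below the linear ones; the last term yields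
      \<open>\<epsilon>^2 \<le> N^6 \<eta>\<close> for the time bound.\<close>
    define \<epsilon>0 where "\<epsilon>0 = (\<lambda>x::real. min (min 1 (1 / \<eta>)) (x ^ 3 * sqrt \<eta>))"
    have fpos: "f x > 0" if "x > 0" for x using H that by blast
    show "\<exists>\<epsilon>0 :: real \<Rightarrow> real. (\<forall>x>0. \<epsilon>0 x > 0) \<and> (\<forall>\<epsilon>2>0. \<exists>P Q. \<forall>m n. \<forall>A\<in>carrier_mat m n. \<forall>b\<in>carrier_vec m. \<forall>f' :: real \<Rightarrow> real.
        let F = frob_norm A; N = spectral_norm A; \<kappa> = kappa2 A; L = sv_interval A;
            \<Omega> = Sup ((\<lambda>\<sigma>. \<bar>f \<sigma>\<bar>) ` L); \<phi> = Sup ((\<lambda>\<sigma>. \<bar>f' \<sigma>\<bar>) ` L); \<omega> = Inf ((\<lambda>\<sigma>. \<bar>f \<sigma>\<bar>) ` L);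
            polylog = (1 + ln (real (m * n))) ^ 2
        in b \<noteq> 0\<^sub>v m \<and> \<epsilon>2 < \<epsilon>0 N \<and> (\<forall>\<sigma>\<in>L. (f has_real_derivative f' \<sigma>) (at \<sigma> within L)) \<and>
           (\<exists>\<sigma>\<in>L. \<forall>\<tau>\<in>L. \<bar>f' \<tau>\<bar> \<le> \<bar>f' \<sigma>\<bar>) \<and> eucl_norm (svt_proj f A b) \<ge> c * eucl_norm b
           \<longrightarrow> samples_from f (access A b) P Q (init_state [m, n] [\<eta>, \<epsilon>2, c, N, \<kappa>, \<Omega>, \<phi>, \<omega>]) \<eta> \<epsilon>2
                 (vec_pmf (svt f (mat_adjoint A) *\<^sub>v b))
                 (C * (F ^ 10 * \<kappa> ^ 14 / (\<epsilon>2 ^ 4 * \<eta>\<^sup>2 * N ^ 6) * (\<Omega> / \<omega>)\<^sup>2 * (\<phi> / \<omega> + 3 * sqrt 2 * (\<Omega> / \<omega>) * (\<kappa> / N)) ^ 4 * polylog))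
                 (C * (F ^ 12 * \<kappa> ^ 12 / (\<epsilon>2 ^ 6 * \<eta> ^ 3) * (\<phi> / \<omega> + 7 * sqrt 2 * (\<Omega> / \<omega>) * (\<kappa> / N)) ^ 6 * polylog)))"
    proof (rule exI[of _ \<epsilon>0], rule conjI)
      show "\<forall>x>0. \<epsilon>0 x > 0" using \<eta> by (simp add: \<epsilon>0_def)
    qed (intro allI impI, rule exI[of _ prepareC], rule exI[of _ drawC], intro allI ballI, unfold Let_def, intro impI, elim conjE,
        rule algorithm_correct[where C = C], use H in blast, erule fpos, rule assms, rule \<eta>, rule C(1), rule C(2), assumption, assumption, assumption, assumption,
        simp add: \<epsilon>0_def, simp add: \<epsilon>0_def, rule small_square[OF _ \<eta>], assumption, assumption, simp add: \<epsilon>0_def, assumption, assumption, assumption)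
  qed
qed

end
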